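(* Let $\Omega\in\mathbb R$ be given. Let $\mathbf k\in\mathbb Z^3\setminus\{\mathbf 0\}$ be fixed and $u_0\in V_{\mathbf k}$. Then the problem $$\frac{du}{dt}+Au+B(u,u)+\Omega Su=0,\qquad u(0)=u_0, \qquad( ** )$$ has a unique global regular solution, namely $$u(t)=e^{-tA}e^{-\Omega tS}u_0,\quad t\ge0.$$ Moreover, $u(t)$ solves the linear equation $$u_t+Au+\Omega Su=0,\quad t>0.$$
   Context: Function spaces. Let $L_1,L_2,L_3>0$ with $\max\{L_1,L_2,L_3\}=2\pi$, and $\mathbb T_{\mathbf L}=(\mathbb R/L_1\mathbb Z)\times(\mathbb R/L_2\mathbb Z)\times(\mathbb R/L_3\mathbb Z)$. For $\mathbf k\in\mathbb Z^3$ let $\check{\mathbf k}=2\pi(k_1/L_1,k_2/L_2,k_3/L_3)$; for $\mathbf k\ne\mathbf 0$ let $X_{\mathbf k}=\{\mathbf z\in\mathbb C^3:\mathbf z\cdot\check{\mathbf k}=0\}$, where $\mathbf x\cdot\mathbf y=\mathbf x^{\rm T}\mathbf y$. $\sum'$ is the sum over $\mathbf k\in\mathbb Z^3\setminus\{\mathbf 0\}$. $\mathcal V$ is the real vector space of all $u=\sum'\widehat{\mathbf u}_{\mathbf k}e^{i\check{\mathbf k}\cdot\mathbf x}$ with $\widehat{\mathbf u}_{\mathbf k}\in X_{\mathbf k}$, $\widehat{\mathbf u}_{-\mathbf k}=\overline{\widehat{\mathbf u}_{\mathbf k}}$ and only finitely many nonzero coefficients. $H$ and $V$ are the closures of $\mathcal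 V$ in $L^2(\mathbb T_{\mathbf L})^3$ and $H^1(\mathbb T_{\mathbf L})^3$; $V\subset H=H'\subset V'$; $H_{\rm w}$ is $H$ with its weak topology. $\langle\cdot,\cdot\rangle$, $|\cdot|$ are the $L^2$ inner product and norm; $\langle\!\langle u,v\rangle\!\rangle=\sum_{j=1}^3\langle\partial_{x_j}u,\partial_{x_j}v\rangle$, $\|u\|=|\nabla u|$. $\mathcal P$ is the orthogonal (Leray) projection of $L^2(\mathbb T_{\mathbf L})^3$ onto $H$. For $\mathbf k\in\mathbb Z^3\setminus\{\mathbf0\}$, $V_{\mathbf k}$ is the space of all $u\in V$ of the form $u=\sum_{m\in\mathbb Z\setminus\{0\}}\widehat{\mathbf u}_{m\mathbf k}e^{im\check{\mathbf k}\cdot\mathbf x}$ (Fourier modes only at nonzero integer multiples of $\mathbf k$). Operators. $Au=\sum'|\check{\mathbf k}|^2\widehat{\mathbf u}_{\mathbf k}e^{i\check{\mathbf k}\cdot\mathbf x}$ (Stokes operator), $\mathcal D(A)=V\cap H^2(\mathbb T_{\mathbf L})^3$; $e^{-tA}u=\sum'e^{-t|\check{\mathbf k}|^2}\widehat{\mathbf u}_{\mathbf k}e^{i\check{\mathbf k}\cdot\mathbf x}$. $b(u,v,w)=\int_{\mathbb T_{\mathbf L}}((u\cdot\nabla)v)\cdot w\,d\mathbf x$ and $B:V\times V\to V'$ is given by $\langle B(u,v),w\rangle_{V',V}=b(u,v,w)$. $J\mathbf z=\mathbf e_3\times\mathbf z$, $S=\mathcal PJ\mathcal P$, a bounded operator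 on $H$, with exponential group $e^{tS}$. Solutions. A Leray-Hopf weak solution of $( ** )$ is $u:[0,\infty)\to H$ with $u\in C([0,\infty),H_{\rm w})\cap L^2_{\rm loc}([0,\infty),V)$, $u'\in L^{4/3}_{\rm loc}([0,\infty),V')$, such that for all $w\in V$, $\frac{d}{dt}\langle u(t),w\rangle+\langle\!\langle u(t),w\rangle\!\rangle+b(u(t),u(t),w)+\Omega\langle Su(t),w\rangle=0$ in the distribution sense on $(0,\infty)$, and $\frac12|u(t)|^2+\int_{t_0}^t\|u(\tau)\|^2d\tau\le\frac12|u(t_0)|^2$ holds for $t_0=0$ and almost all $t_0\in(0,\infty)$, and all $t\ge t_0$. A global regular solution is a Leray-Hopf weak solution with $u\in C([0,\infty),V)\cap L^2_{\rm loc}([0,\infty),\mathcal D(A))$ and $u'\in L^2_{\rm loc}([0,\infty),H)$. *)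

theory Defs
  imports "HOL-Analysis.Analysis"
begin

text \<open>
  A function on the torus with periods \<open>L $ 1\<close>, \<open>L $ 2\<close>, \<open>L $ 3\<close> is a function on
  \<open>real ^ 3\<close> that is \<open>L $ j\<close>-periodic in its \<open>j\<close>-th variable.  An element of \<open>L\<^sup>2\<close> is given by a
  Borel representative, and equality in \<open>L\<^sup>2\<close> is equality almost everywhere (\<open>eqae\<close>).  All the
  sets of fields below are closed under changing the representative, and operators whose value is
  only determined up to null sets choose some representative of it.
\<close>

type_synonym field3 = "real ^ 3 \<Rightarrow> real ^ 3"

definition torus :: "real ^ 3 \<Rightarrow> (real ^ 3) measure" where
  "torus L = restrict_space lborel (cbox 0 L)"

definition periodic :: "real ^ 3 \<Rightarrow> (real ^ 3 \<Rightarrow> 'a) \<Rightarrow> bool" where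
  "periodic L f \<longleftrightarrow> (\<forall>x j. f (x + axis j (L $ j)) = f x)"

definition eqae :: "real ^ 3 \<Rightarrow> field3 \<Rightarrow> field3 \<Rightarrow> bool" where
  "eqae L u v \<longleftrightarrow> (AE x in torus L. u x = v x)"

definition L2 :: "real ^ 3 \<Rightarrow> field3 set" where
  "L2 L = {u. periodic L u \<and> u \<in> borel_measurable borel \<and>
              integrable (torus L) (\<lambda>x. (norm (u x))\<^sup>2)}"

definition ip :: "real ^ 3 \<Rightarrow> field3 \<Rightarrow> field3 \<Rightarrow> real" where
  "ip L u v = (LINT x|torus L. u x \<bullet> v x)"

definition l2norm :: "real ^ 3 \<Rightarrow> field3 \<Rightarrow> real" where
  "l2norm L u = sqrt (ip L u u)"

section \<open>Weak derivatives and Sobolev spaces\<close>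

definition partial :: "3 \<Rightarrow> (real ^ 3 \<Rightarrow> real) \<Rightarrow> real ^ 3 \<Rightarrow> real" where
  "partial j f x = frechet_derivative f (at x) (axis j 1)"

definition smooth :: "(real ^ 3 \<Rightarrow> real) \<Rightarrow> bool" where
  "smooth f \<longleftrightarrow> (\<forall>js x. foldr partial js f differentiable (at x))"

definition is_weak_partial :: "real ^ 3 \<Rightarrow> 3 \<Rightarrow> field3 \<Rightarrow> field3 \<Rightarrow> bool" where
  "is_weak_partial L j u g \<longleftrightarrow> (\<forall>\<phi>. smooth \<phi> \<and> periodic L \<phi> \<longrightarrow>
     (LINT x|torus L. partial j \<phi> x *\<^sub>R u x) = - (LINT x|torus L. \<phi> x *\<^sub>R g x))"

definition wpartial :: "real ^ 3 \<Rightarrow> 3 \<Rightarrow> field3 \<Rightarrow> field3" where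
  "wpartial L j u = (SOME g. g \<in> L2 L \<and> is_weak_partial L j u g)"

definition H1 :: "real ^ 3 \<Rightarrow> field3 set" where
  "H1 L = {u \<in> L2 L. \<forall>j. \<exists>g \<in> L2 L. is_weak_partial L j u g}"

definition H2 :: "real ^ 3 \<Rightarrow> field3 set" where
  "H2 L = {u \<in> H1 L. \<forall>j. wpartial L j u \<in> H1 L}"

definition gip :: "real ^ 3 \<Rightarrow> field3 \<Rightarrow> field3 \<Rightarrow> real" where
  "gip L u v = (\<Sum>j\<in>UNIV. ip L (wpartial L j u) (wpartial L j v))"

definition gnorm :: "real ^ 3 \<Rightarrow> field3 \<Rightarrow> real" where
  "gnorm L u = sqrt (gip L u u)"

definition h1norm :: "real ^ 3 \<Rightarrow> field3 \<Rightarrow> real" where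
  "h1norm L u = sqrt ((l2norm L u)\<^sup>2 + (gnorm L u)\<^sup>2)"

definition h2norm :: "real ^ 3 \<Rightarrow> field3 \<Rightarrow> real" where
  "h2norm L u = sqrt ((h1norm L u)\<^sup>2 +
     (\<Sum>i\<in>UNIV. \<Sum>j\<in>UNIV. (l2norm L (wpartial L i (wpartial L j u)))\<^sup>2))"

section \<open>Fourier series\<close>

definition wave :: "real ^ 3 \<Rightarrow> int ^ 3 \<Rightarrow> real ^ 3" where
  "wave L k = (\<chi> j. 2 * pi * of_int (k $ j) / L $ j)"

definition cvec :: "real ^ 3 \<Rightarrow> complex ^ 3" where
  "cvec x = (\<chi> j. of_real (x $ j))"

definition X :: "real ^ 3 \<Rightarrow> int ^ 3 \<Rightarrow> (complex ^ 3) set" where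
  "X L k = {z. (\<Sum>j\<in>UNIV. z $ j * of_real (wave L k $ j)) = 0}"

definition fcoef :: "real ^ 3 \<Rightarrow> field3 \<Rightarrow> int ^ 3 \<Rightarrow> complex ^ 3" where
  "fcoef L u k = (1 / measure lborel (cbox 0 L)) *\<^sub>R
     (LINT x|torus L. cis (- (wave L k \<bullet> x)) *s cvec (u x))"

definition trig_sum :: "real ^ 3 \<Rightarrow> (int ^ 3) set \<Rightarrow> (int ^ 3 \<Rightarrow> complex ^ 3) \<Rightarrow> real ^ 3 \<Rightarrow> complex ^ 3"
  where "trig_sum L F c x = (\<Sum>k\<in>F. cis (wave L k \<bullet> x) *s c k)"

text \<open>The series of \<open>c k * exp (i k \<cdot> x)\<close> over \<open>k \<in> K\<close> converges unconditionally to \<open>u\<close> in \<open>L\<^sup>2\<close>.\<close>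

definition has_fourier_series ::
    "real ^ 3 \<Rightarrow> (int ^ 3) set \<Rightarrow> (int ^ 3 \<Rightarrow> complex ^ 3) \<Rightarrow> field3 \<Rightarrow> bool" where
  "has_fourier_series L K c u \<longleftrightarrow> u \<in> L2 L \<and>
     ((\<lambda>F. sqrt (LINT x|torus L. (norm (cvec (u x) - trig_sum L F c x))\<^sup>2)) \<longlongrightarrow> 0)
       (finite_subsets_at_top K)"

section \<open>Spaces of solenoidal fields\<close>

definition trig_fields :: "real ^ 3 \<Rightarrow> field3 set" where
  "trig_fields L = {u. \<exists>K c. finite K \<and> 0 \<notin> K \<and> (\<forall>k. k \<notin> K \<longrightarrow> c k = 0) \<and>
     (\<forall>k\<in>K. c k \<in> X L k) \<and> (\<forall>k j. c (- k) $ j = cnj (c k $ j)) \<and>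
     (\<forall>x. cvec (u x) = trig_sum L K c x)}"

definition HH :: "real ^ 3 \<Rightarrow> field3 set" where
  "HH L = {u \<in> L2 L. \<forall>e>0. \<exists>v\<in>trig_fields L. l2norm L (u - v) < e}"

definition VV :: "real ^ 3 \<Rightarrow> field3 set" where
  "VV L = {u \<in> H1 L. \<forall>e>0. \<exists>v\<in>trig_fields L. h1norm L (u - v) < e}"

definition Vmode :: "real ^ 3 \<Rightarrow> int ^ 3 \<Rightarrow> field3 set" where
  "Vmode L k = {u \<in> VV L. has_fourier_series L {\<chi> j. m * k $ j | m. m \<noteq> 0} (fcoef L u) u}"

type_synonym functional3 = "field3 \<Rightarrow> real"

definition VV_dual :: "real ^ 3 \<Rightarrow> functional3 set" where
  "VV_dual L = {f. (\<forall>u\<in>VV L. \<forall>v\<in>VV L. f (\<lambda>x. u x + v x) = f u + f v) \<and>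
     (\<forall>c. \<forall>u\<in>VV L. f (\<lambda>x. c *\<^sub>R u x) = c * f u) \<and>
     (\<exists>C. \<forall>u\<in>VV L. \<bar>f u\<bar> \<le> C * h1norm L u)}"

definition dual_norm :: "real ^ 3 \<Rightarrow> functional3 \<Rightarrow> real" where
  "dual_norm L f = (SUP w \<in> {w \<in> VV L. h1norm L w \<le> 1}. \<bar>f w\<bar>)"

section \<open>Operators\<close>

definition leray :: "real ^ 3 \<Rightarrow> field3 \<Rightarrow> field3" where
  "leray L f = (SOME g. g \<in> HH L \<and> (\<forall>w\<in>HH L. ip L (f - g) w = 0))"

definition coriolis :: "real ^ 3 \<Rightarrow> field3 \<Rightarrow> field3" where
  "coriolis L u = leray L (\<lambda>x. cross3 (axis 3 1) (leray L u x))"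

definition exp_coriolis :: "real ^ 3 \<Rightarrow> real \<Rightarrow> field3 \<Rightarrow> field3" where
  "exp_coriolis L t u = (SOME v. v \<in> HH L \<and>
     (\<lambda>N. l2norm L (\<lambda>x. v x - (\<Sum>n<N. (t ^ n / fact n) *\<^sub>R ((coriolis L ^^ n) u) x)))
       \<longlonglongrightarrow> 0)"

definition stokes_dom :: "real ^ 3 \<Rightarrow> field3 set" where
  "stokes_dom L = VV L \<inter> H2 L"

definition stokes :: "real ^ 3 \<Rightarrow> field3 \<Rightarrow> field3" where
  "stokes L u = (SOME v. has_fourier_series L (- {0})
     (\<lambda>k. (norm (wave L k))\<^sup>2 *\<^sub>R fcoef L u k) v)"

text \<open>\<open>exp_stokes L t\<close> is the operator \<open>e\<^bsup>-tA\<^esup>\<close> of the Stokes semigroup.\<close>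

definition exp_stokes :: "real ^ 3 \<Rightarrow> real \<Rightarrow> field3 \<Rightarrow> field3" where
  "exp_stokes L t u = (SOME v. has_fourier_series L (- {0})
     (\<lambda>k. exp (- t * (norm (wave L k))\<^sup>2) *\<^sub>R fcoef L u k) v)"

definition trilin :: "real ^ 3 \<Rightarrow> field3 \<Rightarrow> field3 \<Rightarrow> field3 \<Rightarrow> real" where
  "trilin L u v w = (LINT x|torus L. (\<Sum>i\<in>UNIV. u x $ i *\<^sub>R wpartial L i v x) \<bullet> w x)"

section \<open>Functions of time\<close>

text \<open>
  Membership of \<open>u\<close> in \<open>L\<^sup>p\<^sub>l\<^sub>o\<^sub>c([0,\<infinity>), E)\<close> for a space \<open>E\<close> with norm \<open>nrm\<close>: \<open>u\<close> is Bochner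
  measurable and the \<open>p\<close>-th power of its norm is integrable on every \<open>[0,T]\<close>.
\<close>

definition Lp_loc :: "real \<Rightarrow> ('a::minus \<Rightarrow> real) \<Rightarrow> 'a set \<Rightarrow> (real \<Rightarrow> 'a) \<Rightarrow> bool" where
  "Lp_loc p nrm E u \<longleftrightarrow>
     (AE t in lebesgue. 0 \<le> t \<longrightarrow> u t \<in> E) \<and>
     (\<exists>s :: nat \<Rightarrow> real \<Rightarrow> 'a. (\<forall>n. simple_function lebesgue (s n) \<and> range (s n) \<subseteq> E) \<and>
        (AE t in lebesgue. 0 \<le> t \<longrightarrow> (\<lambda>n. nrm (u t - s n t)) \<longlonglongrightarrow> 0)) \<and>
     (\<forall>T>0. set_integrable lebesgue {0..T} (\<lambda>t. nrm (u t) powr p))"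

definition cont_norm :: "('a::minus \<Rightarrow> real) \<Rightarrow> 'a set \<Rightarrow> (real \<Rightarrow> 'a) \<Rightarrow> bool" where
  "cont_norm nrm E u \<longleftrightarrow> (\<forall>t\<ge>0. u t \<in> E \<and> ((\<lambda>s. nrm (u s - u t)) \<longlongrightarrow> 0) (at t within {0..}))"

definition cont_weak :: "real ^ 3 \<Rightarrow> (real \<Rightarrow> field3) \<Rightarrow> bool" where
  "cont_weak L u \<longleftrightarrow> (\<forall>t\<ge>0. u t \<in> HH L) \<and> (\<forall>w\<in>HH L. continuous_on {0..} (\<lambda>t. ip L (u t) w))"

definition time_test :: "(real \<Rightarrow> real) \<Rightarrow> bool" where
  "time_test \<phi> \<longleftrightarrow> (\<forall>n t. (deriv ^^ n) \<phi> differentiable (at t)) \<and>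
     (\<exists>a b. 0 < a \<and> (\<forall>t. t \<notin> {a..b} \<longrightarrow> \<phi> t = 0))"

text \<open>
  \<open>f' = g\<close> in the sense of distributions on \<open>(0,\<infinity>)\<close>.  Local integrability makes \<open>f\<close> and \<open>g\<close>
  distributions.
\<close>

definition distr_deriv :: "(real \<Rightarrow> real) \<Rightarrow> (real \<Rightarrow> real) \<Rightarrow> bool" where
  "distr_deriv f g \<longleftrightarrow>
     (\<forall>a b. 0 < a \<longrightarrow> set_integrable lebesgue {a..b} f \<and> set_integrable lebesgue {a..b} g) \<and>
     (\<forall>\<phi>. time_test \<phi> \<longrightarrow>
        (LINT t:{0<..}|lebesgue. f t * deriv \<phi> t) = - (LINT t:{0<..}|lebesgue. g t * \<phi> t))"

section \<open>Solutions\<close>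

text \<open>
  In the two definitions below, the derivative \<open>u'\<close>, as a distribution with values in \<open>V'\<close> or in
  \<open>H\<close>, is the function \<open>g\<close>; an identity between Bochner integrals in \<open>V'\<close> or \<open>H\<close> is expressed by
  evaluating at all \<open>w\<close> in \<open>V\<close>, respectively by pairing with all \<open>w\<close> in \<open>H\<close>.
\<close>

definition leray_hopf :: "real ^ 3 \<Rightarrow> real \<Rightarrow> (real \<Rightarrow> field3) \<Rightarrow> bool" where
  "leray_hopf L \<Omega> u \<longleftrightarrow>
     cont_weak L u \<and>
     Lp_loc 2 (h1norm L) (VV L) u \<and>
     (\<exists>g. Lp_loc (4/3) (dual_norm L) (VV_dual L) g \<and>
        (\<forall>w\<in>VV L. distr_deriv (\<lambda>t. ip L (u t) w) (\<lambda>t. g t w))) \<and>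
     (\<forall>w\<in>VV L. distr_deriv (\<lambda>t. ip L (u t) w)
        (\<lambda>t. - (gip L (u t) w + trilin L (u t) (u t) w + \<Omega> * ip L (coriolis L (u t)) w))) \<and>
     (let energy_ineq = (\<lambda>t0. \<forall>t\<ge>t0.
            (l2norm L (u t))\<^sup>2 / 2 + (LINT \<tau>:{t0..t}|lebesgue. (gnorm L (u \<tau>))\<^sup>2)
              \<le> (l2norm L (u t0))\<^sup>2 / 2)
      in energy_ineq 0 \<and> (AE t0 in lebesgue. 0 < t0 \<longrightarrow> energy_ineq t0))"

definition global_regular :: "real ^ 3 \<Rightarrow> real \<Rightarrow> (real \<Rightarrow> field3) \<Rightarrow> bool" where
  "global_regular L \<Omega> u \<longleftrightarrow>
     leray_hopf L \<Omega> u \<and>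
     cont_norm (h1norm L) (VV L) u \<and>
     Lp_loc 2 (h2norm L) (stokes_dom L) u \<and>
     (\<exists>g. Lp_loc 2 (l2norm L) (HH L) g \<and>
        (\<forall>w\<in>HH L. distr_deriv (\<lambda>t. ip L (u t) w) (\<lambda>t. ip L (g t) w)))"

text \<open>
  Classical solutions of \<open>u\<^sub>t + A u + \<Omega> S u = 0\<close> for \<open>t > 0\<close>: \<open>u\<^sub>t\<close> is the limit in the norm of \<open>H\<close>
  of the difference quotients.
\<close>

definition solves_linear :: "real ^ 3 \<Rightarrow> real \<Rightarrow> (real \<Rightarrow> field3) \<Rightarrow> bool" where
  "solves_linear L \<Omega> u \<longleftrightarrow> (\<forall>t>0. u t \<in> stokes_dom L \<and>
     ((\<lambda>h. l2norm L (\<lambda>x. (u (t + h) x - u t x) /\<^sub>R h + stokes L (u t) x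
                          + \<Omega> *\<^sub>R coriolis L (u t) x)) \<longlongrightarrow> 0) (at 0))"

end

theory Submission
  imports Defs "HOL-Real_Asymp.Real_Asymp" "HOL-Computational_Algebra.Polynomial"
begin

text \<open>
  A field whose Fourier modes are multiples of one wave vector \<open>\<kappa>\<close> depends only on \<open>\<kappa> \<cdot> x\<close> and
  takes values orthogonal to \<open>\<kappa>\<close>. Hence its convective term vanishes, and the Coriolis operator acts
  on it as a multiple of the rotation by a right angle in the plane orthogonal to \<open>\<kappa>\<close>. The equation
  becomes a family of linear ordinary differential equations, one for each mode, which the formula
  solves.

  For uniqueness, let \<open>v\<close> be another solution, \<open>Y\<close> the truncation of the explicit solution to finitely
  many modes, which is an exact smooth solution, and \<open>w = v - Y\<close>. The energy inequality for \<open>v\<close>,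
  the energy equality for \<open>Y\<close> and the weak formulation for \<open>v\<close> tested with \<open>Y\<close> give
  \<open>d/dt |w|\<^sup>2 \<le> - 2 \<parallel>w\<parallel>\<^sup>2 + 2 b(v, v, Y)\<close> in integrated form. Here \<open>b(v, v, Y) = b(w, w, Y)\<close>, and since
  \<open>Y\<close> is bounded uniformly in the truncation, this is absorbed by \<open>\<parallel>w\<parallel>\<^sup>2\<close> up to a multiple of \<open>|w|\<^sup>2\<close>.
  Gronwall's inequality bounds \<open>|w(t)|\<close> by a multiple of \<open>|w(0)|\<close>, which tends to 0 with the truncation.
\<close>

subsection \<open>Square integrable fields\<close>

text \<open>The operators of the equation are choices, determined only up to null sets, so their
  values are never computed. The proof works with the relation \<open>expands\<close> between
  coefficients and fields, which ignores null sets and determines the field up to them. Every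
  operator becomes a multiplier on coefficients, and Riesz-Fischer turns coefficients back into
  fields.

  All wave vectors lie on one line. Hence the reciprocals of the Stokes eigenvalues are summable,
  and data in \<open>VV\<close> have absolutely summable coefficients: the one-dimensional Sobolev
  embedding. This yields unconditional convergence of the Fourier series that define the operators,
  and it is the reason for the uniform bound on \<open>Y\<close>.

  The truncation is there because the weak formulation tests with fields that are fixed in time. A
  finite sum of fixed modes with scalar coefficients depending on time can be treated mode by mode,
  once continuity of \<open>v\<close> in \<open>VV\<close> has turned the distributional time
  derivatives into classical ones.\<close>

lemma space_torus [simp]: "space (torus L) = cbox 0 L"
  by (simp add: torus_def space_restrict_space)

lemma measurable_torus: "f \<in> borel_measurable borel \<Longrightarrow> f \<in> borel_measurable (torus L)"
  by (simp add: torus_def measurable_restrict_space1)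

lemma emeasure_torus: "emeasure (torus L) (cbox 0 L) = emeasure lborel (cbox 0 L)"
  by (simp add: torus_def emeasure_restrict_space)

lemma finite_measure_torus: "finite_measure (torus L)"
  by (rule finite_measureI) (simp add: emeasure_torus emeasure_lborel_cbox_eq)

interpretation torus: finite_measure "torus L" for L
  by (rule finite_measure_torus)

lemma integrable_torus_bounded:
  fixes f :: "real ^ 3 \<Rightarrow> 'a::{banach, second_countable_topology}"
  assumes "f \<in> borel_measurable borel" "\<And>x. x \<in> cbox 0 L \<Longrightarrow> norm (f x) \<le> B"
  shows "integrable (torus L) f"
  using assms by (intro torus.integrable_const_bound[where B=B] AE_I2 measurable_torus) auto

lemma integral_torus: "(LINT x|torus L. f x) = (LINT x:cbox 0 L|lborel. f x)"
  for f :: "real ^ 3 \<Rightarrow> 'a::{banach, second_countable_topology}"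
  by (simp add: torus_def integral_restrict_space set_lebesgue_integral_def)

lemma AE_torus: "(AE x in torus L. P x) \<longleftrightarrow> (AE x in lborel. x \<in> cbox 0 L \<longrightarrow> P x)"
  unfolding torus_def by (subst AE_restrict_space_iff) auto

lemma L2_measurable: "u \<in> L2 L \<Longrightarrow> u \<in> borel_measurable borel"
  and L2_measurable_torus: "u \<in> L2 L \<Longrightarrow> u \<in> borel_measurable (torus L)"
  and L2_periodic: "u \<in> L2 L \<Longrightarrow> periodic L u"
  and L2_integrable: "u \<in> L2 L \<Longrightarrow> integrable (torus L) (\<lambda>x. (norm (u x))\<^sup>2)"
  by (auto simp: L2_def measurable_torus)

lemma integrable_inner:
  assumes "u \<in> L2 L" "v \<in> L2 L"
  shows "integrable (torus L) (\<lambda>x. norm (u x) * norm (v x))" "integrable (torus L) (\<lambda>x. u x \<bullet> v x)"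
proof -
  have [measurable]: "u \<in> borel_measurable (torus L)" "v \<in> borel_measurable (torus L)"
    using assms L2_measurable_torus by auto
  have I: "integrable (torus L) (\<lambda>x. (norm (u x))\<^sup>2 + (norm (v x))\<^sup>2)"
    using assms by (intro Bochner_Integration.integrable_add L2_integrable)
  have b: "norm (u x) * norm (v x) \<le> (norm (u x))\<^sup>2 + (norm (v x))\<^sup>2" for x
    using sum_squares_bound[of "norm (u x)" "norm (v x)"] zero_le_power2[of "norm (u x)"]
      zero_le_power2[of "norm (v x)"] mult_nonneg_nonneg[OF norm_ge_zero norm_ge_zero, of "u x" "v x"]
    by linarith
  show 1: "integrable (torus L) (\<lambda>x. norm (u x) * norm (v x))"
    by (rule Bochner_Integration.integrable_bound[OF I]) (use b in auto)
  show "integrable (torus L) (\<lambda>x. u x \<bullet> v x)"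
    by (rule Bochner_Integration.integrable_bound[OF 1]) (auto simp: Cauchy_Schwarz_ineq2)
qed

lemma L2_lincomb:
  assumes "u \<in> L2 L" "v \<in> L2 L"
  shows "(\<lambda>x. a *\<^sub>R u x + b *\<^sub>R v x) \<in> L2 L"
proof -
  have [measurable]: "u \<in> borel_measurable borel" "v \<in> borel_measurable borel"
    using assms L2_measurable by auto
  have "integrable (torus L) (\<lambda>x. 2 * a\<^sup>2 * (norm (u x))\<^sup>2 + 2 * b\<^sup>2 * (norm (v x))\<^sup>2)"
    using assms by (intro Bochner_Integration.integrable_add integrable_mult_right L2_integrable)
  then have "integrable (torus L) (\<lambda>x. (norm (a *\<^sub>R u x + b *\<^sub>R v x))\<^sup>2)"
  proof (rule Bochner_Integration.integrable_bound)
    show "AE x in torus L. norm ((norm (a *\<^sub>R u x + b *\<^sub>R v x))\<^sup>2)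
       \<le> norm (2 * a\<^sup>2 * (norm (u x))\<^sup>2 + 2 * b\<^sup>2 * (norm (v x))\<^sup>2)"
    proof (rule AE_I2)
      fix x
      have "(norm (a *\<^sub>R u x + b *\<^sub>R v x))\<^sup>2 \<le> (norm (a *\<^sub>R u x) + norm (b *\<^sub>R v x))\<^sup>2"
        by (intro power_mono norm_triangle_ineq) auto
      also have "\<dots> \<le> 2 * (norm (a *\<^sub>R u x))\<^sup>2 + 2 * (norm (b *\<^sub>R v x))\<^sup>2"
        using sum_squares_bound[of "norm (a *\<^sub>R u x)" "norm (b *\<^sub>R v x)"]
        by (simp add: power2_sum)
      finally show "norm ((norm (a *\<^sub>R u x + b *\<^sub>R v x))\<^sup>2)
         \<le> norm (2 * a\<^sup>2 * (norm (u x))\<^sup>2 + 2 * b\<^sup>2 * (norm (v x))\<^sup>2)"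
        by (simp add: power_mult_distrib)
    qed
  qed (intro measurable_torus, measurable)
  then show ?thesis
    using assms by (simp add: L2_def periodic_def)
qed

lemma L2_zero: "(\<lambda>x. 0) \<in> L2 L"
  by (simp add: L2_def periodic_def)

lemma L2_add: "u \<in> L2 L \<Longrightarrow> v \<in> L2 L \<Longrightarrow> (\<lambda>x. u x + v x) \<in> L2 L"
  using L2_lincomb[of u L v 1 1] by simp

lemma L2_diff: "u \<in> L2 L \<Longrightarrow> v \<in> L2 L \<Longrightarrow> (\<lambda>x. u x - v x) \<in> L2 L"
  using L2_lincomb[of u L v 1 "-1"] by simp

lemma L2_scaleR: "u \<in> L2 L \<Longrightarrow> (\<lambda>x. a *\<^sub>R u x) \<in> L2 L"
  using L2_lincomb[of u L u a 0] by simp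

lemma L2_minus: "u \<in> L2 L \<Longrightarrow> (\<lambda>x. - u x) \<in> L2 L"
  using L2_scaleR[of u L "-1"] by simp

lemma L2_sum: "(\<And>i. i \<in> I \<Longrightarrow> u i \<in> L2 L) \<Longrightarrow> (\<lambda>x. \<Sum>i\<in>I. u i x) \<in> L2 L"
  by (induction I rule: infinite_finite_induct) (auto intro: L2_zero L2_add)

lemma L2_bounded_linear:
  assumes "bounded_linear T" "u \<in> L2 L"
  shows "(\<lambda>x. T (u x)) \<in> L2 L"
proof -
  interpret T: bounded_linear T by fact
  obtain K where K: "\<And>x. norm (T x) \<le> norm x * K" using T.bounded by blast
  have [measurable]: "T \<in> borel_measurable borel"
    by (intro borel_measurable_continuous_onI T.continuous_on continuous_on_id)
  have [measurable]: "u \<in> borel_measurable borel" using assms L2_measurable by auto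
  have "integrable (torus L) (\<lambda>x. K\<^sup>2 * (norm (u x))\<^sup>2)"
    using assms by (intro integrable_mult_right L2_integrable)
  then have "integrable (torus L) (\<lambda>x. (norm (T (u x)))\<^sup>2)"
  proof (rule Bochner_Integration.integrable_bound)
    have "(norm (T (u x)))\<^sup>2 \<le> (norm (u x) * K)\<^sup>2" for x
      using K by (intro power_mono) auto
    then show "AE x in torus L. norm ((norm (T (u x)))\<^sup>2) \<le> norm (K\<^sup>2 * (norm (u x))\<^sup>2)"
      by (intro AE_I2) (simp add: power_mult_distrib mult.commute)
  qed (intro measurable_torus, measurable)
  then show ?thesis
    using assms by (simp add: L2_def periodic_def)
qed

section \<open>The inner product and seminorm of L2 on representatives\<close>

lemma ip_commute: "ip L u v = ip L v u"
  by (simp add: ip_def inner_commute)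

lemma ip_add_left: "u \<in> L2 L \<Longrightarrow> v \<in> L2 L \<Longrightarrow> w \<in> L2 L \<Longrightarrow>
    ip L (\<lambda>x. u x + v x) w = ip L u w + ip L v w"
  by (simp add: ip_def inner_add_left integrable_inner)

lemma ip_add_right: "u \<in> L2 L \<Longrightarrow> v \<in> L2 L \<Longrightarrow> w \<in> L2 L \<Longrightarrow>
    ip L w (\<lambda>x. u x + v x) = ip L w u + ip L w v"
  by (simp add: ip_def inner_add_right integrable_inner)

lemma ip_diff_left: "u \<in> L2 L \<Longrightarrow> v \<in> L2 L \<Longrightarrow> w \<in> L2 L \<Longrightarrow>
    ip L (\<lambda>x. u x - v x) w = ip L u w - ip L v w"
  by (simp add: ip_def inner_diff_left integrable_inner)

lemma ip_diff_right: "u \<in> L2 L \<Longrightarrow> v \<in> L2 L \<Longrightarrow> w \<in> L2 L \<Longrightarrow>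
    ip L w (\<lambda>x. u x - v x) = ip L w u - ip L w v"
  by (simp add: ip_def inner_diff_right integrable_inner)

lemma ip_scaleR_left: "ip L (\<lambda>x. a *\<^sub>R u x) v = a * ip L u v"
  by (simp add: ip_def)

lemma ip_scaleR_right: "ip L u (\<lambda>x. a *\<^sub>R v x) = a * ip L u v"
  by (simp add: ip_def)

lemma ip_minus_left: "ip L (\<lambda>x. - u x) v = - ip L u v"
  by (simp add: ip_def)

lemma ip_minus_right: "ip L u (\<lambda>x. - v x) = - ip L u v"
  by (simp add: ip_def)

lemma ip_zero [simp]: "ip L (\<lambda>x. 0) v = 0" "ip L u (\<lambda>x. 0) = 0"
  by (simp_all add: ip_def)

lemma ip_sum_left: "(\<And>i. i \<in> I \<Longrightarrow> u i \<in> L2 L) \<Longrightarrow> w \<in> L2 L \<Longrightarrow>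
    ip L (\<lambda>x. \<Sum>i\<in>I. u i x) w = (\<Sum>i\<in>I. ip L (u i) w)"
  by (simp add: ip_def inner_sum_left integrable_inner)

lemma ip_sum_right: "(\<And>i. i \<in> I \<Longrightarrow> u i \<in> L2 L) \<Longrightarrow> w \<in> L2 L \<Longrightarrow>
    ip L w (\<lambda>x. \<Sum>i\<in>I. u i x) = (\<Sum>i\<in>I. ip L w (u i))"
  by (simp add: ip_def inner_sum_right integrable_inner)

lemma ip_self_nonneg [simp]: "0 \<le> ip L u u"
  by (simp add: ip_def)

lemma l2norm_nonneg [simp]: "0 \<le> l2norm L u"
  by (simp add: l2norm_def)

lemma l2norm_power2: "(l2norm L u)\<^sup>2 = ip L u u"
  by (simp add: l2norm_def)

lemma l2norm_zero [simp]: "l2norm L (\<lambda>x. 0) = 0"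
  by (simp add: l2norm_def)

lemma eqae_refl [simp]: "eqae L u u"
  by (simp add: eqae_def)

lemma eqae_sym: "eqae L u v \<Longrightarrow> eqae L v u"
  by (simp add: eqae_def eq_commute)

lemma ip_cong: "eqae L u u' \<Longrightarrow> eqae L v v' \<Longrightarrow> u \<in> L2 L \<Longrightarrow> u' \<in> L2 L \<Longrightarrow> v \<in> L2 L \<Longrightarrow> v' \<in> L2 L
    \<Longrightarrow> ip L u v = ip L u' v'"
  unfolding ip_def eqae_def
  by (rule integral_cong_AE) (auto dest!: L2_measurable_torus elim!: eventually_elim2)

lemma l2norm_cong: "eqae L u u' \<Longrightarrow> u \<in> L2 L \<Longrightarrow> u' \<in> L2 L \<Longrightarrow> l2norm L u = l2norm L u'"
  unfolding l2norm_def using ip_cong by metis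

lemma eqae_comp: "eqae L u v \<Longrightarrow> eqae L (\<lambda>x. f (u x)) (\<lambda>x. f (v x))"
  unfolding eqae_def by (erule eventually_mono) simp

lemma eqae_comp2: "eqae L u v \<Longrightarrow> eqae L u' v' \<Longrightarrow> eqae L (\<lambda>x. f (u x) (u' x)) (\<lambda>x. f (v x) (v' x))"
  unfolding eqae_def by (erule (1) eventually_elim2) simp

text \<open>Positivity of the quadratic form \<open>q\<close> in the coefficients of
  \<open>u\<close> and \<open>v\<close>. On representatives the form is only semidefinite, because
  null fields have norm zero; this is why \<open>?c = 0\<close> is a case of its own.\<close>

lemma ip_Cauchy_Schwarz:
  assumes "u \<in> L2 L" "v \<in> L2 L"
  shows "\<bar>ip L u v\<bar> \<le> l2norm L u * l2norm L v"
proof -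
  let ?a = "ip L u u" and ?b = "ip L u v" and ?c = "ip L v v"
  have q: "0 \<le> s\<^sup>2 * ?a + 2 * s * r * ?b + r\<^sup>2 * ?c" for s r
  proof -
    have "0 \<le> ip L (\<lambda>x. s *\<^sub>R u x + r *\<^sub>R v x) (\<lambda>x. s *\<^sub>R u x + r *\<^sub>R v x)" by simp
    also have "\<dots> = s\<^sup>2 * ?a + 2 * s * r * ?b + r\<^sup>2 * ?c"
      using assms
      by (simp add: ip_add_left ip_add_right L2_add L2_scaleR ip_scaleR_left ip_scaleR_right
          ip_commute[of L v u] power2_eq_square algebra_simps)
    finally show ?thesis .
  qed
  have "?b\<^sup>2 \<le> ?a * ?c"
  proof (cases "?c = 0")
    case True
    then have *: "0 \<le> s\<^sup>2 * ?a + 2 * s * r * ?b" for s r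
      using q[of s r] by simp
    have "?b = 0"
    proof (rule ccontr)
      assume "?b \<noteq> 0"
      \<comment> \<open>With this second argument the form takes the value - 1.\<close>
      then show False using *[of 1 "- (?a + 1) / (2 * ?b)"] by (simp add: field_simps)
    qed
    then show ?thesis using True by simp
  next
    case False
    then have c: "?c > 0" using ip_self_nonneg[of L v] by linarith
    have "0 \<le> ?c * (?a * ?c - ?b\<^sup>2)"
      using q[of "?c" "- ?b"] by (simp add: power2_eq_square algebra_simps)
    then show ?thesis using c by (simp add: zero_le_mult_iff)
  qed
  then have "sqrt (?b\<^sup>2) \<le> sqrt (?a * ?c)" by (rule real_sqrt_le_mono)
  then show ?thesis by (simp add: l2norm_def real_sqrt_mult)
qed

lemma l2norm_scaleR: "l2norm L (\<lambda>x. a *\<^sub>R u x) = \<bar>a\<bar> * l2norm L u"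
  by (simp add: l2norm_def ip_scaleR_left ip_scaleR_right real_sqrt_mult)

lemma l2norm_minus: "l2norm L (\<lambda>x. - u x) = l2norm L u"
  using l2norm_scaleR[of L "-1" u] by simp

lemma l2norm_minus_commute: "l2norm L (\<lambda>x. u x - v x) = l2norm L (\<lambda>x. v x - u x)"
  using l2norm_minus[of L "\<lambda>x. u x - v x"] by simp

lemma ip_add_self: "u \<in> L2 L \<Longrightarrow> v \<in> L2 L \<Longrightarrow>
    ip L (\<lambda>x. u x + v x) (\<lambda>x. u x + v x) = ip L u u + 2 * ip L u v + ip L v v"
  by (simp add: ip_add_left ip_add_right L2_add ip_commute[of L v u])

lemma ip_diff_self: "u \<in> L2 L \<Longrightarrow> v \<in> L2 L \<Longrightarrow>
    ip L (\<lambda>x. u x - v x) (\<lambda>x. u x - v x) = ip L u u - 2 * ip L u v + ip L v v"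
  by (simp add: ip_diff_left ip_diff_right L2_diff ip_commute[of L v u])

lemma l2norm_triangle:
  assumes "u \<in> L2 L" "v \<in> L2 L"
  shows "l2norm L (\<lambda>x. u x + v x) \<le> l2norm L u + l2norm L v"
proof (rule power2_le_imp_le)
  show "(l2norm L (\<lambda>x. u x + v x))\<^sup>2 \<le> (l2norm L u + l2norm L v)\<^sup>2"
    using ip_Cauchy_Schwarz[OF assms] by (simp add: l2norm_power2 power2_sum ip_add_self assms)
qed simp

lemma l2norm_triangle_diff:
  assumes "u \<in> L2 L" "v \<in> L2 L" "w \<in> L2 L"
  shows "l2norm L (\<lambda>x. u x - w x) \<le> l2norm L (\<lambda>x. u x - v x) + l2norm L (\<lambda>x. v x - w x)"
  using l2norm_triangle[of "\<lambda>x. u x - v x" L "\<lambda>x. v x - w x"] assms by (simp add: L2_diff)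

lemma l2norm_mono:
  assumes "u \<in> L2 L" "v \<in> L2 L" "AE x in torus L. norm (u x) \<le> norm (v x)"
  shows "l2norm L u \<le> l2norm L v"
  unfolding l2norm_def ip_def dot_square_norm
proof (rule real_sqrt_le_mono, rule integral_mono_AE)
  show "AE x in torus L. (norm (u x))\<^sup>2 \<le> (norm (v x))\<^sup>2"
    using assms(3) by eventually_elim (simp add: power_mono)
qed (auto intro: L2_integrable assms)

lemma l2norm_eq_0_iff:
  assumes "u \<in> L2 L"
  shows "l2norm L u = 0 \<longleftrightarrow> eqae L u (\<lambda>x. 0)"
proof -
  have "l2norm L u = 0 \<longleftrightarrow> (LINT x|torus L. (norm (u x))\<^sup>2) = 0"
    by (simp add: l2norm_def ip_def dot_square_norm)
  also have "\<dots> \<longleftrightarrow> (AE x in torus L. (norm (u x))\<^sup>2 = 0)"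
    by (rule integral_nonneg_eq_0_iff_AE) (auto intro: L2_integrable assms)
  finally show ?thesis by (simp add: eqae_def)
qed

lemma l2norm_diff_eq_0_iff:
  assumes "u \<in> L2 L" "v \<in> L2 L"
  shows "l2norm L (\<lambda>x. u x - v x) = 0 \<longleftrightarrow> eqae L u v"
  using l2norm_eq_0_iff[OF L2_diff[OF assms]] by (simp add: eqae_def)

lemma l2_limit_unique:
  assumes "u \<in> L2 L" "v \<in> L2 L" "\<And>i. f i \<in> L2 L" "F \<noteq> bot"
    and "((\<lambda>i. l2norm L (\<lambda>x. u x - f i x)) \<longlongrightarrow> 0) F" "((\<lambda>i. l2norm L (\<lambda>x. v x - f i x)) \<longlongrightarrow> 0) F"
  shows "eqae L u v"
proof -
  have "((\<lambda>i. l2norm L (\<lambda>x. u x - f i x) + l2norm L (\<lambda>x. v x - f i x)) \<longlongrightarrow> 0) F"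
    using tendsto_add[OF assms(5,6)] by simp
  then have "l2norm L (\<lambda>x. u x - v x) \<le> 0"
  proof (rule tendsto_lowerbound)
    show "\<forall>\<^sub>F i in F. l2norm L (\<lambda>x. u x - v x) \<le> l2norm L (\<lambda>x. u x - f i x) + l2norm L (\<lambda>x. v x - f i x)"
      using l2norm_triangle_diff[OF assms(1) assms(3) assms(2)] l2norm_minus_commute[of L v]
      by (intro always_eventually) simp
  qed (rule assms)
  then show ?thesis using l2norm_nonneg[of L "\<lambda>x. u x - v x"] l2norm_diff_eq_0_iff assms by force
qed

lemma tendsto_ip:
  assumes "u \<in> L2 L" "v \<in> L2 L" "\<And>i. f i \<in> L2 L" "\<And>i. g i \<in> L2 L"
    and "((\<lambda>i. l2norm L (\<lambda>x. u x - f i x)) \<longlongrightarrow> 0) F" "((\<lambda>i. l2norm L (\<lambda>x. v x - g i x)) \<longlongrightarrow> 0) F"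
  shows "((\<lambda>i. ip L (f i) (g i)) \<longlongrightarrow> ip L u v) F"
proof -
  let ?a = "\<lambda>i. l2norm L (\<lambda>x. u x - f i x)" and ?b = "\<lambda>i. l2norm L (\<lambda>x. v x - g i x)"
  have "((\<lambda>i. ?a i * l2norm L v + ?a i * ?b i + l2norm L u * ?b i) \<longlongrightarrow> 0 * l2norm L v + 0 * 0 + l2norm L u * 0) F"
    by (intro tendsto_intros assms)
  then have lim: "((\<lambda>i. ?a i * l2norm L v + ?a i * ?b i + l2norm L u * ?b i) \<longlongrightarrow> 0) F" by simp
  have "((\<lambda>i. ip L u v - ip L (f i) (g i)) \<longlongrightarrow> 0) F"
  proof (rule Lim_null_comparison[OF _ lim], rule always_eventually, rule allI)
    fix i
    \<comment> \<open>Everything is expressed through the limits and the errors; the norms of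
      \<open>f i\<close> and \<open>g i\<close> do not enter.\<close>
    have e: "ip L u v - ip L (f i) (g i) =
        ip L (\<lambda>x. u x - f i x) v - ip L (\<lambda>x. u x - f i x) (\<lambda>x. v x - g i x) + ip L u (\<lambda>x. v x - g i x)"
      using assms by (simp add: ip_diff_left ip_diff_right L2_diff)
    show "norm (ip L u v - ip L (f i) (g i)) \<le> ?a i * l2norm L v + ?a i * ?b i + l2norm L u * ?b i"
      using ip_Cauchy_Schwarz[of "\<lambda>x. u x - f i x" L v] ip_Cauchy_Schwarz[of u L "\<lambda>x. v x - g i x"]
        ip_Cauchy_Schwarz[of "\<lambda>x. u x - f i x" L "\<lambda>x. v x - g i x"] assms
      unfolding e by (simp add: L2_diff)
  qed
  then have "((\<lambda>i. ip L u v - (ip L u v - ip L (f i) (g i))) \<longlongrightarrow> ip L u v - 0) F"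
    by (intro tendsto_intros)
  then show ?thesis by simp
qed

lemma tendsto_ip_left:
  assumes "u \<in> L2 L" "v \<in> L2 L" "\<And>i. f i \<in> L2 L"
    and "((\<lambda>i. l2norm L (\<lambda>x. u x - f i x)) \<longlongrightarrow> 0) F"
  shows "((\<lambda>i. ip L (f i) v) \<longlongrightarrow> ip L u v) F"
  by (rule tendsto_ip[OF assms(1,2,3,2,4)]) simp

text \<open>The scalar functions |u| and |v| are turned into fields by placing them along a fixed
  axis, so that the Cauchy-Schwarz inequality for \<open>ip\<close> covers them.\<close>

lemma integral_norm_Cauchy_Schwarz:
  assumes "u \<in> L2 L" "v \<in> L2 L"
  shows "(LINT x|torus L. norm (u x) * norm (v x)) \<le> l2norm L u * l2norm L v"
proof -
  let ?n = "\<lambda>u x. norm (u x) *\<^sub>R axis 1 1 :: real ^ 3"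
  have n: "?n u \<in> L2 L" "l2norm L (?n u) = l2norm L u" if "u \<in> L2 L" for u
  proof -
    have [measurable]: "u \<in> borel_measurable borel" using that L2_measurable by auto
    show "?n u \<in> L2 L" using that by (auto simp: L2_def periodic_def)
    show "l2norm L (?n u) = l2norm L u"
      by (simp add: l2norm_def ip_def dot_square_norm power2_eq_square inner_axis_axis)
  qed
  have "ip L (?n u) (?n v) \<le> l2norm L u * l2norm L v"
    using ip_Cauchy_Schwarz[OF n(1)[OF assms(1)] n(1)[OF assms(2)]] n(2) assms by simp
  then show ?thesis by (simp add: ip_def inner_axis_axis mult.commute)
qed

section \<open>Completeness of L2\<close>

lemma L2_const: "(\<lambda>x. c) \<in> L2 L"
  by (auto simp: L2_def periodic_def)

text \<open>Pairing with a constant unit field bounds the L1 norm by the L2 norm on the cell. The L1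
  norms of the increments are therefore summable, and the telescoping series converges absolutely
  almost everywhere.\<close>

lemma l2_fast_Cauchy_convergent:
  assumes g: "\<And>n. g n \<in> L2 L" and fast: "\<And>n. l2norm L (\<lambda>x. g (Suc n) x - g n x) \<le> (1/2) ^ n"
  shows "AE x in torus L. convergent (\<lambda>n. g n x)"
proof -
  let ?h = "\<lambda>n x. g (Suc n) x - g n x"
  let ?c = "l2norm L (\<lambda>x. axis 1 1)"
  have h: "?h n \<in> L2 L" for n using g by (intro L2_diff)
  have [measurable]: "g n \<in> borel_measurable (torus L)" for n
    using g L2_measurable_torus by auto
  have i: "integrable (torus L) (\<lambda>x. norm (?h n x))" for n
    using integrable_inner(1)[OF h L2_const[of "axis 1 1"]] by simp
  have le: "(LINT x|torus L. norm (?h n x)) \<le> ?c * (1/2) ^ n" for n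
    using integral_norm_Cauchy_Schwarz[OF h L2_const[of "axis 1 1"]]
      mult_right_mono[OF fast[of n] l2norm_nonneg[of L "\<lambda>x. axis 1 1"]]
    by (simp add: mult.commute) (meson order_trans)
  have "(\<integral>\<^sup>+x. (\<Sum>n. ennreal (norm (?h n x))) \<partial>torus L) = (\<Sum>n. \<integral>\<^sup>+x. ennreal (norm (?h n x)) \<partial>torus L)"
    by (intro nn_integral_suminf) measurable
  also have "\<dots> \<le> (\<Sum>n. ennreal (?c * (1/2) ^ n))"
    using le by (intro suminf_le) (auto simp: nn_integral_eq_integral[OF i] intro!: ennreal_leI)
  also have "\<dots> = ennreal (\<Sum>n. ?c * (1/2) ^ n)"
    by (intro suminf_ennreal2 summable_mult) auto
  also have "\<dots> < \<infinity>" by simp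
  finally have "(\<integral>\<^sup>+x. (\<Sum>n. ennreal (norm (?h n x))) \<partial>torus L) \<noteq> \<infinity>" by simp
  then have "AE x in torus L. (\<Sum>n. ennreal (norm (?h n x))) \<noteq> \<infinity>"
    by (intro nn_integral_PInf_AE) measurable
  then show ?thesis
  proof (rule eventually_mono)
    fix x assume "(\<Sum>n. ennreal (norm (?h n x))) \<noteq> \<infinity>"
    then have "summable (\<lambda>n. norm (?h n x))"
      by (intro summable_suminf_not_top) auto
    then have "summable (\<lambda>n. ?h n x)" by (rule summable_norm_cancel)
    then have "convergent (\<lambda>n. \<Sum>i<n. ?h i x)" by (simp add: summable_iff_convergent)
    moreover have "(\<lambda>n. \<Sum>i<n. ?h i x) = (\<lambda>n. g n x - g 0 x)"
      by (rule ext) (rule sum_lessThan_telescope)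
    ultimately have "convergent (\<lambda>n. g n x - g 0 x)" by simp
    then show "convergent (\<lambda>n. g n x)"
      using convergent_diff_const_right_iff[of "\<lambda>n. g n x" "g 0 x"] by simp
  qed
qed

lemma nn_integral_l2norm:
  "u \<in> L2 L \<Longrightarrow> (\<integral>\<^sup>+x. ennreal ((norm (u x))\<^sup>2) \<partial>torus L) = ennreal ((l2norm L u)\<^sup>2)"
  by (simp add: nn_integral_eq_integral[OF L2_integrable] l2norm_power2 ip_def dot_square_norm)

text \<open>The limit is defined at every point by \<open>lim\<close> along a fast subsequence.
  Where the subsequence diverges this is an arbitrary value, but it depends only on the sequence of
  values, so \<open>u\<close> is periodic everywhere and Borel measurable, as \<open>L2\<close>
  demands. Fatou's lemma gives the convergence in norm.\<close>

lemma L2_complete: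
  assumes f: "\<And>n. f n \<in> L2 L"
    and C: "\<And>e. e > 0 \<Longrightarrow> \<exists>N. \<forall>m\<ge>N. \<forall>n\<ge>N. l2norm L (\<lambda>x. f m x - f n x) < e"
  obtains u where "u \<in> L2 L" "(\<lambda>n. l2norm L (\<lambda>x. u x - f n x)) \<longlonglongrightarrow> 0"
proof -
  have "\<forall>k. \<exists>N. \<forall>m\<ge>N. \<forall>n\<ge>N. l2norm L (\<lambda>x. f m x - f n x) < (1/2) ^ k"
    using C by simp
  then obtain N where N: "\<And>k m n. m \<ge> N k \<Longrightarrow> n \<ge> N k \<Longrightarrow> l2norm L (\<lambda>x. f m x - f n x) < (1/2) ^ k"
    by metis
  \<comment> \<open>Summing makes \<open>r\<close> monotone and at least \<open>N k\<close>; the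
    extra \<open>k\<close> makes it unbounded.\<close>
  define r where "r k = (\<Sum>i\<le>k. N i) + k" for k
  have rN: "r k \<ge> N k" and rk: "r k \<ge> k" and rS: "r (Suc k) \<ge> r k" for k
    using member_le_sum[of k "{..k}" N] by (auto simp: r_def)
  define g where "g k = f (r k)" for k
  define u where "u x = lim (\<lambda>k. g k x)" for x
  have g: "g k \<in> L2 L" for k using f by (simp add: g_def)
  have [measurable]: "f k \<in> borel_measurable borel" "g k \<in> borel_measurable borel" for k
    using f g L2_measurable by auto
  have um [measurable]: "u \<in> borel_measurable borel"
    unfolding u_def by measurable
  have up: "periodic L u"
    using g by (simp add: L2_def periodic_def u_def)
  have conv: "AE x in torus L. (\<lambda>k. g k x) \<longlonglongrightarrow> u x"
  proof -
    have "l2norm L (\<lambda>x. g (Suc k) x - g k x) \<le> (1/2) ^ k" for k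
      unfolding g_def using N[of k "r (Suc k)" "r k"] rN[of k] rS[of k] by (meson order_trans less_imp_le)
    from l2_fast_Cauchy_convergent[OF g this] show ?thesis
      by (rule eventually_mono) (simp add: u_def convergent_LIMSEQ_iff)
  qed
  have bound: "\<exists>N. \<forall>n\<ge>N. (\<lambda>x. u x - f n x) \<in> L2 L \<and> l2norm L (\<lambda>x. u x - f n x) \<le> e" if e: "e > 0" for e
  proof -
    obtain M where M: "\<And>m n. m \<ge> M \<Longrightarrow> n \<ge> M \<Longrightarrow> l2norm L (\<lambda>x. f m x - f n x) < e"
      using C[OF e] by blast
    show ?thesis
    proof (intro exI allI impI)
      fix n assume n: "n \<ge> M"
      have "(\<integral>\<^sup>+x. ennreal ((norm (u x - f n x))\<^sup>2) \<partial>torus L)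
          = (\<integral>\<^sup>+x. liminf (\<lambda>k. ennreal ((norm (g k x - f n x))\<^sup>2)) \<partial>torus L)"
      proof (rule nn_integral_cong_AE, rule eventually_mono[OF conv])
        fix x assume "(\<lambda>k. g k x) \<longlonglongrightarrow> u x"
        then have "(\<lambda>k. ennreal ((norm (g k x - f n x))\<^sup>2)) \<longlonglongrightarrow> ennreal ((norm (u x - f n x))\<^sup>2)"
          by (intro tendsto_intros)
        from lim_imp_Liminf[OF trivial_limit_sequentially this, symmetric]
        show "ennreal ((norm (u x - f n x))\<^sup>2) = liminf (\<lambda>k. ennreal ((norm (g k x - f n x))\<^sup>2))" .
      qed
      \<comment> \<open>Fatou's lemma along the subsequence, with \<open>n\<close> fixed.\<close>
      also have "\<dots> \<le> liminf (\<lambda>k. \<integral>\<^sup>+x. ennreal ((norm (g k x - f n x))\<^sup>2) \<partial>torus L)"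
        by (intro nn_integral_liminf measurable_torus) measurable
      also have "\<dots> \<le> liminf (\<lambda>k. ennreal (e\<^sup>2))"
      proof (rule Liminf_mono, rule eventually_sequentiallyI)
        fix k assume "k \<ge> M"
        then have "r k \<ge> M" using rk[of k] by linarith
        then have "l2norm L (\<lambda>x. g k x - f n x) \<le> e" unfolding g_def using M n by (simp add: less_imp_le)
        then show "(\<integral>\<^sup>+x. ennreal ((norm (g k x - f n x))\<^sup>2) \<partial>torus L) \<le> ennreal (e\<^sup>2)"
          using nn_integral_l2norm[OF L2_diff[OF g f]] by (auto intro!: ennreal_leI power_mono)
      qed
      finally have le: "(\<integral>\<^sup>+x. ennreal ((norm (u x - f n x))\<^sup>2) \<partial>torus L) \<le> ennreal (e\<^sup>2)"
        by (simp add: Liminf_const)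
      have "integrable (torus L) (\<lambda>x. (norm (u x - f n x))\<^sup>2)"
        by (rule integrableI_bounded) (use le in \<open>auto intro!: measurable_torus intro: le_less_trans\<close>)
      moreover have "periodic L (\<lambda>x. u x - f n x)"
        using up f[of n] by (simp add: L2_def periodic_def)
      ultimately have uf: "(\<lambda>x. u x - f n x) \<in> L2 L" by (simp add: L2_def)
      have "(l2norm L (\<lambda>x. u x - f n x))\<^sup>2 \<le> e\<^sup>2"
        using le nn_integral_l2norm[OF uf] by simp
      then show "(\<lambda>x. u x - f n x) \<in> L2 L \<and> l2norm L (\<lambda>x. u x - f n x) \<le> e"
        using uf e power2_le_imp_le less_imp_le by blast
    qed
  qed
  show ?thesis
  proof (rule that)
    obtain n where "(\<lambda>x. u x - f n x) \<in> L2 L" using bound[of 1] by auto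
    from L2_add[OF this f[of n]] show "u \<in> L2 L" by simp
    show "(\<lambda>n. l2norm L (\<lambda>x. u x - f n x)) \<longlonglongrightarrow> 0"
    proof (rule LIMSEQ_I)
      fix e :: real assume "e > 0"
      then obtain N where "\<forall>n\<ge>N. l2norm L (\<lambda>x. u x - f n x) \<le> e/2" using bound[of "e/2"] by auto
      then show "\<exists>N. \<forall>n\<ge>N. norm (l2norm L (\<lambda>x. u x - f n x) - 0) < e"
        using \<open>e > 0\<close> by (intro exI[of _ N]) force
    qed
  qed
qed

section \<open>Trigonometric fields and the space H\<close>

lemma wave_inner_period:
  "cis (wave L k \<bullet> (x + axis j (L $ j))) = cis (wave L k \<bullet> x)"
proof (cases "L $ j = 0")
  case True
  have "axis j (L $ j) = 0" using True by (simp add: axis_def vec_eq_iff)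
  show ?thesis unfolding \<open>axis j (L $ j) = 0\<close> by simp
next
  case False
  then have "wave L k \<bullet> (x + axis j (L $ j)) = wave L k \<bullet> x + 2 * pi * of_int (k $ j)"
    by (simp add: inner_add_right inner_axis wave_def)
  then show ?thesis by (simp add: cis_mult[symmetric] cis_multiple_2pi)
qed

lemma continuous_on_trig_sum: "continuous_on UNIV (trig_sum L K c)"
  unfolding trig_sum_def[abs_def] vector_scalar_mult_def
  by (intro continuous_intros)

lemma cvec_eq_iff [simp]: "cvec x = cvec y \<longleftrightarrow> x = y"
  by (simp add: cvec_def vec_eq_iff)

lemma trig_fields_L2:
  assumes "u \<in> trig_fields L" shows "u \<in> L2 L"
proof -
  obtain K c where u: "\<And>x. cvec (u x) = trig_sum L K c x"
    using assms by (auto simp: trig_fields_def)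
  have e: "u x = (\<chi> j. Re (trig_sum L K c x $ j))" for x
    by (simp add: u[symmetric] cvec_def vec_eq_iff)
  have cont: "continuous_on UNIV u"
    unfolding e[abs_def] by (intro continuous_intros continuous_on_trig_sum)
  then have m: "u \<in> borel_measurable borel" by (rule borel_measurable_continuous_onI)
  have "compact (u ` cbox 0 L)"
    by (intro compact_continuous_image continuous_on_subset[OF cont]) auto
  then obtain B where B: "\<And>x. x \<in> cbox 0 L \<Longrightarrow> norm (u x) \<le> B"
    by (meson bounded_iff compact_imp_bounded imageI)
  have "integrable (torus L) (\<lambda>x. (norm (u x))\<^sup>2)"
    using m by (intro integrable_torus_bounded[where B="B\<^sup>2"]) (auto intro!: power_mono B)
  moreover have "periodic L u"
    by (simp add: periodic_def e trig_sum_def wave_inner_period)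
  ultimately show ?thesis using m by (simp add: L2_def)
qed

lemma trig_fields_lincomb:
  assumes "u \<in> trig_fields L" "v \<in> trig_fields L"
  shows "(\<lambda>x. a *\<^sub>R u x + b *\<^sub>R v x) \<in> trig_fields L"
proof -
  obtain K c where K: "finite K" "0 \<notin> K" "\<And>k. k \<notin> K \<Longrightarrow> c k = 0" "\<And>k. k \<in> K \<Longrightarrow> c k \<in> X L k"
      "\<And>k j. c (- k) $ j = cnj (c k $ j)" and u: "\<And>x. cvec (u x) = trig_sum L K c x"
    using assms(1) by (auto simp: trig_fields_def)
  obtain K' c' where K': "finite K'" "0 \<notin> K'" "\<And>k. k \<notin> K' \<Longrightarrow> c' k = 0" "\<And>k. k \<in> K' \<Longrightarrow> c' k \<in> X L k"
      "\<And>k j. c' (- k) $ j = cnj (c' k $ j)" and v: "\<And>x. cvec (v x) = trig_sum L K' c' x"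
    using assms(2) by (auto simp: trig_fields_def)
  have X: "c k \<in> X L k" "c' k \<in> X L k" for k
    using K(3,4)[of k] K'(3,4)[of k] by (cases "k \<in> K"; cases "k \<in> K'"; simp add: X_def)+
  have t: "trig_sum L K c x = trig_sum L (K \<union> K') c x" "trig_sum L K' c' x = trig_sum L (K \<union> K') c' x" for x
    unfolding trig_sum_def using K K' by (auto intro!: sum.mono_neutral_left)
  show ?thesis
    unfolding trig_fields_def
  proof (intro CollectI exI conjI allI ballI impI)
    show "finite (K \<union> K')" "0 \<notin> K \<union> K'" using K K' by auto
    show "(\<lambda>k. a *\<^sub>R c k + b *\<^sub>R c' k) k = 0" if "k \<notin> K \<union> K'" for k using that K K' by simp
    show "(\<lambda>k. a *\<^sub>R c k + b *\<^sub>R c' k) k \<in> X L k" for k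
    proof -
      have "(\<Sum>j\<in>UNIV. (a *\<^sub>R c k + b *\<^sub>R c' k) $ j * of_real (wave L k $ j))
          = a *\<^sub>R (\<Sum>j\<in>UNIV. c k $ j * of_real (wave L k $ j)) + b *\<^sub>R (\<Sum>j\<in>UNIV. c' k $ j * of_real (wave L k $ j))"
        by (simp add: scaleR_sum_right sum.distrib[symmetric] algebra_simps)
      also have "\<dots> = 0" using X[of k] by (simp add: X_def)
      finally show ?thesis by (simp add: X_def)
    qed
    show "(\<lambda>k. a *\<^sub>R c k + b *\<^sub>R c' k) (- k) $ j = cnj ((\<lambda>k. a *\<^sub>R c k + b *\<^sub>R c' k) k $ j)" for k j
      using K(5) K'(5) by simp
    show "cvec (a *\<^sub>R u x + b *\<^sub>R v x) = trig_sum L (K \<union> K') (\<lambda>k. a *\<^sub>R c k + b *\<^sub>R c' k) x" for x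
    proof -
      have "cvec (a *\<^sub>R u x + b *\<^sub>R v x) = a *\<^sub>R cvec (u x) + b *\<^sub>R cvec (v x)"
        by (simp add: cvec_def vec_eq_iff scaleR_conv_of_real[where 'a=complex])
      also have "\<dots> = trig_sum L (K \<union> K') (\<lambda>k. a *\<^sub>R c k + b *\<^sub>R c' k) x"
        unfolding u v t
        by (simp add: trig_sum_def scaleR_sum_right sum.distrib[symmetric] vec_eq_iff algebra_simps)
      finally show ?thesis .
    qed
  qed
qed

lemma HH_L2: "u \<in> HH L \<Longrightarrow> u \<in> L2 L"
  by (simp add: HH_def)

lemma HH_approx:
  assumes "u \<in> HH L"
  shows "\<exists>f. (\<forall>n. f n \<in> trig_fields L) \<and> (\<lambda>n. l2norm L (\<lambda>x. u x - f n x)) \<longlonglongrightarrow> 0"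
proof -
  have "\<forall>n. \<exists>v\<in>trig_fields L. l2norm L (\<lambda>x. u x - v x) < 1 / real (Suc n)"
    using assms by (auto simp: HH_def fun_diff_def)
  then obtain f where f: "\<And>n. f n \<in> trig_fields L" "\<And>n. l2norm L (\<lambda>x. u x - f n x) < 1 / real (Suc n)"
    by metis
  have "(\<lambda>n. l2norm L (\<lambda>x. u x - f n x)) \<longlonglongrightarrow> 0"
    by (rule Lim_null_comparison[OF _ lim_1_over_n[THEN LIMSEQ_Suc]])
      (use f(2) in \<open>auto intro!: always_eventually less_imp_le\<close>)
  with f(1) show ?thesis by blast
qed

lemma HH_limit:
  assumes "u \<in> L2 L" "\<And>n. f n \<in> HH L" "(\<lambda>n. l2norm L (\<lambda>x. u x - f n x)) \<longlonglongrightarrow> 0"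
  shows "u \<in> HH L"
  unfolding HH_def
proof (intro CollectI conjI allI impI assms(1))
  fix e :: real assume e: "e > 0"
  then obtain n where n: "l2norm L (\<lambda>x. u x - f n x) < e/2"
    using LIMSEQ_D[OF assms(3), of "e/2"] by auto
  obtain v where v: "v \<in> trig_fields L" "l2norm L (\<lambda>x. f n x - v x) < e/2"
    using assms(2)[of n] e unfolding HH_def fun_diff_def by (auto dest!: spec[of _ "e/2"])
  have "l2norm L (\<lambda>x. u x - v x) < e"
    using l2norm_triangle_diff[OF assms(1) HH_L2[OF assms(2)] trig_fields_L2[OF v(1)], of n] n v by linarith
  then show "\<exists>v\<in>trig_fields L. l2norm L (u - v) < e"
    using v(1) by (auto simp: fun_diff_def)
qed

lemma trig_fields_HH: "u \<in> trig_fields L \<Longrightarrow> u \<in> HH L"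
  unfolding HH_def by (auto simp: trig_fields_L2 fun_diff_def intro!: bexI[of _ u])

lemma HH_lincomb:
  assumes "u \<in> HH L" "v \<in> HH L"
  shows "(\<lambda>x. a *\<^sub>R u x + b *\<^sub>R v x) \<in> HH L"
proof -
  obtain f where f: "\<And>n. f n \<in> trig_fields L" "(\<lambda>n. l2norm L (\<lambda>x. u x - f n x)) \<longlonglongrightarrow> 0"
    using HH_approx[OF assms(1)] by blast
  obtain g where g: "\<And>n. g n \<in> trig_fields L" "(\<lambda>n. l2norm L (\<lambda>x. v x - g n x)) \<longlonglongrightarrow> 0"
    using HH_approx[OF assms(2)] by blast
  note L2s = HH_L2[OF assms(1)] HH_L2[OF assms(2)] f(1)[THEN trig_fields_L2] g(1)[THEN trig_fields_L2]
  show ?thesis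
  proof (rule HH_limit)
    show "(\<lambda>x. a *\<^sub>R u x + b *\<^sub>R v x) \<in> L2 L" using L2s by (intro L2_lincomb)
    show "(\<lambda>x. a *\<^sub>R f n x + b *\<^sub>R g n x) \<in> HH L" for n
      using f g by (intro trig_fields_HH trig_fields_lincomb)
    have lim: "(\<lambda>n. \<bar>a\<bar> * l2norm L (\<lambda>x. u x - f n x) + \<bar>b\<bar> * l2norm L (\<lambda>x. v x - g n x)) \<longlonglongrightarrow> 0"
      by (rule tendsto_eq_intros f g refl)+ simp
    show "(\<lambda>n. l2norm L (\<lambda>x. a *\<^sub>R u x + b *\<^sub>R v x - (a *\<^sub>R f n x + b *\<^sub>R g n x))) \<longlonglongrightarrow> 0"
    proof (rule Lim_null_comparison[OF _ lim], rule always_eventually, rule allI)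
      fix n
      have "l2norm L (\<lambda>x. a *\<^sub>R (u x - f n x) + b *\<^sub>R (v x - g n x))
          \<le> l2norm L (\<lambda>x. a *\<^sub>R (u x - f n x)) + l2norm L (\<lambda>x. b *\<^sub>R (v x - g n x))"
        using L2s by (intro l2norm_triangle L2_scaleR L2_diff)
      moreover have "(\<lambda>x. a *\<^sub>R u x + b *\<^sub>R v x - (a *\<^sub>R f n x + b *\<^sub>R g n x))
          = (\<lambda>x. a *\<^sub>R (u x - f n x) + b *\<^sub>R (v x - g n x))"
        by (simp add: algebra_simps)
      ultimately show "norm (l2norm L (\<lambda>x. a *\<^sub>R u x + b *\<^sub>R v x - (a *\<^sub>R f n x + b *\<^sub>R g n x)))
          \<le> \<bar>a\<bar> * l2norm L (\<lambda>x. u x - f n x) + \<bar>b\<bar> * l2norm L (\<lambda>x. v x - g n x)"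
        by (simp only: l2norm_scaleR real_norm_def abs_of_nonneg l2norm_nonneg)
    qed
  qed
qed

lemma HH_diff: "u \<in> HH L \<Longrightarrow> v \<in> HH L \<Longrightarrow> (\<lambda>x. u x - v x) \<in> HH L"
  using HH_lincomb[of u L v 1 "-1"] by simp

lemma HH_zero: "(\<lambda>x. 0) \<in> HH L"
proof -
  have "(\<lambda>x. 0) \<in> trig_fields L"
    by (auto simp: trig_fields_def trig_sum_def cvec_def vec_eq_iff intro!: exI[of _ "{}"] exI[of _ "\<lambda>_. 0"])
  then show ?thesis by (rule trig_fields_HH)
qed

section \<open>Orthogonal projection onto H\<close>

lemma parallelogram:
  assumes "f \<in> L2 L" "a \<in> L2 L" "b \<in> L2 L"
  shows "(l2norm L (\<lambda>x. a x - b x))\<^sup>2 = 2 * (l2norm L (\<lambda>x. f x - a x))\<^sup>2 + 2 * (l2norm L (\<lambda>x. f x - b x))\<^sup>2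
    - 4 * (l2norm L (\<lambda>x. f x - ((1/2) *\<^sub>R a x + (1/2) *\<^sub>R b x)))\<^sup>2"
  using assms
  by (simp add: l2norm_power2 ip_diff_left ip_diff_right ip_add_left ip_add_right L2_diff L2_scaleR L2_add
      ip_scaleR_left ip_scaleR_right ip_commute[of L b a] ip_commute[of L a f] ip_commute[of L b f]
      algebra_simps)

text \<open>The Hilbert space projection theorem: a minimising sequence for the distance from
  \<open>f\<close> is Cauchy by the parallelogram identity, its limit stays in \<open>HH\<close>,
  and minimality forces orthogonality.\<close>

lemma HH_projection:
  assumes f: "f \<in> L2 L"
  shows "\<exists>g. g \<in> HH L \<and> (\<forall>w\<in>HH L. ip L (\<lambda>x. f x - g x) w = 0)"
proof -
  define d where "d = (INF g\<in>HH L. (l2norm L (\<lambda>x. f x - g x))\<^sup>2)"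
  have bdd: "bdd_below ((\<lambda>g. (l2norm L (\<lambda>x. f x - g x))\<^sup>2) ` HH L)"
    by (intro bdd_belowI[of _ 0]) auto
  have dle: "d \<le> (l2norm L (\<lambda>x. f x - g x))\<^sup>2" if "g \<in> HH L" for g
    unfolding d_def using bdd that by (rule cINF_lower)
  have "\<exists>g\<in>HH L. (l2norm L (\<lambda>x. f x - g x))\<^sup>2 < d + 1 / real (Suc n)" for n
  proof (rule ccontr)
    assume "\<not> ?thesis"
    then have "d + 1 / real (Suc n) \<le> d"
      using HH_zero unfolding d_def by (intro cINF_greatest) (auto simp: not_less)
    then show False by (simp add: field_simps)
  qed
  then obtain g where g: "\<And>n. g n \<in> HH L" "\<And>n. (l2norm L (\<lambda>x. f x - g n x))\<^sup>2 < d + 1 / real (Suc n)"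
    by metis
  \<comment> \<open>The midpoint of \<open>g m\<close> and \<open>g n\<close> lies in
    \<open>HH\<close>, so its squared distance from \<open>f\<close> is at least \<open>d\<close>;
    in the parallelogram identity all multiples of \<open>d\<close> cancel.\<close>
  have close: "(l2norm L (\<lambda>x. g m x - g n x))\<^sup>2 \<le> 2 / real (Suc m) + 2 / real (Suc n)" for m n
    using parallelogram[OF f HH_L2[OF g(1)] HH_L2[OF g(1)], of m n] g(2)[of m] g(2)[of n]
      dle[OF HH_lincomb[OF g(1)[of m] g(1)[of n], of "1/2" "1/2"]] by linarith
  obtain u where u: "u \<in> L2 L" "(\<lambda>n. l2norm L (\<lambda>x. u x - g n x)) \<longlonglongrightarrow> 0"
  proof (rule L2_complete[OF HH_L2[OF g(1)]])
    fix e :: real assume e: "e > 0"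
    then obtain N where N: "4 / e\<^sup>2 < real N" using reals_Archimedean2 by blast
    show "\<exists>N. \<forall>m\<ge>N. \<forall>n\<ge>N. l2norm L (\<lambda>x. g m x - g n x) < e"
    proof (intro exI allI impI)
      fix m n assume mn: "m \<ge> N" "n \<ge> N"
      have "2 / real (Suc i) < e\<^sup>2 / 2" if "i \<ge> N" for i
      proof -
        have "4 / e\<^sup>2 < real (Suc i)" using N that by (simp add: order_less_le_trans)
        then show ?thesis using e by (simp add: field_simps)
      qed
      from this[OF mn(1)] this[OF mn(2)] have "(l2norm L (\<lambda>x. g m x - g n x))\<^sup>2 < e\<^sup>2"
        using close[of m n] by linarith
      then show "l2norm L (\<lambda>x. g m x - g n x) < e" using e power2_less_imp_less by fastforce
    qed
  qed
  have uH: "u \<in> HH L" by (rule HH_limit[OF u(1) g(1) u(2)])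
  have "(\<lambda>n. ip L (\<lambda>x. f x - g n x) (\<lambda>x. f x - g n x)) \<longlonglongrightarrow> ip L (\<lambda>x. f x - u x) (\<lambda>x. f x - u x)"
    by (rule tendsto_ip) (use u g f in \<open>auto intro!: L2_diff simp: HH_L2 l2norm_minus_commute[of L "g _"]\<close>)
  moreover have "(\<lambda>n. d + 1 / real (Suc n)) \<longlonglongrightarrow> d + 0"
    by (intro tendsto_intros lim_1_over_n[THEN LIMSEQ_Suc])
  ultimately have min: "(l2norm L (\<lambda>x. f x - u x))\<^sup>2 \<le> d"
    using g(2) by (intro LIMSEQ_le) (auto simp: l2norm_power2 intro!: exI[of _ 0] less_imp_le)
  have "ip L (\<lambda>x. f x - u x) w = 0" if w: "w \<in> HH L" for w
  proof -
    let ?b = "ip L (\<lambda>x. f x - u x) w" and ?c = "ip L w w"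
    \<comment> \<open>Minimality of \<open>u\<close> compared with \<open>u + s w\<close>. A nonzero
      \<open>?b\<close> is refuted by \<open>s = ?b\<close> if \<open>?c = 0\<close>, and otherwise
      by \<open>s = ?b / ?c\<close>, the minimiser of the quadratic.\<close>
    have q: "0 \<le> - 2 * s * ?b + s\<^sup>2 * ?c" for s
    proof -
      have "(l2norm L (\<lambda>x. f x - u x))\<^sup>2 \<le> (l2norm L (\<lambda>x. f x - (1 *\<^sub>R u x + s *\<^sub>R w x)))\<^sup>2"
        using min dle[OF HH_lincomb[OF uH w]] by (rule order_trans)
      also have "\<dots> = ip L (\<lambda>x. (f x - u x) - s *\<^sub>R w x) (\<lambda>x. (f x - u x) - s *\<^sub>R w x)"
        by (simp add: l2norm_power2 algebra_simps)
      also have "\<dots> = (l2norm L (\<lambda>x. f x - u x))\<^sup>2 - 2 * s * ?b + s\<^sup>2 * ?c"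
        using f u(1) HH_L2[OF w] ip_diff_self[of "\<lambda>x. f x - u x" L "\<lambda>x. s *\<^sub>R w x"]
        by (simp add: L2_diff L2_scaleR ip_scaleR_left ip_scaleR_right l2norm_power2 power2_eq_square[of s])
      finally show ?thesis by simp
    qed
    show ?thesis
    proof (rule ccontr)
      assume b: "?b \<noteq> 0"
      show False
      proof (cases "?c = 0")
        case True
        then show False using q[of "?b"] b by (simp add: power2_eq_square[symmetric] mult.assoc)
      next
        case False
        then have "?c > 0" using ip_self_nonneg[of L w] by linarith
        then have "- 2 * (?b/?c) * ?b + (?b/?c)\<^sup>2 * ?c = - (?b\<^sup>2 / ?c)"
          by (simp add: power2_eq_square field_simps)
        moreover have "?b\<^sup>2 / ?c > 0" using b \<open>?c > 0\<close> by simp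
        ultimately show False using q[of "?b/?c"] by linarith
      qed
    qed
  qed
  with uH show ?thesis by blast
qed

lemma leray:
  assumes "f \<in> L2 L"
  shows leray_HH: "leray L f \<in> HH L" and leray_orthogonal: "w \<in> HH L \<Longrightarrow> ip L (leray L f) w = ip L f w"
proof -
  have "leray L f \<in> HH L \<and> (\<forall>w\<in>HH L. ip L (f - leray L f) w = 0)"
    unfolding leray_def fun_diff_def by (rule someI_ex[OF HH_projection[OF assms]])
  then show HH: "leray L f \<in> HH L" and "w \<in> HH L \<Longrightarrow> ip L (leray L f) w = ip L f w"
    using ip_diff_left[OF assms HH_L2 HH_L2, of "leray L f" w] by (auto simp: fun_diff_def)
qed

lemma leray_unique:
  assumes "f \<in> L2 L" "g \<in> HH L" "\<And>w. w \<in> HH L \<Longrightarrow> ip L g w = ip L f w"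
  shows "eqae L (leray L f) g"
proof -
  let ?d = "\<lambda>x. leray L f x - g x"
  have d: "?d \<in> HH L" using leray_HH[OF assms(1)] assms(2) by (rule HH_diff)
  have "ip L ?d ?d = 0"
    using leray_orthogonal[OF assms(1) d] assms(3)[OF d] leray_HH[OF assms(1)] assms(2) d
    by (simp add: ip_diff_left HH_L2)
  then have "l2norm L ?d = 0" by (simp add: l2norm_def)
  then show ?thesis
    using l2norm_diff_eq_0_iff leray_HH[OF assms(1)] assms(2) HH_L2 by blast
qed

lemma leray_eq: "u \<in> HH L \<Longrightarrow> eqae L (leray L u) u"
  by (rule leray_unique) (auto simp: HH_L2)

text \<open>On \<open>HH\<close> the inner projection alters \<open>u\<close> only on a null set,
  and the outer projection is invisible when paired with a field of \<open>HH\<close>. This weak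
  description is all that is ever used of \<open>coriolis\<close>.\<close>

lemma coriolis:
  assumes "u \<in> HH L"
  shows coriolis_HH: "coriolis L u \<in> HH L"
    and ip_coriolis: "w \<in> HH L \<Longrightarrow> ip L (coriolis L u) w = ip L (\<lambda>x. cross3 (axis 3 1) (u x)) w"
proof -
  have bl: "bounded_linear (cross3 (axis 3 1))"
    by (rule bilinear_cross[unfolded bilinear_def, THEN conjunct1, rule_format, THEN linear_conv_bounded_linear[THEN iffD1]])
  have e: "eqae L (\<lambda>x. cross3 (axis 3 1) (leray L u x)) (\<lambda>x. cross3 (axis 3 1) (u x))"
    by (rule eqae_comp[OF leray_eq[OF assms]])
  have L: "(\<lambda>x. cross3 (axis 3 1) (leray L u x)) \<in> L2 L" "(\<lambda>x. cross3 (axis 3 1) (u x)) \<in> L2 L"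
    using assms by (auto intro!: L2_bounded_linear[OF bl] simp: HH_L2 leray_HH)
  show "coriolis L u \<in> HH L" unfolding coriolis_def by (rule leray_HH[OF L(1)])
  show "ip L (coriolis L u) w = ip L (\<lambda>x. cross3 (axis 3 1) (u x)) w" if w: "w \<in> HH L" for w
    unfolding coriolis_def leray_orthogonal[OF L(1) w]
    by (rule ip_cong) (use e L w in \<open>auto simp: HH_L2\<close>)
qed

subsection \<open>Smooth functions\<close>

lemma partial_eq: "(f has_derivative f') (at x) \<Longrightarrow> partial j f x = f' (axis j 1)"
  by (simp add: partial_def frechet_derivative_at[symmetric])

lemma sum_axis_mult: "(\<Sum>i\<in>UNIV. axis j r $ i * f i) = r * f j" for r :: real
proof -
  have "axis j r $ i * f i = (if i = j then r * f j else 0)" for i by (auto simp: axis_def)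
  then show ?thesis by simp
qed

text \<open>Smooth functions are the greatest class of differentiable functions closed under
  \<open>partial\<close>, so membership in any such class suffices.\<close>

lemma smooth_coinduct:
  assumes "P f"
    and step: "\<And>g. P g \<Longrightarrow> (\<forall>x. g differentiable (at x)) \<and> (\<forall>j. P (partial j g))"
  shows "smooth f"
proof -
  have "P (foldr partial js f)" for js
    by (induction js) (use assms in auto)
  then show ?thesis using step by (simp add: smooth_def)
qed

lemma smooth_differentiable: "smooth f \<Longrightarrow> f differentiable (at x)"
  unfolding smooth_def by (drule spec[of _ "[]"]) simp

lemma smooth_partial: "smooth f \<Longrightarrow> smooth (partial j f)"
  unfolding smooth_def
proof (intro allI)
  fix js x assume "\<forall>js x. foldr partial js f differentiable (at x)"
  from this[rule_format, of "js @ [j]" x] show "foldr partial js (partial j f) differentiable (at x)" by simp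
qed

lemma smooth_has_derivative:
  assumes "smooth f"
  shows "(f has_derivative (\<lambda>h. \<Sum>j\<in>UNIV. h $ j * partial j f x)) (at x)"
proof -
  let ?D = "frechet_derivative f (at x)"
  have D: "(f has_derivative ?D) (at x)"
    using smooth_differentiable[OF assms] by (simp add: frechet_derivative_works)
  interpret D: linear ?D using D by (rule has_derivative_linear)
  have "?D h = (\<Sum>j\<in>UNIV. h $ j * partial j f x)" for h
  proof -
    have "?D h = ?D (\<Sum>j\<in>UNIV. (h $ j) *\<^sub>R axis j 1)"
      by (simp only: scalar_mult_eq_scaleR[symmetric] basis_expansion)
    also have "\<dots> = (\<Sum>j\<in>UNIV. h $ j * partial j f x)"
      by (simp add: D.sum D.scale partial_def)
    finally show ?thesis .
  qed
  then have "?D = (\<lambda>h. \<Sum>j\<in>UNIV. h $ j * partial j f x)" by (rule ext)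
  with D show ?thesis by simp
qed

lemma smooth_continuous_on: "smooth f \<Longrightarrow> continuous_on S f"
  by (meson smooth_has_derivative has_derivative_continuous continuous_at_imp_continuous_on)

text \<open>The algebra generated by the smooth functions and \<open>exp\<close>. It contains the
  partial derivatives of its members, which makes \<open>smooth\<close> closed under these
  operations without any formula for higher derivatives of products or compositions.\<close>

inductive smooth_alg :: "(real ^ 3 \<Rightarrow> real) \<Rightarrow> bool" where
  "smooth f \<Longrightarrow> smooth_alg f"
| "smooth_alg f \<Longrightarrow> smooth_alg g \<Longrightarrow> smooth_alg (\<lambda>x. f x + g x)"
| "smooth_alg f \<Longrightarrow> smooth_alg g \<Longrightarrow> smooth_alg (\<lambda>x. f x * g x)"
| "smooth_alg f \<Longrightarrow> smooth_alg (\<lambda>x. exp (f x))"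

lemma partial_add:
  assumes "f differentiable (at x)" "g differentiable (at x)"
  shows "partial j (\<lambda>x. f x + g x) x = partial j f x + partial j g x"
  by (subst partial_eq[OF has_derivative_add[OF assms[unfolded frechet_derivative_works]]])
    (simp add: partial_def)

lemma partial_mult:
  assumes "f differentiable (at x)" "g differentiable (at x)"
  shows "partial j (\<lambda>x. f x * g x) x = f x * partial j g x + partial j f x * g x"
  by (subst partial_eq[OF has_derivative_mult[OF assms[unfolded frechet_derivative_works]]])
    (simp add: partial_def)

lemma partial_exp:
  assumes "f differentiable (at x)"
  shows "partial j (\<lambda>x. exp (f x)) x = exp (f x) * partial j f x"
  by (subst partial_eq[OF has_derivative_exp[OF assms[unfolded frechet_derivative_works]]])
    (simp add: partial_def)

lemma differentiable_exp:
  "f differentiable (at x) \<Longrightarrow> (\<lambda>x. exp (f x)) differentiable (at x)" for f :: "real ^ 3 \<Rightarrow> real"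
  unfolding differentiable_def using has_derivative_exp by blast

lemma smooth_alg_partial:
  assumes "smooth_alg f"
  shows "(\<forall>x. f differentiable (at x)) \<and> (\<forall>j. smooth_alg (partial j f))"
  using assms
proof induction
  case (1 f)
  then show ?case by (auto intro: smooth_differentiable smooth_alg.intros smooth_partial)
next
  case (2 f g)
  then have "partial j (\<lambda>x. f x + g x) = (\<lambda>x. partial j f x + partial j g x)" for j
    by (intro ext partial_add) auto
  with 2 show ?case by (auto intro!: smooth_alg.intros(2) differentiable_add)
next
  case (3 f g)
  then have "partial j (\<lambda>x. f x * g x) = (\<lambda>x. f x * partial j g x + partial j f x * g x)" for j
    by (intro ext partial_mult) auto
  with 3 show ?case by (auto intro!: smooth_alg.intros(2,3) differentiable_mult)
next
  case (4 f)
  then have "partial j (\<lambda>x. exp (f x)) = (\<lambda>x. exp (f x) * partial j f x)" for j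
    by (intro ext partial_exp) auto
  with 4 show ?case
    by (auto intro!: smooth_alg.intros(3,4) differentiable_exp)
qed

lemma smooth_algI: "smooth_alg f \<Longrightarrow> smooth f"
  by (rule smooth_coinduct[of smooth_alg]) (use smooth_alg_partial in auto)

lemma smooth_add: "smooth f \<Longrightarrow> smooth g \<Longrightarrow> smooth (\<lambda>x. f x + g x)"
  by (rule smooth_algI[OF smooth_alg.intros(2)]; rule smooth_alg.intros(1))

lemma smooth_mult: "smooth f \<Longrightarrow> smooth g \<Longrightarrow> smooth (\<lambda>x. f x * g x)"
  by (rule smooth_algI[OF smooth_alg.intros(3)]; rule smooth_alg.intros(1))

lemma smooth_exp: "smooth f \<Longrightarrow> smooth (\<lambda>x. exp (f x))"
  by (rule smooth_algI[OF smooth_alg.intros(4)]; rule smooth_alg.intros(1))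

lemma has_derivative_trig:
  "((\<lambda>x. a * cos (\<kappa> \<bullet> x) + b * sin (\<kappa> \<bullet> x)) has_derivative
    (\<lambda>h. (b * cos (\<kappa> \<bullet> x) - a * sin (\<kappa> \<bullet> x)) * (\<kappa> \<bullet> h))) (at x)"
  for \<kappa> :: "real ^ 3"
  by (auto intro!: derivative_eq_intros simp: algebra_simps)

lemma partial_trig:
  "partial j (\<lambda>x. a * cos (\<kappa> \<bullet> x) + b * sin (\<kappa> \<bullet> x)) =
    (\<lambda>x. (b * \<kappa> $ j) * cos (\<kappa> \<bullet> x) + (- a * \<kappa> $ j) * sin (\<kappa> \<bullet> x))"
  by (rule ext, subst partial_eq[OF has_derivative_trig]) (simp add: inner_axis algebra_simps)

lemma smooth_trig: "smooth (\<lambda>x. a * cos (\<kappa> \<bullet> x) + b * sin (\<kappa> \<bullet> x))"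
proof (rule smooth_coinduct[of "\<lambda>f. \<exists>a b. f = (\<lambda>x. a * cos (\<kappa> \<bullet> x) + b * sin (\<kappa> \<bullet> x))"])
  fix g :: "real ^ 3 \<Rightarrow> real" assume "\<exists>a b. g = (\<lambda>x. a * cos (\<kappa> \<bullet> x) + b * sin (\<kappa> \<bullet> x))"
  then obtain a b where g: "g = (\<lambda>x. a * cos (\<kappa> \<bullet> x) + b * sin (\<kappa> \<bullet> x))" by (elim exE)
  show "(\<forall>x. g differentiable (at x)) \<and>
      (\<forall>j. \<exists>a b. partial j g = (\<lambda>x. a * cos (\<kappa> \<bullet> x) + b * sin (\<kappa> \<bullet> x)))"
    unfolding g partial_trig
  proof (intro conjI allI)
    show "(\<lambda>x. a * cos (\<kappa> \<bullet> x) + b * sin (\<kappa> \<bullet> x)) differentiable (at x)" for x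
      by (rule differentiableI[OF has_derivative_trig])
    show "\<exists>a' b'. (\<lambda>x. (b * \<kappa> $ j) * cos (\<kappa> \<bullet> x) + (- a * \<kappa> $ j) * sin (\<kappa> \<bullet> x)) =
        (\<lambda>x. a' * cos (\<kappa> \<bullet> x) + b' * sin (\<kappa> \<bullet> x))" for j
      by (rule exI[of _ "b * \<kappa> $ j"], rule exI[of _ "- a * \<kappa> $ j"], rule refl)
  qed
qed (rule exI[of _ a], rule exI[of _ b], rule refl)

lemma smooth_const: "smooth (\<lambda>x. c)"
  using smooth_trig[of c 0 0] by simp

lemma partial_const: "partial j (\<lambda>x. c) = (\<lambda>x. 0)"
  using partial_trig[of j c 0 0] by simp

lemma smooth_cmult: "smooth f \<Longrightarrow> smooth (\<lambda>x. c * f x)"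
  using smooth_mult[OF smooth_const] .

lemma smooth_sum: "(\<And>i. i \<in> I \<Longrightarrow> smooth (f i)) \<Longrightarrow> smooth (\<lambda>x. \<Sum>i\<in>I. f i x)"
  by (induction I rule: infinite_finite_induct) (auto intro: smooth_add smooth_const)

lemma partial_cmult: "smooth f \<Longrightarrow> partial j (\<lambda>x. c * f x) = (\<lambda>x. c * partial j f x)"
  by (rule ext) (simp add: partial_mult smooth_differentiable smooth_const partial_const)

lemma partial_sum:
  assumes "\<And>i. i \<in> I \<Longrightarrow> smooth (f i)"
  shows "partial j (\<lambda>x. \<Sum>i\<in>I. f i x) = (\<lambda>x. \<Sum>i\<in>I. partial j (f i) x)"
  using assms
proof (induction I rule: infinite_finite_induct)
  case (insert i I)
  then have "partial j (\<lambda>x. f i x + (\<Sum>i\<in>I. f i x)) = (\<lambda>x. partial j (f i) x + partial j (\<lambda>x. \<Sum>i\<in>I. f i x) x)"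
    by (intro ext partial_add smooth_differentiable smooth_sum) auto
  with insert show ?case by simp
qed (simp_all add: partial_const)

lemma partial_periodic:
  assumes "smooth f" "periodic L f" shows "periodic L (partial j f)"
  unfolding periodic_def
proof (intro allI)
  fix x i
  let ?c = "axis i (L $ i)"
  have "(f has_derivative (\<lambda>h. \<Sum>j\<in>UNIV. h $ j * partial j f (x + ?c))) (at (x + ?c))"
    by (rule smooth_has_derivative[OF assms(1)])
  then have "((\<lambda>x. f (x + ?c)) has_derivative (\<lambda>h. \<Sum>j\<in>UNIV. h $ j * partial j f (x + ?c))) (at x)"
    by (rule has_derivative_compose[rotated]) (auto intro!: derivative_eq_intros)
  moreover have "(\<lambda>x. f (x + ?c)) = f" using assms(2) by (simp add: periodic_def)
  ultimately show "partial j f (x + ?c) = partial j f x"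
    by (simp add: partial_eq sum_axis_mult)
qed

subsection \<open>Integration by parts on the torus\<close>

lemma continuous_integrable_torus:
  fixes f :: "real ^ 3 \<Rightarrow> 'a::euclidean_space"
  assumes "continuous_on UNIV f"
  shows "integrable (torus L) f" "(LINT x|torus L. f x) = integral (cbox 0 L) f"
proof -
  have "continuous_on (cbox 0 L) f" using assms by (rule continuous_on_subset) simp
  then have i: "set_integrable lborel (cbox 0 L) f" by (intro borel_integrable_compact[folded set_integrable_def]) auto
  then show "integrable (torus L) f"
    by (simp add: torus_def integrable_restrict_space set_integrable_def)
  show "(LINT x|torus L. f x) = integral (cbox 0 L) f"
    unfolding integral_torus by (rule set_borel_integral_eq_integral(2)[OF i])
qed

text \<open>Lengthen the cell by \<open>s\<close> in direction \<open>j\<close> and cut the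
  resulting box in two ways, at height \<open>s\<close> and at height \<open>L $ j\<close>. The two
  end pieces are translates of each other by one period, so the remaining pieces, the shifted cell
  and the cell, have equal integrals.\<close>

lemma integral_periodic_shift:
  fixes f :: "real ^ 3 \<Rightarrow> real"
  assumes f: "continuous_on UNIV f" "periodic L f" and L: "\<And>j. 0 < L $ j" and s: "0 \<le> s" "s \<le> L $ j"
  shows "integral (cbox 0 L) (\<lambda>x. f (x + axis j s)) = integral (cbox 0 L) f"
proof -
  let ?e = "axis j s" and ?B = "cbox 0 (L + axis j s)"
  let ?S = "cbox 0 (\<chi> i. if i = j then s else L $ i)"
  have i: "f integrable_on ?B" using f(1) by (intro integrable_continuous continuous_on_subset[OF f(1)]) auto
  have L': "0 \<le> L $ i" for i using L[of i] by simp
  have xj: "x \<bullet> axis j 1 = x $ j" for x :: "real ^ 3" by (simp add: inner_axis)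
  have k: "(axis j 1 :: real ^ 3) \<in> Basis" by (simp add: axis_in_Basis_iff Basis_real_def)
  have "integral ?B f = integral (?B \<inter> {x. x \<bullet> axis j 1 \<le> s}) f + integral (?B \<inter> {x. x \<bullet> axis j 1 \<ge> s}) f"
    by (rule integral_split[OF i k])
  also have "?B \<inter> {x. x \<bullet> axis j 1 \<le> s} = ?S"
    unfolding xj using exhaust_3[of j] s L'[of 1] L'[of 2] L'[of 3] by (auto simp: mem_box_cart axis_def forall_3 add.commute)
  also have "?B \<inter> {x. x \<bullet> axis j 1 \<ge> s} = cbox ?e (L + ?e)"
    unfolding xj using exhaust_3[of j] s L'[of 1] L'[of 2] L'[of 3] by (auto simp: mem_box_cart axis_def forall_3 add.commute)
  finally have 1: "integral ?B f = integral ?S f + integral (cbox ?e (L + ?e)) f" .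
  have "integral ?B f = integral (?B \<inter> {x. x \<bullet> axis j 1 \<le> L $ j}) f + integral (?B \<inter> {x. x \<bullet> axis j 1 \<ge> L $ j}) f"
    by (rule integral_split[OF i k])
  also have "?B \<inter> {x. x \<bullet> axis j 1 \<le> L $ j} = cbox 0 L"
    unfolding xj using exhaust_3[of j] s L'[of 1] L'[of 2] L'[of 3] by (auto simp: mem_box_cart axis_def forall_3 add.commute)
  also have "?B \<inter> {x. x \<bullet> axis j 1 \<ge> L $ j} = cbox (0 + axis j (L $ j)) ((\<chi> i. if i = j then s else L $ i) + axis j (L $ j))"
    unfolding xj using exhaust_3[of j] s L'[of 1] L'[of 2] L'[of 3] by (auto simp: mem_box_cart axis_def forall_3 add.commute)
  also have "integral (cbox (0 + axis j (L $ j)) ((\<chi> i. if i = j then s else L $ i) + axis j (L $ j))) f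
      = integral ?S (\<lambda>x. f (axis j (L $ j) + x))"
    unfolding integral_shift_cbox_plus[symmetric] by (simp add: o_def)
  also have "(\<lambda>x. f (axis j (L $ j) + x)) = f"
    using f(2) by (simp add: periodic_def add.commute)
  finally have 2: "integral ?B f = integral (cbox 0 L) f + integral ?S f" .
  have "integral (cbox 0 L) (\<lambda>x. f (x + ?e)) = integral (cbox (0 + ?e) (L + ?e)) f"
    unfolding integral_shift_cbox_plus[symmetric] by (simp add: o_def add.commute)
  with 1 2 show ?thesis by simp
qed

text \<open>The integral of \<open>f\<close> shifted by \<open>s\<close> does not depend on
  \<open>s\<close>; differentiating under the integral sign at \<open>s = 0\<close> produces the
  integral of the partial derivative. The derivative is one-sided, since the shifts range over
  [0, L $ j].\<close>

lemma integral_partial_periodic: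
  fixes f :: "real ^ 3 \<Rightarrow> real"
  assumes f: "smooth f" "periodic L f" and L: "\<And>j. 0 < L $ j"
  shows "(LINT x|torus L. partial j f x) = 0"
proof -
  let ?U = "{0..L $ j}"
  let ?I = "\<lambda>s. integral (cbox 0 L) (\<lambda>x. f (x + axis j s))"
  define e :: "real ^ 3" where "e = axis j 1"
  have ax: "axis j s = s *\<^sub>R e" for s :: real by (simp add: e_def axis_def vec_eq_iff)
  note c = smooth_continuous_on[OF f(1), of UNIV] smooth_continuous_on[OF smooth_partial[OF f(1)], of UNIV]
  have "(?I has_vector_derivative integral (cbox 0 L) (\<lambda>x. partial j f (x + axis j 0))) (at 0 within ?U)"
  proof (rule leibniz_rule_vector_derivative)
    fix s x
    have "(f has_derivative (\<lambda>h. \<Sum>i\<in>UNIV. h $ i * partial i f (x + axis j s))) (at (x + axis j s))"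
      by (rule smooth_has_derivative[OF f(1)])
    moreover have "((\<lambda>s. x + axis j s) has_derivative (\<lambda>r. axis j r)) (at s within ?U)"
      unfolding ax by (auto intro!: derivative_eq_intros)
    ultimately have "((\<lambda>s. f (x + axis j s)) has_derivative
        (\<lambda>r. \<Sum>i\<in>UNIV. axis j r $ i * partial i f (x + axis j s))) (at s within ?U)"
      by (rule has_derivative_compose[rotated])
    then show "((\<lambda>s. f (x + axis j s)) has_vector_derivative partial j f (x + axis j s)) (at s within ?U)"
      by (simp add: has_vector_derivative_def sum_axis_mult)
  next
    show "(\<lambda>x. f (x + axis j s)) integrable_on cbox 0 L" for s
      by (intro integrable_continuous continuous_on_compose2[OF c(1)] continuous_intros) auto
    show "continuous_on (?U \<times> cbox 0 L) (\<lambda>(s, x). partial j f (x + axis j s))"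
      unfolding split_beta ax
      by (intro continuous_on_compose2[OF c(2)] continuous_intros) auto
    show "0 \<in> ?U" using L[of j] by simp
    show "convex ?U" by (rule convex_real_interval)
  qed
  moreover have "(?I has_vector_derivative 0) (at 0 within ?U)"
  proof (rule has_vector_derivative_transform)
    show "0 \<in> ?U" using L[of j] by simp
    show "?I s = integral (cbox 0 L) f" if "s \<in> ?U" for s
      using that by (intro integral_periodic_shift c(1) f(2) L) auto
    show "((\<lambda>_. integral (cbox 0 L) f) has_vector_derivative 0) (at 0 within ?U)"
      by (rule has_vector_derivative_const)
  qed
  ultimately have "integral (cbox 0 L) (\<lambda>x. partial j f (x + axis j 0)) = 0"
    using vector_derivative_unique_within_closed_interval[of 0 "L $ j" 0] L[of j] by auto
  then show ?thesis
    by (subst continuous_integrable_torus(2)[OF c(2)]) (simp add: ax)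
qed

lemma integration_by_parts:
  assumes f: "smooth f" "periodic L f" and g: "smooth g" "periodic L g" and L: "\<And>j. 0 < L $ j"
  shows "(LINT x|torus L. partial j f x * g x) = - (LINT x|torus L. f x * partial j g x)"
proof -
  have "(LINT x|torus L. partial j (\<lambda>x. f x * g x) x) = 0"
    using f g by (intro integral_partial_periodic smooth_mult L) (auto simp: periodic_def)
  also have "partial j (\<lambda>x. f x * g x) = (\<lambda>x. f x * partial j g x + partial j f x * g x)"
    by (intro ext partial_mult smooth_differentiable f g)
  also have "(LINT x|torus L. f x * partial j g x + partial j f x * g x) =
      (LINT x|torus L. f x * partial j g x) + (LINT x|torus L. partial j f x * g x)"
    by (intro Bochner_Integration.integral_add continuous_integrable_torus(1) continuous_on_mult
        smooth_continuous_on smooth_partial f g)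
  finally show ?thesis by simp
qed

subsection \<open>Smooth fields and weak derivatives\<close>

text \<open>Vector-valued test fields. They turn the vector identity in
  \<open>is_weak_partial\<close>, tested with scalar functions, into identities between values of
  \<open>ip\<close>.\<close>

definition sfield :: "real ^ 3 \<Rightarrow> field3 \<Rightarrow> bool" where
  "sfield L w \<longleftrightarrow> periodic L w \<and> (\<forall>i. smooth (\<lambda>x. w x $ i))"

definition fpart :: "3 \<Rightarrow> field3 \<Rightarrow> field3" where
  "fpart j w x = (\<chi> i. partial j (\<lambda>y. w y $ i) x)"

lemma sfield_smooth: "sfield L w \<Longrightarrow> smooth (\<lambda>x. w x $ i)"
  and sfield_periodic: "sfield L w \<Longrightarrow> periodic L w"
  and sfield_periodic_component: "sfield L w \<Longrightarrow> periodic L (\<lambda>x. w x $ i)"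
  by (auto simp: sfield_def periodic_def)

lemma sfield_continuous_on:
  assumes "sfield L w" shows "continuous_on S w"
proof -
  have "continuous_on S (\<lambda>x. \<chi> i. w x $ i)"
    by (intro continuous_on_vec_lambda smooth_continuous_on sfield_smooth[OF assms])
  then show ?thesis by simp
qed

lemma sfield_bounded:
  assumes "sfield L w"
  shows "\<exists>B\<ge>0. \<forall>x\<in>cbox 0 L. norm (w x) \<le> B"
proof -
  have "compact (w ` cbox 0 L)"
    by (intro compact_continuous_image sfield_continuous_on[OF assms] compact_cbox)
  then obtain B where B: "\<forall>x\<in>cbox 0 L. norm (w x) \<le> B"
    by (meson bounded_iff compact_imp_bounded imageI)
  then show ?thesis by (intro exI[of _ "max 0 B"]) auto
qed

lemma sfield_L2: assumes "sfield L w" shows "w \<in> L2 L"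
proof -
  have m: "w \<in> borel_measurable borel"
    by (intro borel_measurable_continuous_onI sfield_continuous_on[OF assms])
  obtain B where "\<And>x. x \<in> cbox 0 L \<Longrightarrow> norm (w x) \<le> B" using sfield_bounded[OF assms] by blast
  then have "integrable (torus L) (\<lambda>x. (norm (w x))\<^sup>2)"
    using m by (intro integrable_torus_bounded[where B="B\<^sup>2"]) (auto intro!: power_mono)
  with m assms show ?thesis by (simp add: L2_def sfield_periodic)
qed

lemma sfield_lincomb:
  assumes "sfield L v" "sfield L w"
  shows "sfield L (\<lambda>x. a *\<^sub>R v x + b *\<^sub>R w x)"
  using assms by (auto simp: sfield_def periodic_def intro!: smooth_add smooth_cmult)

lemma sfield_zero: "sfield L (\<lambda>x. 0)"
  by (simp add: sfield_def periodic_def smooth_const)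

lemma sfield_add: "sfield L v \<Longrightarrow> sfield L w \<Longrightarrow> sfield L (\<lambda>x. v x + w x)"
  using sfield_lincomb[of L v w 1 1] by simp

lemma sfield_sum: "(\<And>i. i \<in> I \<Longrightarrow> sfield L (f i)) \<Longrightarrow> sfield L (\<lambda>x. \<Sum>i\<in>I. f i x)"
  by (induction I rule: infinite_finite_induct) (auto intro: sfield_add sfield_zero)

lemma sfield_fpart: "sfield L w \<Longrightarrow> sfield L (fpart j w)"
  using partial_periodic[OF sfield_smooth sfield_periodic_component]
  by (auto simp: sfield_def fpart_def periodic_def vec_eq_iff intro!: smooth_partial)

lemma sfield_scalar: "smooth f \<Longrightarrow> periodic L f \<Longrightarrow> sfield L (\<lambda>x. f x *\<^sub>R c)"
  unfolding sfield_def by (auto simp: periodic_def mult.commute[of _ "c $ _"] intro!: smooth_cmult)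

lemma fpart_scalar: "smooth f \<Longrightarrow> fpart j (\<lambda>x. f x *\<^sub>R c) = (\<lambda>x. partial j f x *\<^sub>R c)"
  by (rule ext) (simp add: fpart_def vec_eq_iff mult.commute[of _ "c $ _"] partial_cmult)

lemma fpart_sum:
  assumes "\<And>i. i \<in> I \<Longrightarrow> sfield L (f i)"
  shows "fpart j (\<lambda>x. \<Sum>i\<in>I. f i x) = (\<lambda>x. \<Sum>i\<in>I. fpart j (f i) x)"
proof -
  have s: "smooth (\<lambda>y. f i y $ k)" if "i \<in> I" for i k
    using sfield_smooth[OF assms[OF that]] .
  show ?thesis by (intro ext) (simp add: fpart_def vec_eq_iff partial_sum[OF s])
qed

lemma ip_scalar:
  "ip L u (\<lambda>x. f x *\<^sub>R axis i 1) = (LINT x|torus L. f x * u x $ i)"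
  by (simp add: ip_def inner_axis mult.commute)

lemma integrable_scalar_field:
  assumes "u \<in> L2 L" "smooth f"
  shows "integrable (torus L) (\<lambda>x. f x *\<^sub>R u x)"
proof -
  have i: "integrable (torus L) u"
    using integrable_inner(1)[OF assms(1) L2_const[of "axis 1 1"]] L2_measurable_torus[OF assms(1)]
    by (simp add: integrable_norm_iff)
  have "compact (f ` cbox 0 L)"
    by (intro compact_continuous_image smooth_continuous_on assms compact_cbox)
  then obtain B where B: "\<forall>x\<in>cbox 0 L. norm (f x) \<le> B"
    by (meson bounded_iff compact_imp_bounded imageI)
  have [measurable]: "f \<in> borel_measurable (torus L)" "u \<in> borel_measurable (torus L)"
    using L2_measurable_torus[OF assms(1)] smooth_continuous_on[OF assms(2)]
    by (auto intro!: measurable_torus borel_measurable_continuous_onI)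
  have "integrable (torus L) (\<lambda>x. B *\<^sub>R u x)" using i by simp
  then show ?thesis
  proof (rule Bochner_Integration.integrable_bound)
    show "AE x in torus L. norm (f x *\<^sub>R u x) \<le> norm (B *\<^sub>R u x)"
      using B by (intro AE_I2) (auto intro!: mult_right_mono)
  qed measurable
qed

text \<open>A scalar test function against a vector integral carries the same information as the
  test fields with a single nonzero component, and every test field is the sum of its components.
  Weak derivatives thus become adjoint relations in \<open>ip\<close>, which pass to L2
  limits.\<close>

lemma is_weak_partial_iff:
  assumes u: "u \<in> L2 L" and g: "g \<in> L2 L"
  shows "is_weak_partial L j u g \<longleftrightarrow> (\<forall>\<psi>. sfield L \<psi> \<longrightarrow> ip L g \<psi> = - ip L u (fpart j \<psi>))"
proof
  assume w: "is_weak_partial L j u g"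
  show "\<forall>\<psi>. sfield L \<psi> \<longrightarrow> ip L g \<psi> = - ip L u (fpart j \<psi>)"
  proof (intro allI impI)
    fix \<psi> assume \<psi>: "sfield L \<psi>"
    note s = sfield_smooth[OF \<psi>] sfield_periodic_component[OF \<psi>]
    note sc = sfield_scalar[OF s, of _ "axis _ 1"]
    have e: "(\<lambda>x. \<Sum>i\<in>UNIV. w x $ i *\<^sub>R axis i 1) = w" for w :: field3
      by (rule ext) (simp only: scalar_mult_eq_scaleR[symmetric] basis_expansion)
    have "ip L g (\<lambda>x. \<psi> x $ i *\<^sub>R axis i 1) = - ip L u (\<lambda>x. partial j (\<lambda>x. \<psi> x $ i) x *\<^sub>R axis i 1)" for i
    proof -
      have "(LINT x|torus L. partial j (\<lambda>x. \<psi> x $ i) x *\<^sub>R u x) \<bullet> axis i 1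
          = - ((LINT x|torus L. \<psi> x $ i *\<^sub>R g x) \<bullet> axis i 1)"
        using w s by (simp add: is_weak_partial_def)
      then have "(LINT x|torus L. (partial j (\<lambda>x. \<psi> x $ i) x *\<^sub>R u x) \<bullet> axis i 1)
          = - (LINT x|torus L. (\<psi> x $ i *\<^sub>R g x) \<bullet> axis i 1)"
        by (subst (asm) (1 2) integral_inner_left[symmetric])
          (auto intro!: integrable_scalar_field u g s smooth_partial)
      then show ?thesis by (simp add: ip_scalar inner_axis)
    qed
    then have "(\<Sum>i\<in>UNIV. ip L g (\<lambda>x. \<psi> x $ i *\<^sub>R axis i 1))
        = - (\<Sum>i\<in>UNIV. ip L u (\<lambda>x. fpart j \<psi> x $ i *\<^sub>R axis i 1))"
      by (simp add: sum_negf fpart_def)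
    moreover have "(\<Sum>i\<in>UNIV. ip L v (\<lambda>x. w x $ i *\<^sub>R axis i 1)) = ip L v w"
      if "v \<in> L2 L" "sfield L w" for v w
    proof -
      have "(\<lambda>x. w x $ i *\<^sub>R axis i 1) \<in> L2 L" for i
        by (intro sfield_L2 sfield_scalar sfield_smooth[OF that(2)] sfield_periodic_component[OF that(2)])
      then have "ip L v (\<lambda>x. \<Sum>i\<in>UNIV. w x $ i *\<^sub>R axis i 1) = (\<Sum>i\<in>UNIV. ip L v (\<lambda>x. w x $ i *\<^sub>R axis i 1))"
        using that by (intro ip_sum_right)
      then show ?thesis by (simp only: e)
    qed
    ultimately show "ip L g \<psi> = - ip L u (fpart j \<psi>)"
      using u g \<psi> sfield_fpart[OF \<psi>] by simp
  qed
next
  assume w: "\<forall>\<psi>. sfield L \<psi> \<longrightarrow> ip L g \<psi> = - ip L u (fpart j \<psi>)"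
  show "is_weak_partial L j u g"
    unfolding is_weak_partial_def
  proof (intro allI impI, elim conjE)
    fix \<phi> assume \<phi>: "smooth \<phi>" "periodic L \<phi>"
    show "(LINT x|torus L. partial j \<phi> x *\<^sub>R u x) = - (LINT x|torus L. \<phi> x *\<^sub>R g x)"
    proof (simp only: vec_eq_iff, intro allI)
      fix i
      have "(LINT x|torus L. \<phi> x *\<^sub>R g x) \<bullet> axis i 1 = ip L g (\<lambda>x. \<phi> x *\<^sub>R axis i 1)"
        by (subst integral_inner_left[symmetric]) (auto intro!: integrable_scalar_field g \<phi> simp: ip_def inner_commute)
      also have "\<dots> = - ip L u (\<lambda>x. partial j \<phi> x *\<^sub>R axis i 1)"
        using w sfield_scalar[OF \<phi>] by (simp add: fpart_scalar[OF \<phi>(1)])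
      also have "ip L u (\<lambda>x. partial j \<phi> x *\<^sub>R axis i 1) = (LINT x|torus L. partial j \<phi> x *\<^sub>R u x) \<bullet> axis i 1"
        by (subst integral_inner_left[symmetric])
          (auto intro!: integrable_scalar_field u smooth_partial \<phi> simp: ip_def inner_commute)
      finally show "(LINT x|torus L. partial j \<phi> x *\<^sub>R u x) $ i = (- (LINT x|torus L. \<phi> x *\<^sub>R g x)) $ i"
        by (simp add: inner_axis)
    qed
  qed
qed

lemma sfield_weak_partial:
  assumes "\<And>j. 0 < L $ j" "sfield L w" shows "is_weak_partial L j w (fpart j w)"
proof -
  have L2: "w \<in> L2 L" "fpart j w \<in> L2 L" using assms by (auto intro: sfield_L2 sfield_fpart)
  have "ip L (fpart j w) \<psi> = - ip L w (fpart j \<psi>)" if \<psi>: "sfield L \<psi>" for \<psi>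
  proof -
    note s = sfield_smooth[OF assms(2)] sfield_periodic_component[OF assms(2)]
    note t = sfield_smooth[OF \<psi>] sfield_periodic_component[OF \<psi>]
    note c = smooth_continuous_on[OF s(1)] smooth_continuous_on[OF smooth_partial[OF s(1)]]
      smooth_continuous_on[OF t(1)] smooth_continuous_on[OF smooth_partial[OF t(1)]]
    have "ip L (fpart j w) \<psi> = (\<Sum>i\<in>UNIV. LINT x|torus L. partial j (\<lambda>y. w y $ i) x * \<psi> x $ i)"
      unfolding ip_def inner_vec_def fpart_def
      by (subst Bochner_Integration.integral_sum) (auto intro!: continuous_integrable_torus(1) continuous_intros c)
    also have "\<dots> = (\<Sum>i\<in>UNIV. - (LINT x|torus L. w x $ i * partial j (\<lambda>y. \<psi> y $ i) x))"
      by (intro sum.cong refl integration_by_parts s t assms)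
    also have "\<dots> = - ip L w (fpart j \<psi>)"
      unfolding ip_def inner_vec_def fpart_def
      by (subst Bochner_Integration.integral_sum)
        (auto intro!: continuous_integrable_torus(1) continuous_intros c simp: sum_negf)
    finally show ?thesis .
  qed
  then show ?thesis using is_weak_partial_iff[OF L2] by blast
qed

subsection \<open>Uniqueness of weak derivatives\<close>

text \<open>Boxes generate the Borel sets and are stable under intersection, so induction over
  complements and disjoint unions gives vanishing integrals over all Borel sets.\<close>

lemma integral_zero_on_boxes:
  fixes F :: "'a::euclidean_space \<Rightarrow> 'b::{banach, second_countable_topology}"
  assumes F: "integrable lborel F" and box: "\<And>a b. (LINT x:box a b|lborel. F x) = 0"
  shows "AE x in lborel. F x = 0"
proof (rule sigma_finite_measure.density_zero[OF lborel.sigma_finite_measure_axioms F])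
  have si: "set_integrable lborel A F" if "A \<in> sets borel" for A
    using that F by (auto simp: set_integrable_def intro: integrable_mult_indicator)
  \<comment> \<open>The complement step needs the integral over the whole space, obtained as the
    limit over an exhausting sequence of boxes.\<close>
  have total: "(LINT x|lborel. F x) = 0"
  proof -
    have "(\<lambda>n. LINT x|lborel. indicator (box (- real n *\<^sub>R One) (real n *\<^sub>R One)) x *\<^sub>R F x) \<longlonglongrightarrow> (LINT x|lborel. F x)"
    proof (rule integral_dominated_convergence[where w="\<lambda>x. norm (F x)"])
      show "AE x in lborel. (\<lambda>n. indicator (box (- real n *\<^sub>R One) (real n *\<^sub>R One)) x *\<^sub>R F x) \<longlonglongrightarrow> F x"
      proof (rule AE_I2)
        fix x :: 'a
        obtain N where N: "norm x < real N" using reals_Archimedean2 by blast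
        have "x \<in> box (- real n *\<^sub>R One) (real n *\<^sub>R One)" if "n \<ge> N" for n
        proof -
          have "\<bar>x \<bullet> i\<bar> < real n" if "i \<in> Basis" for i
            using Basis_le_norm[OF that, of x] N \<open>n \<ge> N\<close> by linarith
          then show ?thesis by (force simp: mem_box abs_less_iff)
        qed
        then show "(\<lambda>n. indicator (box (- real n *\<^sub>R One) (real n *\<^sub>R One)) x *\<^sub>R F x) \<longlonglongrightarrow> F x"
          by (intro tendsto_eventually eventually_sequentiallyI[of N]) simp
      qed
    qed (use F in \<open>auto simp: indicator_def intro!: AE_I2\<close>)
    then have "(\<lambda>n. 0 :: 'b) \<longlonglongrightarrow> (LINT x|lborel. F x)"
      using box by (simp add: set_lebesgue_integral_def)
    then show ?thesis using LIMSEQ_unique tendsto_const by blast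
  qed
  fix A :: "'a set" assume "A \<in> sets lborel"
  then have A: "A \<in> sigma_sets UNIV (range (\<lambda>(a, b). box a b))"
    using borel_eq_box sets_measure_of by (metis (no_types) sets_lborel subset_UNIV Pow_UNIV)
  have B: "B \<in> sets borel" if "B \<in> sigma_sets UNIV (range (\<lambda>(a, b). box a b))" for B :: "'a set"
    using that borel_eq_box sets_measure_of by (metis (no_types) subset_UNIV Pow_UNIV)
  have sub: "range (\<lambda>(a, b). box a b :: 'a set) \<subseteq> Pow UNIV" by simp
  have "Int_stable (range (\<lambda>(a, b). box a b :: 'a set))"
    unfolding Int_stable_def by (auto simp: Int_interval image_iff box_Int_box)
  from this sub A show "(LINT x:A|lborel. F x) = 0"
  proof (induction rule: sigma_sets_induct_disjoint)
    case (compl A)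
    have "(LINT x:UNIV - A|lborel. F x) + (LINT x:A|lborel. F x) = (LINT x:(UNIV - A) \<union> A|lborel. F x)"
      using B[OF compl(1)] by (intro set_integral_Un[symmetric] si) auto
    also have "\<dots> = (LINT x|lborel. F x)" by (simp add: set_lebesgue_integral_def)
    finally show ?case using total compl by simp
  next
    case (union A)
    have "A i \<in> sets borel" for i using union(2) by (intro B) auto
    then have "(LINT x:(\<Union>i. A i)|lborel. F x) = (\<Sum>i. (LINT x:(A i)|lborel. F x))"
      using union(1) by (intro lebesgue_integral_countable_add si sets.countable_UN) (auto simp: disjoint_family_on_def)
    with union show ?case by simp
  next
    case empty
    show ?case by (simp add: set_lebesgue_integral_def)
  qed (auto simp: box)
qed

text \<open>The bound \<open>2 * pi - r\<close> is what remains when an interval of half-width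
  \<open>r\<close> lies anywhere in the period, not necessarily centred. Beyond pi the angle is
  reflected to \<open>2 * pi - \<bar>y\<bar>\<close>.\<close>

lemma cos_gt_cos_iff:
  assumes "\<bar>y\<bar> \<le> 2 * pi - r" "0 < r" "r \<le> pi"
  shows "cos y > cos r \<longleftrightarrow> \<bar>y\<bar> < r"
proof (cases "\<bar>y\<bar> \<le> pi")
  case True
  then show ?thesis using cos_mono_less_eq[of r "\<bar>y\<bar>"] assms by simp
next
  case False
  have "cos y = cos (2 * pi - \<bar>y\<bar>)" by (simp add: abs_if cos_diff)
  moreover have "cos (2 * pi - \<bar>y\<bar>) \<le> cos r"
    using assms False by (intro cos_monotone_0_pi_le) auto
  ultimately show ?thesis using False assms by simp
qed

text \<open>
  With \<open>d j\<close> a difference of cosines, the sequence consists of smooth periodic functions that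
  converge to the indicator function of a box.
\<close>

lemma tendsto_test_function:
  fixes d :: "'i \<Rightarrow> real"
  assumes "finite I"
  shows "(\<lambda>n. exp (- (\<Sum>j\<in>I. exp ((real n)\<^sup>2 * d j + real n)))) \<longlonglongrightarrow> (if \<forall>j\<in>I. d j < 0 then 1 else 0)"
proof (cases "\<forall>j\<in>I. d j < 0")
  case True
  have "(\<lambda>n. exp ((real n)\<^sup>2 * d + real n)) \<longlonglongrightarrow> 0" if "d < 0" for d :: real
    using that by real_asymp
  then have "(\<lambda>n. \<Sum>j\<in>I. exp ((real n)\<^sup>2 * d j + real n)) \<longlonglongrightarrow> (\<Sum>j\<in>I. 0)"
    using True by (intro tendsto_sum) auto
  then have "(\<lambda>n. exp (- (\<Sum>j\<in>I. exp ((real n)\<^sup>2 * d j + real n)))) \<longlonglongrightarrow> exp (- 0)"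
    by (intro tendsto_exp tendsto_minus) simp
  with True show ?thesis by simp
next
  case False
  then obtain j where j: "j \<in> I" "d j \<ge> 0" by (auto simp: not_less)
  have lim: "(\<lambda>n. exp (- exp (real n))) \<longlonglongrightarrow> 0" by real_asymp
  have "(\<lambda>n. exp (- (\<Sum>j\<in>I. exp ((real n)\<^sup>2 * d j + real n)))) \<longlonglongrightarrow> 0"
  proof (rule Lim_null_comparison[OF _ lim], rule always_eventually, rule allI)
    fix n
    \<comment> \<open>The summand \<open>real n\<close> in the exponent sends the boundary case
      \<open>d j = 0\<close> to the limit 0; for negative \<open>d j\<close> it is dominated by the
      quadratic term.\<close>
    have "exp (real n) \<le> exp ((real n)\<^sup>2 * d j + real n)" using j by simp
    also have "\<dots> \<le> (\<Sum>j\<in>I. exp ((real n)\<^sup>2 * d j + real n))"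
      using j assms by (intro member_le_sum) auto
    finally show "norm (exp (- (\<Sum>j\<in>I. exp ((real n)\<^sup>2 * d j + real n)))) \<le> exp (- exp (real n))" by simp
  qed
  with False show ?thesis by auto
qed

lemma wave_axis_inner: "wave L (axis j 1) \<bullet> x = 2 * pi / L $ j * x $ j"
proof -
  have "wave L (axis j 1) = axis j (2 * pi / L $ j)"
    by (simp add: wave_def axis_def vec_eq_iff)
  then show ?thesis by (simp add: inner_axis')
qed

lemma periodic_wave_trig: "periodic L (\<lambda>x. a * cos (wave L k \<bullet> x) + b * sin (wave L k \<bullet> x))"
proof -
  have "cos (wave L k \<bullet> (x + axis j (L $ j))) = cos (wave L k \<bullet> x)"
    "sin (wave L k \<bullet> (x + axis j (L $ j))) = sin (wave L k \<bullet> x)" for x j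
    using wave_inner_period[of L k x j] by (simp_all add: complex_eq_iff)
  then show ?thesis by (simp add: periodic_def)
qed

text \<open>The fundamental lemma of the calculus of variations on the torus: indicators of boxes in
  the cell are bounded limits of smooth periodic functions, so \<open>g\<close> integrates to zero
  over every box.\<close>

lemma sfields_total:
  assumes L: "\<And>j. 0 < L $ j" and g: "g \<in> L2 L" and zero: "\<And>\<psi>. sfield L \<psi> \<Longrightarrow> ip L g \<psi> = 0"
  shows "eqae L g (\<lambda>x. 0)"
proof -
  define F where "F x = indicator (cbox 0 L) x *\<^sub>R g x" for x
  have gi: "integrable (torus L) g" using integrable_scalar_field[OF g smooth_const[of 1]] by simp
  then have F: "integrable lborel F"
    by (simp add: F_def[abs_def] torus_def integrable_restrict_space)
  have sm: "(LINT x|torus L. \<psi> x *\<^sub>R g x) = 0" if "smooth \<psi>" "periodic L \<psi>" for \<psi>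
  proof (simp only: vec_eq_iff, intro allI)
    fix i
    have "(LINT x|torus L. \<psi> x *\<^sub>R g x) \<bullet> axis i 1 = ip L g (\<lambda>x. \<psi> x *\<^sub>R axis i 1)"
      by (subst integral_inner_left[symmetric]) (auto intro!: integrable_scalar_field g that simp: ip_def inner_commute)
    also have "\<dots> = 0" by (intro zero sfield_scalar that)
    finally show "(LINT x|torus L. \<psi> x *\<^sub>R g x) $ i = 0 $ i" by (simp add: inner_axis)
  qed
  have inner_box: "(LINT x|torus L. indicator (box a b) x *\<^sub>R g x) = 0"
    if ab: "\<And>j. 0 \<le> a $ j" "\<And>j. a $ j < b $ j" "\<And>j. b $ j \<le> L $ j" for a b
  proof -
    \<comment> \<open>The midpoint and the half-width of the \<open>j\<close>-th side of the box,
      measured in the angle \<open>2 * pi / L $ j * x $ j\<close>; \<open>d j\<close> is negative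
      exactly between the two faces.\<close>
    define c r where "c j = pi * (a $ j + b $ j) / L $ j" and "r j = pi * (b $ j - a $ j) / L $ j" for j
    define d where "d j x = cos (r j) - cos (2 * pi / L $ j * x $ j - c j)" for j and x :: "real ^ 3"
    define \<psi> where "\<psi> n x = exp (- (\<Sum>j\<in>UNIV. exp ((real n)\<^sup>2 * d j x + real n)))" for n x
    have d_eq: "d j = (\<lambda>x. cos (r j) + ((- cos (c j)) * cos (wave L (axis j 1) \<bullet> x) + (- sin (c j)) * sin (wave L (axis j 1) \<bullet> x)))" for j
      unfolding d_def wave_axis_inner by (simp add: cos_diff algebra_simps)
    have sd: "smooth (d j)" "periodic L (d j)" for j
      unfolding d_eq using periodic_wave_trig[of L "- cos (c j)" "axis j 1" "- sin (c j)"]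
      by - (rule smooth_add[OF smooth_const smooth_trig], simp add: periodic_def)
    have "smooth (\<lambda>x. exp ((-1) * (\<Sum>j\<in>UNIV. exp ((real n)\<^sup>2 * d j x + real n))))" for n
      by (intro smooth_exp smooth_cmult smooth_sum smooth_add smooth_const sd)
    then have s\<psi>: "smooth (\<psi> n)" "periodic L (\<psi> n)" for n
      using sd(2) by (simp_all add: \<psi>_def[abs_def] periodic_def)
    have neg: "d j x < 0 \<longleftrightarrow> a $ j < x $ j \<and> x $ j < b $ j" if x: "x \<in> cbox 0 L" for j x
    proof -
      let ?y = "2 * pi / L $ j * x $ j - c j"
      note Lj = L[of j]
      have xj: "0 \<le> x $ j" "x $ j \<le> L $ j" using x by (auto simp: mem_box_cart)
      have y: "?y = pi / L $ j * (2 * x $ j - a $ j - b $ j)"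
        using Lj by (simp add: c_def field_simps)
      have 1: "\<bar>?y\<bar> \<le> 2 * pi - r j"
      proof -
        have "2 * pi - r j = pi / L $ j * (2 * L $ j - (b $ j - a $ j))"
          using Lj by (simp add: r_def field_simps)
        moreover have "\<bar>?y\<bar> = pi / L $ j * \<bar>2 * x $ j - a $ j - b $ j\<bar>"
          unfolding y using Lj by (simp add: abs_mult)
        moreover have "\<bar>2 * x $ j - a $ j - b $ j\<bar> \<le> 2 * L $ j - (b $ j - a $ j)"
          using ab[of j] xj by linarith
        ultimately show ?thesis using Lj by (simp add: divide_right_mono mult_left_mono)
      qed
      have 2: "0 < r j" "r j \<le> pi"
      proof -
        show "0 < r j" using ab[of j] Lj by (simp add: r_def)
        have "pi * (b $ j - a $ j) \<le> pi * L $ j" using ab[of j] by (intro mult_left_mono) (auto simp: algebra_simps add_increasing2)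
        then show "r j \<le> pi" using Lj by (simp add: r_def divide_le_eq)
      qed
      have "d j x < 0 \<longleftrightarrow> \<bar>?y\<bar> < r j"
        unfolding d_def using cos_gt_cos_iff[OF 1 2] by simp
      also have "\<dots> \<longleftrightarrow> pi / L $ j * \<bar>2 * x $ j - a $ j - b $ j\<bar> < pi / L $ j * (b $ j - a $ j)"
        unfolding y r_def using Lj by (simp add: abs_mult)
      also have "\<dots> \<longleftrightarrow> \<bar>2 * x $ j - a $ j - b $ j\<bar> < b $ j - a $ j"
        using Lj by (intro mult_less_cancel_left_pos) simp
      also have "\<dots> \<longleftrightarrow> a $ j < x $ j \<and> x $ j < b $ j" by auto
      finally show ?thesis .
    qed
    have "(\<lambda>n. LINT x|torus L. \<psi> n x *\<^sub>R g x) \<longlonglongrightarrow> (LINT x|torus L. indicator (box a b) x *\<^sub>R g x)"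
    proof (rule integral_dominated_convergence[where w="\<lambda>x. norm (g x)"])
      have [measurable]: "g \<in> borel_measurable (torus L)" using L2_measurable_torus[OF g] .
      have [measurable]: "\<psi> n \<in> borel_measurable (torus L)" for n
        by (intro measurable_torus borel_measurable_continuous_onI smooth_continuous_on s\<psi>)
      show "(\<lambda>x. \<psi> n x *\<^sub>R g x) \<in> borel_measurable (torus L)" for n by measurable
      have "(\<lambda>x. indicator (box a b) x :: real) \<in> borel_measurable (torus L)"
        by (intro measurable_torus) measurable
      then show "(\<lambda>x. indicator (box a b) x *\<^sub>R g x) \<in> borel_measurable (torus L)" by measurable
      show "AE x in torus L. (\<lambda>n. \<psi> n x *\<^sub>R g x) \<longlonglongrightarrow> indicator (box a b) x *\<^sub>R g x"
      proof (rule AE_I2)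
        fix x assume "x \<in> space (torus L)"
        then have "(\<forall>j\<in>UNIV. d j x < 0) \<longleftrightarrow> x \<in> box a b" using neg by (simp add: mem_box_cart)
        then have "(\<lambda>n. \<psi> n x) \<longlonglongrightarrow> indicator (box a b) x"
          unfolding \<psi>_def using tendsto_test_function[of UNIV "\<lambda>j. d j x"] by (simp add: indicator_def split: if_splits)
        then show "(\<lambda>n. \<psi> n x *\<^sub>R g x) \<longlonglongrightarrow> indicator (box a b) x *\<^sub>R g x" by (intro tendsto_intros)
      qed
      show "AE x in torus L. norm (\<psi> n x *\<^sub>R g x) \<le> norm (g x)" for n
        by (intro AE_I2) (auto simp: \<psi>_def intro!: mult_left_le_one_le sum_nonneg)
    qed (use gi in auto)
    then have "(\<lambda>n. 0) \<longlonglongrightarrow> (LINT x|torus L. indicator (box a b) x *\<^sub>R g x)"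
      by (simp add: sm[OF s\<psi>])
    then show ?thesis using LIMSEQ_unique tendsto_const by blast
  qed
  have "(LINT x:box a b|lborel. F x) = 0" for a b
  proof -
    \<comment> \<open>The box is clipped to the cell. Since boxes are open, the two versions can
      differ on the boundary of the cell, which is a null set.\<close>
    define a' b' :: "real ^ 3" where "a' = (\<chi> j. max 0 (a $ j))" and "b' = (\<chi> j. min (L $ j) (b $ j))"
    have "cbox 0 L - box 0 L \<in> null_sets lborel"
      using negligible_frontier_interval[of 0 L] by (simp add: negligible_iff_null_sets null_sets_completion_iff)
    then have bd: "AE x in lborel. x \<notin> cbox 0 L - box 0 L" by (rule AE_not_in)
    have "(LINT x:box a b|lborel. F x) = (LINT x|torus L. indicator (box a b) x *\<^sub>R g x)"
      unfolding integral_torus by (simp add: F_def set_lebesgue_integral_def mult.commute)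
    also have "\<dots> = (LINT x|torus L. indicator (box a' b') x *\<^sub>R g x)"
    proof (rule integral_cong_AE)
      have [measurable]: "g \<in> borel_measurable (torus L)" using L2_measurable_torus[OF g] .
      have "(\<lambda>x. indicator (box a b) x :: real) \<in> borel_measurable (torus L)" for a b
        by (intro measurable_torus) measurable
      then show "(\<lambda>x. indicator (box a b) x *\<^sub>R g x) \<in> borel_measurable (torus L)"
        "(\<lambda>x. indicator (box a' b') x *\<^sub>R g x) \<in> borel_measurable (torus L)" by measurable
      show "AE x in torus L. indicator (box a b) x *\<^sub>R g x = indicator (box a' b') x *\<^sub>R g x"
        unfolding AE_torus using bd
      proof (rule eventually_mono, intro impI)
        fix x assume "x \<notin> cbox 0 L - box 0 L" "x \<in> cbox 0 L"
        then have "x \<in> box a b \<longleftrightarrow> x \<in> box a' b'"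
          by (auto simp: mem_box_cart a'_def b'_def)
        then show "indicator (box a b) x *\<^sub>R g x = indicator (box a' b') x *\<^sub>R g x" by (simp add: indicator_def)
      qed
    qed
    also have "\<dots> = 0"
    proof (cases "\<forall>j. a' $ j < b' $ j")
      case True
      then show ?thesis by (intro inner_box) (auto simp: a'_def b'_def)
    next
      case False
      then have "box a' b' = {}" by (simp add: interval_eq_empty_cart not_less)
      then show ?thesis by simp
    qed
    finally show ?thesis .
  qed
  from integral_zero_on_boxes[OF F this] show ?thesis
    unfolding eqae_def AE_torus F_def by (rule eventually_mono) auto
qed

section \<open>Weak derivatives, the space V and orthogonality to gradients\<close>

locale torus3 =
  fixes L :: "real ^ 3"
  assumes L_pos: "0 < L $ j"
begin

lemma weak_partial_unique:
  assumes "u \<in> L2 L" "g \<in> L2 L" "g' \<in> L2 L" "is_weak_partial L j u g" "is_weak_partial L j u g'"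
  shows "eqae L g g'"
proof -
  have "eqae L (\<lambda>x. g x - g' x) (\<lambda>x. 0)"
  proof (rule sfields_total[OF L_pos])
    show "(\<lambda>x. g x - g' x) \<in> L2 L" by (intro L2_diff assms)
    show "ip L (\<lambda>x. g x - g' x) \<psi> = 0" if "sfield L \<psi>" for \<psi>
      using assms that by (simp add: is_weak_partial_iff ip_diff_left sfield_L2)
  qed
  then show ?thesis by (simp add: eqae_def)
qed

lemma H1_L2: "u \<in> H1 L \<Longrightarrow> u \<in> L2 L"
  by (simp add: H1_def)

lemma wpartial:
  assumes "u \<in> H1 L"
  shows wpartial_L2: "wpartial L j u \<in> L2 L" and wpartial_weak: "is_weak_partial L j u (wpartial L j u)"
proof -
  have "\<exists>g. g \<in> L2 L \<and> is_weak_partial L j u g" using assms by (auto simp: H1_def)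
  from someI_ex[OF this] show "wpartial L j u \<in> L2 L" "is_weak_partial L j u (wpartial L j u)"
    by (simp_all add: wpartial_def)
qed

lemma ip_wpartial:
  assumes "u \<in> H1 L" "sfield L \<psi>"
  shows "ip L (wpartial L j u) \<psi> = - ip L u (fpart j \<psi>)"
  using is_weak_partial_iff[OF H1_L2[OF assms(1)] wpartial_L2[OF assms(1)]] wpartial_weak[OF assms(1)] assms(2)
  by blast

lemma wpartial_eqae:
  assumes "u \<in> L2 L" "g \<in> L2 L" "is_weak_partial L j u g"
  shows "eqae L (wpartial L j u) g"
proof -
  have "\<exists>g. g \<in> L2 L \<and> is_weak_partial L j u g" using assms by auto
  from someI_ex[OF this] show ?thesis
    using assms weak_partial_unique[of u "wpartial L j u" g j] by (simp add: wpartial_def)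
qed

lemma is_weak_partial_lincomb:
  assumes "u \<in> L2 L" "v \<in> L2 L" "g \<in> L2 L" "h \<in> L2 L" "is_weak_partial L j u g" "is_weak_partial L j v h"
  shows "is_weak_partial L j (\<lambda>x. a *\<^sub>R u x + b *\<^sub>R v x) (\<lambda>x. a *\<^sub>R g x + b *\<^sub>R h x)"
  using assms
  by (simp add: is_weak_partial_iff L2_lincomb L2_scaleR ip_add_left ip_scaleR_left sfield_L2 sfield_fpart)

lemma H1_lincomb:
  assumes "u \<in> H1 L" "v \<in> H1 L"
  shows "(\<lambda>x. a *\<^sub>R u x + b *\<^sub>R v x) \<in> H1 L"
    and "eqae L (wpartial L j (\<lambda>x. a *\<^sub>R u x + b *\<^sub>R v x)) (\<lambda>x. a *\<^sub>R wpartial L j u x + b *\<^sub>R wpartial L j v x)"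
proof -
  note * = is_weak_partial_lincomb[OF H1_L2[OF assms(1)] H1_L2[OF assms(2)] wpartial_L2[OF assms(1)]
      wpartial_L2[OF assms(2)] wpartial_weak[OF assms(1)] wpartial_weak[OF assms(2)]]
  show "(\<lambda>x. a *\<^sub>R u x + b *\<^sub>R v x) \<in> H1 L"
    using *[of _ a b] L2_lincomb[OF H1_L2[OF assms(1)] H1_L2[OF assms(2)]]
      L2_lincomb[OF wpartial_L2[OF assms(1)] wpartial_L2[OF assms(2)]]
    unfolding H1_def by blast
  show "eqae L (wpartial L j (\<lambda>x. a *\<^sub>R u x + b *\<^sub>R v x)) (\<lambda>x. a *\<^sub>R wpartial L j u x + b *\<^sub>R wpartial L j v x)"
    using * assms by (intro wpartial_eqae L2_lincomb H1_L2 wpartial_L2)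
qed

lemma H1_diff:
  assumes "u \<in> H1 L" "v \<in> H1 L"
  shows "(\<lambda>x. u x - v x) \<in> H1 L"
    and "eqae L (wpartial L j (\<lambda>x. u x - v x)) (\<lambda>x. wpartial L j u x - wpartial L j v x)"
  using H1_lincomb(1)[OF assms, of 1 "-1"] H1_lincomb(2)[OF assms, of j 1 "-1"] by simp_all

lemma sfield_H1: "sfield L w \<Longrightarrow> w \<in> H1 L"
  unfolding H1_def using sfield_weak_partial[OF L_pos] sfield_L2 sfield_fpart by blast

lemma wpartial_sfield: "sfield L w \<Longrightarrow> eqae L (wpartial L j w) (fpart j w)"
  by (intro wpartial_eqae sfield_weak_partial L_pos sfield_L2 sfield_fpart)

text \<open>Weak differentiation is a closed operator: both sides of the tested identity are
  continuous in the L2 norm.\<close>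

lemma is_weak_partial_limit:
  assumes "u \<in> L2 L" "g \<in> L2 L" "\<And>n. f n \<in> L2 L" "\<And>n. h n \<in> L2 L" "\<And>n. is_weak_partial L j (f n) (h n)"
    and "(\<lambda>n. l2norm L (\<lambda>x. u x - f n x)) \<longlonglongrightarrow> 0" "(\<lambda>n. l2norm L (\<lambda>x. g x - h n x)) \<longlonglongrightarrow> 0"
  shows "is_weak_partial L j u g"
  unfolding is_weak_partial_iff[OF assms(1,2)]
proof (intro allI impI)
  fix \<psi> assume \<psi>: "sfield L \<psi>"
  have "(\<lambda>n. ip L (h n) \<psi>) \<longlonglongrightarrow> ip L g \<psi>"
    by (rule tendsto_ip_left) (use assms \<psi> in \<open>auto intro: sfield_L2\<close>)
  moreover have "(\<lambda>n. - ip L (f n) (fpart j \<psi>)) \<longlonglongrightarrow> - ip L u (fpart j \<psi>)"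
    by (rule tendsto_minus, rule tendsto_ip_left) (use assms \<psi> in \<open>auto intro: sfield_L2 sfield_fpart\<close>)
  moreover have "ip L (h n) \<psi> = - ip L (f n) (fpart j \<psi>)" for n
    using assms(3-5) \<psi> is_weak_partial_iff by blast
  ultimately show "ip L g \<psi> = - ip L u (fpart j \<psi>)"
    using LIMSEQ_unique by (metis (no_types, lifting) ext)
qed

lemma gip_commute: "gip L u v = gip L v u"
  by (simp add: gip_def ip_commute)

lemma gip_lincomb_left:
  assumes "u \<in> H1 L" "v \<in> H1 L" "w \<in> H1 L"
  shows "gip L (\<lambda>x. a *\<^sub>R u x + b *\<^sub>R v x) w = a * gip L u w + b * gip L v w"
proof -
  have "ip L (wpartial L j (\<lambda>x. a *\<^sub>R u x + b *\<^sub>R v x)) (wpartial L j w)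
      = ip L (\<lambda>x. a *\<^sub>R wpartial L j u x + b *\<^sub>R wpartial L j v x) (wpartial L j w)" for j
    by (rule ip_cong[OF H1_lincomb(2)])
      (use assms in \<open>auto intro!: wpartial_L2 H1_lincomb(1) L2_lincomb\<close>)
  then show ?thesis
    using assms by (simp add: gip_def ip_add_left ip_scaleR_left wpartial_L2 L2_scaleR sum.distrib sum_distrib_left)
qed

lemma gip_diff_left: "u \<in> H1 L \<Longrightarrow> v \<in> H1 L \<Longrightarrow> w \<in> H1 L \<Longrightarrow>
    gip L (\<lambda>x. u x - v x) w = gip L u w - gip L v w"
  using gip_lincomb_left[of u v w 1 "-1"] by simp

lemma gip_lincomb_right: "u \<in> H1 L \<Longrightarrow> v \<in> H1 L \<Longrightarrow> w \<in> H1 L \<Longrightarrow>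
    gip L w (\<lambda>x. a *\<^sub>R u x + b *\<^sub>R v x) = a * gip L w u + b * gip L w v"
  using gip_lincomb_left[of u v w a b] by (simp add: gip_commute)

lemma gip_diff_right: "u \<in> H1 L \<Longrightarrow> v \<in> H1 L \<Longrightarrow> w \<in> H1 L \<Longrightarrow>
    gip L w (\<lambda>x. u x - v x) = gip L w u - gip L w v"
  using gip_lincomb_right[of u v w 1 "-1"] by simp

lemma gip_self_nonneg [simp]: "0 \<le> gip L u u"
  by (simp add: gip_def sum_nonneg)

lemma gnorm_nonneg [simp]: "0 \<le> gnorm L u"
  by (simp add: gnorm_def)

lemma gnorm_power2: "(gnorm L u)\<^sup>2 = gip L u u"
  by (simp add: gnorm_def)

lemma gnorm_L2_set: "gnorm L u = L2_set (\<lambda>j. l2norm L (wpartial L j u)) UNIV"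
  by (simp add: gnorm_def gip_def L2_set_def l2norm_power2)

lemma gip_Cauchy_Schwarz:
  assumes "u \<in> H1 L" "v \<in> H1 L"
  shows "\<bar>gip L u v\<bar> \<le> gnorm L u * gnorm L v"
proof -
  have "\<bar>gip L u v\<bar> \<le> (\<Sum>j\<in>UNIV. \<bar>ip L (wpartial L j u) (wpartial L j v)\<bar>)"
    unfolding gip_def by (rule sum_abs)
  also have "\<dots> \<le> (\<Sum>j\<in>UNIV. \<bar>l2norm L (wpartial L j u)\<bar> * \<bar>l2norm L (wpartial L j v)\<bar>)"
    using assms by (intro sum_mono) (simp add: ip_Cauchy_Schwarz wpartial_L2)
  also have "\<dots> \<le> gnorm L u * gnorm L v"
    unfolding gnorm_L2_set by (rule L2_set_mult_ineq)
  finally show ?thesis .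
qed

lemma gnorm_triangle_diff2:
  assumes "u \<in> H1 L" "v \<in> H1 L"
  shows "gnorm L u \<le> gnorm L v + gnorm L (\<lambda>x. u x - v x)"
proof (rule power2_le_imp_le)
  let ?d = "\<lambda>x. u x - v x"
  have d: "?d \<in> H1 L" using assms by (intro H1_diff)
  have "gip L ?d ?d = gip L u u - 2 * gip L u v + gip L v v" "gip L v ?d = gip L u v - gip L v v"
    using assms d by (simp_all add: gip_diff_left gip_diff_right gip_commute[of v u])
  then have "(gnorm L u)\<^sup>2 = (gnorm L v)\<^sup>2 + 2 * gip L v ?d + (gnorm L ?d)\<^sup>2"
    by (simp add: gnorm_power2)
  also have "\<dots> \<le> (gnorm L v + gnorm L ?d)\<^sup>2"
    using gip_Cauchy_Schwarz[OF assms(2) d] by (simp add: power2_sum)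
  finally show "(gnorm L u)\<^sup>2 \<le> (gnorm L v + gnorm L ?d)\<^sup>2" .
qed simp

lemma h1norm_nonneg [simp]: "0 \<le> h1norm L u"
  by (simp add: h1norm_def)

lemma h1norm_power2: "(h1norm L u)\<^sup>2 = (l2norm L u)\<^sup>2 + (gnorm L u)\<^sup>2"
  by (simp add: h1norm_def)

lemma l2norm_le_h1norm: "l2norm L u \<le> h1norm L u"
  by (rule power2_le_imp_le) (simp_all add: h1norm_power2)

lemma gnorm_le_h1norm: "gnorm L u \<le> h1norm L u"
  by (rule power2_le_imp_le) (simp_all add: h1norm_power2)

lemma VV_H1: "u \<in> VV L \<Longrightarrow> u \<in> H1 L"
  by (simp add: VV_def)

lemma VV_L2: "u \<in> VV L \<Longrightarrow> u \<in> L2 L"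
  by (simp add: VV_H1 H1_L2)

lemma VV_HH: assumes "u \<in> VV L" shows "u \<in> HH L"
  unfolding HH_def
proof (intro CollectI conjI allI impI VV_L2 assms)
  fix e :: real assume "e > 0"
  then obtain v where "v \<in> trig_fields L" "h1norm L (u - v) < e" using assms by (auto simp: VV_def)
  then show "\<exists>v\<in>trig_fields L. l2norm L (u - v) < e"
    using l2norm_le_h1norm[of "u - v"] by (meson le_less_trans)
qed

text \<open>The condition defining \<open>X L k\<close> is divergence freedom in Fourier terms. Its
  imaginary part cancels the cosines of the divergence, its real part the sines.\<close>

lemma trig_fields_sfield:
  assumes "w \<in> trig_fields L"
  shows "sfield L w" and "(\<Sum>j\<in>UNIV. partial j (\<lambda>x. w x $ j) x) = 0"
proof -
  obtain K c where K: "finite K" "\<And>k. k \<in> K \<Longrightarrow> c k \<in> X L k" and w: "\<And>x. cvec (w x) = trig_sum L K c x"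
    using assms by (auto simp: trig_fields_def)
  have e: "w x $ j = (\<Sum>k\<in>K. Re (c k $ j) * cos (wave L k \<bullet> x) + (- Im (c k $ j)) * sin (wave L k \<bullet> x))" for x j
  proof -
    have "w x $ j = Re (cvec (w x) $ j)" by (simp add: cvec_def)
    also have "\<dots> = (\<Sum>k\<in>K. Re (c k $ j) * cos (wave L k \<bullet> x) + (- Im (c k $ j)) * sin (wave L k \<bullet> x))"
      unfolding w trig_sum_def by (simp add: algebra_simps)
    finally show ?thesis .
  qed
  show "sfield L w"
    unfolding sfield_def
  proof (intro conjI allI)
    show "periodic L w" using L2_periodic trig_fields_L2 assms by blast
    show "smooth (\<lambda>x. w x $ i)" for i unfolding e by (intro smooth_sum smooth_trig)
  qed
  have "(\<Sum>j\<in>UNIV. partial j (\<lambda>x. w x $ j) x) = (\<Sum>j\<in>UNIV. \<Sum>k\<in>K. (- Im (c k $ j) * wave L k $ j) * cos (wave L k \<bullet> x)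
      + (- Re (c k $ j) * wave L k $ j) * sin (wave L k \<bullet> x))"
    unfolding e by (subst partial_sum[OF smooth_trig]) (simp only: partial_trig)
  also have "\<dots> = (\<Sum>k\<in>K. - (\<Sum>j\<in>UNIV. Im (c k $ j) * wave L k $ j) * cos (wave L k \<bullet> x)
      - (\<Sum>j\<in>UNIV. Re (c k $ j) * wave L k $ j) * sin (wave L k \<bullet> x))"
    by (subst sum.swap) (simp add: sum_distrib_right sum_negf sum_subtractf sum.distrib)
  also have "\<dots> = 0"
  proof (rule sum.neutral, rule ballI)
    fix k assume "k \<in> K"
    then have "(\<Sum>j\<in>UNIV. c k $ j * of_real (wave L k $ j)) = 0" using K by (simp add: X_def)
    from arg_cong[OF this, of Re] arg_cong[OF this, of Im]
    show "- (\<Sum>j\<in>UNIV. Im (c k $ j) * wave L k $ j) * cos (wave L k \<bullet> x)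
      - (\<Sum>j\<in>UNIV. Re (c k $ j) * wave L k $ j) * sin (wave L k \<bullet> x) = 0" by simp
  qed
  finally show "(\<Sum>j\<in>UNIV. partial j (\<lambda>x. w x $ j) x) = 0" .
qed

text \<open>Integration by parts on trigonometric fields, followed by an L2 limit. It is the only
  information about divergence extracted from \<open>HH\<close>: it makes coefficients orthogonal to
  the wave vector, removes the gradient part of the Coriolis term, and cancels part of the
  convective term.\<close>

lemma HH_orthogonal_gradient:
  assumes "u \<in> HH L" "smooth \<phi>" "periodic L \<phi>"
  shows "ip L u (\<lambda>x. \<chi> j. partial j \<phi> x) = 0"
proof -
  let ?g = "\<lambda>x. \<chi> j. partial j \<phi> x"
  have g: "?g \<in> L2 L"
    using partial_periodic[OF assms(2,3)] smooth_partial[OF assms(2)]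
    by (intro sfield_L2) (auto simp: sfield_def periodic_def vec_eq_iff)
  obtain f where f: "\<And>n. f n \<in> trig_fields L" "(\<lambda>n. l2norm L (\<lambda>x. u x - f n x)) \<longlonglongrightarrow> 0"
    using HH_approx[OF assms(1)] by blast
  have "ip L w ?g = 0" if "w \<in> trig_fields L" for w
  proof -
    note s = sfield_smooth[OF trig_fields_sfield(1)[OF that]] sfield_periodic_component[OF trig_fields_sfield(1)[OF that]]
    note c = smooth_continuous_on[OF s(1)] smooth_continuous_on[OF smooth_partial[OF s(1)]]
      smooth_continuous_on[OF assms(2)] smooth_continuous_on[OF smooth_partial[OF assms(2)]]
    have "ip L w ?g = (\<Sum>j\<in>UNIV. LINT x|torus L. w x $ j * partial j \<phi> x)"
      unfolding ip_def inner_vec_def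
      by (subst Bochner_Integration.integral_sum) (auto intro!: continuous_integrable_torus(1) continuous_intros c)
    also have "\<dots> = (\<Sum>j\<in>UNIV. - (LINT x|torus L. partial j (\<lambda>x. w x $ j) x * \<phi> x))"
      by (intro sum.cong refl) (simp add: integration_by_parts[OF s assms(2,3) L_pos])
    also have "\<dots> = - (LINT x|torus L. (\<Sum>j\<in>UNIV. partial j (\<lambda>x. w x $ j) x) * \<phi> x)"
      unfolding sum_distrib_right
      by (subst Bochner_Integration.integral_sum)
        (auto intro!: continuous_integrable_torus(1) continuous_intros c simp: sum_negf)
    also have "\<dots> = 0" using trig_fields_sfield(2)[OF that] by simp
    finally show ?thesis .
  qed
  then have "(\<lambda>n. ip L (f n) ?g) = (\<lambda>n. 0)" using f by auto
  moreover have "(\<lambda>n. ip L (f n) ?g) \<longlonglongrightarrow> ip L u ?g"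
    by (rule tendsto_ip_left) (use f g assms(1) in \<open>auto intro: trig_fields_L2 simp: HH_L2\<close>)
  ultimately show ?thesis using LIMSEQ_unique tendsto_const by metis
qed

end

lemma eqae_diff: "eqae L u v \<Longrightarrow> eqae L u' v' \<Longrightarrow> eqae L (\<lambda>x. u x - u' x) (\<lambda>x. v x - v' x)"
  by (rule eqae_comp2)

subsection \<open>Plane waves with wave vectors parallel to a fixed one\<close>

locale torus3_mode = torus3 +
  fixes k :: "int ^ 3"
  assumes k_nonzero: "k \<noteq> 0"
begin

definition \<kappa> :: "real ^ 3" where "\<kappa> = wave L k"
definition V :: real where "V = measure lborel (cbox 0 L)"
text \<open>Mode numbers are shifted by one: index \<open>m\<close> belongs to the multiple
  \<open>m + 1\<close> of \<open>k\<close>. Negative multiples need no index of their own, since a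
  real mode combines \<open>kk m\<close> and \<open>- kk m\<close>.\<close>

definition p :: "nat \<Rightarrow> real" where "p m = real (Suc m)"
definition kk :: "nat \<Rightarrow> int ^ 3" where "kk m = (\<chi> j. int (Suc m) * k $ j)"

text \<open>\<open>q m\<close> is the eigenvalue of the Stokes operator on the \<open>m\<close>-th mode.\<close>

definition q :: "nat \<Rightarrow> real" where "q m = (p m)\<^sup>2 * (\<kappa> \<bullet> \<kappa>)"

text \<open>
  The pair \<open>(a, b)\<close> stands for the real mode with Fourier coefficients \<open>(a - i b) / 2\<close> at \<open>kk m\<close>
  and \<open>(a + i b) / 2\<close> at \<open>- kk m\<close>.
\<close>

definition modal :: "nat \<Rightarrow> (real ^ 3) \<times> (real ^ 3) \<Rightarrow> field3" where
  "modal m z x = cos (wave L (kk m) \<bullet> x) *\<^sub>R fst z + sin (wave L (kk m) \<bullet> x) *\<^sub>R snd z"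

text \<open>The symbol of the partial derivative in direction \<open>j\<close>: differentiating
  \<open>a cos + b sin\<close> turns the pair (a, b) into a multiple of (b, - a).\<close>

definition dz :: "3 \<Rightarrow> nat \<Rightarrow> (real ^ 3) \<times> (real ^ 3) \<Rightarrow> (real ^ 3) \<times> (real ^ 3)" where
  "dz j m z = (p m * \<kappa> $ j) *\<^sub>R (snd z, - fst z)"

text \<open>Divergence freedom of a mode, read off from its coefficient pair.\<close>

definition perp :: "(real ^ 3) \<times> (real ^ 3) \<Rightarrow> bool" where
  "perp z \<longleftrightarrow> fst z \<bullet> \<kappa> = 0 \<and> snd z \<bullet> \<kappa> = 0"

definition partial_modes :: "nat \<Rightarrow> (nat \<Rightarrow> (real ^ 3) \<times> (real ^ 3)) \<Rightarrow> field3" where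
  "partial_modes N z x = (\<Sum>m<N. modal m (z m) x)"

text \<open>A relation rather than a coefficient map: it survives a change of representative and
  determines \<open>f\<close> up to a null set, which suits operators defined by choice.\<close>

definition expands :: "(nat \<Rightarrow> (real ^ 3) \<times> (real ^ 3)) \<Rightarrow> field3 \<Rightarrow> bool" where
  "expands z f \<longleftrightarrow> f \<in> L2 L \<and> (\<lambda>N. l2norm L (\<lambda>x. f x - partial_modes N z x)) \<longlonglongrightarrow> 0"

section \<open>Wave vectors and orthogonality of plane waves\<close>

lemma p_ge_1: "1 \<le> p m" and p_pos: "0 < p m"
  by (simp_all add: p_def)

lemma V_pos: "0 < V"
  using L_pos by (simp add: V_def content_pos_lt_eq Basis_vec_def inner_axis)

lemma V_eq: "V = measure (torus L) (space (torus L))"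
  by (simp add: V_def measure_def emeasure_torus)

lemma wave_eq_0_iff: "wave L r = 0 \<longleftrightarrow> r = 0"
proof -
  have "L $ j \<noteq> 0" for j using L_pos[of j] by simp
  then show ?thesis by (simp add: wave_def vec_eq_iff)
qed

lemma \<kappa>_nonzero: "\<kappa> \<noteq> 0"
  by (simp add: \<kappa>_def wave_eq_0_iff k_nonzero)

lemma \<kappa>_pos: "0 < \<kappa> \<bullet> \<kappa>"
  using \<kappa>_nonzero by simp

lemma q_pos: "0 < q m" and q_nonneg: "0 \<le> q m"
  using \<kappa>_pos p_pos[of m] by (simp_all add: q_def)

lemma wave_kk: "wave L (kk m) = p m *\<^sub>R \<kappa>"
  by (simp add: wave_def kk_def p_def \<kappa>_def vec_eq_iff algebra_simps add_divide_distrib)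

lemma wave_uminus: "wave L (- r) = - wave L r"
  by (simp add: wave_def vec_eq_iff)

lemma wave_add: "wave L (r + s) = wave L r + wave L s"
  by (simp add: wave_def vec_eq_iff algebra_simps add_divide_distrib)

lemma wave_diff: "wave L (r - s) = wave L r - wave L s"
  by (simp add: wave_def vec_eq_iff algebra_simps diff_divide_distrib)

lemma obtain_k: obtains j where "k $ j \<noteq> 0"
  using k_nonzero by (auto simp: vec_eq_iff)

lemma kk_inj: "kk m = kk n \<longleftrightarrow> m = n"
proof -
  obtain j where j: "k $ j \<noteq> 0" by (rule obtain_k)
  have "m = n" if "kk m = kk n"
    using arg_cong[OF that, of "\<lambda>v. v $ j"] j by (simp add: kk_def)
  then show ?thesis by auto
qed

lemma kk_neq_uminus: "kk m \<noteq> - kk n" "- kk n \<noteq> kk m"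
proof -
  obtain j where j: "k $ j \<noteq> 0" by (rule obtain_k)
  have "int (Suc m) * k $ j \<noteq> - (int (Suc n) * k $ j)"
  proof
    assume "int (Suc m) * k $ j = - (int (Suc n) * k $ j)"
    then have "(int (Suc m) + int (Suc n)) * k $ j = 0" by (simp only: distrib_right)
    with j show False by simp
  qed
  then show "kk m \<noteq> - kk n" by (auto simp: kk_def vec_eq_iff)
  then show "- kk n \<noteq> kk m" by auto
qed

lemma kk_nonzero: "kk m \<noteq> 0"
proof -
  obtain j where j: "k $ j \<noteq> 0" by (rule obtain_k)
  then show ?thesis by (auto simp: kk_def vec_eq_iff intro!: exI[of _ j])
qed

text \<open>For a nonzero frequency the wave is a partial derivative of a periodic function, namely
  of the other trigonometric function divided by a nonzero component of the wave vector.\<close>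

lemma integral_cos_wave: "(LINT x|torus L. cos (wave L r \<bullet> x)) = (if r = 0 then V else 0)"
  and integral_sin_wave: "(LINT x|torus L. sin (wave L r \<bullet> x)) = 0"
proof -
  show "(LINT x|torus L. cos (wave L r \<bullet> x)) = (if r = 0 then V else 0)"
  proof (cases "r = 0")
    case True
    then have "wave L r = 0" using wave_eq_0_iff by simp
    with True show ?thesis by (simp add: V_eq)
  next
    case False
    then obtain j where j: "wave L r $ j \<noteq> 0" using wave_eq_0_iff[of r] by (auto simp: vec_eq_iff)
    have "(LINT x|torus L. partial j (\<lambda>x. 0 * cos (wave L r \<bullet> x) + (1 / wave L r $ j) * sin (wave L r \<bullet> x)) x) = 0"
      by (rule integral_partial_periodic[OF smooth_trig periodic_wave_trig L_pos])
    with j False show ?thesis unfolding partial_trig by simp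
  qed
  show "(LINT x|torus L. sin (wave L r \<bullet> x)) = 0"
  proof (cases "r = 0")
    case True
    then have "wave L r = 0" using wave_eq_0_iff by simp
    then show ?thesis by simp
  next
    case False
    then obtain j where j: "wave L r $ j \<noteq> 0" using wave_eq_0_iff[of r] by (auto simp: vec_eq_iff)
    have "(LINT x|torus L. partial j (\<lambda>x. (- 1 / wave L r $ j) * cos (wave L r \<bullet> x) + 0 * sin (wave L r \<bullet> x)) x) = 0"
      by (rule integral_partial_periodic[OF smooth_trig periodic_wave_trig L_pos])
    with j show ?thesis unfolding partial_trig by simp
  qed
qed

lemma integrable_trig:
  "integrable (torus L) (\<lambda>x. cos (\<xi> \<bullet> x))" "integrable (torus L) (\<lambda>x. sin (\<xi> \<bullet> x))"
  "integrable (torus L) (\<lambda>x. cos (\<xi> \<bullet> x) * cos (\<eta> \<bullet> x))"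
  "integrable (torus L) (\<lambda>x. sin (\<xi> \<bullet> x) * cos (\<eta> \<bullet> x))"
  "integrable (torus L) (\<lambda>x. cos (\<xi> \<bullet> x) * sin (\<eta> \<bullet> x))"
  "integrable (torus L) (\<lambda>x. sin (\<xi> \<bullet> x) * sin (\<eta> \<bullet> x))"
  by (intro continuous_integrable_torus(1) continuous_intros)+

lemma integral_cos_cos: "(LINT x|torus L. cos (wave L r \<bullet> x) * cos (wave L s \<bullet> x))
    = V / 2 * (of_bool (r = s) + of_bool (r = - s))"
proof -
  have "(LINT x|torus L. cos (wave L r \<bullet> x) * cos (wave L s \<bullet> x))
      = (LINT x|torus L. (cos (wave L (r - s) \<bullet> x) + cos (wave L (r + s) \<bullet> x)) / 2)"
    by (simp add: wave_diff wave_add inner_diff_left inner_add_left cos_times_cos)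
  also have "\<dots> = ((if r - s = 0 then V else 0) + (if r + s = 0 then V else 0)) / 2"
    by (simp only: integral_divide_zero Bochner_Integration.integral_add integrable_trig integral_cos_wave)
  finally show ?thesis by (simp add: eq_neg_iff_add_eq_0)
qed

lemma integral_sin_sin: "(LINT x|torus L. sin (wave L r \<bullet> x) * sin (wave L s \<bullet> x))
    = V / 2 * (of_bool (r = s) - of_bool (r = - s))"
proof -
  have "(LINT x|torus L. sin (wave L r \<bullet> x) * sin (wave L s \<bullet> x))
      = (LINT x|torus L. (cos (wave L (r - s) \<bullet> x) - cos (wave L (r + s) \<bullet> x)) / 2)"
    by (simp add: wave_diff wave_add inner_diff_left inner_add_left sin_times_sin)
  also have "\<dots> = ((if r - s = 0 then V else 0) - (if r + s = 0 then V else 0)) / 2"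
    by (simp only: integral_divide_zero Bochner_Integration.integral_diff integrable_trig integral_cos_wave)
  finally show ?thesis by (simp add: eq_neg_iff_add_eq_0)
qed

lemma integral_sin_cos: "(LINT x|torus L. sin (wave L r \<bullet> x) * cos (wave L s \<bullet> x)) = 0"
proof -
  have "(LINT x|torus L. sin (wave L r \<bullet> x) * cos (wave L s \<bullet> x))
      = (LINT x|torus L. (sin (wave L (r + s) \<bullet> x) + sin (wave L (r - s) \<bullet> x)) / 2)"
    by (simp add: wave_diff wave_add inner_diff_left inner_add_left sin_times_cos)
  also have "\<dots> = 0"
    by (simp only: integral_divide_zero Bochner_Integration.integral_add integrable_trig integral_sin_wave) simp
  finally show ?thesis .
qed

lemma integral_cos_sin: "(LINT x|torus L. cos (wave L r \<bullet> x) * sin (wave L s \<bullet> x)) = 0"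
  using integral_sin_cos[of s r] by (simp add: mult.commute)

lemma modal_component: "(\<lambda>x. modal m z x $ i) =
    (\<lambda>x. (fst z $ i) * cos (wave L (kk m) \<bullet> x) + (snd z $ i) * sin (wave L (kk m) \<bullet> x))"
  by (simp add: modal_def mult.commute)

lemma modal_sfield: "sfield L (modal m z)"
proof -
  have "periodic L (\<lambda>x. modal m z x $ i)" for i
    unfolding modal_component by (rule periodic_wave_trig)
  then have "periodic L (modal m z)" by (simp add: periodic_def vec_eq_iff)
  then show ?thesis unfolding sfield_def modal_component by (auto intro: smooth_trig)
qed

lemma modal_L2: "modal m z \<in> L2 L"
  by (rule sfield_L2[OF modal_sfield])

lemma fpart_modal: "fpart j (modal m z) = modal m (dz j m z)"
  by (rule ext) (simp add: vec_eq_iff fpart_def modal_component partial_trig, simp add: modal_def dz_def wave_kk algebra_simps)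

lemma modal_lincomb: "modal m (a *\<^sub>R z + b *\<^sub>R w) x = a *\<^sub>R modal m z x + b *\<^sub>R modal m w x"
  by (simp add: modal_def algebra_simps)

lemma modal_add: "modal m (z + w) x = modal m z x + modal m w x"
  and modal_diff: "modal m (z - w) x = modal m z x - modal m w x"
  and modal_scaleR: "modal m (a *\<^sub>R z) x = a *\<^sub>R modal m z x"
  and modal_0: "modal m 0 x = 0"
  by (simp_all add: modal_def algebra_simps)

lemma modal_linear_map: "linear T \<Longrightarrow> T (modal m z x) = modal m (T (fst z), T (snd z)) x"
  by (simp add: modal_def linear_add linear_scale)

lemma norm_modal_le: "norm (modal m z x) \<le> 2 * norm z"
proof -
  have "norm (modal m z x) \<le> \<bar>cos (wave L (kk m) \<bullet> x)\<bar> * norm (fst z) + \<bar>sin (wave L (kk m) \<bullet> x)\<bar> * norm (snd z)"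
    unfolding modal_def by (rule norm_triangle_le) simp
  also have "\<dots> \<le> 1 * norm (fst z) + 1 * norm (snd z)"
    by (intro add_mono mult_right_mono) auto
  also have "\<dots> \<le> 2 * norm z" using norm_fst_le[of "fst z" "snd z"] norm_snd_le[of "snd z" "fst z"] by simp
  finally show ?thesis .
qed

text \<open>The factor \<open>V / 2\<close> is the volume times the mean square of a cosine or sine.
  Mixed terms vanish because the frequencies \<open>kk m\<close> differ from each other and from
  each other's negatives.\<close>

lemma ip_modal: "ip L (modal m z) (modal n w) = (if m = n then V / 2 * (z \<bullet> w) else 0)"
proof -
  let ?c = "\<lambda>m x. cos (wave L (kk m) \<bullet> x)" and ?s = "\<lambda>m x. sin (wave L (kk m) \<bullet> x)"
  have "ip L (modal m z) (modal n w) = (LINT x|torus L. (fst z \<bullet> fst w) * (?c m x * ?c n x) + (snd z \<bullet> snd w) * (?s m x * ?s n x)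
      + (fst z \<bullet> snd w) * (?c m x * ?s n x) + (snd z \<bullet> fst w) * (?s m x * ?c n x))"
    unfolding ip_def modal_def by (intro Bochner_Integration.integral_cong refl) (simp add: inner_add_left inner_add_right algebra_simps)
  also have "\<dots> = (fst z \<bullet> fst w) * (V / 2 * of_bool (m = n)) + (snd z \<bullet> snd w) * (V / 2 * of_bool (m = n))"
    by (simp add: Bochner_Integration.integral_add integrable_trig integral_cos_cos integral_sin_sin integral_sin_cos integral_cos_sin kk_inj kk_neq_uminus)
  finally show ?thesis by (simp add: inner_prod_def algebra_simps)
qed

lemma partial_modes_sfield: "sfield L (partial_modes N z)"
  unfolding partial_modes_def[abs_def] by (intro sfield_sum modal_sfield)

lemma partial_modes_L2: "partial_modes N z \<in> L2 L"
  by (rule sfield_L2[OF partial_modes_sfield])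

lemma partial_modes_lincomb: "partial_modes N (\<lambda>m. a *\<^sub>R z m + b *\<^sub>R w m) x = a *\<^sub>R partial_modes N z x + b *\<^sub>R partial_modes N w x"
  by (simp add: partial_modes_def modal_lincomb sum.distrib scaleR_sum_right)

lemma fpart_partial_modes: "fpart j (partial_modes N z) = partial_modes N (\<lambda>m. dz j m (z m))"
  unfolding partial_modes_def[abs_def] by (simp add: fpart_sum[OF modal_sfield] fpart_modal)

lemma partial_modes_linear_map:
  "linear T \<Longrightarrow> T (partial_modes N z x) = partial_modes N (\<lambda>m. (T (fst (z m)), T (snd (z m)))) x"
  by (simp add: partial_modes_def linear_sum modal_linear_map)

lemma ip_partial_modes_modal: "ip L (partial_modes N z) (modal n w) = (if n < N then V / 2 * (z n \<bullet> w) else 0)"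
  unfolding partial_modes_def[abs_def]
  by (subst ip_sum_left) (auto simp: modal_L2 ip_modal)

lemma ip_partial_modes: "ip L (partial_modes M z) (partial_modes N w) = V / 2 * (\<Sum>m<min M N. z m \<bullet> w m)"
proof -
  have e: "partial_modes N w = (\<lambda>x. \<Sum>m<N. modal m (w m) x)"
    by (simp add: partial_modes_def[abs_def])
  have "ip L (partial_modes M z) (partial_modes N w) = (\<Sum>n<N. ip L (partial_modes M z) (modal n (w n)))"
    unfolding e by (subst ip_sum_right) (auto simp: modal_L2 partial_modes_L2)
  also have "\<dots> = (\<Sum>n\<in>{..<N} \<inter> {n. n < M}. V / 2 * (z n \<bullet> w n))"
    by (simp only: ip_partial_modes_modal sum.inter_restrict[OF finite_lessThan] mem_Collect_eq)
  also have "{..<N} \<inter> {n. n < M} = {..<min M N}" by auto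
  finally show ?thesis by (simp only: sum_distrib_left)
qed

section \<open>Expansions in modes and their L2 calculus\<close>

lemma expands_L2: "expands z f \<Longrightarrow> f \<in> L2 L"
  by (simp add: expands_def)

lemma expands_lim: "expands z f \<Longrightarrow> (\<lambda>N. l2norm L (\<lambda>x. f x - partial_modes N z x)) \<longlonglongrightarrow> 0"
  by (simp add: expands_def)

lemma expands_cong:
  assumes "expands z f" "eqae L f g" "g \<in> L2 L" shows "expands z g"
proof -
  have "l2norm L (\<lambda>x. g x - partial_modes N z x) = l2norm L (\<lambda>x. f x - partial_modes N z x)" for N
    using assms expands_L2[OF assms(1)]
    by (intro l2norm_cong eqae_diff L2_diff partial_modes_L2 eqae_refl) (auto intro: eqae_sym)
  with assms show ?thesis by (simp add: expands_def)
qed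

lemma expands_unique: "expands z f \<Longrightarrow> expands z g \<Longrightarrow> eqae L f g"
  by (rule l2_limit_unique[of f L g "\<lambda>N. partial_modes N z" sequentially])
    (auto simp: expands_def partial_modes_L2)

lemma expands_lincomb:
  assumes "expands z f" "expands w g"
  shows "expands (\<lambda>m. a *\<^sub>R z m + b *\<^sub>R w m) (\<lambda>x. a *\<^sub>R f x + b *\<^sub>R g x)"
  unfolding expands_def
proof
  note L2s = expands_L2[OF assms(1)] expands_L2[OF assms(2)]
  show "(\<lambda>x. a *\<^sub>R f x + b *\<^sub>R g x) \<in> L2 L" by (intro L2_lincomb L2s)
  let ?df = "\<lambda>N x. f x - partial_modes N z x" and ?dg = "\<lambda>N x. g x - partial_modes N w x"
  have lim: "(\<lambda>N. \<bar>a\<bar> * l2norm L (?df N) + \<bar>b\<bar> * l2norm L (?dg N)) \<longlonglongrightarrow> 0"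
    using assms by (auto intro!: tendsto_eq_intros simp: expands_def)
  show "(\<lambda>N. l2norm L (\<lambda>x. a *\<^sub>R f x + b *\<^sub>R g x - partial_modes N (\<lambda>m. a *\<^sub>R z m + b *\<^sub>R w m) x)) \<longlonglongrightarrow> 0"
  proof (rule Lim_null_comparison[OF _ lim], rule always_eventually, rule allI)
    fix N
    have "l2norm L (\<lambda>x. a *\<^sub>R ?df N x + b *\<^sub>R ?dg N x) \<le> l2norm L (\<lambda>x. a *\<^sub>R ?df N x) + l2norm L (\<lambda>x. b *\<^sub>R ?dg N x)"
      using L2s by (intro l2norm_triangle L2_scaleR L2_diff partial_modes_L2)
    moreover have "(\<lambda>x. a *\<^sub>R f x + b *\<^sub>R g x - partial_modes N (\<lambda>m. a *\<^sub>R z m + b *\<^sub>R w m) x) = (\<lambda>x. a *\<^sub>R ?df N x + b *\<^sub>R ?dg N x)"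
      by (simp add: partial_modes_lincomb algebra_simps)
    ultimately show "norm (l2norm L (\<lambda>x. a *\<^sub>R f x + b *\<^sub>R g x - partial_modes N (\<lambda>m. a *\<^sub>R z m + b *\<^sub>R w m) x))
        \<le> \<bar>a\<bar> * l2norm L (?df N) + \<bar>b\<bar> * l2norm L (?dg N)"
      by (simp only: l2norm_scaleR real_norm_def abs_of_nonneg l2norm_nonneg)
  qed
qed

lemma expands_diff: "expands z f \<Longrightarrow> expands w g \<Longrightarrow> expands (\<lambda>m. z m - w m) (\<lambda>x. f x - g x)"
  using expands_lincomb[of z f w g 1 "-1"] by simp

lemma expands_scaleR: "expands z f \<Longrightarrow> expands (\<lambda>m. a *\<^sub>R z m) (\<lambda>x. a *\<^sub>R f x)"
  using expands_lincomb[of z f z f a 0] by simp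

lemma l2norm_bounded_linear:
  assumes "bounded_linear T" shows "\<exists>K. \<forall>f\<in>L2 L. l2norm L (\<lambda>x. T (f x)) \<le> K * l2norm L f"
proof -
  obtain K where K: "K > 0" "\<And>x. norm (T x) \<le> norm x * K" using bounded_linear.pos_bounded[OF assms] by blast
  have "l2norm L (\<lambda>x. T (f x)) \<le> l2norm L (\<lambda>x. K *\<^sub>R f x)" if "f \<in> L2 L" for f
    using that K by (intro l2norm_mono L2_bounded_linear[OF assms] L2_scaleR AE_I2) (auto simp: mult.commute)
  then show ?thesis using K by (intro exI[of _ K]) (simp add: l2norm_scaleR)
qed

lemma expands_linear_map:
  assumes "expands z f" "bounded_linear T"
  shows "expands (\<lambda>m. (T (fst (z m)), T (snd (z m)))) (\<lambda>x. T (f x))"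
  unfolding expands_def
proof
  show "(\<lambda>x. T (f x)) \<in> L2 L" by (rule L2_bounded_linear[OF assms(2) expands_L2[OF assms(1)]])
  obtain K where K: "\<And>f. f \<in> L2 L \<Longrightarrow> l2norm L (\<lambda>x. T (f x)) \<le> K * l2norm L f"
    using l2norm_bounded_linear[OF assms(2)] by blast
  have lin: "linear T" using assms(2) by (rule bounded_linear.linear)
  have lim: "(\<lambda>N. K * l2norm L (\<lambda>x. f x - partial_modes N z x)) \<longlonglongrightarrow> 0"
    using expands_lim[OF assms(1)] by (auto intro!: tendsto_eq_intros)
  show "(\<lambda>N. l2norm L (\<lambda>x. T (f x) - partial_modes N (\<lambda>m. (T (fst (z m)), T (snd (z m)))) x)) \<longlonglongrightarrow> 0"
  proof (rule Lim_null_comparison[OF _ lim], rule always_eventually, rule allI)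
    fix N
    have "(\<lambda>x. T (f x) - partial_modes N (\<lambda>m. (T (fst (z m)), T (snd (z m)))) x) = (\<lambda>x. T (f x - partial_modes N z x))"
      by (simp add: partial_modes_linear_map[OF lin, symmetric] linear_diff[OF lin])
    then show "norm (l2norm L (\<lambda>x. T (f x) - partial_modes N (\<lambda>m. (T (fst (z m)), T (snd (z m)))) x))
        \<le> K * l2norm L (\<lambda>x. f x - partial_modes N z x)"
      using K[OF L2_diff[OF expands_L2[OF assms(1)] partial_modes_L2]] by simp
  qed
qed

lemma expands_ip_sums:
  assumes "expands z f" "expands w g"
  shows "(\<lambda>m. V / 2 * (z m \<bullet> w m)) sums ip L f g"
proof -
  have "(\<lambda>N. ip L (partial_modes N z) (partial_modes N w)) \<longlonglongrightarrow> ip L f g"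
    by (rule tendsto_ip) (use assms in \<open>auto simp: expands_def partial_modes_L2\<close>)
  then show ?thesis by (simp add: ip_partial_modes sums_def sum_distrib_left)
qed

lemma expands_ip_modal:
  assumes "expands z f" shows "ip L f (modal n w) = V / 2 * (z n \<bullet> w)"
proof -
  have "(\<lambda>N. ip L (partial_modes N z) (modal n w)) \<longlonglongrightarrow> ip L f (modal n w)"
    by (rule tendsto_ip_left) (use assms in \<open>auto simp: expands_def partial_modes_L2 modal_L2\<close>)
  moreover have "(\<lambda>N. ip L (partial_modes N z) (modal n w)) \<longlonglongrightarrow> V / 2 * (z n \<bullet> w)"
    by (intro tendsto_eventually eventually_sequentiallyI[of "Suc n"]) (simp add: ip_partial_modes_modal)
  ultimately show ?thesis using LIMSEQ_unique by blast
qed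

lemma expands_l2norm_sums: "expands z f \<Longrightarrow> (\<lambda>m. V / 2 * (norm (z m))\<^sup>2) sums (l2norm L f)\<^sup>2"
  using expands_ip_sums[of z f z f] by (simp add: l2norm_power2 dot_square_norm)

text \<open>By orthogonality the difference of two partial sums has as squared norm a block of the
  convergent series, so the partial sums are Cauchy. This is the source of fields known only through
  coefficients, such as derivatives in space and time.\<close>

lemma Riesz_Fischer:
  assumes "summable (\<lambda>m. (norm (z m))\<^sup>2)"
  shows "\<exists>f. expands z f"
proof -
  have key: "(l2norm L (\<lambda>x. partial_modes M z x - partial_modes N z x))\<^sup>2 = V / 2 * (\<Sum>m=N..<M. (norm (z m))\<^sup>2)"
    if "N \<le> M" for M N
  proof -
    have "(\<Sum>m<M. (norm (z m))\<^sup>2) = (\<Sum>m<N. (norm (z m))\<^sup>2) + (\<Sum>m=N..<M. (norm (z m))\<^sup>2)"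
      using that by (metis lessThan_atLeast0 sum.atLeastLessThan_concat zero_le)
    then show ?thesis
      using that by (simp add: l2norm_power2 ip_diff_self partial_modes_L2 ip_partial_modes dot_square_norm
          algebra_simps min_absorb2)
  qed
  have "\<exists>f\<in>L2 L. (\<lambda>N. l2norm L (\<lambda>x. f x - partial_modes N z x)) \<longlonglongrightarrow> 0"
  proof (rule L2_complete[of "\<lambda>N. partial_modes N z"])
    show "partial_modes N z \<in> L2 L" for N by (rule partial_modes_L2)
    fix e :: real assume e: "e > 0"
    then have "2 / V * e\<^sup>2 > 0" using V_pos by simp
    then obtain N where N: "\<And>m n. m \<ge> N \<Longrightarrow> norm (\<Sum>i=m..<n. (norm (z i))\<^sup>2) < 2 / V * e\<^sup>2"
      using assms unfolding summable_Cauchy by blast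
    have *: "l2norm L (\<lambda>x. partial_modes m z x - partial_modes n z x) < e" if "n \<le> m" "N \<le> n" for m n
    proof -
      have "V / 2 * (\<Sum>m=n..<m. (norm (z m))\<^sup>2) < V / 2 * (2 / V * e\<^sup>2)"
        using N[OF that(2), of m] V_pos by (intro mult_strict_left_mono) auto
      also have "\<dots> = e\<^sup>2" using V_pos by simp
      finally have "(l2norm L (\<lambda>x. partial_modes m z x - partial_modes n z x))\<^sup>2 < e\<^sup>2" using key[OF that(1)] by simp
      then show ?thesis using e power2_less_imp_less less_imp_le by blast
    qed
    show "\<exists>N. \<forall>m\<ge>N. \<forall>n\<ge>N. l2norm L (\<lambda>x. partial_modes m z x - partial_modes n z x) < e"
    proof (intro exI allI impI)
      fix m n assume "m \<ge> N" "n \<ge> N"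
      then show "l2norm L (\<lambda>x. partial_modes m z x - partial_modes n z x) < e"
        using *[of m n] *[of n m] l2norm_minus_commute[of L "partial_modes m z"] by (cases "n \<le> m") auto
    qed
  qed blast
  then show ?thesis by (auto simp: expands_def)
qed

text \<open>Bessel's inequality for a field of which only the pairings with the modes are known; it
  is applied to weak derivatives before any expansion of them is available.\<close>

lemma bessel:
  assumes "g \<in> L2 L" "\<And>m w. ip L g (modal m w) = V / 2 * (c m \<bullet> w)"
  shows "summable (\<lambda>m. (norm (c m))\<^sup>2)"
proof (rule bounded_imp_summable)
  fix N
  have "ip L g (partial_modes (Suc N) c) = V / 2 * (\<Sum>m<Suc N. (norm (c m))\<^sup>2)"
    unfolding partial_modes_def[abs_def] sum_distrib_left
    by (subst ip_sum_right) (auto simp: assms modal_L2 dot_square_norm)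
  then have "0 \<le> (l2norm L g)\<^sup>2 - V / 2 * (\<Sum>m<Suc N. (norm (c m))\<^sup>2)"
    using ip_self_nonneg[of L "\<lambda>x. g x - partial_modes (Suc N) c x"] assms(1)
    by (simp add: ip_diff_self partial_modes_L2 l2norm_power2 ip_partial_modes dot_square_norm)
  then show "(\<Sum>m\<le>N. (norm (c m))\<^sup>2) \<le> 2 / V * (l2norm L g)\<^sup>2"
    using V_pos by (simp add: lessThan_Suc_atMost field_simps)
qed simp

section \<open>Derivatives and Sobolev norms in terms of coefficients\<close>

lemma norm_dz: "(norm (dz j m z))\<^sup>2 = (p m)\<^sup>2 * (\<kappa> $ j)\<^sup>2 * (norm z)\<^sup>2"
proof -
  have "(norm (snd z, - fst z))\<^sup>2 = (norm z)\<^sup>2" by (simp add: norm_prod_def)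
  then show ?thesis unfolding dz_def norm_scaleR by (simp add: power_mult_distrib)
qed

lemma dz_inner: "dz j m z \<bullet> w = - (z \<bullet> dz j m w)"
  by (simp add: dz_def inner_prod_def inner_commute algebra_simps)

lemma dz_dz: "dz i m (dz j m z) = - ((p m)\<^sup>2 * \<kappa> $ i * \<kappa> $ j) *\<^sub>R z"
  by (simp add: dz_def power2_eq_square prod_eq_iff)

lemma sum_\<kappa>_square: "(\<Sum>j\<in>UNIV. (\<kappa> $ j)\<^sup>2) = \<kappa> \<bullet> \<kappa>"
  by (simp add: inner_vec_def power2_eq_square)

lemma sum_norm_dz: "(\<Sum>j\<in>UNIV. (norm (dz j m z))\<^sup>2) = q m * (norm z)\<^sup>2"
  unfolding norm_dz by (simp add: sum_\<kappa>_square q_def sum_distrib_left[symmetric] sum_distrib_right[symmetric])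

lemma expands_weak_partial:
  assumes "expands z f" "expands (\<lambda>m. dz j m (z m)) g"
  shows "is_weak_partial L j f g"
  by (rule is_weak_partial_limit[where f="\<lambda>N. partial_modes N z" and h="\<lambda>N. partial_modes N (\<lambda>m. dz j m (z m))"])
    (use assms sfield_weak_partial[OF L_pos partial_modes_sfield] in
      \<open>auto simp: expands_def partial_modes_L2 fpart_partial_modes\<close>)

lemma summable_dz:
  assumes "summable (\<lambda>m. q m * (norm (z m))\<^sup>2)" shows "summable (\<lambda>m. (norm (dz j m (z m)))\<^sup>2)"
proof (rule summable_comparison_test'[OF assms])
  fix m
  have "(norm (dz j m (z m)))\<^sup>2 \<le> (\<Sum>j\<in>UNIV. (norm (dz j m (z m)))\<^sup>2)" by (rule member_le_sum) auto
  then show "norm ((norm (dz j m (z m)))\<^sup>2) \<le> q m * (norm (z m))\<^sup>2" by (simp add: sum_norm_dz)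
qed

text \<open>The termwise derivative series converges by Riesz-Fischer, and closedness of weak
  differentiation identifies its sum. As \<open>wpartial\<close> is a choice, the expansion is
  carried over to it by uniqueness up to null sets.\<close>

lemma expands_H1:
  assumes "expands z f" "summable (\<lambda>m. q m * (norm (z m))\<^sup>2)"
  shows "f \<in> H1 L" and expands_wpartial: "expands (\<lambda>m. dz j m (z m)) (wpartial L j f)"
proof -
  have ex: "\<exists>g. expands (\<lambda>m. dz j m (z m)) g" for j
    by (intro Riesz_Fischer summable_dz assms)
  then show f: "f \<in> H1 L"
    unfolding H1_def using expands_L2 expands_weak_partial[OF assms(1)] assms(1) by blast
  obtain g where g: "expands (\<lambda>m. dz j m (z m)) g" using ex by blast
  then have "eqae L (wpartial L j f) g"
    using expands_L2 expands_weak_partial[OF assms(1) g] assms(1) by (intro wpartial_eqae)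
  then show "expands (\<lambda>m. dz j m (z m)) (wpartial L j f)"
    using g f by (intro expands_cong[OF g] wpartial_L2) (auto intro: eqae_sym)
qed

text \<open>Testing the weak derivative with modes shows that its coefficients are
  \<open>dz j m (z m)\<close>; Bessel's inequality makes them square summable for each
  direction.\<close>

lemma H1_expands_summable:
  assumes "expands z f" "f \<in> H1 L" shows "summable (\<lambda>m. q m * (norm (z m))\<^sup>2)"
proof -
  have "summable (\<lambda>m. (norm (dz j m (z m)))\<^sup>2)" for j
    by (rule bessel[OF wpartial_L2[OF assms(2), of j]])
      (simp add: ip_wpartial[OF assms(2) modal_sfield] fpart_modal expands_ip_modal[OF assms(1)] dz_inner)
  then have "summable (\<lambda>m. \<Sum>j\<in>UNIV. (norm (dz j m (z m)))\<^sup>2)" by (intro summable_sum)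
  then show ?thesis by (simp add: sum_norm_dz)
qed

lemma gip_sums:
  assumes "expands z f" "summable (\<lambda>m. q m * (norm (z m))\<^sup>2)" "expands w g" "summable (\<lambda>m. q m * (norm (w m))\<^sup>2)"
  shows "(\<lambda>m. V / 2 * q m * (z m \<bullet> w m)) sums gip L f g"
proof -
  have "(\<lambda>m. \<Sum>j\<in>UNIV. V / 2 * (dz j m (z m) \<bullet> dz j m (w m))) sums gip L f g"
    unfolding gip_def by (intro sums_sum expands_ip_sums expands_wpartial assms)
  moreover have "(\<Sum>j\<in>UNIV. V / 2 * (dz j m (z m) \<bullet> dz j m (w m))) = V / 2 * q m * (z m \<bullet> w m)" for m
  proof -
    have "dz j m (z m) \<bullet> dz j m (w m) = (p m)\<^sup>2 * (\<kappa> $ j)\<^sup>2 * (z m \<bullet> w m)" for j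
      unfolding dz_inner dz_dz by (simp add: power2_eq_square)
    then show ?thesis by (simp add: q_def sum_\<kappa>_square[symmetric] sum_distrib_left sum_distrib_right algebra_simps)
  qed
  ultimately show ?thesis by (simp only:)
qed

lemma gnorm_sums:
  assumes "expands z f" "summable (\<lambda>m. q m * (norm (z m))\<^sup>2)"
  shows "(\<lambda>m. V / 2 * (q m * (norm (z m))\<^sup>2)) sums (gnorm L f)\<^sup>2"
  using gip_sums[OF assms assms] by (simp add: gnorm_power2 dot_square_norm mult.assoc)

lemma partial_modes_expands: "expands (\<lambda>m. if m < N then z m else 0) (partial_modes N z)"
proof -
  have "partial_modes M (\<lambda>m. if m < N then z m else 0) = partial_modes N z" if "M \<ge> N" for M
  proof (rule ext)
    fix x
    have "(\<Sum>m<N. modal m (if m < N then z m else 0) x) = (\<Sum>m<M. modal m (if m < N then z m else 0) x)"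
      using that by (intro sum.mono_neutral_left) (auto simp: modal_0)
    then show "partial_modes M (\<lambda>m. if m < N then z m else 0) x = partial_modes N z x"
      by (simp add: partial_modes_def)
  qed
  then show ?thesis
    unfolding expands_def
    by (intro conjI partial_modes_L2 tendsto_eventually eventually_sequentiallyI[of N]) simp
qed

lemma h1norm_sums:
  assumes "expands z f" "summable (\<lambda>m. q m * (norm (z m))\<^sup>2)"
  shows "(\<lambda>m. V / 2 * ((1 + q m) * (norm (z m))\<^sup>2)) sums (h1norm L f)\<^sup>2"
  using sums_add[OF expands_l2norm_sums[OF assms(1)] gnorm_sums[OF assms]]
  by (simp add: h1norm_power2 algebra_simps)

text \<open>The eigenvalues are bounded below by \<open>\<kappa> \<bullet> \<kappa>\<close>: the
  Poincare inequality on coefficients.\<close>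

lemma summable_q:
  assumes "summable (\<lambda>m. q m * r m)" "\<And>m. 0 \<le> r m" shows "summable r"
proof (rule summable_comparison_test'[OF summable_mult[OF assms(1), of "1 / (\<kappa> \<bullet> \<kappa>)"]])
  fix m
  have "1 * r m \<le> (p m)\<^sup>2 * r m" using p_ge_1[of m] assms(2) by (intro mult_right_mono) auto
  then show "norm (r m) \<le> 1 / (\<kappa> \<bullet> \<kappa>) * (q m * r m)"
    using \<kappa>_pos assms(2)[of m] by (simp add: q_def)
qed

text \<open>The squared H1 error of a partial sum is a tail of the convergent series in
  \<open>h1norm_sums\<close>.\<close>

lemma partial_modes_h1:
  assumes "expands z f" "summable (\<lambda>m. q m * (norm (z m))\<^sup>2)"
  shows "(\<lambda>N. h1norm L (\<lambda>x. f x - partial_modes N z x)) \<longlonglongrightarrow> 0"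
proof -
  let ?t = "\<lambda>m. V / 2 * ((1 + q m) * (norm (z m))\<^sup>2)"
  have eq: "(h1norm L (\<lambda>x. f x - partial_modes N z x))\<^sup>2 = (\<Sum>m. ?t (m + N))" for N
  proof -
    let ?w = "\<lambda>m. z m - (if m < N then z m else 0)"
    have "summable (\<lambda>m. q m * (norm (?w m))\<^sup>2)"
      by (rule summable_comparison_test'[OF assms(2)]) (auto simp: q_nonneg)
    from h1norm_sums[OF expands_diff[OF assms(1) partial_modes_expands] this]
    have s: "(\<lambda>m. V / 2 * ((1 + q m) * (norm (?w m))\<^sup>2)) sums (h1norm L (\<lambda>x. f x - partial_modes N z x))\<^sup>2" .
    have "(\<lambda>m. V / 2 * ((1 + q (m + N)) * (norm (?w (m + N)))\<^sup>2)) sums ((h1norm L (\<lambda>x. f x - partial_modes N z x))\<^sup>2 -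
       (\<Sum>m<N. V / 2 * ((1 + q m) * (norm (?w m))\<^sup>2)))"
      by (rule sums_split_initial_segment[OF s])
    then have "(\<lambda>m. ?t (m + N)) sums (h1norm L (\<lambda>x. f x - partial_modes N z x))\<^sup>2" by simp
    then show ?thesis by (simp add: sums_iff)
  qed
  have "(\<lambda>N. \<Sum>m. ?t (m + N)) \<longlonglongrightarrow> 0"
    using h1norm_sums[OF assms] by (intro suminf_exist_split2) (simp add: sums_iff)
  then have "(\<lambda>N. sqrt ((h1norm L (\<lambda>x. f x - partial_modes N z x))\<^sup>2)) \<longlonglongrightarrow> sqrt 0"
    unfolding eq by (intro tendsto_real_sqrt)
  then show ?thesis by simp
qed

end

context torus3_mode
begin

subsection \<open>Fourier coefficients\<close>

text \<open>\<open>CC z\<close> are the complex Fourier coefficients of the field with real modes \<open>z\<close>.\<close>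

definition CC :: "(nat \<Rightarrow> (real ^ 3) \<times> (real ^ 3)) \<Rightarrow> int ^ 3 \<Rightarrow> complex ^ 3" where
  "CC z r = (if r \<in> range kk then (\<chi> j. Complex (fst (z (inv kk r)) $ j / 2) (- (snd (z (inv kk r)) $ j / 2)))
    else if - r \<in> range kk then (\<chi> j. Complex (fst (z (inv kk (- r))) $ j / 2) (snd (z (inv kk (- r))) $ j / 2))
    else 0)"

lemma inv_kk: "inv kk (kk m) = m"
  by (rule inv_f_f) (simp add: inj_def kk_inj)

lemma CC_kk: "CC z (kk m) = (\<chi> j. Complex (fst (z m) $ j / 2) (- (snd (z m) $ j / 2)))"
  by (simp add: CC_def inv_kk)

lemma CC_uminus_kk: "CC z (- kk m) = (\<chi> j. Complex (fst (z m) $ j / 2) (snd (z m) $ j / 2))"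
proof -
  have "- kk m \<notin> range kk" using kk_neq_uminus by auto
  then show ?thesis by (simp add: CC_def inv_kk)
qed

lemma CC_other: "r \<notin> range kk \<Longrightarrow> - r \<notin> range kk \<Longrightarrow> CC z r = 0"
  by (simp add: CC_def)

lemma CC_cases:
  obtains m where "r = kk m" | m where "r = - kk m" | "r \<notin> range kk" "- r \<notin> range kk"
proof (cases "r \<in> range kk \<or> - r \<in> range kk")
  case True
  then show ?thesis using that(1,2) by (metis minus_minus rangeE)
next
  case False
  then show ?thesis using that(3) by auto
qed

lemma cvec_modal: "cvec (modal m (z m) x) =
    cis (wave L (kk m) \<bullet> x) *s CC z (kk m) + cis (wave L (- kk m) \<bullet> x) *s CC z (- kk m)"
  by (simp add: vec_eq_iff complex_eq_iff cvec_def modal_def CC_kk CC_uminus_kk wave_uminus algebra_simps)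

definition modes :: "nat \<Rightarrow> (int ^ 3) set" where
  "modes N = kk ` {..<N} \<union> (\<lambda>m. - kk m) ` {..<N}"

lemma finite_modes: "finite (modes N)"
  by (simp add: modes_def)

lemma modes_mono: "M \<le> N \<Longrightarrow> modes M \<subseteq> modes N"
  by (force simp: modes_def)

lemma zero_notin_modes: "0 \<notin> modes N"
  using kk_nonzero by (force simp: modes_def)

lemma sum_modes: "(\<Sum>r\<in>modes N. g r) = (\<Sum>m<N. g (kk m) + g (- kk m))"
  for g :: "int ^ 3 \<Rightarrow> 'a::comm_monoid_add"
proof -
  have "(\<Sum>r\<in>modes N. g r) = (\<Sum>r\<in>kk ` {..<N}. g r) + (\<Sum>r\<in>(\<lambda>m. - kk m) ` {..<N}. g r)"
    unfolding modes_def by (rule sum.union_disjoint) (use kk_neq_uminus in auto)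
  then show ?thesis by (simp add: sum.reindex inj_on_def kk_inj sum.distrib)
qed

lemma cvec_add: "cvec (x + y) = cvec x + cvec y"
  and cvec_diff: "cvec (x - y) = cvec x - cvec y"
  and cvec_0: "cvec 0 = 0"
  by (simp_all add: cvec_def vec_eq_iff)

lemma cvec_sum: "cvec (\<Sum>i\<in>I. f i) = (\<Sum>i\<in>I. cvec (f i))"
  by (induction I rule: infinite_finite_induct) (auto simp: cvec_add cvec_0)

lemma norm_cvec: "norm (cvec x) = norm x"
  by (simp add: norm_vec_def L2_set_def cvec_def)

lemma cvec_partial_modes: "cvec (partial_modes N z x) = trig_sum L (modes N) (CC z) x"
  by (simp add: partial_modes_def cvec_sum cvec_modal trig_sum_def sum_modes)

lemma perp_X:
  assumes "perp (z m)" shows "CC z (kk m) \<in> X L (kk m)" "CC z (- kk m) \<in> X L (- kk m)"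
proof -
  have s: "(\<Sum>j\<in>UNIV. fst (z m) $ j * \<kappa> $ j) = 0" "(\<Sum>j\<in>UNIV. snd (z m) $ j * \<kappa> $ j) = 0"
    using assms by (simp_all add: perp_def inner_vec_def)
  have "(\<Sum>j\<in>UNIV. (fst (z m) $ j / 2) * (p m * \<kappa> $ j)) = p m / 2 * (\<Sum>j\<in>UNIV. fst (z m) $ j * \<kappa> $ j)"
    "(\<Sum>j\<in>UNIV. (snd (z m) $ j / 2) * (p m * \<kappa> $ j)) = p m / 2 * (\<Sum>j\<in>UNIV. snd (z m) $ j * \<kappa> $ j)"
    by (simp_all add: sum_distrib_left algebra_simps)
  then have t: "(\<Sum>j\<in>UNIV. (fst (z m) $ j / 2) * (p m * \<kappa> $ j)) = 0"
    "(\<Sum>j\<in>UNIV. (snd (z m) $ j / 2) * (p m * \<kappa> $ j)) = 0" using s by simp_all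
  show "CC z (kk m) \<in> X L (kk m)" "CC z (- kk m) \<in> X L (- kk m)"
    using t by (simp_all add: X_def CC_kk CC_uminus_kk wave_uminus wave_kk complex_eq_iff sum_negf)
qed

lemma partial_modes_trig:
  assumes "\<And>m. m < N \<Longrightarrow> perp (z m)" shows "partial_modes N z \<in> trig_fields L"
proof -
  \<comment> \<open>The coefficients beyond \<open>N\<close> are replaced by zero, because
    \<open>trig_fields\<close> asks for coefficients that vanish off the finite index set.\<close>
  define w where "w m = (if m < N then z m else 0)" for m
  have pe: "partial_modes N z = partial_modes N w"
    by (rule ext) (simp add: partial_modes_def w_def)
  show ?thesis
    unfolding trig_fields_def
  proof (intro CollectI exI conjI allI ballI impI)
    show "finite (modes N)" "0 \<notin> modes N" by (rule finite_modes zero_notin_modes)+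
    show "CC w r = 0" if "r \<notin> modes N" for r
    proof (cases r rule: CC_cases)
      case (1 m)
      then have "\<not> m < N" using that by (auto simp: modes_def)
      then show ?thesis unfolding 1 CC_kk by (simp add: w_def vec_eq_iff complex_eq_iff)
    next
      case (2 m)
      then have "\<not> m < N" using that by (auto simp: modes_def)
      then show ?thesis unfolding 2 CC_uminus_kk by (simp add: w_def vec_eq_iff complex_eq_iff)
    qed (simp add: CC_other)
    show "CC w r \<in> X L r" if "r \<in> modes N" for r
    proof -
      have "perp (w m)" for m using assms by (simp add: w_def perp_def)
      with that perp_X[of w] show ?thesis by (auto simp: modes_def)
    qed
    show "CC w (- r) $ j = cnj (CC w r $ j)" for r j
    proof (cases r rule: CC_cases)
      case 3
      then show ?thesis by (simp add: CC_other)
    qed (simp_all add: CC_kk CC_uminus_kk complex_eq_iff)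
    show "cvec (partial_modes N z x) = trig_sum L (modes N) (CC w) x" for x
      unfolding pe by (rule cvec_partial_modes)
  qed
qed

lemma expands_HH:
  assumes "expands z f" "\<And>m. perp (z m)" shows "f \<in> HH L"
  using assms by (intro HH_limit[of f L "\<lambda>N. partial_modes N z"]) (auto simp: expands_def intro!: trig_fields_HH partial_modes_trig)

lemma modal_HH: "perp z \<Longrightarrow> modal m z \<in> HH L"
proof -
  assume "perp z"
  then have "partial_modes (Suc m) (\<lambda>n. if n = m then z else 0) \<in> trig_fields L"
    by (intro partial_modes_trig) (auto simp: perp_def)
  moreover have "partial_modes (Suc m) (\<lambda>n. if n = m then z else 0) = modal m z"
    by (rule ext) (simp add: partial_modes_def modal_0)
  ultimately show "modal m z \<in> HH L" by (simp add: trig_fields_HH)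
qed

text \<open>Gradients of scalar waves with frequency \<open>kk m\<close> are modes whose coefficient
  vectors are multiples of \<open>\<kappa>\<close>. Orthogonality to the two basic ones removes the
  \<open>\<kappa>\<close> components of \<open>z m\<close>.\<close>

lemma HH_expands_perp:
  assumes "expands z f" "f \<in> HH L" shows "perp (z m)"
proof -
  have g: "(\<lambda>x. \<chi> j. partial j (\<lambda>x. a * cos (wave L (kk m) \<bullet> x) + b * sin (wave L (kk m) \<bullet> x)) x)
      = modal m (p m *\<^sub>R (b *\<^sub>R \<kappa>, - a *\<^sub>R \<kappa>))" for a b
    unfolding partial_trig by (rule ext) (simp add: vec_eq_iff modal_def wave_kk algebra_simps)
  have "V / 2 * (z m \<bullet> (p m *\<^sub>R (b *\<^sub>R \<kappa>, - a *\<^sub>R \<kappa>))) = 0" for a b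
    using HH_orthogonal_gradient[OF assms(2) smooth_trig periodic_wave_trig, of a "kk m" b]
    unfolding g expands_ip_modal[OF assms(1)] .
  from this[of 1 0] this[of 0 1] show ?thesis
    using V_pos p_pos[of m] by (simp_all add: perp_def inner_prod_def)
qed

lemma expands_VV:
  assumes "expands z f" "summable (\<lambda>m. q m * (norm (z m))\<^sup>2)" "\<And>m. perp (z m)"
  shows "f \<in> VV L"
  unfolding VV_def
proof (intro CollectI conjI allI impI)
  show "f \<in> H1 L" by (rule expands_H1[OF assms(1,2)])
  fix e :: real assume "e > 0"
  then obtain N where "h1norm L (\<lambda>x. f x - partial_modes N z x) < e"
    using LIMSEQ_D[OF partial_modes_h1[OF assms(1,2)]] by fastforce
  then show "\<exists>v\<in>trig_fields L. h1norm L (f - v) < e"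
    using partial_modes_trig[of N z] assms(3) by (intro bexI[of _ "partial_modes N z"]) (auto simp: fun_diff_def)
qed

text \<open>The complex vector integral is reduced to real pairings in \<open>ip\<close>, to which
  the L2 limit lemmas apply.\<close>

lemma fcoef_component:
  assumes "f \<in> L2 L"
  shows "fcoef L f r $ i = Complex (1 / V * ip L f (\<lambda>x. cos (wave L r \<bullet> x) *\<^sub>R axis i 1))
    (- 1 / V * ip L f (\<lambda>x. sin (wave L r \<bullet> x) *\<^sub>R axis i 1))"
proof -
  have c: "smooth (\<lambda>x. cos (wave L r \<bullet> x))" and s: "smooth (\<lambda>x. sin (wave L r \<bullet> x))"
    using smooth_trig[of 1 "wave L r" 0] smooth_trig[of 0 "wave L r" 1] by simp_all
  let ?F = "\<lambda>x. cis (- (wave L r \<bullet> x)) *s cvec (f x)"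
  have comp: "?F x $ i = of_real ((cos (wave L r \<bullet> x) *\<^sub>R f x) \<bullet> axis i 1) + (- \<i>) * of_real ((sin (wave L r \<bullet> x) *\<^sub>R f x) \<bullet> axis i 1)" for x i
    by (simp add: cvec_def complex_eq_iff inner_axis)
  have ic: "integrable (torus L) (\<lambda>x. (cos (wave L r \<bullet> x) *\<^sub>R f x) \<bullet> axis i 1)"
    and si: "integrable (torus L) (\<lambda>x. (sin (wave L r \<bullet> x) *\<^sub>R f x) \<bullet> axis i 1)" for i
    by (intro integrable_inner_left integrable_scalar_field assms c s)+
  have int_i: "integrable (torus L) (\<lambda>x. ?F x $ i)" for i
    unfolding comp by (intro Bochner_Integration.integrable_add integrable_mult_right integrable_of_real ic si)
  have "integrable (torus L) (\<lambda>x. \<Sum>i\<in>UNIV. axis i (?F x $ i))"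
  proof (intro Bochner_Integration.integrable_sum)
    fix i
    have bl: "bounded_linear (axis i :: complex \<Rightarrow> complex ^ 3)"
      by (rule linear_conv_bounded_linear[THEN iffD1], rule linearI) (auto simp: axis_def vec_eq_iff)
    show "integrable (torus L) (\<lambda>x. axis i (?F x $ i))"
      by (rule integrable_bounded_linear[OF bl int_i])
  qed
  moreover have "(\<Sum>i\<in>UNIV. axis i (v $ i)) = v" for v :: "complex ^ 3"
    by (simp add: vec_eq_iff axis_def sum.delta cong: if_cong)
  ultimately have int: "integrable (torus L) ?F" by (simp only:)
  have "(LINT x|torus L. ?F x) $ i = (LINT x|torus L. ?F x $ i)"
    by (rule integral_bounded_linear[OF bounded_linear_vec_nth int, symmetric])
  also have "\<dots> = of_real (LINT x|torus L. (cos (wave L r \<bullet> x) *\<^sub>R f x) \<bullet> axis i 1)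
      + (- \<i>) * of_real (LINT x|torus L. (sin (wave L r \<bullet> x) *\<^sub>R f x) \<bullet> axis i 1)"
    unfolding comp
    by (subst Bochner_Integration.integral_add)
      (auto intro!: integrable_mult_right integrable_of_real ic si simp del: inner_scaleR_left)
  finally show ?thesis
    by (simp add: fcoef_def V_def ip_def complex_eq_iff inner_axis mult.commute)
qed

lemma ip_modal_wave:
  "ip L (modal m z) (\<lambda>x. cos (wave L r \<bullet> x) *\<^sub>R axis i 1) = V / 2 * fst z $ i * (of_bool (kk m = r) + of_bool (kk m = - r))"
  "ip L (modal m z) (\<lambda>x. sin (wave L r \<bullet> x) *\<^sub>R axis i 1) = V / 2 * snd z $ i * (of_bool (kk m = r) - of_bool (kk m = - r))"
proof -
  let ?c = "\<lambda>x. cos (wave L (kk m) \<bullet> x)" and ?s = "\<lambda>x. sin (wave L (kk m) \<bullet> x)"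
  have "ip L (modal m z) (\<lambda>x. cos (wave L r \<bullet> x) *\<^sub>R axis i 1) =
      (LINT x|torus L. fst z $ i * (?c x * cos (wave L r \<bullet> x)) + snd z $ i * (?s x * cos (wave L r \<bullet> x)))"
    unfolding ip_scalar modal_def by (intro Bochner_Integration.integral_cong refl) (simp add: algebra_simps)
  also have "\<dots> = V / 2 * fst z $ i * (of_bool (kk m = r) + of_bool (kk m = - r))"
    by (simp add: Bochner_Integration.integral_add integrable_trig integral_cos_cos integral_sin_cos)
  finally show "ip L (modal m z) (\<lambda>x. cos (wave L r \<bullet> x) *\<^sub>R axis i 1) = V / 2 * fst z $ i * (of_bool (kk m = r) + of_bool (kk m = - r))" .
  have "ip L (modal m z) (\<lambda>x. sin (wave L r \<bullet> x) *\<^sub>R axis i 1) =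
      (LINT x|torus L. fst z $ i * (?c x * sin (wave L r \<bullet> x)) + snd z $ i * (?s x * sin (wave L r \<bullet> x)))"
    unfolding ip_scalar modal_def by (intro Bochner_Integration.integral_cong refl) (simp add: algebra_simps)
  also have "\<dots> = V / 2 * snd z $ i * (of_bool (kk m = r) - of_bool (kk m = - r))"
    by (simp add: Bochner_Integration.integral_add integrable_trig integral_sin_sin integral_cos_sin)
  finally show "ip L (modal m z) (\<lambda>x. sin (wave L r \<bullet> x) *\<^sub>R axis i 1) = V / 2 * snd z $ i * (of_bool (kk m = r) - of_bool (kk m = - r))" .
qed

lemma sum_of_bool_eq: "(\<Sum>m<N. a m * of_bool (m = n)) = (if n < N then a n else 0)" for a :: "nat \<Rightarrow> real"
  by (simp add: of_bool_def if_distrib sum.delta cong: if_cong)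

text \<open>The pairings of the partial sums with a fixed wave are constant from some index on, so
  the coefficient of the limit is read off from a single partial sum.\<close>

lemma fcoef_expands:
  assumes "expands z f" shows "fcoef L f r = CC z r"
proof -
  let ?w = "\<lambda>i x. cos (wave L r \<bullet> x) *\<^sub>R axis i 1" and ?v = "\<lambda>i x. sin (wave L r \<bullet> x) *\<^sub>R axis i 1"
  have L2s: "?w i \<in> L2 L" "?v i \<in> L2 L" for i :: 3
    using smooth_trig[of 1 "wave L r" 0] smooth_trig[of 0 "wave L r" 1]
      periodic_wave_trig[of L 1 r 0] periodic_wave_trig[of L 0 r 1]
    by (auto intro!: sfield_L2 sfield_scalar)
  have lim: "(\<lambda>N. ip L (partial_modes N z) w) \<longlonglongrightarrow> ip L f w" if "w \<in> L2 L" for w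
    by (rule tendsto_ip_left) (use assms that in \<open>auto simp: expands_def partial_modes_L2\<close>)
  have eqw: "ip L (partial_modes N z) (?w i) = (\<Sum>m<N. V / 2 * fst (z m) $ i * (of_bool (kk m = r) + of_bool (kk m = - r)))" for N i
    unfolding partial_modes_def[abs_def] by (subst ip_sum_left) (simp_all add: modal_L2 L2s ip_modal_wave)
  have eqv: "ip L (partial_modes N z) (?v i) = (\<Sum>m<N. V / 2 * snd (z m) $ i * (of_bool (kk m = r) - of_bool (kk m = - r)))" for N i
    unfolding partial_modes_def[abs_def] by (subst ip_sum_left) (simp_all add: modal_L2 L2s ip_modal_wave)
  have C: "ip L f (?w i) = c \<and> ip L f (?v i) = s"
    if "\<And>N. N > M \<Longrightarrow> ip L (partial_modes N z) (?w i) = c" "\<And>N. N > M \<Longrightarrow> ip L (partial_modes N z) (?v i) = s" for c s M i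
  proof -
    have "(\<lambda>N. ip L (partial_modes N z) (?w i)) \<longlonglongrightarrow> c" "(\<lambda>N. ip L (partial_modes N z) (?v i)) \<longlonglongrightarrow> s"
      using that by (auto intro!: tendsto_eventually eventually_sequentiallyI[of "Suc M"])
    with lim[OF L2s(1)] lim[OF L2s(2)] show ?thesis using LIMSEQ_unique by blast
  qed
  show ?thesis
  proof (cases r rule: CC_cases)
    case (1 m)
    have "ip L f (?w i) = V / 2 * fst (z m) $ i \<and> ip L f (?v i) = V / 2 * snd (z m) $ i" for i
      by (rule C[of m]; unfold eqw eqv; unfold 1;
          simp only: kk_inj kk_neq_uminus of_bool_eq add_0_right diff_0_right sum_of_bool_eq if_True)
    then show ?thesis
      using V_pos fcoef_component[OF expands_L2[OF assms]] by (simp add: vec_eq_iff 1 CC_kk)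
  next
    case (2 m)
    have "ip L f (?w i) = V / 2 * fst (z m) $ i \<and> ip L f (?v i) = - (V / 2 * snd (z m) $ i)" for i
      by (rule C[of m]; unfold eqw eqv; unfold 2;
          simp only: kk_inj kk_neq_uminus minus_minus of_bool_eq add_0_left diff_0 mult_minus_right sum_negf
            sum_of_bool_eq if_True)
    then show ?thesis
      using V_pos fcoef_component[OF expands_L2[OF assms]] by (simp add: vec_eq_iff 2 CC_uminus_kk)
  next
    case 3
    then have "kk m \<noteq> r" "kk m \<noteq> - r" for m by (metis rangeI minus_minus)+
    then have "ip L f (?w i) = 0 \<and> ip L f (?v i) = 0" for i
      by (intro C) (simp_all add: eqw eqv)
    then show ?thesis
      using fcoef_component[OF expands_L2[OF assms]] 3 by (simp add: vec_eq_iff CC_other complex_eq_iff)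
  qed
qed

lemma integrable_trig_sum_diff:
  assumes "f \<in> L2 L"
  shows "integrable (torus L) (\<lambda>x. (norm (cvec (f x) - trig_sum L F c x))\<^sup>2)"
proof -
  have m: "f \<in> borel_measurable (torus L)" using L2_measurable_torus[OF assms] .
  have cc: "continuous_on UNIV cvec" unfolding cvec_def[abs_def] by (intro continuous_intros)
  have [measurable]: "(\<lambda>x. cvec (f x)) \<in> borel_measurable (torus L)"
    by (rule measurable_compose[OF m borel_measurable_continuous_onI[OF cc]])
  have [measurable]: "trig_sum L F c \<in> borel_measurable (torus L)"
    by (intro measurable_torus borel_measurable_continuous_onI continuous_on_trig_sum)
  have "compact (trig_sum L F c ` cbox 0 L)"
    by (intro compact_continuous_image continuous_on_subset[OF continuous_on_trig_sum]) auto
  then obtain B where B: "\<And>x. x \<in> cbox 0 L \<Longrightarrow> norm (trig_sum L F c x) \<le> B"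
    by (meson bounded_iff compact_imp_bounded imageI)
  have "integrable (torus L) (\<lambda>x. 2 * (norm (f x))\<^sup>2 + 2 * B\<^sup>2)"
    by (intro Bochner_Integration.integrable_add integrable_mult_right L2_integrable assms) simp
  then show ?thesis
  proof (rule Bochner_Integration.integrable_bound)
    show "AE x in torus L. norm ((norm (cvec (f x) - trig_sum L F c x))\<^sup>2) \<le> norm (2 * (norm (f x))\<^sup>2 + 2 * B\<^sup>2)"
    proof (rule AE_I2)
      fix x assume "x \<in> space (torus L)"
      then have "norm (trig_sum L F c x) \<le> B" using B by simp
      then have "norm (cvec (f x) - trig_sum L F c x) \<le> norm (f x) + B"
        using norm_triangle_ineq4[of "cvec (f x)" "trig_sum L F c x"] by (simp add: norm_cvec)
      then have "(norm (cvec (f x) - trig_sum L F c x))\<^sup>2 \<le> (norm (f x) + B)\<^sup>2" by (intro power_mono) auto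
      also have "\<dots> \<le> 2 * (norm (f x))\<^sup>2 + 2 * B\<^sup>2"
        using sum_squares_bound[of "norm (f x)" B] by (simp add: power2_sum)
      finally show "norm ((norm (cvec (f x) - trig_sum L F c x))\<^sup>2) \<le> norm (2 * (norm (f x))\<^sup>2 + 2 * B\<^sup>2)" by simp
    qed
  qed measurable
qed

text \<open>Two fields with the same approximating sums agree. The comparison passes through the
  complexified fields, because a sum over a finite set of frequencies that is not symmetric need not
  be real.\<close>

lemma has_fourier_series_unique:
  assumes "has_fourier_series L K c f" "has_fourier_series L K c g"
  shows "eqae L f g"
proof -
  have fg: "f \<in> L2 L" "g \<in> L2 L" using assms by (auto simp: has_fourier_series_def)
  let ?I = "\<lambda>f F. LINT x|torus L. (norm (cvec (f x) - trig_sum L F c x))\<^sup>2"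
  have lim: "((\<lambda>F. 2 * (sqrt (?I f F))\<^sup>2 + 2 * (sqrt (?I g F))\<^sup>2) \<longlongrightarrow> 2 * 0\<^sup>2 + 2 * 0\<^sup>2) (finite_subsets_at_top K)"
    using assms by (intro tendsto_intros) (auto simp: has_fourier_series_def)
  have "(l2norm L (\<lambda>x. f x - g x))\<^sup>2 \<le> 2 * 0\<^sup>2 + 2 * 0\<^sup>2"
  proof (rule tendsto_lowerbound[OF lim], rule always_eventually, rule allI)
    fix F
    have "(l2norm L (\<lambda>x. f x - g x))\<^sup>2 = (LINT x|torus L. (norm (f x - g x))\<^sup>2)"
      by (simp add: l2norm_power2 ip_def dot_square_norm)
    also have "\<dots> \<le> (LINT x|torus L. 2 * (norm (cvec (f x) - trig_sum L F c x))\<^sup>2 + 2 * (norm (cvec (g x) - trig_sum L F c x))\<^sup>2)"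
    proof (rule integral_mono)
      show "integrable (torus L) (\<lambda>x. (norm (f x - g x))\<^sup>2)"
        using fg by (intro L2_integrable L2_diff)
      show "integrable (torus L) (\<lambda>x. 2 * (norm (cvec (f x) - trig_sum L F c x))\<^sup>2 + 2 * (norm (cvec (g x) - trig_sum L F c x))\<^sup>2)"
        using fg by (intro Bochner_Integration.integrable_add integrable_mult_right integrable_trig_sum_diff)
      fix x
      let ?a = "cvec (f x) - trig_sum L F c x" and ?b = "cvec (g x) - trig_sum L F c x"
      have "norm (f x - g x) = norm (?a - ?b)" by (simp add: norm_cvec[symmetric] cvec_diff)
      then have "(norm (f x - g x))\<^sup>2 \<le> (norm ?a + norm ?b)\<^sup>2" using norm_triangle_ineq4[of ?a ?b] by (intro power_mono) auto
      also have "\<dots> \<le> 2 * (norm ?a)\<^sup>2 + 2 * (norm ?b)\<^sup>2"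
        using sum_squares_bound[of "norm ?a" "norm ?b"] by (simp add: power2_sum)
      finally show "(norm (f x - g x))\<^sup>2 \<le> 2 * (norm ?a)\<^sup>2 + 2 * (norm ?b)\<^sup>2" .
    qed
    also have "\<dots> = 2 * ?I f F + 2 * ?I g F"
      using fg by (simp add: Bochner_Integration.integral_add integrable_trig_sum_diff)
    finally show "(l2norm L (\<lambda>x. f x - g x))\<^sup>2 \<le> 2 * (sqrt (?I f F))\<^sup>2 + 2 * (sqrt (?I g F))\<^sup>2" by simp
  qed simp
  then show ?thesis using l2norm_diff_eq_0_iff[OF fg] by simp
qed

lemma norm_CC: "norm (CC z (kk m)) \<le> norm (z m)" "norm (CC z (- kk m)) \<le> norm (z m)"
proof -
  have *: "norm (\<chi> j. Complex (a $ j / 2) (b $ j / 2)) \<le> norm (a, b)" for a b :: "real ^ 3"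
  proof (rule power2_le_imp_le)
    have "(norm (\<chi> j. Complex (a $ j / 2) (b $ j / 2)))\<^sup>2 = (\<Sum>j\<in>UNIV. (a $ j)\<^sup>2 / 4 + (b $ j)\<^sup>2 / 4)"
      unfolding norm_vec_def L2_set_def by (simp add: cmod_def power_divide sum_nonneg)
    also have "\<dots> = (norm (a, b))\<^sup>2 / 4"
      by (simp add: norm_prod_def norm_vec_def L2_set_def sum_nonneg sum.distrib sum_divide_distrib[symmetric])
    also have "\<dots> \<le> (norm (a, b))\<^sup>2" by simp
    finally show "(norm (\<chi> j. Complex (a $ j / 2) (b $ j / 2)))\<^sup>2 \<le> (norm (a, b))\<^sup>2" .
  qed simp
  show "norm (CC z (kk m)) \<le> norm (z m)"
    using *[of "fst (z m)" "- snd (z m)"] by (simp add: CC_kk norm_prod_def)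
  show "norm (CC z (- kk m)) \<le> norm (z m)"
    using *[of "fst (z m)" "snd (z m)"] by (simp add: CC_uminus_kk)
qed

text \<open>Beyond the frequencies of the first \<open>N\<close> modes, any finite set of
  frequencies is controlled by the tail of the coefficient series; the factor 2 counts
  \<open>kk m\<close> and \<open>- kk m\<close>.\<close>

lemma sum_norm_CC_le:
  assumes z: "summable (\<lambda>m. norm (z m))" and F: "finite F" "F \<inter> modes N = {}"
  shows "(\<Sum>r\<in>F. norm (CC z r)) \<le> 2 * (\<Sum>m. norm (z (m + N)))"
proof -
  have "\<exists>M. F \<subseteq> modes M \<union> {r. CC z r = 0}"
    using F(1)
  proof (induction F)
    case (insert r F)
    then obtain M where M: "F \<subseteq> modes M \<union> {r. CC z r = 0}" by auto
    have "\<exists>M. r \<in> modes M \<union> {r. CC z r = 0}"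
      by (cases r rule: CC_cases) (auto simp: modes_def CC_other)
    then obtain M' where "r \<in> modes M' \<union> {r. CC z r = 0}" by auto
    with M modes_mono[of M "max M M'"] modes_mono[of M' "max M M'"] show ?case
      by (intro exI[of _ "max M M'"]) auto
  qed auto
  then obtain M where M: "F \<subseteq> modes M \<union> {r. CC z r = 0}" by auto
  let ?M = "max M N"
  have "(\<Sum>r\<in>F. norm (CC z r)) = (\<Sum>r\<in>F \<inter> modes M. norm (CC z r))"
    using M F(1) by (intro sum.mono_neutral_right) auto
  also have "\<dots> \<le> (\<Sum>r\<in>modes ?M - modes N. norm (CC z r))"
    using F modes_mono[of M ?M] by (intro sum_mono2) (auto simp: finite_modes)
  also have "\<dots> = (\<Sum>r\<in>modes ?M. norm (CC z r)) - (\<Sum>r\<in>modes N. norm (CC z r))"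
    by (intro sum_diff finite_modes modes_mono) simp
  also have "\<dots> = (\<Sum>m=N..<?M. norm (CC z (kk m)) + norm (CC z (- kk m)))"
    unfolding sum_modes
    using sum.atLeastLessThan_concat[of 0 N ?M "\<lambda>m. norm (CC z (kk m)) + norm (CC z (- kk m))"]
    by (simp add: lessThan_atLeast0)
  also have "\<dots> \<le> (\<Sum>m=N..<?M. 2 * norm (z m))"
  proof (rule sum_mono)
    show "norm (CC z (kk m)) + norm (CC z (- kk m)) \<le> 2 * norm (z m)" for m
      using norm_CC[of z m] by simp
  qed
  also have "\<dots> = 2 * (\<Sum>m<?M - N. norm (z (m + N)))"
    using sum.shift_bounds_nat_ivl[of "\<lambda>m. norm (z m)" 0 N "?M - N"]
    by (simp add: sum_distrib_left[symmetric] lessThan_atLeast0)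
  also have "\<dots> \<le> 2 * (\<Sum>m. norm (z (m + N)))"
    using z by (intro mult_left_mono sum_le_suminf summable_ignore_initial_segment) auto
  finally show ?thesis .
qed

text \<open>\<open>expands\<close> sums the modes in their order, whereas
  \<open>has_fourier_series\<close> asks for convergence along all finite sets of frequencies.
  Absolute summability bridges the gap: a finite set containing \<open>modes N\<close> yields a sum
  that differs from the \<open>N\<close>-th partial sum by at most twice the tail, uniformly in
  \<open>x\<close>.\<close>

lemma expands_has_fourier_series:
  assumes f: "expands z f" and z: "summable (\<lambda>m. norm (z m))"
  shows "has_fourier_series L (- {0}) (CC z) f"
  unfolding has_fourier_series_def
proof
  show "f \<in> L2 L" using f by (rule expands_L2)
  let ?I = "\<lambda>F. LINT x|torus L. (norm (cvec (f x) - trig_sum L F (CC z) x))\<^sup>2"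
  let ?T = "\<lambda>N. 2 * (\<Sum>m. norm (z (m + N)))"
  let ?B = "\<lambda>N. 2 * (l2norm L (\<lambda>x. f x - partial_modes N z x))\<^sup>2 + 2 * (?T N)\<^sup>2 * V"
  have bound: "?I F \<le> ?B N" if F: "finite F" "modes N \<subseteq> F" for F N
  proof -
    let ?a = "\<lambda>x. f x - partial_modes N z x"
    have a: "?a \<in> L2 L" using f by (intro L2_diff expands_L2 partial_modes_L2)
    have "?I F \<le> (LINT x|torus L. 2 * (norm (?a x))\<^sup>2 + 2 * (?T N)\<^sup>2)"
    proof (rule integral_mono)
      show "integrable (torus L) (\<lambda>x. (norm (cvec (f x) - trig_sum L F (CC z) x))\<^sup>2)"
        using f by (intro integrable_trig_sum_diff expands_L2)
      show "integrable (torus L) (\<lambda>x. 2 * (norm (?a x))\<^sup>2 + 2 * (?T N)\<^sup>2)"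
        using a by (intro Bochner_Integration.integrable_add integrable_mult_right L2_integrable) simp_all
      fix x
      have "trig_sum L F (CC z) x = trig_sum L (modes N) (CC z) x + trig_sum L (F - modes N) (CC z) x"
        unfolding trig_sum_def using F by (intro sum.subset_diff[THEN trans] add.commute) auto
      then have "cvec (f x) - trig_sum L F (CC z) x = cvec (?a x) - trig_sum L (F - modes N) (CC z) x"
        by (simp add: cvec_diff cvec_partial_modes)
      moreover have "norm (trig_sum L (F - modes N) (CC z) x) \<le> ?T N"
      proof -
        have n: "norm (cis t *s v) = norm v" for t and v :: "complex ^ 3"
          by (simp add: norm_vec_def norm_mult)
        have "norm (trig_sum L (F - modes N) (CC z) x) \<le> (\<Sum>r\<in>F - modes N. norm (CC z r))"
          unfolding trig_sum_def by (rule norm_sum[THEN order_trans]) (simp add: n)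
        also have "\<dots> \<le> ?T N" using F by (intro sum_norm_CC_le z) auto
        finally show ?thesis .
      qed
      ultimately have "norm (cvec (f x) - trig_sum L F (CC z) x) \<le> norm (?a x) + ?T N"
        using norm_triangle_ineq4[of "cvec (?a x)" "trig_sum L (F - modes N) (CC z) x"] by (simp add: norm_cvec)
      then have "(norm (cvec (f x) - trig_sum L F (CC z) x))\<^sup>2 \<le> (norm (?a x) + ?T N)\<^sup>2" by (intro power_mono) auto
      also have "\<dots> \<le> 2 * (norm (?a x))\<^sup>2 + 2 * (?T N)\<^sup>2"
        using sum_squares_bound[of "norm (?a x)" "?T N"] unfolding power2_sum by linarith
      finally show "(norm (cvec (f x) - trig_sum L F (CC z) x))\<^sup>2 \<le> 2 * (norm (?a x))\<^sup>2 + 2 * (?T N)\<^sup>2" .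
    qed
    also have "\<dots> = 2 * (l2norm L ?a)\<^sup>2 + 2 * (?T N)\<^sup>2 * V"
      using L2_integrable[OF a] by (simp add: l2norm_power2 ip_def dot_square_norm V_eq mult.commute)
    finally show ?thesis .
  qed
  have "?B \<longlonglongrightarrow> 2 * 0\<^sup>2 + 2 * (2 * 0)\<^sup>2 * V"
    using expands_lim[OF f] suminf_exist_split2[OF z] by (intro tendsto_intros)
  from tendsto_real_sqrt[OF this] have B: "(\<lambda>N. sqrt (?B N)) \<longlonglongrightarrow> 0" by simp
  show "((\<lambda>F. sqrt (?I F)) \<longlongrightarrow> 0) (finite_subsets_at_top (- {0}))"
  proof (rule tendstoI)
    fix e :: real assume "e > 0"
    then obtain N where N: "sqrt (?B N) < e"
      using order_tendstoD(2)[OF B] unfolding eventually_sequentially by blast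
    show "\<forall>\<^sub>F F in finite_subsets_at_top (- {0}). dist (sqrt (?I F)) 0 < e"
      unfolding eventually_finite_subsets_at_top
    proof (intro exI[of _ "modes N"] conjI allI impI)
      show "finite (modes N)" "modes N \<subseteq> - {0}" using finite_modes zero_notin_modes by auto
      fix F assume "finite F \<and> modes N \<subseteq> F \<and> F \<subseteq> - {0}"
      then have "sqrt (?I F) \<le> sqrt (?B N)" using bound by simp
      then have "sqrt (?I F) < e" using N by (rule le_less_trans)
      then show "dist (sqrt (?I F)) 0 < e" by (simp add: dist_real_def)
    qed
  qed
qed

text \<open>The chosen field and \<open>f\<close> have the same unconditionally convergent series,
  so they agree almost everywhere.\<close>

lemma fourier_choice:
  assumes "expands z f" "summable (\<lambda>m. norm (z m))"
  shows "expands z (SOME v. has_fourier_series L (- {0}) (CC z) v)"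
proof -
  let ?v = "SOME v. has_fourier_series L (- {0}) (CC z) v"
  have v: "has_fourier_series L (- {0}) (CC z) ?v"
    using expands_has_fourier_series[OF assms] by (rule someI[where P="has_fourier_series L (- {0}) (CC z)"])
  then have "eqae L f ?v"
    using has_fourier_series_unique expands_has_fourier_series[OF assms] by blast
  with v show ?thesis using expands_cong[OF assms(1)] by (simp add: has_fourier_series_def)
qed

lemma norm_wave_kk: "(norm (wave L (kk m)))\<^sup>2 = q m" "(norm (wave L (- kk m)))\<^sup>2 = q m"
  by (simp_all add: wave_uminus wave_kk q_def power_mult_distrib dot_square_norm)

text \<open>A multiplier depending only on the length of the wave vector takes the same real value
  at \<open>kk m\<close> and \<open>- kk m\<close>, so it scales the real mode as a whole.\<close>

lemma CC_multiplier: "g ((norm (wave L r))\<^sup>2) *\<^sub>R CC z r = CC (\<lambda>m. g (q m) *\<^sub>R z m) r"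
proof (cases r rule: CC_cases)
  case (1 m)
  show ?thesis unfolding 1 CC_kk norm_wave_kk by (simp add: vec_eq_iff complex_eq_iff)
next
  case (2 m)
  show ?thesis unfolding 2 CC_uminus_kk norm_wave_kk by (simp add: vec_eq_iff complex_eq_iff)
qed (simp add: CC_other)

text \<open>Passage from the complex description of the data to real modes. The series is given
  along all finite sets of frequencies; restricting it to the sets \<open>modes N\<close> gives the
  ordered sums of \<open>expands\<close>.\<close>

lemma Vmode_expands:
  assumes u: "u \<in> Vmode L k"
  obtains z where "expands z u" "summable (\<lambda>m. q m * (norm (z m))\<^sup>2)" "\<And>m. perp (z m)"
proof -
  let ?K = "{\<chi> j. m * k $ j | m. m \<noteq> 0}"
  \<comment> \<open>Solves \<open>(a - i b) / 2\<close> equal to the Fourier coefficient at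
    \<open>kk m\<close>; the coefficient at \<open>- kk m\<close> is its conjugate.\<close>
  define z where "z m = ((\<chi> j. 2 * Re (fcoef L u (kk m) $ j)), (\<chi> j. - 2 * Im (fcoef L u (kk m) $ j)))" for m
  have uV: "u \<in> VV L" and hf: "has_fourier_series L ?K (fcoef L u) u" using u by (auto simp: Vmode_def)
  have uL: "u \<in> L2 L" using uV VV_L2 by blast
  have conj: "fcoef L u (- r) $ j = cnj (fcoef L u r $ j)" for r j
    using fcoef_component[OF uL, of r j] fcoef_component[OF uL, of "- r" j]
    by (simp add: wave_uminus complex_eq_iff ip_minus_right)
  have CC: "CC z r = fcoef L u r" if "r \<in> modes N" for r N
  proof -
    have "CC z (kk m) = fcoef L u (kk m)" "CC z (- kk m) = fcoef L u (- kk m)" for m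
      by (simp_all add: CC_kk CC_uminus_kk z_def vec_eq_iff complex_eq_iff conj)
    with that show ?thesis by (auto simp: modes_def)
  qed
  have sub: "modes N \<subseteq> ?K" for N
  proof -
    have "kk m \<in> ?K" for m by (auto simp: kk_def intro!: exI[of _ "int (Suc m)"])
    moreover have "- kk m \<in> ?K" for m by (auto simp: kk_def vec_eq_iff algebra_simps intro!: exI[of _ "- int (Suc m)"])
    ultimately show ?thesis by (auto simp: modes_def)
  qed
  have cover: "\<exists>N. r \<in> modes N" if r: "r \<in> ?K" for r
  proof -
    obtain m where m: "m \<noteq> 0" "r = (\<chi> j. m * k $ j)" using r by blast
    show ?thesis
    proof (cases "m > 0")
      case True
      then have "r = kk (nat m - 1)" using m by (simp add: kk_def vec_eq_iff)
      then show ?thesis by (auto simp: modes_def)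
    next
      case False
      then have "r = - kk (nat (- m) - 1)" using m by (simp add: kk_def vec_eq_iff)
      then show ?thesis by (auto simp: modes_def)
    qed
  qed
  \<comment> \<open>Every finite set of multiples of \<open>k\<close> lies in some
    \<open>modes N\<close>, so this sequence is cofinal among the finite sets.\<close>
  have fl: "filterlim modes (finite_subsets_at_top ?K) sequentially"
    unfolding filterlim_iff eventually_finite_subsets_at_top
  proof (intro allI impI, elim exE conjE)
    fix P F assume F: "finite F" "F \<subseteq> ?K" and P: "\<forall>Y. finite Y \<and> F \<subseteq> Y \<and> Y \<subseteq> ?K \<longrightarrow> P Y"
    have "\<exists>N. F \<subseteq> modes N"
      using F
    proof (induction F)
      case (insert r F)
      have rF: "r \<in> ?K" "F \<subseteq> ?K" using insert.prems by (simp_all only: insert_subset)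
      from insert.IH[OF rF(2)] obtain N where "F \<subseteq> modes N" by (rule exE)
      moreover from cover[OF rF(1)] obtain M where "r \<in> modes M" by (rule exE)
      ultimately show ?case
        using modes_mono[of N "max N M"] modes_mono[of M "max N M"] by (intro exI[of _ "max N M"]) auto
    qed auto
    then obtain N where "F \<subseteq> modes N" by blast
    then show "\<forall>\<^sub>F N in sequentially. P (modes N)"
      using P sub finite_modes modes_mono by (intro eventually_sequentiallyI[of N]) (metis (no_types, lifting) order_trans)
  qed
  have "(\<lambda>N. sqrt (LINT x|torus L. (norm (cvec (u x) - trig_sum L (modes N) (fcoef L u) x))\<^sup>2)) \<longlonglongrightarrow> 0"
    using hf fl unfolding has_fourier_series_def by (auto intro: filterlim_compose)
  moreover have "trig_sum L (modes N) (fcoef L u) x = cvec (partial_modes N z x)" for N x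
    unfolding cvec_partial_modes trig_sum_def using CC by simp
  ultimately have e: "expands z u"
    using uL by (simp add: expands_def l2norm_def ip_def dot_square_norm cvec_diff[symmetric] norm_cvec)
  show ?thesis
    by (rule that[OF e H1_expands_summable[OF e VV_H1[OF uV]] HH_expands_perp[OF e VV_HH[OF uV]]])
qed

end

lemma linear_cross3: "linear (cross3 x)"
  using bilinear_cross by (simp add: bilinear_def)

lemma bounded_linear_cross3: "bounded_linear (cross3 x)"
  using linear_cross3 by (simp add: linear_conv_bounded_linear)

text \<open>Split \<open>e\<close> into its part along \<open>y\<close> and a part orthogonal to
  \<open>y\<close>. The latter and \<open>a\<close> both lie in the plane orthogonal to
  \<open>y\<close>, so their cross product is parallel to \<open>y\<close>. The formula says this
  with the denominator \<open>y \<bullet> y\<close> cleared.\<close>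

lemma cross3_orthogonal_plane:
  assumes "y \<bullet> a = 0"
  shows "(y \<bullet> y) *\<^sub>R cross3 e a - (e \<bullet> y) *\<^sub>R cross3 y a = (cross3 e a \<bullet> y) *\<^sub>R y"
proof -
  have "(y \<bullet> y) *\<^sub>R cross3 e a - (e \<bullet> y) *\<^sub>R cross3 y a - (cross3 e a \<bullet> y) *\<^sub>R y
      = - (y \<bullet> a) *\<^sub>R cross3 y e"
    by (simp add: vec_eq_iff forall_3 cross3_def inner_vec_def sum_3 vector_3 algebra_simps)
  with assms show ?thesis by simp
qed

context torus3_mode
begin

subsection \<open>The Coriolis operator on a mode space\<close>

text \<open>
  On the plane orthogonal to \<open>\<kappa>\<close>, \<open>T\<close> is the rotation by a right angle, and the Coriolis operator is
  \<open>\<omega> T\<close>: the component of \<open>e\<^sub>3\<close> orthogonal to \<open>\<kappa>\<close> contributes only a multiple of \<open>\<kappa>\<close>, which the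
  Leray projection removes.
\<close>

definition T :: "real ^ 3 \<Rightarrow> real ^ 3" where "T a = (1 / sqrt (\<kappa> \<bullet> \<kappa>)) *\<^sub>R cross3 \<kappa> a"
definition \<omega> :: real where "\<omega> = \<kappa> $ 3 / sqrt (\<kappa> \<bullet> \<kappa>)"
definition TT :: "(real ^ 3) \<times> (real ^ 3) \<Rightarrow> (real ^ 3) \<times> (real ^ 3)" where "TT z = (T (fst z), T (snd z))"

lemma T_linear: "linear T"
  unfolding T_def[abs_def] by (intro linear_compose_scale_right linear_cross3)

lemma T_bounded_linear: "bounded_linear T"
  using T_linear by (simp add: linear_conv_bounded_linear)

lemma T_perp: "T a \<bullet> \<kappa> = 0"
  by (simp add: T_def dot_cross_self)

lemma T_T: "a \<bullet> \<kappa> = 0 \<Longrightarrow> T (T a) = - a"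
  using \<kappa>_pos by (simp add: T_def Lagrange inner_commute linear_cmul[OF linear_cross3] flip: power2_eq_square)

lemma T_inner: "T a \<bullet> b = - (a \<bullet> T b)"
proof -
  have "cross3 \<kappa> a \<bullet> b = - (a \<bullet> cross3 \<kappa> b)"
    by (simp add: cross3_def inner_vec_def sum_3 vector_3 algebra_simps)
  then show ?thesis by (simp add: T_def)
qed

lemma TT_linear: "linear TT"
  by (rule linearI) (simp_all add: TT_def linear_add[OF T_linear] linear_cmul[OF T_linear])

lemma TT_perp: "perp (TT z)"
  by (simp add: perp_def TT_def T_perp)

lemma TT_TT: "perp z \<Longrightarrow> TT (TT z) = - z"
  by (simp add: TT_def perp_def T_T prod_eq_iff)

lemma TT_inner: "TT z \<bullet> w = - (z \<bullet> TT w)"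
  by (simp add: TT_def inner_prod_def T_inner)

lemma TT_inner_self: "z \<bullet> TT z = 0"
  using TT_inner[of z z] by (simp add: inner_commute)

lemma norm_TT: "perp z \<Longrightarrow> norm (TT z) = norm z"
  using TT_inner[of z "TT z"] by (simp add: TT_TT norm_eq_sqrt_inner)

lemma perp_add: "perp z \<Longrightarrow> perp w \<Longrightarrow> perp (z + w)"
  and perp_scaleR: "perp z \<Longrightarrow> perp (a *\<^sub>R z)"
  and perp_uminus: "perp z \<Longrightarrow> perp (- z)"
  and perp_0: "perp 0"
  by (simp_all add: perp_def inner_add_left)

lemma expands_TT: "expands z u \<Longrightarrow> expands (\<lambda>m. TT (z m)) (\<lambda>x. T (u x))"
  using expands_linear_map[OF _ T_bounded_linear] by (simp add: TT_def)

lemma ip_gradient_modal: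
  assumes "w \<in> HH L" shows "ip L w (modal m (a *\<^sub>R \<kappa>, b *\<^sub>R \<kappa>)) = 0"
proof -
  \<comment> \<open>The mode with coefficients along \<open>\<kappa>\<close> is a gradient;
    \<open>- b / p m\<close> and \<open>a / p m\<close> are the coefficients of its
    potential.\<close>
  have g: "(\<lambda>x. \<chi> j. partial j (\<lambda>x. (- b / p m) * cos (wave L (kk m) \<bullet> x) + (a / p m) * sin (wave L (kk m) \<bullet> x)) x)
      = modal m (a *\<^sub>R \<kappa>, b *\<^sub>R \<kappa>)"
    unfolding partial_trig using p_pos[of m] by (intro ext) (simp add: vec_eq_iff modal_def wave_kk)
  show ?thesis
    using HH_orthogonal_gradient[OF assms smooth_trig periodic_wave_trig, of "- b / p m" "kk m" "a / p m"]
    unfolding g .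
qed

lemma coriolis_symbol:
  assumes "a \<bullet> \<kappa> = 0"
  shows "cross3 (axis 3 1) a = \<omega> *\<^sub>R T a + (cross3 (axis 3 1) a \<bullet> \<kappa> / (\<kappa> \<bullet> \<kappa>)) *\<^sub>R \<kappa>"
proof -
  have "(\<kappa> \<bullet> \<kappa>) *\<^sub>R cross3 (axis 3 1) a = (axis 3 1 \<bullet> \<kappa>) *\<^sub>R cross3 \<kappa> a + (cross3 (axis 3 1) a \<bullet> \<kappa>) *\<^sub>R \<kappa>"
    using cross3_orthogonal_plane[of \<kappa> a "axis 3 1"] assms by (simp add: inner_commute algebra_simps)
  then have "(1 / (\<kappa> \<bullet> \<kappa>)) *\<^sub>R ((\<kappa> \<bullet> \<kappa>) *\<^sub>R cross3 (axis 3 1) a)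
      = (1 / (\<kappa> \<bullet> \<kappa>)) *\<^sub>R ((axis 3 1 \<bullet> \<kappa>) *\<^sub>R cross3 \<kappa> a + (cross3 (axis 3 1) a \<bullet> \<kappa>) *\<^sub>R \<kappa>)" by simp
  then show ?thesis
    using \<kappa>_pos by (simp add: \<omega>_def T_def scaleR_add_right inner_axis' flip: power2_eq_square)
qed

lemma ip_cross_modal:
  assumes "w \<in> HH L" "perp z"
  shows "ip L w (\<lambda>x. cross3 (axis 3 1) (modal m z x)) = \<omega> * ip L w (modal m (TT z))"
proof -
  let ?c = "\<lambda>a. cross3 (axis 3 1) a \<bullet> \<kappa> / (\<kappa> \<bullet> \<kappa>)"
  have "cross3 (axis 3 1) (modal m z x) = modal m (cross3 (axis 3 1) (fst z), cross3 (axis 3 1) (snd z)) x" for x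
    by (rule modal_linear_map[OF linear_cross3])
  also have "(cross3 (axis 3 1) (fst z), cross3 (axis 3 1) (snd z)) =
      \<omega> *\<^sub>R TT z + 1 *\<^sub>R (?c (fst z) *\<^sub>R \<kappa>, ?c (snd z) *\<^sub>R \<kappa>)"
    using coriolis_symbol[of "fst z"] coriolis_symbol[of "snd z"] assms(2)
    by (simp add: TT_def perp_def)
  finally have "(\<lambda>x. cross3 (axis 3 1) (modal m z x)) =
      (\<lambda>x. \<omega> *\<^sub>R modal m (TT z) x + 1 *\<^sub>R modal m (?c (fst z) *\<^sub>R \<kappa>, ?c (snd z) *\<^sub>R \<kappa>) x)"
    unfolding modal_lincomb by (rule ext)
  then show ?thesis
    using ip_gradient_modal[OF assms(1), of m "?c (fst z)" "?c (snd z)"] assms(1)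
    by (simp add: ip_add_right L2_scaleR modal_L2 HH_L2 ip_scaleR_right)
qed

text \<open>The candidate is \<open>\<omega>\<close> times the rotated field. It pairs with every
  field of \<open>HH\<close> as the cross product does, mode by mode and in the limit; the
  difference from \<open>coriolis L u\<close> lies in \<open>HH\<close> and is therefore orthogonal
  to itself.\<close>

lemma coriolis_expands:
  assumes u: "expands z u" and z: "\<And>m. perp (z m)"
  shows "expands (\<lambda>m. \<omega> *\<^sub>R TT (z m)) (coriolis L u)"
proof -
  have uH: "u \<in> HH L" by (rule expands_HH[OF u z])
  let ?g = "\<lambda>x. \<omega> *\<^sub>R T (u x)" and ?J = "\<lambda>x. cross3 (axis 3 1) (u x)"
  have eg: "expands (\<lambda>m. \<omega> *\<^sub>R TT (z m)) ?g" by (rule expands_scaleR[OF expands_TT[OF u]])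
  have gH: "?g \<in> HH L" by (rule expands_HH[OF eg]) (intro perp_scaleR TT_perp)
  have J: "?J \<in> L2 L" by (rule L2_bounded_linear[OF bounded_linear_cross3 HH_L2[OF uH]])
  have ip: "ip L ?J w = ip L ?g w" if w: "w \<in> HH L" for w
  proof -
    have eJ: "expands (\<lambda>m. (cross3 (axis 3 1) (fst (z m)), cross3 (axis 3 1) (snd (z m)))) ?J"
      by (rule expands_linear_map[OF u bounded_linear_cross3])
    let ?pJ = "\<lambda>N. partial_modes N (\<lambda>m. (cross3 (axis 3 1) (fst (z m)), cross3 (axis 3 1) (snd (z m))))"
    let ?pg = "\<lambda>N. partial_modes N (\<lambda>m. \<omega> *\<^sub>R TT (z m))"
    have "ip L w (?pJ N) = ip L w (?pg N)" for N
    proof -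
      have "ip L w (modal m (cross3 (axis 3 1) (fst (z m)), cross3 (axis 3 1) (snd (z m)))) = ip L w (modal m (\<omega> *\<^sub>R TT (z m)))" for m
        using ip_cross_modal[OF w z[of m], of m]
        unfolding modal_linear_map[OF linear_cross3] by (simp add: ip_scaleR_right[symmetric] modal_scaleR[abs_def])
      then show ?thesis
        unfolding partial_modes_def[abs_def] using w by (simp add: ip_sum_right modal_L2 HH_L2)
    qed
    moreover have "(\<lambda>N. ip L (?pJ N) w) \<longlonglongrightarrow> ip L ?J w" "(\<lambda>N. ip L (?pg N) w) \<longlonglongrightarrow> ip L ?g w"
      using eJ eg w by (auto intro!: tendsto_ip_left simp: expands_def partial_modes_L2 HH_L2)
    ultimately show ?thesis using LIMSEQ_unique by (simp add: ip_commute[of L w])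
  qed
  let ?d = "\<lambda>x. coriolis L u x - ?g x"
  have d: "?d \<in> HH L" by (rule HH_diff[OF coriolis_HH[OF uH] gH])
  have "ip L ?d ?d = 0"
    using ip_diff_left[OF HH_L2[OF coriolis_HH[OF uH]] HH_L2[OF gH] HH_L2[OF d]] ip_coriolis[OF uH d] ip[OF d] by simp
  then have "l2norm L ?d = 0" by (simp add: l2norm_def)
  then have "eqae L (coriolis L u) ?g"
    using l2norm_diff_eq_0_iff[OF HH_L2[OF coriolis_HH[OF uH]] HH_L2[OF gH]] by simp
  then show ?thesis
    by (intro expands_cong[OF eg eqae_sym] HH_L2 coriolis_HH uH)
qed

text \<open>The exponential of \<open>s TT\<close> on pairs satisfying \<open>perp\<close>, where
  \<open>TT\<close> squares to minus the identity.\<close>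

definition rot :: "real \<Rightarrow> (real ^ 3) \<times> (real ^ 3) \<Rightarrow> (real ^ 3) \<times> (real ^ 3)" where
  "rot s z = cos s *\<^sub>R z + sin s *\<^sub>R TT z"

lemma norm_lincomb_TT: "perp z \<Longrightarrow> (norm (a *\<^sub>R z + b *\<^sub>R TT z))\<^sup>2 = (a\<^sup>2 + b\<^sup>2) * (norm z)\<^sup>2"
proof -
  assume z: "perp z"
  have "TT z \<bullet> TT z = z \<bullet> z" using norm_TT[OF z] by (simp add: dot_square_norm)
  then show ?thesis
    unfolding power2_norm_eq_inner
    by (simp add: inner_add_left inner_add_right TT_inner_self inner_commute[of "TT z" z]
        power2_eq_square algebra_simps)
qed

lemma norm_rot: "perp z \<Longrightarrow> norm (rot s z) = norm z"
  using norm_lincomb_TT[of z "cos s" "sin s"] by (simp add: rot_def)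

lemma perp_rot: "perp z \<Longrightarrow> perp (rot s z)"
  by (simp add: rot_def perp_add perp_scaleR TT_perp)

lemma expands_zero: "expands (\<lambda>m. 0) (\<lambda>x. 0)"
  by (simp add: expands_def L2_zero partial_modes_def modal_0)

lemma expands_sum: "(\<And>i. i \<in> I \<Longrightarrow> expands (z i) (f i)) \<Longrightarrow>
    expands (\<lambda>m. \<Sum>i\<in>I. c i *\<^sub>R z i m) (\<lambda>x. \<Sum>i\<in>I. c i *\<^sub>R f i x)"
proof (induction I rule: infinite_finite_induct)
  case (insert i I)
  then have "expands (\<lambda>m. c i *\<^sub>R z i m + 1 *\<^sub>R (\<Sum>i\<in>I. c i *\<^sub>R z i m)) (\<lambda>x. c i *\<^sub>R f i x + 1 *\<^sub>R (\<Sum>i\<in>I. c i *\<^sub>R f i x))"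
    by (intro expands_lincomb) auto
  with insert show ?case by simp
qed (simp_all add: expands_zero)

text \<open>The powers of \<open>TT\<close> have period four: \<open>fact n * cos_coeff n\<close>
  runs through 1, 0, -1, 0 and \<open>fact n * sin_coeff n\<close> through 0, 1, 0, -1. Written this
  way, the exponential series becomes the Taylor sums of cosine and sine.\<close>

lemma coriolis_funpow_expands:
  assumes u: "expands z u" and z: "\<And>m. perp (z m)"
  shows "expands (\<lambda>m. (fact n * cos_coeff n * \<omega> ^ n) *\<^sub>R z m + (fact n * sin_coeff n * \<omega> ^ n) *\<^sub>R TT (z m)) ((coriolis L ^^ n) u)"
proof (induction n)
  case 0
  then show ?case using u by simp
next
  case (Suc n)
  have "expands (\<lambda>m. \<omega> *\<^sub>R TT ((fact n * cos_coeff n * \<omega> ^ n) *\<^sub>R z m + (fact n * sin_coeff n * \<omega> ^ n) *\<^sub>R TT (z m)))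
      (coriolis L ((coriolis L ^^ n) u))"
    by (rule coriolis_expands[OF Suc]) (intro perp_add perp_scaleR z TT_perp)
  moreover have "\<omega> *\<^sub>R TT ((fact n * cos_coeff n * \<omega> ^ n) *\<^sub>R z m + (fact n * sin_coeff n * \<omega> ^ n) *\<^sub>R TT (z m)) =
      (fact (Suc n) * cos_coeff (Suc n) * \<omega> ^ Suc n) *\<^sub>R z m + (fact (Suc n) * sin_coeff (Suc n) * \<omega> ^ Suc n) *\<^sub>R TT (z m)" for m
  proof -
    have "fact (Suc n) * cos_coeff (Suc n) = - (fact n * sin_coeff n)" "fact (Suc n) * sin_coeff (Suc n) = fact n * cos_coeff n"
      by (simp_all add: cos_coeff_Suc sin_coeff_Suc field_simps del: of_nat_Suc)
    then show ?thesis
      by (simp add: linear_add[OF TT_linear] linear_cmul[OF TT_linear] TT_TT[OF z] algebra_simps del: fact_Suc)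
  qed
  ultimately show ?case by simp
qed

text \<open>The exponential series of the operator acts on every mode through the same Taylor
  polynomials of cosine and sine at \<open>\<omega> * t\<close>, so it converges to the rotation by
  this angle.\<close>

lemma exp_coriolis_expands:
  assumes u: "expands z u" and z: "\<And>m. perp (z m)"
  shows "expands (\<lambda>m. rot (\<omega> * t) (z m)) (exp_coriolis L t u)"
proof -
  let ?P = "\<lambda>v. v \<in> HH L \<and> (\<lambda>N. l2norm L (\<lambda>x. v x - (\<Sum>n<N. (t ^ n / fact n) *\<^sub>R ((coriolis L ^^ n) u) x))) \<longlonglongrightarrow> 0"
  let ?S = "\<lambda>N x. \<Sum>n<N. (t ^ n / fact n) *\<^sub>R ((coriolis L ^^ n) u) x"
  define E where "E x = cos (\<omega> * t) *\<^sub>R u x + sin (\<omega> * t) *\<^sub>R T (u x)" for x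
  define c where "c N = (\<Sum>n<N. cos_coeff n *\<^sub>R (\<omega> * t) ^ n)" for N
  define s where "s N = (\<Sum>n<N. sin_coeff n *\<^sub>R (\<omega> * t) ^ n)" for N
  have E: "expands (\<lambda>m. rot (\<omega> * t) (z m)) E"
    unfolding E_def[abs_def] rot_def by (intro expands_lincomb u expands_TT)
  have S: "expands (\<lambda>m. c N *\<^sub>R z m + s N *\<^sub>R TT (z m)) (?S N)" for N
  proof -
    have "expands (\<lambda>m. \<Sum>n<N. (t ^ n / fact n) *\<^sub>R ((fact n * cos_coeff n * \<omega> ^ n) *\<^sub>R z m + (fact n * sin_coeff n * \<omega> ^ n) *\<^sub>R TT (z m))) (?S N)"
      by (intro expands_sum coriolis_funpow_expands u z)
    moreover have "(\<Sum>n<N. (t ^ n / fact n) *\<^sub>R ((fact n * cos_coeff n * \<omega> ^ n) *\<^sub>R z m + (fact n * sin_coeff n * \<omega> ^ n) *\<^sub>R TT (z m)))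
        = c N *\<^sub>R z m + s N *\<^sub>R TT (z m)" for m
      by (simp add: c_def s_def scaleR_sum_left sum.distrib[symmetric] scaleR_add_right power_mult_distrib mult_ac)
    ultimately show ?thesis by simp
  qed
  \<comment> \<open>\<open>z m\<close> and \<open>TT (z m)\<close> are orthogonal and of equal
    length, so the relative error is the same in every mode and factors out of the norm.\<close>
  have norm: "l2norm L (\<lambda>x. E x - ?S N x) = sqrt ((cos (\<omega> * t) - c N)\<^sup>2 + (sin (\<omega> * t) - s N)\<^sup>2) * l2norm L u" for N
  proof -
    let ?r = "(cos (\<omega> * t) - c N)\<^sup>2 + (sin (\<omega> * t) - s N)\<^sup>2"
    have "rot (\<omega> * t) (z m) - (c N *\<^sub>R z m + s N *\<^sub>R TT (z m)) = (cos (\<omega> * t) - c N) *\<^sub>R z m + (sin (\<omega> * t) - s N) *\<^sub>R TT (z m)" for m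
      by (simp add: rot_def algebra_simps)
    then have "(norm (rot (\<omega> * t) (z m) - (c N *\<^sub>R z m + s N *\<^sub>R TT (z m))))\<^sup>2 = ?r * (norm (z m))\<^sup>2" for m
      by (simp only: norm_lincomb_TT[OF z])
    then have "(\<lambda>m. ?r * (V / 2 * (norm (z m))\<^sup>2)) sums (l2norm L (\<lambda>x. E x - ?S N x))\<^sup>2"
      using expands_l2norm_sums[OF expands_diff[OF E S], of N] by (simp only: mult.left_commute[of "V / 2" ?r])
    moreover have "(\<lambda>m. ?r * (V / 2 * (norm (z m))\<^sup>2)) sums (?r * (l2norm L u)\<^sup>2)"
      by (intro sums_mult expands_l2norm_sums u)
    ultimately have "(l2norm L (\<lambda>x. E x - ?S N x))\<^sup>2 = ?r * (l2norm L u)\<^sup>2"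
      by (rule sums_unique2)
    then have "sqrt ((l2norm L (\<lambda>x. E x - ?S N x))\<^sup>2) = sqrt (?r * (l2norm L u)\<^sup>2)" by simp
    then show ?thesis by (simp add: real_sqrt_mult)
  qed
  have "c \<longlonglongrightarrow> cos (\<omega> * t)" "s \<longlonglongrightarrow> sin (\<omega> * t)"
    using cos_converges[of "\<omega> * t"] sin_converges[of "\<omega> * t"] by (simp_all add: sums_def c_def[abs_def] s_def[abs_def])
  then have "(\<lambda>N. sqrt ((cos (\<omega> * t) - c N)\<^sup>2 + (sin (\<omega> * t) - s N)\<^sup>2) * l2norm L u)
      \<longlonglongrightarrow> sqrt ((cos (\<omega> * t) - cos (\<omega> * t))\<^sup>2 + (sin (\<omega> * t) - sin (\<omega> * t))\<^sup>2) * l2norm L u"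
    by (intro tendsto_intros)
  then have lim: "(\<lambda>N. l2norm L (\<lambda>x. E x - ?S N x)) \<longlonglongrightarrow> 0"
    unfolding norm by simp
  have PE: "?P E" using lim expands_HH[OF E] z perp_rot by blast
  have Pv: "?P (exp_coriolis L t u)"
    unfolding exp_coriolis_def by (rule someI[of ?P, OF PE])
  have "eqae L E (exp_coriolis L t u)"
    by (rule l2_limit_unique[OF _ _ _ _ lim]) (use PE Pv S expands_L2 HH_L2 in auto)
  with Pv show ?thesis by (intro expands_cong[OF E]) (auto simp: HH_L2)
qed

subsection \<open>Exponentials on a mode space\<close>

text \<open>The frequencies lie on a line, so the eigenvalues grow like the square of the index.
  Over the full three-dimensional lattice the corresponding sum diverges.\<close>

lemma summable_inverse_q: "summable (\<lambda>m. 1 / q m)"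
proof -
  have "summable (\<lambda>m. inverse ((real (Suc m))\<^sup>2))"
    using inverse_power_summable[of 2, where 'a=real] by (subst summable_Suc_iff) simp
  then have "summable (\<lambda>m. (1 / (\<kappa> \<bullet> \<kappa>)) * inverse ((real (Suc m))\<^sup>2))" by (rule summable_mult)
  then show ?thesis by (simp add: q_def p_def divide_inverse mult.commute)
qed

text \<open>The one-dimensional Sobolev embedding on coefficients: the inequality of arithmetic and
  geometric means for \<open>1 / sqrt (q m)\<close> and
  \<open>sqrt (q m) * norm (z m)\<close>.\<close>

lemma summable_norm_of_q:
  assumes "summable (\<lambda>m. q m * (norm (z m))\<^sup>2)" shows "summable (\<lambda>m. norm (z m))"
proof (rule summable_comparison_test'[OF summable_add[OF summable_inverse_q assms]])
  fix m
  have "2 * (1 / sqrt (q m)) * (sqrt (q m) * norm (z m)) \<le> (1 / sqrt (q m))\<^sup>2 + (sqrt (q m) * norm (z m))\<^sup>2"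
    by (rule sum_squares_bound)
  then have "2 * norm (z m) \<le> 1 / q m + q m * (norm (z m))\<^sup>2"
    using q_pos[of m] by (simp add: power_divide power_mult_distrib)
  then show "norm (norm (z m)) \<le> 1 / q m + q m * (norm (z m))\<^sup>2" using norm_ge_zero[of "z m"] unfolding real_norm_def by linarith
qed

text \<open>The common form of \<open>stokes\<close> and \<open>exp_stokes\<close>, each of which
  chooses a field with a prescribed Fourier series. H1 summability of the new coefficients makes
  their series absolutely convergent, so a field to choose exists.\<close>

lemma multiplier_choice:
  assumes f: "expands z f" and z: "summable (\<lambda>m. q m * (g (q m) * norm (z m))\<^sup>2)"
  shows "expands (\<lambda>m. g (q m) *\<^sub>R z m)
    (SOME v. has_fourier_series L (- {0}) (\<lambda>r. g ((norm (wave L r))\<^sup>2) *\<^sub>R fcoef L f r) v)"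
proof -
  have s: "summable (\<lambda>m. q m * (norm (g (q m) *\<^sub>R z m))\<^sup>2)"
    using z by (simp add: power_mult_distrib)
  have "summable (\<lambda>m. (norm (g (q m) *\<^sub>R z m))\<^sup>2)" by (rule summable_q[OF s]) simp
  from Riesz_Fischer[OF this] obtain h where "expands (\<lambda>m. g (q m) *\<^sub>R z m) h" by (rule exE)
  from fourier_choice[OF this summable_norm_of_q[OF s]] show ?thesis
    unfolding fcoef_expands[OF f] CC_multiplier .
qed

lemma stokes_expands:
  assumes "expands z f" "summable (\<lambda>m. q m * (q m * norm (z m))\<^sup>2)"
  shows "expands (\<lambda>m. q m *\<^sub>R z m) (stokes L f)"
  unfolding stokes_def using multiplier_choice[of z f "\<lambda>s. s"] assms by simp

lemma solution_expands:
  assumes u: "expands z u" and z: "\<And>m. perp (z m)" "summable (\<lambda>m. q m * (norm (z m))\<^sup>2)" and t: "0 \<le> t"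
  shows "expands (\<lambda>m. exp (- t * q m) *\<^sub>R rot (\<omega> * s) (z m)) (exp_stokes L t (exp_coriolis L s u))"
  unfolding exp_stokes_def
proof (rule multiplier_choice[where g="\<lambda>r. exp (- t * r)"])
  show "expands (\<lambda>m. rot (\<omega> * s) (z m)) (exp_coriolis L s u)" by (rule exp_coriolis_expands[OF u z(1)])
  show "summable (\<lambda>m. q m * (exp (- t * q m) * norm (rot (\<omega> * s) (z m)))\<^sup>2)"
  proof (rule summable_comparison_test'[OF z(2)])
    fix m
    have "exp (- t * q m) * norm (z m) \<le> 1 * norm (z m)"
      using t q_nonneg[of m] by (intro mult_right_mono) auto
    then show "norm (q m * (exp (- t * q m) * norm (rot (\<omega> * s) (z m)))\<^sup>2) \<le> q m * (norm (z m))\<^sup>2"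
      using q_nonneg[of m] by (simp add: norm_rot z(1) abs_mult mult_left_mono power_mono)
  qed
qed

end

subsection \<open>Functions of time\<close>

lemma tendsto_suminf_dominated:
  fixes a :: "nat \<Rightarrow> 'b \<Rightarrow> real"
  assumes "\<And>k. ((\<lambda>s. a k s) \<longlongrightarrow> b k) F" "eventually (\<lambda>s. \<forall>k. norm (a k s) \<le> M k) F" "summable M" "F \<noteq> bot"
  shows "((\<lambda>s. \<Sum>k. a k s) \<longlongrightarrow> (\<Sum>k. b k)) F"
proof -
  have "eventually (\<lambda>(k, s). norm (a k s) \<le> M k) (at_top \<times>\<^sub>F F)"
    unfolding eventually_prod_filter using assms(2)
    by (intro exI[of _ "\<lambda>_. True"] exI[of _ "\<lambda>s. \<forall>k. norm (a k s) \<le> M k"]) auto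
  from tannerys_theorem[OF assms(1) this assms(3,4)] show ?thesis by simp
qed

lemma AE_lebesgue_nonzero: "AE t in lebesgue. (t :: real) \<noteq> 0"
  by (rule AE_completion) (rule AE_lborel_singleton)

text \<open>The smoothing estimate of the heat semigroup, from
  \<open>(1 + x / n) ^ n \<le> exp x\<close> with \<open>x = t * y\<close>.\<close>

lemma power_times_exp_le:
  fixes y t :: real
  assumes "0 < t" "0 \<le> y" shows "y ^ n * exp (- t * y) \<le> (real n / t) ^ n"
proof (cases "n = 0")
  case True
  with assms show ?thesis by simp
next
  case False
  have "(t * y / real n) ^ n \<le> (1 + t * y / real n) ^ n"
    using assms by (intro power_mono) auto
  also have "\<dots> \<le> exp (t * y)"
    using assms False by (intro exp_ge_one_plus_x_over_n_power_n) (auto intro: order_trans[of _ 0])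
  finally have "(t * y / real n) ^ n \<le> exp (t * y)" .
  then have "(t * y / real n) ^ n * exp (- t * y) \<le> exp (t * y) * exp (- t * y)" by (intro mult_right_mono) auto
  then have "(t * y / real n) ^ n * exp (- t * y) \<le> 1" by (simp add: exp_minus)
  then have "(real n / t) ^ n * ((t * y / real n) ^ n * exp (- t * y)) \<le> (real n / t) ^ n * 1"
    using assms by (intro mult_left_mono) auto
  moreover have "(real n / t) ^ n * (t * y / real n) ^ n = y ^ n"
    using assms False by (simp add: power_mult_distrib[symmetric])
  ultimately show ?thesis by (simp add: mult.assoc[symmetric])
qed

text \<open>
  \<open>grid n\<close> is a simple approximation of the identity on \<open>[0, \<infinity>)\<close> with positive values, so that
  composing it with a curve that is continuous only on \<open>(0, \<infinity>)\<close> gives simple approximations of the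
  curve.
\<close>

definition grid :: "nat \<Rightarrow> real \<Rightarrow> real" where
  "grid n t = (1 + real (nat \<lfloor>real (Suc n) * min t (real n)\<rfloor>)) / real (Suc n)"

lemma grid_pos: "0 < grid n t"
  by (simp add: grid_def add_pos_nonneg)

lemma grid_simple: "simple_function lebesgue (grid n)"
proof (rule simple_function_borel_measurable)
  have "grid n \<in> borel_measurable borel" unfolding grid_def[abs_def] by measurable
  then show "grid n \<in> borel_measurable lebesgue" by (simp add: measurable_completion)
  have "nat \<lfloor>real (Suc n) * min t (real n)\<rfloor> \<le> Suc n * n" for t
  proof -
    have "real (Suc n) * min t (real n) \<le> real (Suc n * n)"
      unfolding of_nat_mult by (intro mult_left_mono) auto
    then have "\<lfloor>real (Suc n) * min t (real n)\<rfloor> \<le> int (Suc n * n)" by linarith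
    then show ?thesis by linarith
  qed
  then have "range (grid n) \<subseteq> (\<lambda>i. (1 + real i) / real (Suc n)) ` {..Suc n * n}"
    by (auto simp: grid_def)
  then show "finite (grid n ` space lebesgue)" using finite_subset by auto
qed

lemma grid_tendsto: assumes "0 \<le> t" shows "(\<lambda>n. grid n t) \<longlonglongrightarrow> t"
proof -
  obtain N where N: "t \<le> real N" using real_arch_simple by blast
  have lim: "(\<lambda>n. 1 / real (Suc n)) \<longlonglongrightarrow> 0" by (rule lim_1_over_n[THEN LIMSEQ_Suc])
  have "(\<lambda>n. grid n t - t) \<longlonglongrightarrow> 0"
  proof (rule Lim_null_comparison[OF eventually_sequentiallyI[of N] lim])
    fix n assume "N \<le> n"
    then have "min t (real n) = t" using N by simp
    moreover have "real (nat \<lfloor>real (Suc n) * t\<rfloor>) = of_int \<lfloor>real (Suc n) * t\<rfloor>" using assms by simp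
    ultimately have "grid n t - t = (1 + of_int \<lfloor>real (Suc n) * t\<rfloor> - real (Suc n) * t) / real (Suc n)"
      by (simp add: grid_def field_simps del: of_nat_Suc)
    moreover have "\<bar>1 + of_int \<lfloor>real (Suc n) * t\<rfloor> - real (Suc n) * t\<bar> \<le> 1" by linarith
    ultimately show "norm (grid n t - t) \<le> 1 / real (Suc n)"
      by (simp add: abs_divide divide_right_mono del: of_nat_Suc)
  qed
  then show ?thesis by (simp add: LIM_zero_iff)
qed

text \<open>Time 0 is left out because it is a null set, and because membership of the solution in
  \<open>stokes_dom\<close> is available at positive times only.\<close>

lemma Lp_locI:
  fixes u :: "real \<Rightarrow> 'a::minus"
  assumes E: "\<And>t. t > 0 \<Longrightarrow> u t \<in> E"
    and c: "\<And>t. t > 0 \<Longrightarrow> ((\<lambda>s. nrm (u t - u s)) \<longlongrightarrow> 0) (nhds t)"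
    and i: "\<And>T. T > 0 \<Longrightarrow> set_integrable lebesgue {0..T} (\<lambda>t. nrm (u t) powr p)"
  shows "Lp_loc p nrm E u"
  unfolding Lp_loc_def
proof (intro conjI allI impI i)
  show "AE t in lebesgue. 0 \<le> t \<longrightarrow> u t \<in> E"
    using AE_lebesgue_nonzero by (rule eventually_mono) (use E in auto)
  show "\<exists>s. (\<forall>n. simple_function lebesgue (s n) \<and> range (s n) \<subseteq> E) \<and>
      (AE t in lebesgue. 0 \<le> t \<longrightarrow> (\<lambda>n. nrm (u t - s n t)) \<longlonglongrightarrow> 0)"
  proof (intro exI[of _ "\<lambda>n. u \<circ> grid n"] conjI allI)
    show "simple_function lebesgue (u \<circ> grid n)" for n
      by (rule simple_function_compose[OF grid_simple])
    show "range (u \<circ> grid n) \<subseteq> E" for n using E grid_pos by auto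
    show "AE t in lebesgue. 0 \<le> t \<longrightarrow> (\<lambda>n. nrm (u t - (u \<circ> grid n) t)) \<longlonglongrightarrow> 0"
      using AE_lebesgue_nonzero
    proof (rule eventually_mono, intro impI)
      fix t :: real assume "t \<noteq> 0" "0 \<le> t"
      then have t: "t > 0" by simp
      have "filterlim (\<lambda>n. grid n t) (nhds t) sequentially" using grid_tendsto t by simp
      from filterlim_compose[OF c[OF t] this] show "(\<lambda>n. nrm (u t - (u \<circ> grid n) t)) \<longlonglongrightarrow> 0" by simp
    qed
  qed
qed

lemma time_test_deriv:
  assumes "time_test \<phi>"
  shows "(\<phi> has_real_derivative deriv \<phi> t) (at t)" "continuous_on S (deriv \<phi>)"
proof -
  have "(deriv ^^ 0) \<phi> differentiable (at t)" for t using assms unfolding time_test_def by blast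
  then show "(\<phi> has_real_derivative deriv \<phi> t) (at t)"
    by (simp add: DERIV_deriv_iff_real_differentiable)
  have "(deriv ^^ 1) \<phi> differentiable (at t)" for t using assms unfolding time_test_def by blast
  then have "deriv \<phi> differentiable (at t)" for t by simp
  then show "continuous_on S (deriv \<phi>)"
    by (meson continuous_at_imp_continuous_on differentiable_imp_continuous_within)
qed

lemma time_test_support:
  assumes "time_test \<phi>"
  obtains a b where "0 < a" "a < b" "\<And>t. t \<notin> {a..b} \<Longrightarrow> \<phi> t = 0" "\<And>t. t \<notin> {a..b} \<Longrightarrow> deriv \<phi> t = 0" "\<phi> a = 0" "\<phi> b = 0"
proof -
  obtain a b where ab: "0 < a" "\<And>t. t \<notin> {a..b} \<Longrightarrow> \<phi> t = 0" using assms unfolding time_test_def by blast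
  have d: "deriv \<phi> t = 0" if "t \<notin> {a..b}" for t
  proof -
    have "open (- {a..b})" by auto
    then have "eventually (\<lambda>s. \<phi> s = 0) (nhds t)"
      using that ab(2) by (auto simp: eventually_nhds intro!: exI[of _ "- {a..b}"])
    then have "deriv \<phi> t = deriv (\<lambda>_. 0) t" by (rule deriv_cong_ev) simp
    then show ?thesis by simp
  qed
  have out: "t \<notin> {a..b}" if "t \<notin> {a / 2..max a b + 1}" for t using that ab(1) by auto
  have ends: "a / 2 \<notin> {a..b}" "max a b + 1 \<notin> {a..b}" using ab(1) by auto
  show ?thesis
  \<comment> \<open>The interval is widened so that it is nondegenerate and the test function
    vanishes at both ends, which disposes of boundary terms.\<close>
  proof (rule that[of "a / 2" "max a b + 1"])
    show "0 < a / 2" "a / 2 < max a b + 1" using ab(1) by auto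
  qed (use ab(2) d out ends in blast)+
qed

lemma time_test_integral_eq:
  fixes h :: "real \<Rightarrow> real"
  assumes "0 < a" "\<And>t. t \<notin> {a..b} \<Longrightarrow> h t = 0"
  shows "(LINT t:{0<..}|lebesgue. h t) = (LINT t:{a..b}|lebesgue. h t)"
  unfolding set_lebesgue_integral_def using assms
  by (intro Bochner_Integration.integral_cong refl) (auto simp: indicator_def)

lemma lebesgue_integral_continuous:
  fixes h :: "real \<Rightarrow> real"
  assumes "continuous_on {a..b} h"
  shows "set_integrable lebesgue {a..b} h" "(LINT t:{a..b}|lebesgue. h t) = integral {a..b} h"
proof -
  show 1: "set_integrable lebesgue {a..b} h" by (rule absolutely_integrable_continuous_real[OF assms])
  show "(LINT t:{a..b}|lebesgue. h t) = integral {a..b} h"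
    by (rule set_lebesgue_integral_eq_integral(2)[OF 1])
qed

lemma distr_derivI:
  assumes f: "\<And>t. 0 < t \<Longrightarrow> (f has_real_derivative g t) (at t)" and g: "continuous_on {0<..} g"
  shows "distr_deriv f g"
  unfolding distr_deriv_def
proof (intro conjI allI impI)
  have fc: "continuous_on {0<..} f"
    by (meson DERIV_isCont continuous_at_imp_continuous_on f greaterThan_iff)
  have c: "continuous_on {a..b} f" "continuous_on {a..b} g" if "0 < a" for a b
    using that by (auto intro!: continuous_on_subset[OF fc] continuous_on_subset[OF g])
  show "set_integrable lebesgue {a..b} f" "set_integrable lebesgue {a..b} g" if "0 < a" for a b
    using lebesgue_integral_continuous(1) c[OF that] by blast+
  fix \<phi> assume \<phi>: "time_test \<phi>"
  then obtain a b where ab: "0 < a" "a < b" and z: "\<And>t. t \<notin> {a..b} \<Longrightarrow> \<phi> t = 0" "\<And>t. t \<notin> {a..b} \<Longrightarrow> deriv \<phi> t = 0"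
      and e: "\<phi> a = 0" "\<phi> b = 0" using time_test_support by metis
  have pc: "continuous_on {a..b} \<phi>"
    by (meson DERIV_isCont continuous_at_imp_continuous_on time_test_deriv(1)[OF \<phi>])
  note cc = c[OF ab(1)] pc time_test_deriv(2)[OF \<phi>]
  have "((\<lambda>t. f t * deriv \<phi> t + g t * \<phi> t) has_integral (f b * \<phi> b - f a * \<phi> a)) {a..b}"
  proof (rule fundamental_theorem_of_calculus)
    fix t assume t: "t \<in> {a..b}"
    have "((\<lambda>t. f t * \<phi> t) has_real_derivative f t * deriv \<phi> t + g t * \<phi> t) (at t)"
      using t ab by (auto intro!: derivative_eq_intros f time_test_deriv(1)[OF \<phi>])
    then show "((\<lambda>t. f t * \<phi> t) has_vector_derivative f t * deriv \<phi> t + g t * \<phi> t) (at t within {a..b})"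
      by (rule has_vector_derivative_at_within[OF has_real_derivative_iff_has_vector_derivative[THEN iffD1]])
  qed (use ab in simp)
  then have "integral {a..b} (\<lambda>t. f t * deriv \<phi> t + g t * \<phi> t) = 0" using e by (simp add: integral_unique)
  moreover have "integral {a..b} (\<lambda>t. f t * deriv \<phi> t + g t * \<phi> t)
      = integral {a..b} (\<lambda>t. f t * deriv \<phi> t) + integral {a..b} (\<lambda>t. g t * \<phi> t)"
    by (intro integral_add integrable_continuous_real continuous_intros cc)
  moreover have "(LINT t:{0<..}|lebesgue. f t * deriv \<phi> t) = integral {a..b} (\<lambda>t. f t * deriv \<phi> t)"
    by (subst time_test_integral_eq[OF ab(1), of b]) (auto simp: z intro!: lebesgue_integral_continuous(2) continuous_intros cc)
  moreover have "(LINT t:{0<..}|lebesgue. g t * \<phi> t) = integral {a..b} (\<lambda>t. g t * \<phi> t)"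
    by (subst time_test_integral_eq[OF ab(1), of b]) (auto simp: z intro!: lebesgue_integral_continuous(2) continuous_intros cc)
  ultimately show "(LINT t:{0<..}|lebesgue. f t * deriv \<phi> t) = - (LINT t:{0<..}|lebesgue. g t * \<phi> t)" by simp
qed

section \<open>Second-order norms and time integrals of heat series\<close>

context torus3_mode
begin

lemma summable_q_dz:
  assumes z: "summable (\<lambda>m. (q m)\<^sup>2 * (norm (z m))\<^sup>2)"
  shows "summable (\<lambda>m. q m * (norm (dz j m (z m)))\<^sup>2)"
proof (rule summable_comparison_test'[OF z])
  fix m
  have "(norm (dz j m (z m)))\<^sup>2 \<le> (\<Sum>j\<in>UNIV. (norm (dz j m (z m)))\<^sup>2)" by (rule member_le_sum) auto
  then have "q m * (norm (dz j m (z m)))\<^sup>2 \<le> q m * (q m * (norm (z m))\<^sup>2)"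
    unfolding sum_norm_dz by (intro mult_left_mono q_nonneg)
  then show "norm (q m * (norm (dz j m (z m)))\<^sup>2) \<le> (q m)\<^sup>2 * (norm (z m))\<^sup>2"
    using q_nonneg[of m] by (simp add: abs_mult power2_eq_square mult.assoc)
qed

lemma h2norm_sums:
  assumes f: "expands z f" and z: "summable (\<lambda>m. (q m)\<^sup>2 * (norm (z m))\<^sup>2)"
  shows "f \<in> H2 L" "(\<lambda>m. V / 2 * ((1 + q m + (q m)\<^sup>2) * (norm (z m))\<^sup>2)) sums (h2norm L f)\<^sup>2"
proof -
  have z1: "summable (\<lambda>m. q m * (norm (z m))\<^sup>2)"
  proof (rule summable_q)
    show "summable (\<lambda>m. q m * (q m * (norm (z m))\<^sup>2))" using z by (simp add: power2_eq_square mult.assoc)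
  qed (simp add: q_nonneg)
  note zd = summable_q_dz[OF z]
  have w: "wpartial L j f \<in> H1 L" for j
    by (rule expands_H1[OF expands_wpartial[OF f z1] zd])
  show "f \<in> H2 L" using expands_H1[OF f z1] w by (simp add: H2_def)
  have "(\<lambda>m. V / 2 * (norm (dz i m (dz j m (z m))))\<^sup>2) sums (l2norm L (wpartial L i (wpartial L j f)))\<^sup>2" for i j
    by (intro expands_l2norm_sums expands_wpartial zd f z1)
  then have "(\<lambda>m. \<Sum>i\<in>UNIV. \<Sum>j\<in>UNIV. V / 2 * (norm (dz i m (dz j m (z m))))\<^sup>2) sums
      (\<Sum>i\<in>UNIV. \<Sum>j\<in>UNIV. (l2norm L (wpartial L i (wpartial L j f)))\<^sup>2)"
    by (intro sums_sum)
  moreover have "(\<Sum>i\<in>UNIV. \<Sum>j\<in>UNIV. V / 2 * (norm (dz i m (dz j m (z m))))\<^sup>2) = V / 2 * ((q m)\<^sup>2 * (norm (z m))\<^sup>2)" for m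
    by (subst sum.swap) (simp only: sum_distrib_left[symmetric] sum_norm_dz power2_eq_square[of "q m"] mult.assoc)
  ultimately have "(\<lambda>m. V / 2 * ((q m)\<^sup>2 * (norm (z m))\<^sup>2)) sums (\<Sum>i\<in>UNIV. \<Sum>j\<in>UNIV. (l2norm L (wpartial L i (wpartial L j f)))\<^sup>2)"
    by (simp only:)
  from sums_add[OF h1norm_sums[OF f z1] this]
  show "(\<lambda>m. V / 2 * ((1 + q m + (q m)\<^sup>2) * (norm (z m))\<^sup>2)) sums (h2norm L f)\<^sup>2"
    by (simp add: h2norm_def sum_nonneg algebra_simps)
qed

text \<open>Integration in time gains a factor \<open>1 / (2 * q m)\<close>, so summability of
  \<open>c m / q m\<close> is enough although the series may diverge at time 0. In this way H1 data
  give a square integrable H2 norm.\<close>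

lemma heat_integral:
  assumes c: "\<And>m. 0 \<le> c m" "summable (\<lambda>m. c m / q m)" and ab: "0 \<le> a" "a \<le> b"
  shows "set_integrable lebesgue {a..b} (\<lambda>t. \<Sum>m. c m * exp (- 2 * t * q m))"
    and "(\<lambda>m. c m * (exp (- 2 * a * q m) - exp (- 2 * b * q m)) / (2 * q m)) sums
      (LINT t:{a..b}|lebesgue. \<Sum>m. c m * exp (- 2 * t * q m))"
proof -
  let ?f = "\<lambda>m t. indicator {a..b} t *\<^sub>R (c m * exp (- 2 * t * q m))"
  let ?v = "\<lambda>m. c m * (exp (- 2 * a * q m) - exp (- 2 * b * q m)) / (2 * q m)"
  have cont: "continuous_on {a..b} (\<lambda>t. c m * exp (- 2 * t * q m))" for m by (intro continuous_intros)
  have int: "integrable lebesgue (?f m)" for m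
    using lebesgue_integral_continuous(1)[OF cont] by (simp add: set_integrable_def)
  have val: "integral\<^sup>L lebesgue (?f m) = ?v m" for m
  proof -
    have "((\<lambda>t. c m * exp (- 2 * t * q m)) has_integral
        (- c m / (2 * q m) * exp (- 2 * b * q m) - (- c m / (2 * q m) * exp (- 2 * a * q m)))) {a..b}"
    proof (rule fundamental_theorem_of_calculus[OF ab(2)])
      fix t
      have "((\<lambda>t. - c m / (2 * q m) * exp (- 2 * t * q m)) has_real_derivative c m * exp (- 2 * t * q m)) (at t)"
        using q_pos[of m] by (auto intro!: derivative_eq_intros)
      then show "((\<lambda>t. - c m / (2 * q m) * exp (- 2 * t * q m)) has_vector_derivative c m * exp (- 2 * t * q m)) (at t within {a..b})"
        by (rule has_vector_derivative_at_within[OF has_real_derivative_iff_has_vector_derivative[THEN iffD1]])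
    qed
    then have "integral {a..b} (\<lambda>t. c m * exp (- 2 * t * q m)) =
        - c m / (2 * q m) * exp (- 2 * b * q m) - (- c m / (2 * q m) * exp (- 2 * a * q m))"
      by (rule integral_unique)
    also have "\<dots> = ?v m" by (simp add: right_diff_distrib diff_divide_distrib)
    finally show ?thesis
      using lebesgue_integral_continuous(2)[OF cont] unfolding set_lebesgue_integral_def by (rule trans[rotated])
  qed
  have norm: "norm (?f m t) = ?f m t" for m t using c(1)[of m] by (simp add: indicator_def)
  have sv: "summable ?v"
  proof (rule summable_comparison_test'[OF c(2)])
    fix m
    have "exp (- 2 * b * q m) \<le> exp (- 2 * a * q m)" "exp (- 2 * a * q m) \<le> 1"
      using ab q_nonneg[of m] by (simp_all add: mult_right_mono)
    then have e: "0 \<le> exp (- 2 * a * q m) - exp (- 2 * b * q m)" "exp (- 2 * a * q m) - exp (- 2 * b * q m) \<le> 1"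
      using exp_ge_zero[of "- 2 * b * q m"] by linarith+
    have "?v m \<le> c m * 1 / q m"
      using e c(1)[of m] q_pos[of m] by (intro frac_le mult_left_mono) auto
    moreover have "0 \<le> ?v m" using e c(1)[of m] q_pos[of m] by simp
    ultimately show "norm (?v m) \<le> c m / q m" by simp
  qed
  \<comment> \<open>At positive times \<open>q m * exp (- 2 * t * q m)\<close> is bounded in
    \<open>m\<close>, which recovers summability; time 0 is discarded.\<close>
  have AE: "AE t in lebesgue. summable (\<lambda>m. norm (?f m t))"
    using AE_lebesgue_nonzero
  proof (rule eventually_mono)
    fix t :: real assume t: "t \<noteq> 0"
    show "summable (\<lambda>m. norm (?f m t))"
    proof (cases "t \<in> {a..b}")
      case True
      then have t: "0 < t" using t ab by auto
      show ?thesis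
        unfolding norm
      proof (rule summable_comparison_test'[OF summable_mult[OF c(2), of "1 / (2 * t)"]])
        fix m
        have "q m ^ 1 * exp (- (2 * t) * q m) \<le> (real 1 / (2 * t)) ^ 1"
          using t by (intro power_times_exp_le q_nonneg) simp
        then have "c m / q m * (q m * exp (- 2 * t * q m)) \<le> c m / q m * (1 / (2 * t))"
          using c(1)[of m] q_nonneg[of m] by (intro mult_left_mono) auto
        then show "norm (?f m t) \<le> 1 / (2 * t) * (c m / q m)"
          using True c(1)[of m] q_pos[of m] by (simp add: mult.commute)
      qed
    qed simp
  qed
  have eq: "(\<Sum>m. ?f m t) = indicator {a..b} t *\<^sub>R (\<Sum>m. c m * exp (- 2 * t * q m))" for t
    by (simp add: indicator_def)
  have sn: "summable (\<lambda>m. LINT t|lebesgue. norm (?f m t))" unfolding norm val by (rule sv)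
  show "set_integrable lebesgue {a..b} (\<lambda>t. \<Sum>m. c m * exp (- 2 * t * q m))"
    using integrable_suminf[OF int AE sn] unfolding eq set_integrable_def .
  show "?v sums (LINT t:{a..b}|lebesgue. \<Sum>m. c m * exp (- 2 * t * q m))"
    using sums_integral[OF int AE sn] unfolding eq val set_lebesgue_integral_def .
qed

end

subsection \<open>The explicit solution\<close>

text \<open>The solution enters only through its expansion at nonnegative times, since the formula
  for it is a composition of choices. Its values at negative times are unconstrained.\<close>

locale torus3_solution = torus3_mode +
  fixes z :: "nat \<Rightarrow> (real ^ 3) \<times> (real ^ 3)" and \<Omega> :: real and U :: "real \<Rightarrow> field3"
  assumes perp_z: "perp (z m)" and summable_z: "summable (\<lambda>m. q m * (norm (z m))\<^sup>2)"
    and U_expands': "0 \<le> t \<Longrightarrow> expands (\<lambda>m. exp (- t * q m) *\<^sub>R rot (\<omega> * (- \<Omega> * t)) (z m)) (U t)"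
begin

definition Z :: "real \<Rightarrow> nat \<Rightarrow> (real ^ 3) \<times> (real ^ 3)" where
  "Z t m = exp (- t * q m) *\<^sub>R rot (\<omega> * (- \<Omega> * t)) (z m)"

definition dZ :: "real \<Rightarrow> nat \<Rightarrow> (real ^ 3) \<times> (real ^ 3)" where
  "dZ t m = - (q m *\<^sub>R Z t m + (\<Omega> * \<omega>) *\<^sub>R TT (Z t m))"

lemma U_expands: "0 \<le> t \<Longrightarrow> expands (Z t) (U t)"
  using U_expands' by (simp add: Z_def[abs_def])

lemma perp_Z: "perp (Z t m)"
  by (simp add: Z_def perp_scaleR perp_rot perp_z)

lemma norm_Z: "norm (Z t m) = exp (- t * q m) * norm (z m)"
  by (simp add: Z_def norm_rot perp_z)

lemma norm_Z_square: "(norm (Z t m))\<^sup>2 = exp (- 2 * t * q m) * (norm (z m))\<^sup>2"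
  by (simp add: norm_Z power_mult_distrib exp_double[symmetric])

lemma norm_dZ_square: "(norm (dZ t m))\<^sup>2 = ((q m)\<^sup>2 + (\<Omega> * \<omega>)\<^sup>2) * (norm (Z t m))\<^sup>2"
  using norm_lincomb_TT[OF perp_Z, of "q m" t m "\<Omega> * \<omega>"] unfolding dZ_def norm_minus_cancel .

text \<open>Away from time 0 the exponential absorbs every power of the eigenvalue. The bound is
  uniform in \<open>s\<close>, as a majorant for limits in time must be.\<close>

lemma Z_decay:
  assumes "0 < t" "t \<le> s"
  shows "(q m) ^ n * (norm (Z s m))\<^sup>2 \<le> (real n / (2 * t)) ^ n * (norm (z m))\<^sup>2"
proof -
  have "exp (- 2 * s * q m) \<le> exp (- (2 * t) * q m)" using assms q_nonneg[of m] by (simp add: mult_right_mono)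
  then have "(q m) ^ n * exp (- 2 * s * q m) \<le> (q m) ^ n * exp (- (2 * t) * q m)"
    using q_nonneg by (intro mult_left_mono) auto
  also have "\<dots> \<le> (real n / (2 * t)) ^ n" using assms by (intro power_times_exp_le q_nonneg) simp
  finally show ?thesis by (simp add: norm_Z_square mult.assoc[symmetric] mult_right_mono)
qed

lemma Z_le: "0 \<le> s \<Longrightarrow> (norm (Z s m))\<^sup>2 \<le> (norm (z m))\<^sup>2"
  using q_nonneg[of m] by (auto simp: norm_Z_square intro!: mult_left_le_one_le)

lemma summable_z0: "summable (\<lambda>m. (norm (z m))\<^sup>2)"
  by (rule summable_q[OF summable_z]) simp

lemma summable_z_div: "summable (\<lambda>m. (norm (z m))\<^sup>2 / q m)"
proof (rule summable_comparison_test'[OF summable_mult[OF summable_z0, of "1 / (\<kappa> \<bullet> \<kappa>)"]])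
  fix m
  have "1 * (\<kappa> \<bullet> \<kappa>) \<le> q m"
    unfolding q_def using p_ge_1[of m] by (intro mult_right_mono) auto
  then show "norm ((norm (z m))\<^sup>2 / q m) \<le> 1 / (\<kappa> \<bullet> \<kappa>) * (norm (z m))\<^sup>2"
    using \<kappa>_pos by (simp add: frac_le)
qed

lemma summable_Z_q: "0 \<le> t \<Longrightarrow> summable (\<lambda>m. q m * (norm (Z t m))\<^sup>2)"
  by (rule summable_comparison_test'[OF summable_z])
    (use q_nonneg Z_le in \<open>auto simp: abs_mult intro!: mult_left_mono\<close>)

lemma summable_Z_power: "0 < t \<Longrightarrow> summable (\<lambda>m. q m ^ n * (norm (Z t m))\<^sup>2)"
  by (rule summable_comparison_test'[OF summable_mult[OF summable_z0, of "(real n / (2 * t)) ^ n"]])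
    (use q_nonneg Z_decay[of t t] in \<open>auto simp: abs_mult\<close>)

lemma Z_has_vector_derivative: "((\<lambda>t. Z t m) has_vector_derivative dZ t m) (at t)"
proof -
  have "((\<lambda>t. exp (- t * q m) *\<^sub>R rot (\<omega> * (- \<Omega> * t)) (z m)) has_vector_derivative
      exp (- t * q m) *\<^sub>R (((\<omega> * \<Omega>) * sin (\<omega> * (- \<Omega> * t))) *\<^sub>R z m + (- (\<omega> * \<Omega>) * cos (\<omega> * (- \<Omega> * t))) *\<^sub>R TT (z m))
      + (- q m * exp (- t * q m)) *\<^sub>R rot (\<omega> * (- \<Omega> * t)) (z m)) (at t)"
    unfolding rot_def
    by (auto intro!: derivative_eq_intros has_vector_derivative_scaleR has_vector_derivative_add
        simp: has_real_derivative_iff_has_vector_derivative[symmetric] mult_ac)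
  moreover have "exp (- t * q m) *\<^sub>R (((\<omega> * \<Omega>) * sin (\<omega> * (- \<Omega> * t))) *\<^sub>R z m + (- (\<omega> * \<Omega>) * cos (\<omega> * (- \<Omega> * t))) *\<^sub>R TT (z m))
      + (- q m * exp (- t * q m)) *\<^sub>R rot (\<omega> * (- \<Omega> * t)) (z m) = dZ t m"
    by (simp add: dZ_def Z_def rot_def linear_add[OF TT_linear] linear_cmul[OF TT_linear] linear_diff[OF TT_linear]
        TT_TT[OF perp_z] algebra_simps)
  ultimately show ?thesis by (simp add: Z_def[abs_def])
qed

lemma Z_tendsto: "((\<lambda>s. Z s m) \<longlongrightarrow> Z t m) (at t within S)"
  using has_vector_derivative_continuous[OF Z_has_vector_derivative[where m=m and t=t]]
  by (meson continuous_at_imp_continuous_at_within continuous_within)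

lemma Z_tendsto_nhds: "((\<lambda>s. Z s m) \<longlongrightarrow> Z t m) (nhds t)"
  using has_vector_derivative_continuous[OF Z_has_vector_derivative[where m=m and t=t]]
  by (simp add: continuous_at_imp_continuous_at_within tendsto_nhds_iff isCont_def)

lemma dZ_tendsto_nhds: "((\<lambda>s. dZ s m) \<longlongrightarrow> dZ t m) (nhds t)"
proof -
  have "((\<lambda>s. TT (Z s m)) \<longlongrightarrow> TT (Z t m)) (nhds t)"
    using TT_linear by (intro bounded_linear.tendsto[OF _ Z_tendsto_nhds]) (simp add: linear_conv_bounded_linear)
  then show ?thesis unfolding dZ_def by (intro tendsto_intros Z_tendsto_nhds)
qed

text \<open>Dominated convergence for weighted square sums. The limits in time below reduce to it:
  coefficients converge one by one, and only the weight and the majorant change. The factor 4 comes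
  from estimating a squared difference by twice the sum of squares.\<close>

lemma weighted_tendsto:
  fixes y :: "real \<Rightarrow> nat \<Rightarrow> (real ^ 3) \<times> (real ^ 3)"
  assumes "\<And>m. ((\<lambda>s. y s m) \<longlongrightarrow> y' m) F" "F \<noteq> bot" "\<And>m. 0 \<le> w m" "summable M"
    and "eventually (\<lambda>s. \<forall>m. w m * (norm (y s m))\<^sup>2 \<le> M m) F" "\<And>m. w m * (norm (y' m))\<^sup>2 \<le> M m"
  shows "((\<lambda>s. \<Sum>m. w m * (norm (y s m - y' m))\<^sup>2) \<longlongrightarrow> 0) F"
proof -
  have "((\<lambda>s. \<Sum>m. w m * (norm (y s m - y' m))\<^sup>2) \<longlongrightarrow> (\<Sum>m. w m * (norm (y' m - y' m))\<^sup>2)) F"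
  proof (rule tendsto_suminf_dominated)
    show "((\<lambda>s. w k * (norm (y s k - y' k))\<^sup>2) \<longlongrightarrow> w k * (norm (y' k - y' k))\<^sup>2) F" for k
      by (intro tendsto_intros assms)
    show "summable (\<lambda>m. 4 * M m)" by (intro summable_mult assms)
    show "eventually (\<lambda>s. \<forall>k. norm (w k * (norm (y s k - y' k))\<^sup>2) \<le> 4 * M k) F"
      using assms(5)
    proof (rule eventually_mono, intro allI)
      fix s k assume s: "\<forall>m. w m * (norm (y s m))\<^sup>2 \<le> M m"
      have "(norm (y s k - y' k))\<^sup>2 \<le> (norm (y s k) + norm (y' k))\<^sup>2"
        by (intro power_mono norm_triangle_ineq4) auto
      also have "\<dots> \<le> 2 * (norm (y s k))\<^sup>2 + 2 * (norm (y' k))\<^sup>2"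
        using sum_squares_bound[of "norm (y s k)" "norm (y' k)"] by (simp add: power2_sum)
      finally have "w k * (norm (y s k - y' k))\<^sup>2 \<le> w k * (2 * (norm (y s k))\<^sup>2 + 2 * (norm (y' k))\<^sup>2)"
        using assms(3) by (intro mult_left_mono)
      also have "\<dots> = 2 * (w k * (norm (y s k))\<^sup>2) + 2 * (w k * (norm (y' k))\<^sup>2)" by (simp add: algebra_simps)
      also have "\<dots> \<le> 4 * M k" using s assms(6)[of k] by (smt (verit))
      finally show "norm (w k * (norm (y s k - y' k))\<^sup>2) \<le> 4 * M k" using assms(3)[of k] by simp
    qed
  qed (rule assms)
  then show ?thesis by simp
qed

lemma eventually_gt_half: "0 < t \<Longrightarrow> eventually (\<lambda>s. t / 2 \<le> s) (nhds t)" for t :: real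
  by (rule eventually_mono[OF eventually_nhds_in_open[of "{t / 2<..}"]]) auto

lemma summable_diff_square:
  assumes "summable (\<lambda>m. w m * (norm (x m))\<^sup>2)" "summable (\<lambda>m. w m * (norm (y m))\<^sup>2)" "\<And>m. 0 \<le> w m"
  shows "summable (\<lambda>m. w m * (norm (x m - y m :: (real ^ 3) \<times> (real ^ 3)))\<^sup>2)"
proof (rule summable_comparison_test'[OF summable_mult[OF summable_add[OF assms(1,2)], of 2]])
  fix m
  have "(norm (x m - y m))\<^sup>2 \<le> (norm (x m) + norm (y m))\<^sup>2" by (intro power_mono norm_triangle_ineq4) auto
  also have "\<dots> \<le> 2 * ((norm (x m))\<^sup>2 + (norm (y m))\<^sup>2)"
    using sum_squares_bound[of "norm (x m)" "norm (y m)"] by (simp add: power2_sum)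
  finally have "w m * (norm (x m - y m))\<^sup>2 \<le> w m * (2 * ((norm (x m))\<^sup>2 + (norm (y m))\<^sup>2))"
    by (intro mult_left_mono assms)
  then show "norm (w m * (norm (x m - y m))\<^sup>2) \<le> 2 * (w m * (norm (x m))\<^sup>2 + w m * (norm (y m))\<^sup>2)"
    using assms(3)[of m] by (simp add: algebra_simps)
qed

lemma h1norm_diff_U:
  assumes "0 \<le> s" "0 \<le> t"
  shows "h1norm L (\<lambda>x. U s x - U t x) = sqrt (\<Sum>m. V / 2 * (1 + q m) * (norm (Z s m - Z t m))\<^sup>2)"
proof -
  have "(\<lambda>m. V / 2 * ((1 + q m) * (norm (Z s m - Z t m))\<^sup>2)) sums (h1norm L (\<lambda>x. U s x - U t x))\<^sup>2"
    by (intro h1norm_sums expands_diff U_expands summable_diff_square summable_Z_q q_nonneg assms)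
  then have "(\<Sum>m. V / 2 * (1 + q m) * (norm (Z s m - Z t m))\<^sup>2) = (h1norm L (\<lambda>x. U s x - U t x))\<^sup>2"
    by (simp add: sums_iff mult.assoc)
  then show ?thesis by simp
qed

lemma h1_weight: "0 \<le> s \<Longrightarrow> V / 2 * (1 + q m) * (norm (Z s m))\<^sup>2 \<le> V / 2 * (norm (z m))\<^sup>2 + V / 2 * (q m * (norm (z m))\<^sup>2)"
proof -
  assume "0 \<le> s"
  then have "V / 2 * (1 + q m) * (norm (Z s m))\<^sup>2 \<le> V / 2 * (1 + q m) * (norm (z m))\<^sup>2"
    using V_pos q_nonneg[of m] by (intro mult_left_mono Z_le) auto
  then show ?thesis by (simp add: algebra_simps)
qed

text \<open>Continuity down to time 0: the majorant is the H1 series of the initial data, with no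
  help from smoothing.\<close>

lemma U_h1_tendsto:
  assumes "0 \<le> t"
  shows "((\<lambda>s. h1norm L (\<lambda>x. U s x - U t x)) \<longlongrightarrow> 0) (at t within {0..})"
proof (cases "at t within {0..} = bot")
  case False
  have ev: "eventually (\<lambda>s. 0 \<le> s) (at t within {0..})" by (simp add: eventually_at_filter)
  have "((\<lambda>s. \<Sum>m. (V / 2 * (1 + q m)) * (norm (Z s m - Z t m))\<^sup>2) \<longlongrightarrow> 0) (at t within {0..})"
  proof (rule weighted_tendsto[OF Z_tendsto False])
    show "0 \<le> V / 2 * (1 + q m)" for m using V_pos q_nonneg[of m] by simp
    show "summable (\<lambda>m. V / 2 * (norm (z m))\<^sup>2 + V / 2 * (q m * (norm (z m))\<^sup>2))"
      by (intro summable_add summable_mult summable_z summable_z0)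
    show "eventually (\<lambda>s. \<forall>m. V / 2 * (1 + q m) * (norm (Z s m))\<^sup>2 \<le> V / 2 * (norm (z m))\<^sup>2 + V / 2 * (q m * (norm (z m))\<^sup>2)) (at t within {0..})"
      using ev by (rule eventually_mono) (blast intro: h1_weight)
    show "V / 2 * (1 + q m) * (norm (Z t m))\<^sup>2 \<le> V / 2 * (norm (z m))\<^sup>2 + V / 2 * (q m * (norm (z m))\<^sup>2)" for m
      by (rule h1_weight[OF assms])
  qed
  from tendsto_real_sqrt[OF this]
  have "((\<lambda>s. sqrt (\<Sum>m. (V / 2 * (1 + q m)) * (norm (Z s m - Z t m))\<^sup>2)) \<longlongrightarrow> 0) (at t within {0..})" by simp
  then show ?thesis
    by (rule Lim_transform_eventually) (use ev in \<open>rule eventually_mono\<close>, simp add: h1norm_diff_U assms)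
qed simp

lemma U_VV: assumes "0 \<le> t" shows "U t \<in> VV L"
  using U_expands[OF assms] summable_Z_q[OF assms] perp_Z by (rule expands_VV)

lemma h2norm_diff_U:
  assumes "0 < s" "0 < t"
  shows "h2norm L (\<lambda>x. U s x - U t x) = sqrt (\<Sum>m. V / 2 * (1 + q m + (q m)\<^sup>2) * (norm (Z s m - Z t m))\<^sup>2)"
proof -
  have "(\<lambda>m. V / 2 * ((1 + q m + (q m)\<^sup>2) * (norm (Z s m - Z t m))\<^sup>2)) sums (h2norm L (\<lambda>x. U s x - U t x))\<^sup>2"
    using assms by (intro h2norm_sums expands_diff U_expands summable_diff_square summable_Z_power) auto
  then have "(\<Sum>m. V / 2 * (1 + q m + (q m)\<^sup>2) * (norm (Z s m - Z t m))\<^sup>2) = (h2norm L (\<lambda>x. U s x - U t x))\<^sup>2"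
    by (simp add: sums_iff mult.assoc)
  moreover have "0 \<le> h2norm L (\<lambda>x. U s x - U t x)" by (simp add: h2norm_def sum_nonneg)
  ultimately show ?thesis by simp
qed

lemma h2_weight:
  assumes "0 < t" "t \<le> s"
  shows "V / 2 * (1 + q m + (q m)\<^sup>2) * (norm (Z s m))\<^sup>2 \<le> V / 2 * (1 + 1 / (2 * t) + (1 / t)\<^sup>2) * (norm (z m))\<^sup>2"
proof -
  have "(norm (Z s m))\<^sup>2 + q m * (norm (Z s m))\<^sup>2 + (q m)\<^sup>2 * (norm (Z s m))\<^sup>2
      \<le> (norm (z m))\<^sup>2 + 1 / (2 * t) * (norm (z m))\<^sup>2 + (1 / t)\<^sup>2 * (norm (z m))\<^sup>2"
    using Z_le[of s m] Z_decay[OF assms, of m 1] Z_decay[OF assms, of m 2] assms by (intro add_mono) auto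
  then have "V / 2 * ((norm (Z s m))\<^sup>2 + q m * (norm (Z s m))\<^sup>2 + (q m)\<^sup>2 * (norm (Z s m))\<^sup>2)
      \<le> V / 2 * ((norm (z m))\<^sup>2 + 1 / (2 * t) * (norm (z m))\<^sup>2 + (1 / t)\<^sup>2 * (norm (z m))\<^sup>2)"
    using V_pos by (intro mult_left_mono) auto
  then show ?thesis by (simp add: algebra_simps)
qed

text \<open>Times near \<open>t\<close> stay above \<open>t / 2\<close>, where
  \<open>Z_decay\<close> bounds the H2 weights by a multiple of the L2 series of the initial
  data.\<close>

lemma U_h2_tendsto:
  assumes "0 < t"
  shows "((\<lambda>s. h2norm L (\<lambda>x. U t x - U s x)) \<longlongrightarrow> 0) (nhds t)"
proof -
  let ?M = "\<lambda>m. V / 2 * (1 + 1 / (2 * (t / 2)) + (1 / (t / 2))\<^sup>2) * (norm (z m))\<^sup>2"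
  have "((\<lambda>s. \<Sum>m. (V / 2 * (1 + q m + (q m)\<^sup>2)) * (norm (Z s m - Z t m))\<^sup>2) \<longlongrightarrow> 0) (nhds t)"
  proof (rule weighted_tendsto[OF Z_tendsto_nhds])
    show "0 \<le> V / 2 * (1 + q m + (q m)\<^sup>2)" for m using V_pos q_nonneg[of m] by simp
    show "summable ?M" by (intro summable_mult summable_z0)
    show "eventually (\<lambda>s. \<forall>m. V / 2 * (1 + q m + (q m)\<^sup>2) * (norm (Z s m))\<^sup>2 \<le> ?M m) (nhds t)"
      using eventually_gt_half[OF assms] by (rule eventually_mono) (use assms in \<open>blast intro: h2_weight half_gt_zero\<close>)
    show "V / 2 * (1 + q m + (q m)\<^sup>2) * (norm (Z t m))\<^sup>2 \<le> ?M m" for m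
      using assms by (intro h2_weight) auto
  qed simp
  from tendsto_real_sqrt[OF this]
  have "((\<lambda>s. sqrt (\<Sum>m. (V / 2 * (1 + q m + (q m)\<^sup>2)) * (norm (Z s m - Z t m))\<^sup>2)) \<longlongrightarrow> 0) (nhds t)" by simp
  then show ?thesis
  proof (rule Lim_transform_eventually)
    show "eventually (\<lambda>s. sqrt (\<Sum>m. (V / 2 * (1 + q m + (q m)\<^sup>2)) * (norm (Z s m - Z t m))\<^sup>2) = h2norm L (\<lambda>x. U t x - U s x)) (nhds t)"
      using eventually_gt_half[OF assms]
      by (rule eventually_mono) (use assms in \<open>simp add: h2norm_diff_U norm_minus_commute\<close>)
  qed
qed

lemma U_stokes_dom: assumes "0 < t" shows "U t \<in> stokes_dom L"
proof -
  have "0 \<le> t" using assms by simp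
  then show ?thesis
    using U_VV h2norm_sums(1)[OF U_expands summable_Z_power[OF assms, of 2]] by (simp add: stokes_dom_def)
qed

lemma h1norm_U_square: "0 \<le> t \<Longrightarrow> (h1norm L (U t))\<^sup>2 = (\<Sum>m. V / 2 * (1 + q m) * (norm (z m))\<^sup>2 * exp (- 2 * t * q m))"
  using h1norm_sums[OF U_expands summable_Z_q] by (simp add: sums_iff norm_Z_square mult_ac)

lemma gnorm_U_square: "0 \<le> t \<Longrightarrow> (gnorm L (U t))\<^sup>2 = (\<Sum>m. V / 2 * q m * (norm (z m))\<^sup>2 * exp (- 2 * t * q m))"
  using gnorm_sums[OF U_expands summable_Z_q] by (simp add: sums_iff norm_Z_square mult_ac)

lemma h2norm_U_square: "0 < t \<Longrightarrow> (h2norm L (U t))\<^sup>2 = (\<Sum>m. V / 2 * (1 + q m + (q m)\<^sup>2) * (norm (z m))\<^sup>2 * exp (- 2 * t * q m))"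
  using h2norm_sums(2)[OF U_expands summable_Z_power[of t 2]] by (simp add: sums_iff norm_Z_square mult_ac)

lemma set_integrable_cong_pos:
  fixes f g :: "real \<Rightarrow> real"
  assumes "set_integrable lebesgue {0..b} f" "\<And>t. 0 < t \<Longrightarrow> f t = g t"
  shows "set_integrable lebesgue {0..b} g"
proof -
  have "set_integrable lebesgue {0..b} f \<longleftrightarrow> set_integrable lebesgue {0..b} g"
    by (rule absolutely_integrable_spike_eq[of "{0}"]) (use assms(2) in auto)
  with assms(1) show ?thesis by simp
qed

lemma U_h1_Lp: "Lp_loc 2 (h1norm L) (VV L) U"
proof (rule Lp_locI)
  show "U t \<in> VV L" if "0 < t" for t using U_VV that by simp
  show "((\<lambda>s. h1norm L (U t - U s)) \<longlongrightarrow> 0) (nhds t)" if t: "0 < t" for t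
  proof (rule Lim_null_comparison[OF _ U_h2_tendsto[OF t]], rule always_eventually, rule allI)
    fix s
    have "h1norm L (\<lambda>x. U t x - U s x) \<le> h2norm L (\<lambda>x. U t x - U s x)"
      unfolding h2norm_def by (rule real_le_rsqrt) (simp add: sum_nonneg)
    then show "norm (h1norm L (U t - U s)) \<le> h2norm L (\<lambda>x. U t x - U s x)" by (simp add: fun_diff_def)
  qed
  fix b :: real assume "0 < b"
  have "summable (\<lambda>m. V / 2 * (1 + q m) * (norm (z m))\<^sup>2 / q m)"
  proof -
    have "summable (\<lambda>m. V / 2 * ((norm (z m))\<^sup>2 / q m) + V / 2 * (norm (z m))\<^sup>2)"
      by (intro summable_add summable_mult summable_z_div summable_z0)
    moreover have "V / 2 * ((norm (z m))\<^sup>2 / q m) + V / 2 * (norm (z m))\<^sup>2 = V / 2 * (1 + q m) * (norm (z m))\<^sup>2 / q m" for m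
      using q_pos[of m] by (simp add: field_simps)
    ultimately show ?thesis by simp
  qed
  then have "set_integrable lebesgue {0..b} (\<lambda>t. \<Sum>m. V / 2 * (1 + q m) * (norm (z m))\<^sup>2 * exp (- 2 * t * q m))"
    using \<open>0 < b\<close> V_pos q_nonneg by (intro heat_integral(1)) auto
  then show "set_integrable lebesgue {0..b} (\<lambda>t. h1norm L (U t) powr 2)"
  proof (rule set_integrable_cong_pos)
    fix t :: real assume "0 < t"
    then have "(h1norm L (U t))\<^sup>2 = (\<Sum>m. V / 2 * (1 + q m) * (norm (z m))\<^sup>2 * exp (- 2 * t * q m))"
      by (intro h1norm_U_square) simp
    moreover have "h1norm L (U t) powr 2 = (h1norm L (U t))\<^sup>2" by simp
    ultimately show "(\<Sum>m. V / 2 * (1 + q m) * (norm (z m))\<^sup>2 * exp (- 2 * t * q m)) = h1norm L (U t) powr 2"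
      by (simp only:)
  qed
qed

lemma U_h2_Lp: "Lp_loc 2 (h2norm L) (stokes_dom L) U"
proof (rule Lp_locI)
  show "U t \<in> stokes_dom L" if "0 < t" for t using U_stokes_dom that by simp
  show "((\<lambda>s. h2norm L (U t - U s)) \<longlongrightarrow> 0) (nhds t)" if t: "0 < t" for t
    using U_h2_tendsto[OF t] by (simp add: fun_diff_def)
  fix b :: real assume "0 < b"
  have "summable (\<lambda>m. V / 2 * (1 + q m + (q m)\<^sup>2) * (norm (z m))\<^sup>2 / q m)"
  proof -
    have "summable (\<lambda>m. V / 2 * ((norm (z m))\<^sup>2 / q m) + V / 2 * (norm (z m))\<^sup>2 + V / 2 * (q m * (norm (z m))\<^sup>2))"
      by (intro summable_add summable_mult summable_z_div summable_z0 summable_z)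
    moreover have "V / 2 * ((norm (z m))\<^sup>2 / q m) + V / 2 * (norm (z m))\<^sup>2 + V / 2 * (q m * (norm (z m))\<^sup>2)
        = V / 2 * (1 + q m + (q m)\<^sup>2) * (norm (z m))\<^sup>2 / q m" for m
      using q_pos[of m] by (simp add: field_simps power2_eq_square)
    ultimately show ?thesis by simp
  qed
  then have "set_integrable lebesgue {0..b} (\<lambda>t. \<Sum>m. V / 2 * (1 + q m + (q m)\<^sup>2) * (norm (z m))\<^sup>2 * exp (- 2 * t * q m))"
    using \<open>0 < b\<close> V_pos q_nonneg by (intro heat_integral(1)) auto
  then show "set_integrable lebesgue {0..b} (\<lambda>t. h2norm L (U t) powr 2)"
  proof (rule set_integrable_cong_pos)
    fix t :: real assume "0 < t"
    then have "(h2norm L (U t))\<^sup>2 = (\<Sum>m. V / 2 * (1 + q m + (q m)\<^sup>2) * (norm (z m))\<^sup>2 * exp (- 2 * t * q m))"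
      by (intro h2norm_U_square)
    moreover have "0 \<le> h2norm L (U t)" by (simp add: h2norm_def sum_nonneg)
    then have "h2norm L (U t) powr 2 = (h2norm L (U t))\<^sup>2" by simp
    ultimately show "(\<Sum>m. V / 2 * (1 + q m + (q m)\<^sup>2) * (norm (z m))\<^sup>2 * exp (- 2 * t * q m)) = h2norm L (U t) powr 2"
      by (simp only:)
  qed
qed

text \<open>An equality in every mode: the rotation preserves the norm of the coefficients, and
  integrating \<open>q m * exp (- 2 * t * q m)\<close> gives half the decrease of the
  exponential.\<close>

lemma U_energy:
  assumes "0 \<le> t0" "t0 \<le> t"
  shows "(l2norm L (U t))\<^sup>2 / 2 + (LINT \<tau>:{t0..t}|lebesgue. (gnorm L (U \<tau>))\<^sup>2) = (l2norm L (U t0))\<^sup>2 / 2"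
proof -
  let ?c = "\<lambda>m. V / 2 * q m * (norm (z m))\<^sup>2"
  have "?c m / q m = V / 2 * (norm (z m))\<^sup>2" for m using q_pos[of m] by simp
  then have "summable (\<lambda>m. ?c m / q m)" using summable_z0 by (simp only: summable_mult)
  then have "(\<lambda>m. ?c m * (exp (- 2 * t0 * q m) - exp (- 2 * t * q m)) / (2 * q m)) sums
      (LINT \<tau>:{t0..t}|lebesgue. \<Sum>m. ?c m * exp (- 2 * \<tau> * q m))"
    using assms V_pos q_nonneg by (intro heat_integral(2)) auto
  moreover have "(LINT \<tau>:{t0..t}|lebesgue. \<Sum>m. ?c m * exp (- 2 * \<tau> * q m)) = (LINT \<tau>:{t0..t}|lebesgue. (gnorm L (U \<tau>))\<^sup>2)"
    using assms by (intro set_lebesgue_integral_cong) (auto simp: gnorm_U_square)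
  moreover have "(\<lambda>m. (V / 2 * (norm (Z t0 m))\<^sup>2) / 2 - (V / 2 * (norm (Z t m))\<^sup>2) / 2) sums ((l2norm L (U t0))\<^sup>2 / 2 - (l2norm L (U t))\<^sup>2 / 2)"
    using assms by (intro sums_diff sums_divide expands_l2norm_sums U_expands) auto
  moreover have "(V / 2 * (norm (Z t0 m))\<^sup>2) / 2 - (V / 2 * (norm (Z t m))\<^sup>2) / 2
      = ?c m * (exp (- 2 * t0 * q m) - exp (- 2 * t * q m)) / (2 * q m)" for m
    using q_pos[of m] by (simp add: norm_Z_square field_simps)
  ultimately have "(LINT \<tau>:{t0..t}|lebesgue. (gnorm L (U \<tau>))\<^sup>2) = (l2norm L (U t0))\<^sup>2 / 2 - (l2norm L (U t))\<^sup>2 / 2"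
    using sums_unique2 by simp
  then show ?thesis by simp
qed

end

section \<open>The terms of the weak formulation and the dual norm\<close>

context torus3_mode
begin

text \<open>Neither field is smooth, but the partial sums of \<open>f\<close> are test fields for
  the weak derivative of \<open>w\<close>; the identity passes to the limit in L2.\<close>

lemma ip_wpartial_right:
  assumes f: "expands y f" and y: "summable (\<lambda>m. q m * (norm (y m))\<^sup>2)" and w: "w \<in> H1 L"
  shows "ip L f (wpartial L j w) = - ip L (wpartial L j f) w"
proof -
  have "(\<lambda>N. ip L (partial_modes N y) (wpartial L j w)) \<longlonglongrightarrow> ip L f (wpartial L j w)"
    by (rule tendsto_ip_left) (use f w in \<open>auto simp: expands_def partial_modes_L2 wpartial_L2\<close>)
  moreover have "(\<lambda>N. - ip L (partial_modes N (\<lambda>m. dz j m (y m))) w) \<longlonglongrightarrow> - ip L (wpartial L j f) w"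
    by (rule tendsto_minus, rule tendsto_ip_left)
      (use expands_wpartial[OF f y, of j] w in \<open>auto simp: expands_def partial_modes_L2 H1_L2\<close>)
  moreover have "ip L (partial_modes N y) (wpartial L j w) = - ip L (partial_modes N (\<lambda>m. dz j m (y m))) w" for N
    using ip_wpartial[OF w partial_modes_sfield, of j N y]
    by (simp add: fpart_partial_modes ip_commute[of L w] ip_commute[of L "wpartial L j w"])
  ultimately show ?thesis using LIMSEQ_unique by simp
qed

text \<open>The sum of the second derivatives of \<open>f\<close> has coefficients
  \<open>- q m *\<^sub>R y m\<close>, so one integration by parts moves all derivatives from
  \<open>w\<close> to \<open>f\<close>.\<close>

lemma gip_eq_ip:
  assumes f: "expands y f" and y: "summable (\<lambda>m. (q m)\<^sup>2 * (norm (y m))\<^sup>2)" and w: "w \<in> H1 L"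
    and g: "expands (\<lambda>m. q m *\<^sub>R y m) g"
  shows "gip L f w = ip L g w"
proof -
  have y1: "summable (\<lambda>m. q m * (norm (y m))\<^sup>2)"
  proof (rule summable_q)
    show "summable (\<lambda>m. q m * (q m * (norm (y m))\<^sup>2))" using y by (simp add: power2_eq_square mult.assoc)
  qed (simp add: q_nonneg)
  note d = expands_wpartial[OF f y1]
  note dd = expands_wpartial[OF d summable_q_dz[OF y]]
  let ?s = "\<lambda>x. \<Sum>j\<in>UNIV. 1 *\<^sub>R wpartial L j (wpartial L j f) x"
  have "expands (\<lambda>m. \<Sum>j\<in>UNIV. 1 *\<^sub>R dz j m (dz j m (y m))) ?s"
    by (intro expands_sum dd)
  moreover have "(\<Sum>j\<in>UNIV. 1 *\<^sub>R dz j m (dz j m (y m))) = (- 1) *\<^sub>R q m *\<^sub>R y m" for m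
  proof -
    have "(\<Sum>j\<in>UNIV. 1 *\<^sub>R dz j m (dz j m (y m))) = (\<Sum>j\<in>UNIV. - ((p m)\<^sup>2 * (\<kappa> $ j)\<^sup>2)) *\<^sub>R y m"
      unfolding scaleR_sum_left by (simp add: dz_dz power2_eq_square mult.assoc)
    also have "(\<Sum>j\<in>UNIV. - ((p m)\<^sup>2 * (\<kappa> $ j)\<^sup>2)) = - q m"
      by (simp add: sum_negf sum_distrib_left[symmetric] sum_\<kappa>_square q_def)
    finally show ?thesis by simp
  qed
  ultimately have "expands (\<lambda>m. (- 1) *\<^sub>R q m *\<^sub>R y m) ?s" by (simp only:)
  from expands_unique[OF this expands_scaleR[OF g, of "- 1"]]
  have e: "eqae L ?s (\<lambda>x. (- 1) *\<^sub>R g x)" .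
  have "gip L f w = (\<Sum>j\<in>UNIV. - ip L (wpartial L j (wpartial L j f)) w)"
    unfolding gip_def by (intro sum.cong refl ip_wpartial_right[OF d summable_q_dz[OF y] w])
  also have "\<dots> = - ip L ?s w"
    using expands_L2[OF dd] w by (simp add: ip_sum_left H1_L2 sum_negf)
  also have "ip L ?s w = ip L (\<lambda>x. (- 1) *\<^sub>R g x) w"
    by (rule ip_cong[OF e eqae_refl])
      (use expands_L2[OF dd] expands_L2[OF g] w in \<open>auto intro!: L2_sum L2_minus simp: H1_L2\<close>)
  finally show ?thesis by (simp add: ip_minus_left)
qed

text \<open>
  A field with modes parallel to \<open>\<kappa>\<close> varies only in the direction \<open>\<kappa>\<close> and takes values orthogonal to
  \<open>\<kappa>\<close>, so that its convective derivative along itself vanishes.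
\<close>

lemma trilin_self_zero:
  assumes f: "expands y f" and y: "summable (\<lambda>m. q m * (norm (y m))\<^sup>2)" "\<And>m. perp (y m)"
  shows "trilin L f f w = 0"
proof -
  \<comment> \<open>The scalar \<open>f x \<bullet> \<kappa>\<close> is stored in one component of a
    field, so that the calculus of expansions shows that it vanishes almost everywhere.\<close>
  have bl: "bounded_linear (\<lambda>a. (a \<bullet> \<kappa>) *\<^sub>R axis 1 1 :: real ^ 3)"
    by (intro bounded_linear_scaleR_const bounded_linear_inner_left)
  have "expands (\<lambda>m. 0) (\<lambda>x. (f x \<bullet> \<kappa>) *\<^sub>R axis 1 1)"
    using expands_linear_map[OF f bl] y(2) by (simp add: perp_def zero_prod_def)
  from expands_unique[OF this expands_zero]
  have orth: "AE x in torus L. f x \<bullet> \<kappa> = 0"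
    unfolding eqae_def by (rule eventually_mono) (simp add: axis_eq_0_iff)
  \<comment> \<open>The coefficients of the derivative of \<open>f\<close> with respect to the phase
    \<open>\<kappa> \<bullet> x\<close>; every partial derivative is a multiple of this one
    field.\<close>
  let ?y = "\<lambda>m. p m *\<^sub>R (snd (y m), - fst (y m))"
  have "(norm (?y m))\<^sup>2 = 1 / (\<kappa> \<bullet> \<kappa>) * (q m * (norm (y m))\<^sup>2)" for m
  proof -
    have "(norm (snd (y m), - fst (y m)))\<^sup>2 = (norm (y m))\<^sup>2" by (simp add: norm_prod_def)
    then show ?thesis unfolding norm_scaleR using \<kappa>_pos by (simp add: power_mult_distrib q_def)
  qed
  then have "summable (\<lambda>m. (norm (?y m))\<^sup>2)" using summable_mult[OF y(1)] by (simp only:)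
  from Riesz_Fischer[OF this] obtain \<psi> where \<psi>: "expands ?y \<psi>" by (rule exE)
  have "eqae L (wpartial L j f) (\<lambda>x. \<kappa> $ j *\<^sub>R \<psi> x)" for j
  proof (rule expands_unique[OF expands_wpartial[OF f y(1)]])
    show "expands (\<lambda>m. dz j m (y m)) (\<lambda>x. \<kappa> $ j *\<^sub>R \<psi> x)"
      using expands_scaleR[OF \<psi>, of "\<kappa> $ j"] by (simp add: dz_def mult.commute)
  qed
  then have "AE x in torus L. \<forall>j. wpartial L j f x = \<kappa> $ j *\<^sub>R \<psi> x"
    unfolding eqae_def by (simp add: AE_all_countable)
  with orth have "AE x in torus L. (\<Sum>i\<in>UNIV. f x $ i *\<^sub>R wpartial L i f x) \<bullet> w x = 0"
  proof (rule eventually_elim2)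
    fix x assume o: "f x \<bullet> \<kappa> = 0" and d: "\<forall>j. wpartial L j f x = \<kappa> $ j *\<^sub>R \<psi> x"
    have "(\<Sum>i\<in>UNIV. f x $ i *\<^sub>R wpartial L i f x) = (f x \<bullet> \<kappa>) *\<^sub>R \<psi> x"
      using d by (simp add: inner_vec_def scaleR_sum_left)
    with o show "(\<Sum>i\<in>UNIV. f x $ i *\<^sub>R wpartial L i f x) \<bullet> w x = 0" by simp
  qed
  then show ?thesis unfolding trilin_def by (rule integral_eq_zero_AE)
qed

lemma zero_VV: "(\<lambda>x. 0) \<in> VV L"
  by (rule expands_VV[OF expands_zero]) (simp_all add: perp_0)

lemma h1norm_zero: "h1norm L (\<lambda>x. 0) = 0"
  using h1norm_sums[OF expands_zero] by (simp add: sums_0 sums_iff)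

lemma ip_le_h1norm:
  assumes "F \<in> L2 L" "w \<in> VV L" shows "\<bar>ip L F w\<bar> \<le> l2norm L F * h1norm L w"
proof -
  have "\<bar>ip L F w\<bar> \<le> l2norm L F * l2norm L w" by (intro ip_Cauchy_Schwarz assms VV_L2)
  also have "\<dots> \<le> l2norm L F * h1norm L w" by (intro mult_left_mono l2norm_le_h1norm l2norm_nonneg)
  finally show ?thesis .
qed

text \<open>\<open>dual_norm\<close> is a supremum of reals, so its estimates require a bounded
  family and a nonempty unit ball; the Cauchy-Schwarz inequality and the zero field provide
  these.\<close>

lemma dual_norm_ip:
  assumes "F \<in> L2 L" "F' \<in> L2 L"
  shows dual_norm_bdd: "bdd_above ((\<lambda>w. \<bar>ip L F w\<bar>) ` {w \<in> VV L. h1norm L w \<le> 1})"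
    and dual_norm_nonneg: "0 \<le> dual_norm L (ip L F)"
    and dual_norm_triangle: "dual_norm L (ip L F) \<le> dual_norm L (ip L F') + l2norm L (\<lambda>x. F x - F' x)"
proof -
  let ?S = "{w \<in> VV L. h1norm L w \<le> 1}"
  have le: "\<bar>ip L F w\<bar> \<le> l2norm L F" if "F \<in> L2 L" "w \<in> ?S" for F w
    using ip_le_h1norm[OF that(1), of w] that mult_left_mono[of "h1norm L w" 1 "l2norm L F"] by auto
  have bdd: "bdd_above ((\<lambda>w. \<bar>ip L F w\<bar>) ` ?S)" if "F \<in> L2 L" for F
    using le[OF that] by (intro bdd_aboveI[of _ "l2norm L F"]) auto
  show "bdd_above ((\<lambda>w. \<bar>ip L F w\<bar>) ` ?S)" by (rule bdd[OF assms(1)])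
  have z: "(\<lambda>x. 0) \<in> ?S" using zero_VV h1norm_zero by simp
  have "\<bar>ip L F (\<lambda>x. 0)\<bar> \<le> dual_norm L (ip L F)"
    unfolding dual_norm_def by (rule cSUP_upper[OF z bdd[OF assms(1)]])
  then show "0 \<le> dual_norm L (ip L F)" by simp
  show "dual_norm L (ip L F) \<le> dual_norm L (ip L F') + l2norm L (\<lambda>x. F x - F' x)"
    unfolding dual_norm_def[of L "ip L F"]
  proof (rule cSUP_least)
    show "?S \<noteq> {}" using z by blast
    fix w assume w: "w \<in> ?S"
    have "ip L F w = ip L F' w + ip L (\<lambda>x. F x - F' x) w"
      using assms w by (simp add: ip_diff_left VV_L2)
    moreover have "\<bar>ip L F' w\<bar> \<le> dual_norm L (ip L F')"
      unfolding dual_norm_def by (rule cSUP_upper[OF w bdd[OF assms(2)]])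
    moreover have "\<bar>ip L (\<lambda>x. F x - F' x) w\<bar> \<le> l2norm L (\<lambda>x. F x - F' x)"
      by (rule le[OF L2_diff[OF assms] w])
    ultimately show "\<bar>ip L F w\<bar> \<le> dual_norm L (ip L F') + l2norm L (\<lambda>x. F x - F' x)" by linarith
  qed
qed

lemma dual_norm_diff_le:
  assumes "F \<in> L2 L" "F' \<in> L2 L"
  shows "dual_norm L (ip L F - ip L F') \<le> l2norm L (\<lambda>x. F x - F' x)" "0 \<le> dual_norm L (ip L F - ip L F')"
proof -
  let ?d = "\<lambda>x. F x - F' x" and ?S = "{w \<in> VV L. h1norm L w \<le> 1}"
  have d: "?d \<in> L2 L" by (rule L2_diff[OF assms])
  have "(\<lambda>w. \<bar>(ip L F - ip L F') w\<bar>) ` ?S = (\<lambda>w. \<bar>ip L ?d w\<bar>) ` ?S"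
    using assms by (intro image_cong refl) (simp add: ip_diff_left VV_L2)
  then have e: "dual_norm L (ip L F - ip L F') = dual_norm L (ip L ?d)" by (simp add: dual_norm_def)
  have "ip L (\<lambda>x. 0) = (\<lambda>w. 0)" by (rule ext) simp
  moreover have "{w \<in> VV L. h1norm L w \<le> 1} \<noteq> {}" using zero_VV h1norm_zero by force
  ultimately have "dual_norm L (ip L (\<lambda>x. 0)) = 0" by (simp add: dual_norm_def)
  then show "dual_norm L (ip L F - ip L F') \<le> l2norm L ?d"
    using dual_norm_triangle[OF d L2_zero] e by simp
  show "0 \<le> dual_norm L (ip L F - ip L F')" unfolding e by (rule dual_norm_nonneg[OF d d])
qed

lemma ip_VV_dual: "F \<in> L2 L \<Longrightarrow> ip L F \<in> VV_dual L"
  unfolding VV_dual_def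
  by (auto simp: ip_add_right VV_L2 ip_scaleR_right intro!: exI[of _ "l2norm L F"] ip_le_h1norm)

end

section \<open>Time derivative and regularity of the explicit solution\<close>

context torus3_solution
begin

text \<open>\<open>G\<close> is the time derivative of the explicit solution.\<close>

definition G :: "real \<Rightarrow> field3" where
  "G t = (if 0 < t then SOME f. expands (dZ t) f else (\<lambda>x. 0))"

lemma summable_dZ: "0 < t \<Longrightarrow> summable (\<lambda>m. (norm (dZ t m))\<^sup>2)"
  using summable_add[OF summable_Z_power[of t 2] summable_mult[OF summable_Z_power[of t 0], of "(\<Omega> * \<omega>)\<^sup>2"]]
  by (simp add: norm_dZ_square algebra_simps)

lemma G_expands: "0 < t \<Longrightarrow> expands (dZ t) (G t)"
  using someI_ex[OF Riesz_Fischer[OF summable_dZ]] by (simp add: G_def)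

lemma perp_dZ: "perp (dZ t m)"
  unfolding dZ_def by (intro perp_uminus perp_add perp_scaleR perp_Z TT_perp)

lemma G_HH: "G t \<in> HH L"
  using expands_HH[OF G_expands perp_dZ] HH_zero by (cases "0 < t") (auto simp: G_def)

lemma G_L2: "G t \<in> L2 L"
  by (rule HH_L2[OF G_HH])

lemma dZ_bound:
  assumes "0 < t" "t \<le> s"
  shows "(norm (dZ s m))\<^sup>2 \<le> ((1 / t)\<^sup>2 + (\<Omega> * \<omega>)\<^sup>2) * (norm (z m))\<^sup>2"
proof -
  have "(q m)\<^sup>2 * (norm (Z s m))\<^sup>2 + (\<Omega> * \<omega>)\<^sup>2 * (norm (Z s m))\<^sup>2 \<le> (1 / t)\<^sup>2 * (norm (z m))\<^sup>2 + (\<Omega> * \<omega>)\<^sup>2 * (norm (z m))\<^sup>2"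
    using Z_decay[OF assms, of m 2] Z_le[of s m] assms by (intro add_mono mult_left_mono) auto
  then show ?thesis by (simp add: norm_dZ_square algebra_simps)
qed

lemma G_tendsto:
  assumes "0 < t"
  shows "((\<lambda>s. l2norm L (\<lambda>x. G t x - G s x)) \<longlongrightarrow> 0) (nhds t)"
proof -
  let ?M = "\<lambda>m. V / 2 * (((1 / (t / 2))\<^sup>2 + (\<Omega> * \<omega>)\<^sup>2) * (norm (z m))\<^sup>2)"
  have "((\<lambda>s. \<Sum>m. V / 2 * (norm (dZ s m - dZ t m))\<^sup>2) \<longlongrightarrow> 0) (nhds t)"
  proof (rule weighted_tendsto[OF dZ_tendsto_nhds])
    show "0 \<le> V / 2" using V_pos by simp
    show "summable ?M" by (intro summable_mult summable_z0)
    have b: "V / 2 * (norm (dZ s m))\<^sup>2 \<le> ?M m" if "t / 2 \<le> s" for s m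
      using dZ_bound[OF half_gt_zero[OF assms] that, of m] V_pos by (intro mult_left_mono) auto
    show "eventually (\<lambda>s. \<forall>m. V / 2 * (norm (dZ s m))\<^sup>2 \<le> ?M m) (nhds t)"
      using eventually_gt_half[OF assms] by (rule eventually_mono) (blast intro: b)
    show "V / 2 * (norm (dZ t m))\<^sup>2 \<le> ?M m" for m using assms by (intro b) simp
  qed simp
  from tendsto_real_sqrt[OF this]
  have "((\<lambda>s. sqrt (\<Sum>m. V / 2 * (norm (dZ s m - dZ t m))\<^sup>2)) \<longlongrightarrow> 0) (nhds t)" by simp
  then show ?thesis
  proof (rule Lim_transform_eventually)
    show "eventually (\<lambda>s. sqrt (\<Sum>m. V / 2 * (norm (dZ s m - dZ t m))\<^sup>2) = l2norm L (\<lambda>x. G t x - G s x)) (nhds t)"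
      using eventually_gt_half[OF assms]
    proof (rule eventually_mono)
      fix s assume "t / 2 \<le> s"
      then have "0 < s" using assms by simp
      then have "(\<lambda>m. V / 2 * (norm (dZ s m - dZ t m))\<^sup>2) sums (l2norm L (\<lambda>x. G s x - G t x))\<^sup>2"
        using assms by (intro expands_l2norm_sums expands_diff G_expands)
      then have "(\<Sum>m. V / 2 * (norm (dZ s m - dZ t m))\<^sup>2) = (l2norm L (\<lambda>x. G s x - G t x))\<^sup>2"
        by (simp add: sums_iff)
      then show "sqrt (\<Sum>m. V / 2 * (norm (dZ s m - dZ t m))\<^sup>2) = l2norm L (\<lambda>x. G t x - G s x)"
        by (simp add: l2norm_minus_commute[of L "G t"])
    qed
  qed
qed

text \<open>A majorant for the difference quotients, independent of \<open>h\<close>. From time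
  \<open>t / 2\<close> on the derivative is bounded by \<open>B\<close>; the deviation from the
  linearization contributes \<open>2 * B\<close> and the linear part \<open>B\<close>, and 9 is the
  square of this factor 3.\<close>

lemma Z_quotient_bound:
  assumes t: "0 < t" and h: "\<bar>h\<bar> \<le> t / 2"
  shows "(norm ((Z (t + h) m - Z t m) /\<^sub>R h))\<^sup>2 \<le> 9 * (((1 / (t / 2))\<^sup>2 + (\<Omega> * \<omega>)\<^sup>2) * (norm (z m))\<^sup>2)"
proof -
  define B where "B = sqrt (((1 / (t / 2))\<^sup>2 + (\<Omega> * \<omega>)\<^sup>2) * (norm (z m))\<^sup>2)"
  have b: "norm (dZ s m) \<le> B" if "t / 2 \<le> s" for s
    unfolding B_def using dZ_bound[OF half_gt_zero[OF t] that, of m] by (rule real_le_rsqrt)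
  have B0: "0 \<le> B" by (simp add: B_def)
  have "norm (Z (t + h) m - Z t m - (t + h - t) *\<^sub>R dZ t m) \<le> norm (t + h - t) * (2 * B)"
  proof (rule vector_differentiable_bound_linearization[where S="{t / 2..}"])
    show "((\<lambda>s. Z s m) has_vector_derivative dZ s m) (at s within {t / 2..})" for s
      by (rule has_vector_derivative_at_within[OF Z_has_vector_derivative])
    show "closed_segment t (t + h) \<subseteq> {t / 2..}" using h t by (auto simp: closed_segment_eq_real_ivl)
    show "norm (dZ s m - dZ t m) \<le> 2 * B" if "s \<in> {t / 2..}" for s
      using norm_triangle_ineq4[of "dZ s m" "dZ t m"] b[of s] b[of t] that t by simp
  qed (use t in simp)
  then have "norm (Z (t + h) m - Z t m - h *\<^sub>R dZ t m) \<le> \<bar>h\<bar> * (2 * B)" by simp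
  moreover have "\<bar>h\<bar> * norm (dZ t m) \<le> \<bar>h\<bar> * B" using b[of t] t by (intro mult_left_mono) auto
  ultimately have X: "norm (Z (t + h) m - Z t m) \<le> \<bar>h\<bar> * (2 * B) + \<bar>h\<bar> * B"
    using norm_triangle_ineq2[of "Z (t + h) m - Z t m" "h *\<^sub>R dZ t m"] unfolding norm_scaleR real_norm_def by linarith
  have "norm ((Z (t + h) m - Z t m) /\<^sub>R h) \<le> 3 * B"
  proof (cases "h = 0")
    case False
    moreover have "norm ((Z (t + h) m - Z t m) /\<^sub>R h) = norm (Z (t + h) m - Z t m) / \<bar>h\<bar>"
      unfolding norm_scaleR by (simp add: divide_inverse mult.commute)
    ultimately show ?thesis using X by (simp add: divide_le_eq algebra_simps)
  qed (use B0 in simp)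
  then have "(norm ((Z (t + h) m - Z t m) /\<^sub>R h))\<^sup>2 \<le> (3 * B)\<^sup>2" by (intro power_mono) auto
  then show ?thesis by (simp add: B_def power_mult_distrib)
qed

lemma eventually_small: "0 < t \<Longrightarrow> eventually (\<lambda>h. \<bar>h\<bar> \<le> t / 2) (at 0)" for t :: real
  unfolding eventually_at by (intro exI[of _ "t / 2"]) (auto simp: dist_real_def)

text \<open>Any field with coefficients \<open>dZ t\<close> is allowed as limit, because both the
  chosen derivative \<open>G t\<close> and the right-hand side of the linear equation are needed in
  this place.\<close>

lemma U_quotient_tendsto:
  assumes t: "0 < t" and g: "expands (dZ t) g"
  shows "((\<lambda>h. l2norm L (\<lambda>x. (U (t + h) x - U t x) /\<^sub>R h - g x)) \<longlongrightarrow> 0) (at 0)"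
proof -
  let ?K = "((1 / (t / 2))\<^sup>2 + (\<Omega> * \<omega>)\<^sup>2)"
  let ?M = "\<lambda>m. V / 2 * (9 * (?K * (norm (z m))\<^sup>2))"
  let ?y = "\<lambda>h m. (Z (t + h) m - Z t m) /\<^sub>R h"
  have "((\<lambda>h. \<Sum>m. V / 2 * (norm (?y h m - dZ t m))\<^sup>2) \<longlongrightarrow> 0) (at 0)"
  proof (rule weighted_tendsto)
    show "((\<lambda>h. ?y h m) \<longlongrightarrow> dZ t m) (at 0)" for m
    proof -
      have "((\<lambda>s. Z s m) has_derivative (\<lambda>h. h *\<^sub>R dZ t m)) (at t)"
        using Z_has_vector_derivative[where m=m and t=t] by (simp add: has_vector_derivative_def)
      then have l: "(\<lambda>h. norm (Z (t + h) m - Z t m - h *\<^sub>R dZ t m) / norm h) \<midarrow>0\<rightarrow> 0" by (simp add: has_derivative_at)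
      have "norm (Z (t + h) m - Z t m - h *\<^sub>R dZ t m) / norm h = norm (?y h m - dZ t m)" if "h \<noteq> 0" for h
      proof -
        have "?y h m - dZ t m = (Z (t + h) m - Z t m - h *\<^sub>R dZ t m) /\<^sub>R h"
          using that by (simp add: scaleR_diff_right)
        then show ?thesis by (simp add: divide_inverse mult.commute)
      qed
      then have "eventually (\<lambda>h. norm (Z (t + h) m - Z t m - h *\<^sub>R dZ t m) / norm h = norm (?y h m - dZ t m)) (at 0)"
        by (simp add: eventually_at_filter)
      with l have "((\<lambda>h. norm (?y h m - dZ t m)) \<longlongrightarrow> 0) (at 0)"
        by (rule Lim_transform_eventually)
      then show ?thesis by (simp add: tendsto_norm_zero_iff LIM_zero_iff)
    qed
    show "0 \<le> V / 2" using V_pos by simp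
    show "summable ?M" by (intro summable_mult summable_z0)
    show "eventually (\<lambda>h. \<forall>m. V / 2 * (norm (?y h m))\<^sup>2 \<le> ?M m) (at 0)"
      using eventually_small[OF t]
    proof (rule eventually_mono, intro allI)
      fix h m assume "\<bar>h\<bar> \<le> t / 2"
      then show "V / 2 * (norm (?y h m))\<^sup>2 \<le> ?M m"
        using V_pos by (intro mult_left_mono Z_quotient_bound t) auto
    qed
    show "V / 2 * (norm (dZ t m))\<^sup>2 \<le> ?M m" for m
    proof -
      have "(norm (dZ t m))\<^sup>2 \<le> ?K * (norm (z m))\<^sup>2" using t by (intro dZ_bound) auto
      also have "\<dots> \<le> 9 * (?K * (norm (z m))\<^sup>2)" by simp
      finally show ?thesis using V_pos by (intro mult_left_mono) auto
    qed
  qed simp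
  from tendsto_real_sqrt[OF this]
  have "((\<lambda>h. sqrt (\<Sum>m. V / 2 * (norm (?y h m - dZ t m))\<^sup>2)) \<longlongrightarrow> 0) (at 0)" by simp
  then show ?thesis
  proof (rule Lim_transform_eventually)
    show "eventually (\<lambda>h. sqrt (\<Sum>m. V / 2 * (norm (?y h m - dZ t m))\<^sup>2) = l2norm L (\<lambda>x. (U (t + h) x - U t x) /\<^sub>R h - g x)) (at 0)"
      using eventually_small[OF t]
    proof (rule eventually_mono)
      fix h assume "\<bar>h\<bar> \<le> t / 2"
      then have "0 \<le> t + h" using t by linarith
      then have "(\<lambda>m. V / 2 * (norm (?y h m - dZ t m))\<^sup>2) sums (l2norm L (\<lambda>x. (U (t + h) x - U t x) /\<^sub>R h - g x))\<^sup>2"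
        using t g by (intro expands_l2norm_sums expands_diff expands_scaleR U_expands) auto
      then have "(\<Sum>m. V / 2 * (norm (?y h m - dZ t m))\<^sup>2) = (l2norm L (\<lambda>x. (U (t + h) x - U t x) /\<^sub>R h - g x))\<^sup>2"
        by (simp add: sums_iff)
      then show "sqrt (\<Sum>m. V / 2 * (norm (?y h m - dZ t m))\<^sup>2) = l2norm L (\<lambda>x. (U (t + h) x - U t x) /\<^sub>R h - g x)" by simp
    qed
  qed
qed

lemma coriolis_U: "0 \<le> t \<Longrightarrow> expands (\<lambda>m. \<omega> *\<^sub>R TT (Z t m)) (coriolis L (U t))"
  by (rule coriolis_expands[OF U_expands perp_Z])

lemma stokes_U: assumes "0 < t" shows "expands (\<lambda>m. q m *\<^sub>R Z t m) (stokes L (U t))"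
proof (rule stokes_expands)
  show "summable (\<lambda>m. q m * (q m * norm (Z t m))\<^sup>2)"
    using summable_Z_power[OF assms, of 3] by (simp add: power_mult_distrib power3_eq_cube power2_eq_square mult_ac)
qed (use assms U_expands in simp)

lemma rhs_U:
  assumes "0 < t"
  shows "expands (dZ t) (\<lambda>x. - (stokes L (U t) x + \<Omega> *\<^sub>R coriolis L (U t) x))"
proof -
  have "expands (\<lambda>m. (- 1) *\<^sub>R (q m *\<^sub>R Z t m) + (- \<Omega>) *\<^sub>R (\<omega> *\<^sub>R TT (Z t m)))
      (\<lambda>x. (- 1) *\<^sub>R stokes L (U t) x + (- \<Omega>) *\<^sub>R coriolis L (U t) x)"
    using assms by (intro expands_lincomb stokes_U coriolis_U) auto
  then show ?thesis by (simp add: dZ_def[abs_def])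
qed

lemma U_solves_linear: "solves_linear L \<Omega> U"
  unfolding solves_linear_def
proof (intro allI impI conjI)
  fix t :: real assume t: "0 < t"
  show "U t \<in> stokes_dom L" by (rule U_stokes_dom[OF t])
  show "((\<lambda>h. l2norm L (\<lambda>x. (U (t + h) x - U t x) /\<^sub>R h + stokes L (U t) x + \<Omega> *\<^sub>R coriolis L (U t) x)) \<longlongrightarrow> 0) (at 0)"
    using U_quotient_tendsto[OF t rhs_U[OF t]] by (simp only: diff_minus_eq_add add.assoc)
qed

lemma ip_U_derivative:
  assumes t: "0 < t" and w: "w \<in> L2 L"
  shows "((\<lambda>t. ip L (U t) w) has_real_derivative ip L (G t) w) (at t)"
  unfolding DERIV_def
proof -
  have lim: "((\<lambda>h. l2norm L (\<lambda>x. (U (t + h) x - U t x) /\<^sub>R h - G t x) * l2norm L w) \<longlongrightarrow> 0) (at 0)"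
    using tendsto_mult_right[OF U_quotient_tendsto[OF t G_expands[OF t]], of "l2norm L w"] by simp
  have "((\<lambda>h. (ip L (U (t + h)) w - ip L (U t) w) / h - ip L (G t) w) \<longlongrightarrow> 0) (at 0)"
  proof (rule Lim_null_comparison[OF _ lim])
    show "eventually (\<lambda>h. norm ((ip L (U (t + h)) w - ip L (U t) w) / h - ip L (G t) w)
        \<le> l2norm L (\<lambda>x. (U (t + h) x - U t x) /\<^sub>R h - G t x) * l2norm L w) (at 0)"
      using eventually_small[OF t]
    proof (rule eventually_mono)
      fix h assume "\<bar>h\<bar> \<le> t / 2"
      then have "0 \<le> t + h" "0 \<le> t" using t by linarith+
      then have L2s: "U (t + h) \<in> L2 L" "U t \<in> L2 L" using U_expands expands_L2 by blast+
      have "(ip L (U (t + h)) w - ip L (U t) w) / h - ip L (G t) w = ip L (\<lambda>x. (U (t + h) x - U t x) /\<^sub>R h - G t x) w"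
        using L2s w G_L2[of t] by (simp add: ip_diff_left L2_diff L2_scaleR ip_scaleR_left divide_inverse mult.commute)
      then show "norm ((ip L (U (t + h)) w - ip L (U t) w) / h - ip L (G t) w)
          \<le> l2norm L (\<lambda>x. (U (t + h) x - U t x) /\<^sub>R h - G t x) * l2norm L w"
        using ip_Cauchy_Schwarz[of "\<lambda>x. (U (t + h) x - U t x) /\<^sub>R h - G t x" L w] L2s w G_L2[of t]
        by (simp add: L2_diff L2_scaleR)
    qed
  qed
  then show "(\<lambda>h. (ip L (U (t + h)) w - ip L (U t) w) / h) \<midarrow>0\<rightarrow> ip L (G t) w"
    by (simp add: LIM_zero_iff)
qed

lemma ip_G_continuous: assumes "w \<in> L2 L" shows "continuous_on {0<..} (\<lambda>t. ip L (G t) w)"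
proof (rule continuous_at_imp_continuous_on, rule ballI)
  fix t :: real assume t: "t \<in> {0<..}"
  have "((\<lambda>s. ip L (G s) w) \<longlongrightarrow> ip L (G t) w) (nhds t)"
    using t G_tendsto by (intro tendsto_ip_left G_L2 assms) auto
  then show "isCont (\<lambda>t. ip L (G t) w) t" by (simp add: isCont_def tendsto_nhds_iff)
qed

lemma ip_U_continuous: assumes "w \<in> L2 L" shows "continuous_on {0..} (\<lambda>t. ip L (U t) w)"
  unfolding continuous_on_def
proof
  fix t :: real assume t: "t \<in> {0..}"
  have lim: "((\<lambda>s. h1norm L (\<lambda>x. U s x - U t x) * l2norm L w) \<longlongrightarrow> 0) (at t within {0..})"
    using tendsto_mult_right[OF U_h1_tendsto, of t "l2norm L w"] t by simp
  have "((\<lambda>s. ip L (U s) w - ip L (U t) w) \<longlongrightarrow> 0) (at t within {0..})"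
  proof (rule Lim_null_comparison[OF _ lim])
    have "norm (ip L (U s) w - ip L (U t) w) \<le> h1norm L (\<lambda>x. U s x - U t x) * l2norm L w" if "0 \<le> s" for s
    proof -
      have L2s: "U s \<in> L2 L" "U t \<in> L2 L" using U_expands expands_L2 t that by auto
      have "\<bar>ip L (\<lambda>x. U s x - U t x) w\<bar> \<le> l2norm L (\<lambda>x. U s x - U t x) * l2norm L w"
        by (intro ip_Cauchy_Schwarz L2_diff L2s assms)
      also have "\<dots> \<le> h1norm L (\<lambda>x. U s x - U t x) * l2norm L w"
        by (intro mult_right_mono l2norm_le_h1norm l2norm_nonneg)
      finally show ?thesis using L2s assms by (simp add: ip_diff_left)
    qed
    then show "eventually (\<lambda>s. norm (ip L (U s) w - ip L (U t) w) \<le> h1norm L (\<lambda>x. U s x - U t x) * l2norm L w) (at t within {0..})"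
      by (simp add: eventually_at_filter)
  qed
  then show "((\<lambda>s. ip L (U s) w) \<longlongrightarrow> ip L (U t) w) (at t within {0..})" by (simp add: LIM_zero_iff)
qed

lemma l2norm_G_square: "0 < t \<Longrightarrow> (l2norm L (G t))\<^sup>2 = (\<Sum>m. V / 2 * ((q m)\<^sup>2 + (\<Omega> * \<omega>)\<^sup>2) * (norm (z m))\<^sup>2 * exp (- 2 * t * q m))"
  using expands_l2norm_sums[OF G_expands] by (simp add: sums_iff norm_dZ_square norm_Z_square mult_ac)

lemma G_integrable:
  assumes "0 < b" shows "set_integrable lebesgue {0..b} (\<lambda>t. (l2norm L (G t))\<^sup>2)"
proof -
  let ?c = "\<lambda>m. V / 2 * ((q m)\<^sup>2 + (\<Omega> * \<omega>)\<^sup>2) * (norm (z m))\<^sup>2"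
  have "summable (\<lambda>m. V / 2 * (q m * (norm (z m))\<^sup>2) + V / 2 * (\<Omega> * \<omega>)\<^sup>2 * ((norm (z m))\<^sup>2 / q m))"
    by (intro summable_add summable_mult summable_z_div summable_z)
  moreover have "V / 2 * (q m * (norm (z m))\<^sup>2) + V / 2 * (\<Omega> * \<omega>)\<^sup>2 * ((norm (z m))\<^sup>2 / q m) = ?c m / q m" for m
    using q_pos[of m] by (simp add: field_simps power2_eq_square)
  ultimately have "summable (\<lambda>m. ?c m / q m)" by (simp only:)
  then have "set_integrable lebesgue {0..b} (\<lambda>t. \<Sum>m. ?c m * exp (- 2 * t * q m))"
    using assms V_pos by (intro heat_integral(1)) auto
  then show ?thesis
    by (rule set_integrable_cong_pos) (simp only: l2norm_G_square)
qed

lemma G_Lp: "Lp_loc 2 (l2norm L) (HH L) G"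
proof (rule Lp_locI)
  show "set_integrable lebesgue {0..b} (\<lambda>t. l2norm L (G t) powr 2)" if "0 < b" for b
    using G_integrable[OF that] by simp
qed (use G_HH G_tendsto in \<open>auto simp: fun_diff_def\<close>)

text \<open>The dual norm is a supremum over an uncountable family, so its measurability in time is
  drawn from continuity at positive times. The exponent 4/3 is below 2, hence the power is dominated
  by one plus the square of the L2 norm.\<close>

lemma ip_G_Lp: "Lp_loc (4 / 3) (dual_norm L) (VV_dual L) (\<lambda>t. ip L (G t))"
proof (rule Lp_locI)
  show "ip L (G t) \<in> VV_dual L" for t by (rule ip_VV_dual[OF G_L2])
  show "((\<lambda>s. dual_norm L (ip L (G t) - ip L (G s))) \<longlongrightarrow> 0) (nhds t)" if "0 < t" for t
    by (rule Lim_null_comparison[OF _ G_tendsto[OF that]])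
      (use dual_norm_diff_le[OF G_L2 G_L2] in \<open>auto intro!: always_eventually\<close>)
  fix b :: real assume b: "0 < b"
  let ?n = "\<lambda>t. dual_norm L (ip L (G t))"
  have n0: "0 \<le> ?n t" for t by (rule dual_norm_nonneg[OF G_L2 G_L2])
  have nle: "?n t \<le> l2norm L (G t)" for t
    using dual_norm_diff_le(1)[OF G_L2[of t] L2_zero] by (simp add: fun_diff_def)
  have "continuous_on {0<..} ?n"
  proof (rule continuous_at_imp_continuous_on, rule ballI)
    fix t :: real assume t: "t \<in> {0<..}"
    have "((\<lambda>s. ?n s - ?n t) \<longlongrightarrow> 0) (nhds t)"
    proof (rule Lim_null_comparison[OF _ G_tendsto])
      show "eventually (\<lambda>s. norm (?n s - ?n t) \<le> l2norm L (\<lambda>x. G t x - G s x)) (nhds t)"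
      proof (rule always_eventually, rule allI)
        fix s
        show "norm (?n s - ?n t) \<le> l2norm L (\<lambda>x. G t x - G s x)"
          using dual_norm_triangle[OF G_L2[of s] G_L2[of t]] dual_norm_triangle[OF G_L2[of t] G_L2[of s]]
            l2norm_minus_commute[of L "G s" "G t"] by simp
      qed
    qed (use t in simp)
    then have "(?n \<longlongrightarrow> ?n t) (nhds t)" by (simp add: LIM_zero_iff)
    then show "isCont ?n t" by (simp add: isCont_def tendsto_nhds_iff)
  qed
  then have "continuous_on {0<..b} (\<lambda>t. ?n t powr (4 / 3))"
    by (intro continuous_on_powr' continuous_on_const) (auto intro: continuous_on_subset n0)
  then have "(\<lambda>t. indicator {0<..b} t *\<^sub>R (?n t powr (4 / 3))) \<in> borel_measurable borel"
    by (intro borel_measurable_continuous_on_indicator) auto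
  then have m: "(\<lambda>t. indicator {0<..b} t *\<^sub>R (?n t powr (4 / 3))) \<in> borel_measurable lebesgue"
    by (simp add: measurable_completion)
  have "set_integrable lebesgue {0..b} (\<lambda>t. 1 + (l2norm L (G t))\<^sup>2)"
    by (intro set_integral_add(1) G_integrable[OF b] lebesgue_integral_continuous(1) continuous_intros)
  then have i: "integrable lebesgue (\<lambda>t. indicator {0<..b} t *\<^sub>R (?n t powr (4 / 3)))"
    unfolding set_integrable_def
  proof (rule Bochner_Integration.integrable_bound[OF _ m], intro AE_I2)
    fix t
    have "?n t powr (4 / 3) \<le> 1 + (l2norm L (G t))\<^sup>2"
    proof (cases "?n t \<le> 1")
      case True
      then have "?n t powr (4 / 3) \<le> 1 powr (4 / 3)" using n0 by (intro powr_mono2) auto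
      then show ?thesis by (simp add: add_increasing2)
    next
      case False
      then have "?n t powr (4 / 3) \<le> ?n t powr 2" by (intro powr_mono) auto
      also have "\<dots> = (?n t)\<^sup>2" using n0 by simp
      also have "\<dots> \<le> (l2norm L (G t))\<^sup>2" by (intro power_mono nle n0)
      finally show ?thesis by simp
    qed
    then show "norm (indicator {0<..b} t *\<^sub>R (?n t powr (4 / 3))) \<le> norm (indicator {0..b} t *\<^sub>R (1 + (l2norm L (G t))\<^sup>2))"
      by (auto simp: indicator_def abs_of_nonneg)
  qed
  have "set_integrable lebesgue {0..b} (\<lambda>t. indicator {0<..} t *\<^sub>R (?n t powr (4 / 3)))"
    unfolding set_integrable_def
    by (rule Bochner_Integration.integrable_cong[THEN iffD1, OF refl _ i]) (auto simp: indicator_def)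
  then show "set_integrable lebesgue {0..b} (\<lambda>t. ?n t powr (4 / 3))"
    by (rule set_integrable_cong_pos) simp
qed

text \<open>The convective term drops out and \<open>gip\<close> is the pairing with the Stokes
  operator, so the weak equation is the linear equation paired with \<open>w\<close>.\<close>

lemma U_weak_form:
  assumes t: "0 < t" and w: "w \<in> VV L"
  shows "- (gip L (U t) w + trilin L (U t) (U t) w + \<Omega> * ip L (coriolis L (U t)) w) = ip L (G t) w"
proof -
  note L2s = expands_L2[OF stokes_U[OF t]] expands_L2[OF coriolis_U] VV_L2[OF w]
  have "eqae L (G t) (\<lambda>x. - (stokes L (U t) x + \<Omega> *\<^sub>R coriolis L (U t) x))"
    by (rule expands_unique[OF G_expands[OF t] rhs_U[OF t]])
  then have "ip L (G t) w = ip L (\<lambda>x. - (stokes L (U t) x + \<Omega> *\<^sub>R coriolis L (U t) x)) w"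
    by (rule ip_cong) (use expands_L2[OF rhs_U[OF t]] L2s G_L2 in auto)
  also have "\<dots> = - (ip L (stokes L (U t)) w + \<Omega> * ip L (coriolis L (U t)) w)"
    using L2s t by (simp only: ip_minus_left) (simp add: ip_add_left L2_scaleR ip_scaleR_left)
  also have "ip L (stokes L (U t)) w = gip L (U t) w"
    by (rule gip_eq_ip[OF U_expands summable_Z_power[OF t] VV_H1[OF w] stokes_U[OF t], symmetric]) (use t in simp)
  moreover have "trilin L (U t) (U t) w = 0"
    using t by (intro trilin_self_zero[OF U_expands summable_Z_q perp_Z]) auto
  ultimately show ?thesis by simp
qed

lemma U_leray_hopf: "leray_hopf L \<Omega> U"
  unfolding leray_hopf_def Let_def
proof (intro conjI ballI exI allI impI)
  show "cont_weak L U"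
    unfolding cont_weak_def using U_VV VV_HH ip_U_continuous HH_L2 by blast
  show "Lp_loc 2 (h1norm L) (VV L) U" by (rule U_h1_Lp)
  show "Lp_loc (4 / 3) (dual_norm L) (VV_dual L) (\<lambda>t. ip L (G t))" by (rule ip_G_Lp)
  fix w assume w: "w \<in> VV L"
  show "distr_deriv (\<lambda>t. ip L (U t) w) (\<lambda>t. ip L (G t) w)"
    by (intro distr_derivI ip_U_derivative ip_G_continuous VV_L2 w)
  show "distr_deriv (\<lambda>t. ip L (U t) w)
      (\<lambda>t. - (gip L (U t) w + trilin L (U t) (U t) w + \<Omega> * ip L (coriolis L (U t)) w))"
  proof (rule distr_derivI)
    show "((\<lambda>t. ip L (U t) w) has_real_derivative
        - (gip L (U t) w + trilin L (U t) (U t) w + \<Omega> * ip L (coriolis L (U t)) w)) (at t)" if "0 < t" for t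
      unfolding U_weak_form[OF that w] by (intro ip_U_derivative that VV_L2 w)
    show "continuous_on {0<..} (\<lambda>t. - (gip L (U t) w + trilin L (U t) (U t) w + \<Omega> * ip L (coriolis L (U t)) w))"
      using ip_G_continuous[OF VV_L2[OF w]] by (rule continuous_on_eq) (rule U_weak_form[OF _ w, symmetric], simp)
  qed
next
  show "(l2norm L (U t))\<^sup>2 / 2 + (LINT \<tau>:{0..t}|lebesgue. (gnorm L (U \<tau>))\<^sup>2) \<le> (l2norm L (U 0))\<^sup>2 / 2" if "0 \<le> t" for t
    using U_energy[of 0 t] that by simp
  show "AE t0 in lebesgue. 0 < t0 \<longrightarrow> (\<forall>t\<ge>t0. (l2norm L (U t))\<^sup>2 / 2 + (LINT \<tau>:{t0..t}|lebesgue. (gnorm L (U \<tau>))\<^sup>2) \<le> (l2norm L (U t0))\<^sup>2 / 2)"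
    by (intro always_eventually allI impI) (simp add: U_energy)
qed

lemma U_global_regular: "global_regular L \<Omega> U"
  unfolding global_regular_def
proof (intro conjI exI ballI)
  show "leray_hopf L \<Omega> U" by (rule U_leray_hopf)
  show "cont_norm (h1norm L) (VV L) U"
    unfolding cont_norm_def using U_VV U_h1_tendsto by (auto simp: fun_diff_def)
  show "Lp_loc 2 (h2norm L) (stokes_dom L) U" by (rule U_h2_Lp)
  show "Lp_loc 2 (l2norm L) (HH L) G" by (rule G_Lp)
  show "distr_deriv (\<lambda>t. ip L (U t) w) (\<lambda>t. ip L (G t) w)" if "w \<in> HH L" for w
    by (intro distr_derivI ip_U_derivative ip_G_continuous HH_L2 that)
qed

end

subsection \<open>Distributional derivatives in time\<close>

lemma real_differentiableI: "(f has_real_derivative d) (at t) \<Longrightarrow> f differentiable (at t)"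
  by (auto simp: real_differentiable_def)

section \<open>Smooth test functions on the line\<close>

definition smooth1 :: "(real \<Rightarrow> real) \<Rightarrow> bool" where
  "smooth1 f \<longleftrightarrow> (\<forall>n t. (deriv ^^ n) f differentiable (at t))"

lemma smooth1_coinduct:
  assumes "P f" and step: "\<And>g. P g \<Longrightarrow> (\<forall>t. g differentiable (at t)) \<and> P (deriv g)"
  shows "smooth1 f"
proof -
  have "P ((deriv ^^ n) f)" for n by (induction n) (use assms in auto)
  then show ?thesis using step by (simp add: smooth1_def)
qed

lemma smooth1_D:
  assumes "smooth1 f"
  shows smooth1_has_derivative: "(f has_real_derivative deriv f t) (at t)" and smooth1_deriv: "smooth1 (deriv f)"
proof -
  have "(deriv ^^ 0) f differentiable (at t)" using assms unfolding smooth1_def by blast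
  then show "(f has_real_derivative deriv f t) (at t)" by (simp add: DERIV_deriv_iff_real_differentiable)
  show "smooth1 (deriv f)"
    unfolding smooth1_def
  proof (intro allI)
    fix n t
    have "(deriv ^^ Suc n) f differentiable (at t)" using assms unfolding smooth1_def by blast
    then show "(deriv ^^ n) (deriv f) differentiable (at t)" by (simp only: funpow_Suc_right o_apply)
  qed
qed

lemma smooth1_continuous_on: "smooth1 f \<Longrightarrow> continuous_on S f"
  by (meson DERIV_isCont continuous_at_imp_continuous_on smooth1_has_derivative)

lemma smooth1_I:
  assumes "\<And>t. (f has_real_derivative g t) (at t)" "smooth1 g"
  shows "smooth1 f"
proof -
  have d: "deriv f = g" using DERIV_imp_deriv[OF assms(1)] by (rule ext)
  have "(deriv ^^ n) f differentiable (at t)" for n t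
  proof (cases n)
    case 0
    then show ?thesis using real_differentiableI[OF assms(1)] by simp
  next
    case (Suc m)
    then have "(deriv ^^ n) f = (deriv ^^ m) g" by (simp only: funpow_Suc_right o_apply d)
    then show ?thesis using assms(2) by (simp add: smooth1_def)
  qed
  then show ?thesis by (simp add: smooth1_def)
qed

text \<open>The one-variable analogue of \<open>smooth_alg\<close>. Affine substitution is included
  because test functions are translates and dilates of one step.\<close>

inductive smooth1_alg :: "(real \<Rightarrow> real) \<Rightarrow> bool" where
  "smooth1 f \<Longrightarrow> smooth1_alg f"
| "smooth1_alg f \<Longrightarrow> smooth1_alg g \<Longrightarrow> smooth1_alg (\<lambda>t. f t + g t)"
| "smooth1_alg f \<Longrightarrow> smooth1_alg g \<Longrightarrow> smooth1_alg (\<lambda>t. f t * g t)"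
| "smooth1_alg f \<Longrightarrow> smooth1_alg (\<lambda>t. f (c * t + d))"

lemma smooth1_const: "smooth1 (\<lambda>t. c)"
  by (rule smooth1_coinduct[of "\<lambda>f. \<exists>c. f = (\<lambda>t. c)"]) auto

lemma smooth1_alg_deriv:
  assumes "smooth1_alg f"
  shows "\<exists>g. (\<forall>t. (f has_real_derivative g t) (at t)) \<and> smooth1_alg g"
  using assms
proof induction
  case (1 f)
  then show ?case using smooth1_D smooth1_alg.intros(1) by blast
next
  case (2 f g)
  then obtain f' g' where "\<And>t. (f has_real_derivative f' t) (at t)" "smooth1_alg f'"
    "\<And>t. (g has_real_derivative g' t) (at t)" "smooth1_alg g'" by blast
  then show ?case
    by (intro exI[of _ "\<lambda>t. f' t + g' t"]) (auto intro!: derivative_eq_intros smooth1_alg.intros(2))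
next
  case (3 f g)
  then obtain f' g' where "\<And>t. (f has_real_derivative f' t) (at t)" "smooth1_alg f'"
    "\<And>t. (g has_real_derivative g' t) (at t)" "smooth1_alg g'" by blast
  with 3 show ?case
    by (intro exI[of _ "\<lambda>t. f' t * g t + f t * g' t"]) (auto intro!: derivative_eq_intros smooth1_alg.intros(2,3))
next
  case (4 f c d)
  then obtain f' where f': "\<And>t. (f has_real_derivative f' t) (at t)" "smooth1_alg f'" by blast
  have "((\<lambda>t. f (c * t + d)) has_real_derivative f' (c * t + d) * c) (at t)" for t
    by (rule DERIV_chain2[OF f'(1)]) (auto intro!: derivative_eq_intros)
  moreover have "smooth1_alg (\<lambda>t. f' (c * t + d) * c)"
    by (rule smooth1_alg.intros(3)[OF smooth1_alg.intros(4)[OF f'(2)] smooth1_alg.intros(1)[OF smooth1_const]])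
  ultimately show ?case by (intro exI[of _ "\<lambda>t. f' (c * t + d) * c"] conjI allI)
qed

lemma smooth1_algI: "smooth1_alg f \<Longrightarrow> smooth1 f"
proof (rule smooth1_coinduct[of smooth1_alg])
  fix g assume "smooth1_alg g"
  then obtain g' where g': "\<And>t. (g has_real_derivative g' t) (at t)" "smooth1_alg g'"
    using smooth1_alg_deriv by blast
  have "deriv g = g'" using DERIV_imp_deriv[OF g'(1)] by (rule ext)
  with g' show "(\<forall>t. g differentiable (at t)) \<and> smooth1_alg (deriv g)"
    using real_differentiableI by blast
qed

lemma smooth1_mult: "smooth1 f \<Longrightarrow> smooth1 g \<Longrightarrow> smooth1 (\<lambda>t. f t * g t)"
  by (rule smooth1_algI[OF smooth1_alg.intros(3)]; rule smooth1_alg.intros(1))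

lemma smooth1_add: "smooth1 f \<Longrightarrow> smooth1 g \<Longrightarrow> smooth1 (\<lambda>t. f t + g t)"
  by (rule smooth1_algI[OF smooth1_alg.intros(2)]; rule smooth1_alg.intros(1))

lemma smooth1_affine: "smooth1 f \<Longrightarrow> smooth1 (\<lambda>t. f (c * t + d))"
  by (rule smooth1_algI[OF smooth1_alg.intros(4)]; rule smooth1_alg.intros(1))

text \<open>The classical flat functions, with all polynomials \<open>P\<close> at once so that the
  family is closed under differentiation.\<close>

definition flat :: "real poly \<Rightarrow> real \<Rightarrow> real" where
  "flat P t = (if 0 < t then poly P (1 / t) * exp (- (1 / t)) else 0)"

lemma poly_exp_tendsto_0: "((\<lambda>y. poly P y * exp (- y)) \<longlongrightarrow> 0) at_top" for P :: "real poly"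
proof (induction P)
  case (pCons a P)
  have 1: "((\<lambda>y. a * exp (- y)) \<longlongrightarrow> 0) (at_top :: real filter)" by real_asymp
  have "((\<lambda>y. y ^ n * exp (- y)) \<longlongrightarrow> 0) (at_top :: real filter)" for n
    using tendsto_power_div_exp_0[of n] by (simp add: exp_minus divide_inverse)
  then have "((\<lambda>y. \<Sum>i\<le>degree P. coeff P i * (y ^ Suc i * exp (- y))) \<longlongrightarrow> (\<Sum>i\<le>degree P. coeff P i * 0)) (at_top :: real filter)"
    by (intro tendsto_sum tendsto_mult_left)
  then have 2: "((\<lambda>y. y * poly P y * exp (- y)) \<longlongrightarrow> 0) at_top"
    by (simp add: poly_altdef sum_distrib_left sum_distrib_right mult_ac)
  show ?case using tendsto_add[OF 1 2] by (simp add: algebra_simps)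
qed simp

text \<open>For positive \<open>t\<close> the chain rule produces the factor
  \<open>1 / t\<^sup>2\<close>, which is \<open>monom 1 2\<close> evaluated at \<open>1 / t\<close>.
  At 0 the difference quotient is again of flat type and tends to 0.\<close>

lemma flat_derivative:
  "(flat P has_real_derivative flat (monom 1 2 * (P - pderiv P)) t) (at t)"
proof (cases "t = 0")
  case False
  have "eventually (\<lambda>s. flat P s = (if 0 < t then poly P (1 / s) * exp (- (1 / s)) else 0)) (nhds t)"
  proof (cases "0 < t")
    case True
    then show ?thesis
      using eventually_nhds_in_open[of "{0<..}" t] by (auto elim!: eventually_mono simp: flat_def)
  next
    case F: False
    with False show ?thesis
      using eventually_nhds_in_open[of "{..<0}" t] by (auto elim!: eventually_mono simp: flat_def)
  qed
  moreover have "((\<lambda>s. if 0 < t then poly P (1 / s) * exp (- (1 / s)) else 0) has_real_derivative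
      flat (monom 1 2 * (P - pderiv P)) t) (at t)"
  proof (cases "0 < t")
    case True
    have "((\<lambda>s. poly P (1 / s) * exp (- (1 / s))) has_real_derivative
        poly (pderiv P) (1 / t) * (- (1 / t\<^sup>2)) * exp (- (1 / t)) + poly P (1 / t) * (exp (- (1 / t)) * (1 / t\<^sup>2))) (at t)"
      using True by (auto intro!: derivative_eq_intros DERIV_chain2[OF poly_DERIV] simp: power2_eq_square field_simps)
    moreover have "poly (pderiv P) (1 / t) * (- (1 / t\<^sup>2)) * exp (- (1 / t)) + poly P (1 / t) * (exp (- (1 / t)) * (1 / t\<^sup>2))
        = flat (monom 1 2 * (P - pderiv P)) t"
      using True by (simp add: flat_def poly_monom power_one_over algebra_simps)
    ultimately show ?thesis using True by simp
  next
    case False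
    then show ?thesis by (simp add: flat_def)
  qed
  ultimately show ?thesis by (subst DERIV_cong_ev[OF refl _ refl]) auto
next
  case True
  have r: "((\<lambda>h. flat P h / h) \<longlongrightarrow> 0) (at_right 0)"
  proof -
    \<comment> \<open>Division by \<open>h\<close> is multiplication of the polynomial by its
      variable, that is, \<open>pCons 0\<close>.\<close>
    have "((\<lambda>y. poly (pCons 0 P) y * exp (- y)) \<longlongrightarrow> 0) at_top" by (rule poly_exp_tendsto_0)
    then have "((\<lambda>h. poly (pCons 0 P) (inverse h) * exp (- inverse h)) \<longlongrightarrow> 0) (at_right 0)"
      by (rule filterlim_compose[OF _ filterlim_inverse_at_top_right])
    then show ?thesis
      by (rule Lim_transform_eventually)
        (auto simp: eventually_at_filter flat_def divide_inverse mult_ac)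
  qed
  have l: "((\<lambda>h. flat P h / h) \<longlongrightarrow> 0) (at_left 0)"
    by (rule tendsto_eventually) (auto simp: eventually_at_filter flat_def)
  have "((\<lambda>h. flat P h / h) \<longlongrightarrow> 0) (at 0)"
    using l r by (simp add: filterlim_at_split)
  then show ?thesis using True by (simp add: DERIV_def flat_def)
qed

lemma smooth1_flat: "smooth1 (flat P)"
proof (rule smooth1_coinduct[of "\<lambda>f. \<exists>P. f = flat P"])
  fix g assume "\<exists>P. g = flat P"
  then obtain P where g: "g = flat P" by blast
  have "deriv g = flat (monom 1 2 * (P - pderiv P))"
    unfolding g using DERIV_imp_deriv[OF flat_derivative] by (rule ext)
  then show "(\<forall>t. g differentiable (at t)) \<and> (\<exists>P. deriv g = flat P)"
    using flat_derivative[of P] g real_differentiableI by blast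
qed blast

definition bump :: "real \<Rightarrow> real" where
  "bump t = flat 1 t * flat 1 (1 - t)"

lemma bump_smooth: "smooth1 bump"
  using smooth1_mult[OF smooth1_flat[of 1] smooth1_affine[OF smooth1_flat[of 1], of "- 1" 1]]
  by (simp add: bump_def[abs_def])

lemma bump_nonneg: "0 \<le> bump t" and bump_pos_iff: "0 < bump t \<longleftrightarrow> 0 < t \<and> t < 1"
  by (simp_all add: bump_def flat_def)

lemma bump_zero: "t \<le> 0 \<or> 1 \<le> t \<Longrightarrow> bump t = 0"
  by (auto simp: bump_def flat_def)

text \<open>The step is the primitive of the bump. It starts at -1 so that every nonnegative
  \<open>t\<close> is interior to the interval of integration.\<close>

lemma smooth_step:
  obtains S where "\<And>t. (S has_real_derivative bump t) (at t)" "\<And>t. t \<le> 0 \<Longrightarrow> S t = 0" "\<And>t. 1 \<le> t \<Longrightarrow> S t = S 1"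
proof -
  define S where "S t = integral {-1..t} bump" for t
  note c = smooth1_continuous_on[OF bump_smooth]
  have int: "bump integrable_on {a..b}" for a b by (rule integrable_continuous_real[OF c])
  have z: "S t = 0" if "t \<le> 0" for t
  proof -
    have "integral {-1..t} bump = integral {-1..t} (\<lambda>t. 0)"
      by (rule integral_cong) (use that bump_zero in auto)
    then show ?thesis by (simp add: S_def)
  qed
  have one: "S t = S 1" if "1 \<le> t" for t
  proof -
    have "integral {-1..1} bump + integral {1..t} bump = integral {-1..t} bump"
      using that int by (intro Henstock_Kurzweil_Integration.integral_combine) auto
    moreover have "integral {1..t} bump = integral {1..t} (\<lambda>t. 0)"
      by (rule integral_cong) (use bump_zero in auto)
    ultimately show ?thesis by (simp add: S_def)
  qed
  have "(S has_real_derivative bump t) (at t)" for t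
  proof (cases "t < 0")
    case True
    have "eventually (\<lambda>s. S s = 0) (nhds t)"
      using eventually_nhds_in_open[of "{..<0}" t] True z by (auto elim!: eventually_mono)
    then show ?thesis using True bump_zero[of t] by (subst DERIV_cong_ev[OF refl _ refl, where g="\<lambda>_. 0"]) auto
  next
    case False
    have "(S has_real_derivative bump t) (at t within {-1..t + 1})"
      unfolding S_def[abs_def] by (rule integral_has_real_derivative[OF c]) (use False in auto)
    moreover have "at t within {-1..t + 1} = at t"
      using False by (intro at_within_interior) auto
    ultimately show ?thesis by simp
  qed
  from that[OF this z one] show ?thesis .
qed

text \<open>
  The test function is the difference of two smooth steps, one near \<open>a\<close> and one near \<open>b\<close>; its
  derivative is positive where \<open>h\<close> is close to \<open>h a\<close> and negative where \<open>h\<close> is close to \<open>h b\<close>.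
\<close>

lemma weak_derivative_zero_imp_not_less:
  fixes h :: "real \<Rightarrow> real"
  assumes h: "continuous_on {a0<..} h"
    and zero: "\<And>\<phi> l u. smooth1 \<phi> \<Longrightarrow> a0 < l \<Longrightarrow> l < u \<Longrightarrow> (\<And>t. t \<notin> {l<..<u} \<Longrightarrow> \<phi> t = 0) \<Longrightarrow>
      integral {l..u} (\<lambda>t. h t * deriv \<phi> t) = 0"
    and ab: "a0 < a" "a0 < b"
  shows "\<not> h a < h b"
proof
  assume lt: "h a < h b"
  define c where "c = (h a + h b) / 2"
  have c: "h a < c" "c < h b" using lt by (auto simp: c_def)
  have ev: "\<exists>e>0. \<forall>s. \<bar>s - x\<bar> \<le> e \<longrightarrow> \<bar>h s - h x\<bar> < r" if x: "a0 < x" and r: "0 < r" for x r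
  proof -
    have "isCont h x" using h x by (simp add: continuous_on_eq_continuous_at)
    then obtain e where e: "e > 0" "\<And>s. dist s x < e \<Longrightarrow> dist (h s) (h x) < r"
      using r by (auto simp: continuous_at_eps_delta)
    then show ?thesis by (intro exI[of _ "e / 2"]) (auto simp: dist_real_def)
  qed
  obtain e1 where e1: "e1 > 0" "\<And>s. \<bar>s - a\<bar> \<le> e1 \<Longrightarrow> \<bar>h s - h a\<bar> < c - h a" using ev[of a "c - h a"] ab c by auto
  obtain e2 where e2: "e2 > 0" "\<And>s. \<bar>s - b\<bar> \<le> e2 \<Longrightarrow> \<bar>h s - h b\<bar> < h b - c" using ev[of b "h b - c"] ab c by auto
  define e where "e = min e1 e2"
  have e: "e > 0" using e1 e2 by (simp add: e_def)
  obtain S where S: "\<And>t. (S has_real_derivative bump t) (at t)" "\<And>t. t \<le> 0 \<Longrightarrow> S t = 0" "\<And>t. 1 \<le> t \<Longrightarrow> S t = S 1"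
    using smooth_step by blast
  \<comment> \<open>Affine form for \<open>smooth1_affine\<close>; the two steps rise over intervals
    of length \<open>e\<close> that start at \<open>a\<close> and at \<open>b\<close>.\<close>
  let ?A = "\<lambda>t. (1 / e) * t + (- a / e)" and ?B = "\<lambda>t. (1 / e) * t + (- b / e)"
  have AB: "?A t = (t - a) / e" "?B t = (t - b) / e" for t by (simp_all add: diff_divide_distrib)
  define \<phi> where "\<phi> t = S (?A t) + (- 1) * S (?B t)" for t
  have sS: "smooth1 S" by (rule smooth1_I[OF S(1) bump_smooth])
  have s\<phi>: "smooth1 \<phi>"
    unfolding \<phi>_def[abs_def] by (intro smooth1_add smooth1_mult smooth1_const smooth1_affine sS)
  have "(\<phi> has_real_derivative (bump (?A t) - bump (?B t)) / e) (at t)" for t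
  proof -
    have "((\<lambda>t. (1 / e) * t + r) has_real_derivative 1 / e) (at t)" for r
      by (rule DERIV_add[OF DERIV_cmult[OF DERIV_ident, of "1 / e"] DERIV_const, THEN DERIV_cong]) simp
    then have "((\<lambda>t. S (?A t)) has_real_derivative bump (?A t) * (1 / e)) (at t)"
      "((\<lambda>t. S (?B t)) has_real_derivative bump (?B t) * (1 / e)) (at t)"
      by - (rule DERIV_chain2[OF S(1)], assumption)+
    from DERIV_add[OF this(1) DERIV_cmult[OF this(2), of "- 1"]] show ?thesis
      by (simp add: \<phi>_def[abs_def] diff_divide_distrib)
  qed
  then have d\<phi>: "deriv \<phi> t = (bump ((t - a) / e) - bump ((t - b) / e)) / e" for t
    unfolding AB by (rule DERIV_imp_deriv)
  define l u where "l = (a0 + min a b) / 2" and "u = max a b + e + 1"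
  have lu: "a0 < l" "l < a" "l < b" "a + e < u" "b + e < u" "l < u" using ab e by (auto simp: l_def u_def)
  have out: "\<phi> t = 0" if "t \<notin> {l<..<u}" for t
  proof (cases "t \<le> l")
    case True
    then have "(t - a) / e \<le> 0" "(t - b) / e \<le> 0" using lu e by (auto simp: divide_le_0_iff)
    then show ?thesis unfolding \<phi>_def AB using S(2) by simp
  next
    case False
    then have "1 \<le> (t - a) / e" "1 \<le> (t - b) / e" using that lu e by (auto simp: le_divide_eq)
    from S(3)[OF this(1)] S(3)[OF this(2)] show ?thesis unfolding \<phi>_def AB by simp
  qed
  have hc: "continuous_on {l..u} h" using lu by (intro continuous_on_subset[OF h]) auto
  have dc: "continuous_on {l..u} (deriv \<phi>)" by (rule smooth1_continuous_on[OF smooth1_deriv[OF s\<phi>]])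
  have "((deriv \<phi>) has_integral (\<phi> u - \<phi> l)) {l..u}"
    by (rule fundamental_theorem_of_calculus[OF less_imp_le[OF lu(6)]])
      (rule has_vector_derivative_at_within[OF has_real_derivative_iff_has_vector_derivative[THEN iffD1,
        OF smooth1_has_derivative[OF s\<phi>]]])
  then have i0: "integral {l..u} (deriv \<phi>) = 0" using out by (simp add: integral_unique)
  \<comment> \<open>The derivative of the test function has integral zero, so the level
    \<open>c\<close> between \<open>h a\<close> and \<open>h b\<close> can be subtracted.\<close>
  have "integral {l..u} (\<lambda>t. (c - h t) * deriv \<phi> t) = integral {l..u} (\<lambda>t. c * deriv \<phi> t - h t * deriv \<phi> t)"
    by (simp add: left_diff_distrib)
  also have "\<dots> = integral {l..u} (\<lambda>t. c * deriv \<phi> t) - integral {l..u} (\<lambda>t. h t * deriv \<phi> t)"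
    by (intro integral_diff integrable_continuous_real continuous_intros hc dc)
  also have "\<dots> = 0" using i0 zero[OF s\<phi> lu(1) lu(6) out] by simp
  finally have "integral {l..u} (\<lambda>t. (c - h t) * deriv \<phi> t) = 0" .
  moreover have "0 \<le> (c - h t) * deriv \<phi> t" for t
  proof -
    have 1: "0 \<le> (c - h t) * bump ((t - a) / e)"
    proof (cases "0 < (t - a) / e \<and> (t - a) / e < 1")
      case True
      then have "\<bar>t - a\<bar> \<le> e1" using e by (auto simp: e_def zero_less_divide_iff divide_less_eq)
      then have "0 \<le> c - h t" using e1(2)[of t] by linarith
      then show ?thesis using bump_nonneg by simp
    qed (use bump_zero[of "(t - a) / e"] in auto)
    have 2: "0 \<le> (h t - c) * bump ((t - b) / e)"
    proof (cases "0 < (t - b) / e \<and> (t - b) / e < 1")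
      case True
      then have "\<bar>t - b\<bar> \<le> e2" using e by (auto simp: e_def zero_less_divide_iff divide_less_eq)
      then have "0 \<le> h t - c" using e2(2)[of t] by linarith
      then show ?thesis using bump_nonneg by simp
    qed (use bump_zero[of "(t - b) / e"] in auto)
    have "(c - h t) * deriv \<phi> t = ((c - h t) * bump ((t - a) / e) + (h t - c) * bump ((t - b) / e)) / e"
      unfolding d\<phi> by (simp add: algebra_simps)
    then show ?thesis using 1 2 e by simp
  qed
  moreover have "continuous_on {l..u} (\<lambda>t. (c - h t) * deriv \<phi> t)" by (intro continuous_intros hc dc)
  ultimately have all0: "(c - h t) * deriv \<phi> t = 0" if "t \<in> {l..u}" for t
    using integral_eq_0_iff[of l u "\<lambda>t. (c - h t) * deriv \<phi> t"] lu that by auto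
  \<comment> \<open>The centre of the bump near \<open>a\<close>. There \<open>h\<close> is below
    \<open>c\<close>, so the bump near \<open>b\<close>, supported where \<open>h\<close> exceeds
    \<open>c\<close>, cannot interfere.\<close>
  let ?t = "a + e / 2"
  have "e \<le> e1" by (simp add: e_def)
  then have "\<bar>?t - a\<bar> \<le> e1" using e by simp
  from e1(2)[OF this] have "h ?t < c" by linarith
  moreover have "bump ((?t - b) / e) = 0"
  proof (rule ccontr)
    assume "bump ((?t - b) / e) \<noteq> 0"
    then have "0 < bump ((?t - b) / e)" using bump_nonneg[of "(?t - b) / e"] by linarith
    then have "0 < (?t - b) / e \<and> (?t - b) / e < 1" unfolding bump_pos_iff .
    then have "\<bar>?t - b\<bar> \<le> e2" using e unfolding e_def by (auto simp: zero_less_divide_iff divide_less_eq)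
    then show False using e2(2)[of ?t] \<open>h ?t < c\<close> by linarith
  qed
  moreover have "0 < bump ((?t - a) / e)" using e by (simp add: bump_pos_iff)
  ultimately have pos: "0 < (c - h ?t) * deriv \<phi> ?t" unfolding d\<phi> using e by simp
  have tin: "?t \<in> {l..u}" using lu e by auto
  show False using all0[OF tin] pos by linarith
qed

text \<open>The du Bois-Reymond lemma: after subtraction of a primitive of \<open>g\<close>, the
  function has distributional derivative zero and is continuous, hence constant.\<close>

lemma distr_deriv_continuous:
  assumes D: "distr_deriv f g" and f: "continuous_on {0<..} f" and g: "continuous_on {0<..} g" and t: "0 < t"
  shows "(f has_real_derivative g t) (at t)"
proof -
  \<comment> \<open>Continuity of \<open>g\<close> is known on positive times only, so the primitive
    has to start at a positive time.\<close>
  define a0 where "a0 = t / 2"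
  have a0: "0 < a0" "a0 < t" using t by (auto simp: a0_def)
  define J where "J s = integral {a0..s} g" for s
  define h where "h s = f s - J s" for s
  have J: "(J has_real_derivative g s) (at s)" if "a0 < s" for s
  proof -
    have "(J has_real_derivative g s) (at s within {a0..s + 1})"
      unfolding J_def[abs_def]
      by (rule integral_has_real_derivative) (use that a0 in \<open>auto intro: continuous_on_subset[OF g]\<close>)
    moreover have "at s within {a0..s + 1} = at s" using that by (intro at_within_interior) auto
    ultimately show ?thesis by simp
  qed
  have Jc: "continuous_on {a0<..} J"
    by (meson DERIV_isCont J continuous_at_imp_continuous_on greaterThan_iff)
  have hc: "continuous_on {a0<..} h"
    unfolding h_def[abs_def] using a0 by (intro continuous_intros Jc continuous_on_subset[OF f]) auto
  have zero: "integral {l..u} (\<lambda>t. h t * deriv \<phi> t) = 0"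
    if \<phi>: "smooth1 \<phi>" and lu: "a0 < l" "l < u" and out: "\<And>t. t \<notin> {l<..<u} \<Longrightarrow> \<phi> t = 0" for \<phi> l u
  proof -
    have out': "\<phi> t = 0" if "t \<notin> {l..u}" for t using that by (intro out) auto
    have tt: "time_test \<phi>"
      unfolding time_test_def
    proof (rule conjI, goal_cases)
      case 1
      show "\<forall>n t. (deriv ^^ n) \<phi> differentiable (at t)" using \<phi> by (simp add: smooth1_def)
    next
      case 2
      have "0 < l \<and> (\<forall>t. t \<notin> {l..u} \<longrightarrow> \<phi> t = 0)" using lu a0 out' by simp
      then show ?case by blast
    qed
    have dout: "deriv \<phi> t = 0" if "t \<notin> {l..u}" for t
    proof -
      have "eventually (\<lambda>s. \<phi> s = 0) (nhds t)"
      proof (rule eventually_mono[OF eventually_nhds_in_open[of "- {l..u}" t]])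
        show "open (- {l..u})" by (simp add: open_Compl)
        show "t \<in> - {l..u}" using that by simp
      qed (use out' in blast)
      then have "deriv \<phi> t = deriv (\<lambda>_. 0) t" by (rule deriv_cong_ev) simp
      then show ?thesis by simp
    qed
    have sub: "{l..u} \<subseteq> {a0<..}" "{l..u} \<subseteq> {0<..}" using lu a0 by auto
    note c = continuous_on_subset[OF f sub(2)] continuous_on_subset[OF g sub(2)] continuous_on_subset[OF Jc sub(1)]
      smooth1_continuous_on[OF \<phi>] smooth1_continuous_on[OF smooth1_deriv[OF \<phi>]]
    have l0: "0 < l" using lu a0 by simp
    have "(LINT t:{0<..}|lebesgue. f t * deriv \<phi> t) = - (LINT t:{0<..}|lebesgue. g t * \<phi> t)"
      using D tt unfolding distr_deriv_def by blast
    moreover have "(LINT t:{0<..}|lebesgue. f t * deriv \<phi> t) = integral {l..u} (\<lambda>t. f t * deriv \<phi> t)"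
      by (subst time_test_integral_eq[OF l0, of u]) (auto simp: dout intro!: lebesgue_integral_continuous(2) continuous_intros c)
    moreover have "(LINT t:{0<..}|lebesgue. g t * \<phi> t) = integral {l..u} (\<lambda>t. g t * \<phi> t)"
      by (subst time_test_integral_eq[OF l0, of u]) (auto simp: out' intro!: lebesgue_integral_continuous(2) continuous_intros c)
    ultimately have 1: "integral {l..u} (\<lambda>t. f t * deriv \<phi> t) = - integral {l..u} (\<lambda>t. g t * \<phi> t)" by simp
    have "((\<lambda>t. J t * deriv \<phi> t + g t * \<phi> t) has_integral (J u * \<phi> u - J l * \<phi> l)) {l..u}"
    proof (rule fundamental_theorem_of_calculus)
      fix s assume s: "s \<in> {l..u}"
      have "((\<lambda>t. J t * \<phi> t) has_real_derivative J s * deriv \<phi> s + g s * \<phi> s) (at s)"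
        using s lu by (auto intro!: derivative_eq_intros J smooth1_has_derivative[OF \<phi>])
      then show "((\<lambda>t. J t * \<phi> t) has_vector_derivative J s * deriv \<phi> s + g s * \<phi> s) (at s within {l..u})"
        by (rule has_vector_derivative_at_within[OF has_real_derivative_iff_has_vector_derivative[THEN iffD1]])
    qed (use lu in simp)
    then have "integral {l..u} (\<lambda>t. J t * deriv \<phi> t + g t * \<phi> t) = 0" using out by (simp add: integral_unique)
    moreover have "integral {l..u} (\<lambda>t. J t * deriv \<phi> t + g t * \<phi> t)
        = integral {l..u} (\<lambda>t. J t * deriv \<phi> t) + integral {l..u} (\<lambda>t. g t * \<phi> t)"
      by (intro integral_add integrable_continuous_real continuous_intros c)
    moreover have "integral {l..u} (\<lambda>t. h t * deriv \<phi> t) = integral {l..u} (\<lambda>t. f t * deriv \<phi> t - J t * deriv \<phi> t)"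
      by (simp add: h_def left_diff_distrib)
    moreover have "\<dots> = integral {l..u} (\<lambda>t. f t * deriv \<phi> t) - integral {l..u} (\<lambda>t. J t * deriv \<phi> t)"
      by (intro integral_diff integrable_continuous_real continuous_intros c)
    ultimately show ?thesis using 1 by simp
  qed
  have const: "h s = h t" if "a0 < s" for s
  proof -
    have "\<not> h r < h r'" if "a0 < r" "a0 < r'" for r r'
      by (rule weak_derivative_zero_imp_not_less[OF hc _ that]) (rule zero)
    from this[OF that a0(2)] this[OF a0(2) that] show ?thesis by simp
  qed
  have "eventually (\<lambda>s. f s = h t + J s) (nhds t)"
    using eventually_nhds_in_open[of "{a0<..}" t] a0
  proof (auto elim!: eventually_mono)
    fix s assume "a0 < s"
    from const[OF this] show "f s = h t + J s" by (simp add: h_def)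
  qed
  moreover have "((\<lambda>s. h t + J s) has_real_derivative g t) (at t)"
    using J[OF a0(2)] by (auto intro!: derivative_eq_intros)
  ultimately show ?thesis by (subst DERIV_cong_ev[OF refl _ refl]) auto
qed

text \<open>The function \<open>?F\<close> does not increase, since its derivative has the sign of
  \<open>y t\<close> minus its bound; comparing the times \<open>b\<close> and 0 gives the
  estimate.\<close>

lemma gronwall:
  fixes y :: "real \<Rightarrow> real"
  assumes y: "continuous_on {0..b} y" and K: "0 \<le> K" and b: "0 \<le> b"
    and le: "\<And>t. t \<in> {0..b} \<Longrightarrow> y t \<le> c + K * integral {0..t} y"
  shows "y b \<le> c * exp (K * b)"
proof -
  let ?J = "\<lambda>t. integral {0..t} y"
  let ?F = "\<lambda>t. exp (- K * t) * (c + K * ?J t)"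
  have J: "(?J has_real_derivative y t) (at t within {0..b})" if "t \<in> {0..b}" for t
    by (rule integral_has_real_derivative[OF y that])
  have "?F b \<le> ?F 0"
  proof (rule DERIV_nonpos_imp_decreasing_open[OF b])
    show "\<exists>y'. (?F has_real_derivative y') (at t) \<and> y' \<le> 0" if "0 < t" "t < b" for t
    proof (intro exI conjI)
      have "at t within {0..b} = at t" using that by (intro at_within_interior) auto
      then have "(?J has_real_derivative y t) (at t)" using J[of t] that by simp
      then show "(?F has_real_derivative exp (- K * t) * (K * (y t - (c + K * ?J t)))) (at t)"
        by (auto intro!: derivative_eq_intros simp: algebra_simps)
      show "exp (- K * t) * (K * (y t - (c + K * ?J t))) \<le> 0"
        using le[of t] that K by (intro mult_nonneg_nonpos) auto
    qed
    have "continuous_on {0..b} ?J"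
      using J by (meson DERIV_continuous continuous_on_eq_continuous_within)
    then show "continuous_on {0..b} ?F" by (intro continuous_intros)
  qed
  then have "exp (K * b) * (exp (- K * b) * (c + K * ?J b)) \<le> exp (K * b) * c" by simp
  moreover have "exp (K * b) * (exp (- K * b) * x) = x" for x
    by (simp add: mult.assoc[symmetric] exp_add[symmetric])
  ultimately have "c + K * ?J b \<le> exp (K * b) * c" by (simp only:)
  then show ?thesis using le[of b] b by (simp add: mult.commute)
qed

subsection \<open>The convective term\<close>

context torus3
begin

lemma sfield_measurable:
  assumes "sfield L E"
  shows "E \<in> borel_measurable (torus L)"
  using L2_measurable_torus[OF sfield_L2[OF assms]] .

lemma borel_measurable_nth [measurable]:
  fixes f :: "'b \<Rightarrow> real ^ 'n"
  assumes [measurable]: "f \<in> borel_measurable M" shows "(\<lambda>x. f x $ i) \<in> borel_measurable M"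
proof -
  have "(\<lambda>x. f x \<bullet> axis i 1) \<in> borel_measurable M" by measurable
  then show ?thesis by (simp add: inner_axis)
qed

lemma norm_trilin_term_le:
  assumes "norm (E x) \<le> M"
  shows "\<bar>(u x $ i *\<^sub>R wpartial L i v x) \<bullet> E x\<bar> \<le> M * (norm (u x) * norm (wpartial L i v x))"
proof -
  have "\<bar>(u x $ i *\<^sub>R wpartial L i v x) \<bullet> E x\<bar> \<le> norm (u x $ i *\<^sub>R wpartial L i v x) * norm (E x)"
    by (rule Cauchy_Schwarz_ineq2)
  also have "\<dots> \<le> (norm (u x) * norm (wpartial L i v x)) * M"
    using assms component_le_norm_cart[of "u x" i] by (intro mult_mono) (simp_all add: mult_right_mono)
  finally show ?thesis by (simp only: mult.commute)
qed

lemma integrable_trilin_term: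
  assumes u: "u \<in> L2 L" and v: "v \<in> H1 L" and E: "sfield L E"
  shows "integrable (torus L) (\<lambda>x. (u x $ i *\<^sub>R wpartial L i v x) \<bullet> E x)"
proof -
  obtain M where M: "\<And>x. x \<in> cbox 0 L \<Longrightarrow> norm (E x) \<le> M" using sfield_bounded[OF E] by blast
  have [measurable]: "u \<in> borel_measurable (torus L)" "wpartial L i v \<in> borel_measurable (torus L)"
    "E \<in> borel_measurable (torus L)"
    using L2_measurable_torus u wpartial_L2[OF v] sfield_measurable[OF E] by auto
  have ib: "integrable (torus L) (\<lambda>x. M * (norm (u x) * norm (wpartial L i v x)))"
    by (intro integrable_mult_right integrable_inner(1) u wpartial_L2 v)
  show ?thesis
  proof (rule Bochner_Integration.integrable_bound[OF ib])
    show "AE x in torus L. norm ((u x $ i *\<^sub>R wpartial L i v x) \<bullet> E x) \<le> norm (M * (norm (u x) * norm (wpartial L i v x)))"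
    proof (rule AE_I2)
      fix x assume "x \<in> space (torus L)"
      then have "norm (E x) \<le> M" by (intro M) (simp add: space_torus)
      then show "norm ((u x $ i *\<^sub>R wpartial L i v x) \<bullet> E x) \<le> norm (M * (norm (u x) * norm (wpartial L i v x)))"
        using norm_trilin_term_le[of E x M u i v] unfolding real_norm_def by linarith
    qed
  qed measurable
qed

lemma trilin_sum:
  assumes "u \<in> L2 L" "v \<in> H1 L" "sfield L E"
  shows "trilin L u v E = (\<Sum>i\<in>UNIV. LINT x|torus L. (u x $ i *\<^sub>R wpartial L i v x) \<bullet> E x)"
  unfolding trilin_def inner_sum_left by (rule Bochner_Integration.integral_sum[OF integrable_trilin_term[OF assms]])

text \<open>A sup bound on \<open>E\<close> leaves a product of two L2 functions, to which
  Cauchy-Schwarz applies. The factor 3 counts the directions of differentiation.\<close>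

lemma trilin_bound:
  assumes u: "u \<in> L2 L" and v: "v \<in> H1 L" and E: "sfield L E" and M: "\<And>x. x \<in> cbox 0 L \<Longrightarrow> norm (E x) \<le> M"
  shows "\<bar>trilin L u v E\<bar> \<le> 3 * M * (l2norm L u * gnorm L v)"
proof -
  have "0 \<in> cbox 0 L" using L_pos by (simp add: mem_box_cart less_imp_le)
  then have M0: "0 \<le> M" using M[of 0] norm_ge_zero[of "E 0"] by linarith
  have ib: "integrable (torus L) (\<lambda>x. M * (norm (u x) * norm (wpartial L i v x)))" for i
    by (intro integrable_mult_right integrable_inner(1) u wpartial_L2 v)
  have "\<bar>LINT x|torus L. (u x $ i *\<^sub>R wpartial L i v x) \<bullet> E x\<bar> \<le> M * (l2norm L u * gnorm L v)" for i
  proof -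
    have "\<bar>LINT x|torus L. (u x $ i *\<^sub>R wpartial L i v x) \<bullet> E x\<bar> \<le> (LINT x|torus L. norm ((u x $ i *\<^sub>R wpartial L i v x) \<bullet> E x))"
      using integral_norm_bound[of "torus L" "\<lambda>x. (u x $ i *\<^sub>R wpartial L i v x) \<bullet> E x"] by (simp only: real_norm_def)
    also have "\<dots> \<le> (LINT x|torus L. M * (norm (u x) * norm (wpartial L i v x)))"
    proof (rule integral_mono[OF integrable_norm[OF integrable_trilin_term[OF u v E]] ib])
      fix x assume "x \<in> space (torus L)"
      then have "norm (E x) \<le> M" by (intro M) (simp add: space_torus)
      then show "norm ((u x $ i *\<^sub>R wpartial L i v x) \<bullet> E x) \<le> M * (norm (u x) * norm (wpartial L i v x))"
        using norm_trilin_term_le[of E x M u i v] by (simp only: real_norm_def)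
    qed
    also have "\<dots> = M * (LINT x|torus L. norm (u x) * norm (wpartial L i v x))" by (rule integral_mult_right_zero)
    also have "\<dots> \<le> M * (l2norm L u * l2norm L (wpartial L i v))"
      by (intro mult_left_mono integral_norm_Cauchy_Schwarz u wpartial_L2 v M0)
    also have "\<dots> \<le> M * (l2norm L u * gnorm L v)"
      unfolding gnorm_L2_set by (intro mult_left_mono M0 l2norm_nonneg member_le_L2_set) auto
    finally show ?thesis .
  qed
  then have "\<bar>trilin L u v E\<bar> \<le> (\<Sum>i\<in>(UNIV :: 3 set). M * (l2norm L u * gnorm L v))"
    unfolding trilin_sum[OF u v E] by (intro order_trans[OF sum_abs] sum_mono)
  then show ?thesis by simp
qed

lemma trilin_diff_left:
  assumes "u \<in> L2 L" "u' \<in> L2 L" "v \<in> H1 L" "sfield L E"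
  shows "trilin L (\<lambda>x. u x - u' x) v E = trilin L u v E - trilin L u' v E"
proof -
  note i = integrable_trilin_term[OF assms(1,3,4)] integrable_trilin_term[OF assms(2,3,4)]
  show ?thesis
    unfolding trilin_sum[OF assms(1,3,4)] trilin_sum[OF assms(2,3,4)] trilin_sum[OF L2_diff[OF assms(1,2)] assms(3,4)]
    using i by (simp add: scaleR_diff_left inner_diff_left sum_subtractf)
qed

text \<open>The weak derivative of a difference equals the difference of the weak derivatives only
  almost everywhere, so linearity holds under the integral.\<close>

lemma trilin_diff_middle:
  assumes "u \<in> L2 L" "v \<in> H1 L" "v' \<in> H1 L" "sfield L E"
  shows "trilin L u (\<lambda>x. v x - v' x) E = trilin L u v E - trilin L u v' E"
proof -
  note i = integrable_trilin_term[OF assms(1,2,4)] integrable_trilin_term[OF assms(1,3,4)]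
    integrable_trilin_term[OF assms(1) H1_diff(1)[OF assms(2,3)] assms(4)]
  have "(LINT x|torus L. (u x $ j *\<^sub>R wpartial L j (\<lambda>x. v x - v' x) x) \<bullet> E x)
      = (LINT x|torus L. (u x $ j *\<^sub>R wpartial L j v x) \<bullet> E x - (u x $ j *\<^sub>R wpartial L j v' x) \<bullet> E x)" for j
  proof (rule integral_cong_AE)
    show "AE x in torus L. (u x $ j *\<^sub>R wpartial L j (\<lambda>x. v x - v' x) x) \<bullet> E x
        = (u x $ j *\<^sub>R wpartial L j v x) \<bullet> E x - (u x $ j *\<^sub>R wpartial L j v' x) \<bullet> E x"
      using H1_diff(2)[OF assms(2,3), of j] unfolding eqae_def
      by (rule eventually_mono) (simp add: scaleR_diff_right inner_diff_left right_diff_distrib)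
  qed (use i in \<open>auto intro!: borel_measurable_integrable borel_measurable_diff\<close>)
  then show ?thesis
    unfolding trilin_sum[OF assms(1,2,4)] trilin_sum[OF assms(1,3,4)] trilin_sum[OF assms(1) H1_diff(1)[OF assms(2,3)] assms(4)]
    using i by (simp add: sum_subtractf)
qed

lemma trilin_lincomb_right:
  assumes "u \<in> L2 L" "v \<in> H1 L" "sfield L E" "sfield L E'"
  shows "trilin L u v (\<lambda>x. a *\<^sub>R E x + b *\<^sub>R E' x) = a * trilin L u v E + b * trilin L u v E'"
proof -
  have i: "integrable (torus L) (\<lambda>x. a * ((u x $ i *\<^sub>R wpartial L i v x) \<bullet> E x))"
    "integrable (torus L) (\<lambda>x. b * ((u x $ i *\<^sub>R wpartial L i v x) \<bullet> E' x))" for i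
    using integrable_trilin_term[OF assms(1,2,3)] integrable_trilin_term[OF assms(1,2,4)]
    by (intro integrable_mult_right, simp)+
  have "(LINT x|torus L. (u x $ i *\<^sub>R wpartial L i v x) \<bullet> (a *\<^sub>R E x + b *\<^sub>R E' x))
      = a * (LINT x|torus L. (u x $ i *\<^sub>R wpartial L i v x) \<bullet> E x) + b * (LINT x|torus L. (u x $ i *\<^sub>R wpartial L i v x) \<bullet> E' x)" for i
  proof -
    have "(LINT x|torus L. (u x $ i *\<^sub>R wpartial L i v x) \<bullet> (a *\<^sub>R E x + b *\<^sub>R E' x))
      = (LINT x|torus L. a * ((u x $ i *\<^sub>R wpartial L i v x) \<bullet> E x) + b * ((u x $ i *\<^sub>R wpartial L i v x) \<bullet> E' x))"
      by (simp only: inner_add_right inner_scaleR_right)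
    then show ?thesis using i[of i] by (simp only: Bochner_Integration.integral_add) simp
  qed
  then show ?thesis
    unfolding trilin_sum[OF assms(1,2,3)] trilin_sum[OF assms(1,2,4)] trilin_sum[OF assms(1,2) sfield_lincomb[OF assms(3,4)]]
    by (simp only: sum.distrib sum_distrib_left)
qed

lemma trilin_sum_right:
  assumes "u \<in> L2 L" "v \<in> H1 L" "\<And>i. i \<in> I \<Longrightarrow> sfield L (E i)"
  shows "trilin L u v (\<lambda>x. \<Sum>i\<in>I. E i x) = (\<Sum>i\<in>I. trilin L u v (E i))"
  using assms(3)
proof (induction I rule: infinite_finite_induct)
  case (insert i I)
  have "trilin L u v (\<lambda>x. 1 *\<^sub>R E i x + 1 *\<^sub>R (\<Sum>i\<in>I. E i x)) = 1 * trilin L u v (E i) + 1 * trilin L u v (\<lambda>x. \<Sum>i\<in>I. E i x)"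
    using insert.prems by (intro trilin_lincomb_right assms(1,2) sfield_sum) simp_all
  with insert show ?case by simp
qed (simp_all add: trilin_def)

end

context torus3_mode
begin

lemma partial_modes_gradient:
  "fpart j (partial_modes N y) x = \<kappa> $ j *\<^sub>R partial_modes N (\<lambda>m. p m *\<^sub>R (snd (y m), - fst (y m))) x"
proof -
  have "dz j m (y m) = \<kappa> $ j *\<^sub>R (p m *\<^sub>R (snd (y m), - fst (y m))) + 0 *\<^sub>R y m" for m
    by (simp add: dz_def mult.commute)
  then show ?thesis
    unfolding fpart_partial_modes using partial_modes_lincomb[of N "\<kappa> $ j" "\<lambda>m. p m *\<^sub>R (snd (y m), - fst (y m))" 0 y x]
    by simp
qed

lemma partial_modes_perp:
  assumes "\<And>m. perp (y m)" shows "partial_modes N y x \<bullet> \<kappa> = 0"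
  using assms by (simp add: partial_modes_def inner_sum_left modal_def inner_add_left perp_def)

text \<open>The integrand is the pairing of \<open>v\<close> with the gradient of half the squared
  length of the truncated field, and \<open>v\<close> is orthogonal to gradients.\<close>

lemma trilin_right_cancel:
  assumes v: "v \<in> HH L" and y: "\<And>m. perp (y m)"
  shows "trilin L v (partial_modes N y) (partial_modes N y) = 0"
proof -
  let ?Z = "partial_modes N y"
  define \<phi> where "\<phi> x = (\<Sum>i\<in>UNIV. (1 / 2) * (?Z x $ i * ?Z x $ i))" for x
  note s = sfield_smooth[OF partial_modes_sfield[of N y]] sfield_periodic[OF partial_modes_sfield[of N y]]
  have \<phi>: "smooth \<phi>" "periodic L \<phi>"
    unfolding \<phi>_def[abs_def] by (intro smooth_sum smooth_cmult smooth_mult s(1)) (use s(2) in \<open>simp add: periodic_def\<close>)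
  have d: "partial j \<phi> x = fpart j ?Z x \<bullet> ?Z x" for j x
  proof -
    have "partial j \<phi> x = (\<Sum>i\<in>UNIV. partial j (\<lambda>x. (1 / 2) * (?Z x $ i * ?Z x $ i)) x)"
      unfolding \<phi>_def[abs_def] by (subst partial_sum) (intro smooth_cmult smooth_mult s(1) refl)+
    also have "\<dots> = (\<Sum>i\<in>UNIV. partial j (\<lambda>x. ?Z x $ i) x * ?Z x $ i)"
      by (simp only: partial_cmult[OF smooth_mult[OF s(1) s(1)]] partial_mult[OF smooth_differentiable[OF s(1)] smooth_differentiable[OF s(1)]])
        (simp add: mult.commute)
    finally show ?thesis by (simp add: fpart_def inner_vec_def)
  qed
  have "trilin L v ?Z ?Z = (LINT x|torus L. v x \<bullet> (\<chi> j. partial j \<phi> x))"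
    unfolding trilin_def
  proof (rule integral_cong_AE)
    have [measurable]: "v \<in> borel_measurable (torus L)" "wpartial L i ?Z \<in> borel_measurable (torus L)"
      "?Z \<in> borel_measurable (torus L)" for i
      using L2_measurable_torus HH_L2[OF v] wpartial_L2[OF sfield_H1[OF partial_modes_sfield]] partial_modes_L2 by auto
    show "(\<lambda>x. (\<Sum>i\<in>UNIV. v x $ i *\<^sub>R wpartial L i ?Z x) \<bullet> ?Z x) \<in> borel_measurable (torus L)" by measurable
    have "sfield L (\<lambda>x. \<chi> j. partial j \<phi> x)"
      using partial_periodic[OF \<phi>] smooth_partial[OF \<phi>(1)] by (simp add: sfield_def periodic_def vec_eq_iff)
    then have [measurable]: "(\<lambda>x. \<chi> j. partial j \<phi> x) \<in> borel_measurable (torus L)" by (rule sfield_measurable)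
    show "(\<lambda>x. v x \<bullet> (\<chi> j. partial j \<phi> x)) \<in> borel_measurable (torus L)" by measurable
    have "AE x in torus L. \<forall>j. wpartial L j ?Z x = fpart j ?Z x"
      using wpartial_sfield[OF partial_modes_sfield, of _ N y] unfolding eqae_def by (simp add: AE_all_countable)
    then show "AE x in torus L. (\<Sum>i\<in>UNIV. v x $ i *\<^sub>R wpartial L i ?Z x) \<bullet> ?Z x = v x \<bullet> (\<chi> j. partial j \<phi> x)"
      by (rule eventually_mono) (simp add: d inner_sum_left inner_vec_def[of "v _"])
  qed
  also have "\<dots> = 0" using HH_orthogonal_gradient[OF v \<phi>] by (simp add: ip_def)
  finally show ?thesis .
qed

text \<open>This cancellation is special to modes along one direction. After integration by parts
  the divergence of the products \<open>?Z x $ i *\<^sub>R ?Z x\<close> appears; it vanishes because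
  both \<open>?Z\<close> and its phase derivative \<open>?W\<close> are orthogonal to
  \<open>\<kappa>\<close>.\<close>

lemma trilin_left_cancel:
  assumes v: "v \<in> H1 L" and y: "\<And>m. perp (y m)"
  shows "trilin L (partial_modes N y) v (partial_modes N y) = 0"
proof -
  let ?Z = "partial_modes N y" and ?W = "partial_modes N (\<lambda>m. p m *\<^sub>R (snd (y m), - fst (y m)))"
  note s = sfield_smooth[OF partial_modes_sfield[of N y]] sfield_periodic[OF partial_modes_sfield[of N y]]
  let ?F = "\<lambda>i x. ?Z x $ i *\<^sub>R ?Z x"
  have F: "sfield L (?F i)" for i
    using s(2) by (auto simp: sfield_def periodic_def intro!: smooth_mult s(1))
  have pZ: "partial j (\<lambda>x. ?Z x $ i) x = \<kappa> $ j * ?W x $ i" for i j x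
    using arg_cong[OF partial_modes_gradient[of j N y x], of "\<lambda>v. v $ i"] by (simp add: fpart_def)
  have dF: "fpart i (?F i) x = \<kappa> $ i *\<^sub>R (?Z x $ i *\<^sub>R ?W x + ?W x $ i *\<^sub>R ?Z x)" for i x
    by (simp add: fpart_def vec_eq_iff partial_mult smooth_differentiable s(1) pZ algebra_simps)
  have W: "?W x \<bullet> \<kappa> = 0" for x
    by (rule partial_modes_perp) (use y in \<open>simp add: perp_def\<close>)
  have sum0: "(\<Sum>i\<in>UNIV. fpart i (?F i) x) = 0" for x
  proof -
    have "(\<Sum>i\<in>UNIV. fpart i (?F i) x) = (?Z x \<bullet> \<kappa>) *\<^sub>R ?W x + (?W x \<bullet> \<kappa>) *\<^sub>R ?Z x"
      unfolding dF by (simp add: scaleR_add_right sum.distrib scaleR_sum_left inner_vec_def mult.commute)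
    then show ?thesis using partial_modes_perp[OF y] W by simp
  qed
  have "trilin L ?Z v ?Z = (\<Sum>i\<in>UNIV. ip L (wpartial L i v) (?F i))"
    unfolding trilin_sum[OF partial_modes_L2 v partial_modes_sfield] ip_def by (simp add: mult.left_commute)
  also have "\<dots> = - (\<Sum>i\<in>UNIV. ip L v (fpart i (?F i)))"
    by (simp add: ip_wpartial[OF v F] sum_negf)
  also have "(\<Sum>i\<in>UNIV. ip L v (fpart i (?F i))) = ip L v (\<lambda>x. \<Sum>i\<in>UNIV. fpart i (?F i) x)"
    using v by (intro ip_sum_right[symmetric] sfield_L2 sfield_fpart F H1_L2)
  finally show ?thesis by (simp add: sum0)
qed

text \<open>Of the four terms in the expansion of the right side, three vanish by the cancellations
  above. The convective term is thus quadratic in the deviation, as Gronwall's inequality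
  requires.\<close>

lemma trilin_deviation:
  assumes v: "v \<in> VV L" and y: "\<And>m. perp (y m)"
  shows "trilin L v v (partial_modes N y) =
    trilin L (\<lambda>x. v x - partial_modes N y x) (\<lambda>x. v x - partial_modes N y x) (partial_modes N y)"
proof -
  let ?Z = "partial_modes N y"
  note Z = partial_modes_L2 sfield_H1[OF partial_modes_sfield] partial_modes_sfield
  have ZH: "?Z \<in> HH L" by (intro trig_fields_HH partial_modes_trig y)
  have "trilin L (\<lambda>x. v x - ?Z x) (\<lambda>x. v x - ?Z x) ?Z
      = trilin L v (\<lambda>x. v x - ?Z x) ?Z - trilin L ?Z (\<lambda>x. v x - ?Z x) ?Z"
    by (intro trilin_diff_left VV_L2 v Z H1_diff VV_H1)
  also have "\<dots> = trilin L v v ?Z - trilin L v ?Z ?Z - (trilin L ?Z v ?Z - trilin L ?Z ?Z ?Z)"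
    using v by (simp add: trilin_diff_middle VV_L2 VV_H1 Z)
  finally show ?thesis
    by (simp add: trilin_right_cancel[OF VV_HH[OF v] y] trilin_right_cancel[OF ZH y] trilin_left_cancel[OF VV_H1[OF v] y])
qed

lemma gip_modal: "v \<in> H1 L \<Longrightarrow> gip L v (modal m e) = q m * ip L v (modal m e)"
proof -
  assume v: "v \<in> H1 L"
  have "ip L (wpartial L j v) (wpartial L j (modal m e)) = (p m)\<^sup>2 * (\<kappa> $ j)\<^sup>2 * ip L v (modal m e)" for j
  proof -
    have "ip L (wpartial L j v) (wpartial L j (modal m e)) = ip L (wpartial L j v) (fpart j (modal m e))"
      by (rule ip_cong[OF eqae_refl wpartial_sfield])
        (intro modal_sfield wpartial_L2 v sfield_L2[OF sfield_fpart] sfield_H1)+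
    also have "\<dots> = - ip L v (fpart j (fpart j (modal m e)))" by (intro ip_wpartial v sfield_fpart modal_sfield)
    also have "fpart j (fpart j (modal m e)) = (\<lambda>x. (- ((p m)\<^sup>2 * (\<kappa> $ j)\<^sup>2)) *\<^sub>R modal m e x)"
      by (rule ext) (simp add: fpart_modal dz_dz modal_scaleR power2_eq_square mult.assoc flip: modal_scaleR)
    finally show ?thesis by (simp only: ip_scaleR_right) simp
  qed
  then show ?thesis
    by (simp add: gip_def sum_distrib_left[symmetric] sum_distrib_right[symmetric] sum_\<kappa>_square q_def)
qed

text \<open>The cross product is skew, which moves the operator from \<open>v\<close> to the mode,
  where its symbol is known.\<close>

lemma ip_coriolis_modal:
  assumes v: "v \<in> HH L" and e: "perp e"
  shows "ip L (coriolis L v) (modal m e) = - \<omega> * ip L v (modal m (TT e))"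
proof -
  have "cross3 c a \<bullet> b = - (a \<bullet> cross3 c b)" for a b c
    by (simp add: cross3_def inner_vec_def sum_3 vector_3 algebra_simps)
  then have "ip L (coriolis L v) (modal m e) = - ip L v (\<lambda>x. cross3 (axis 3 1) (modal m e x))"
    unfolding ip_coriolis[OF v modal_HH[OF e]] by (simp add: ip_def)
  then show ?thesis by (simp add: ip_cross_modal[OF v e])
qed

end

subsection \<open>Uniqueness\<close>

context torus3
begin

text \<open>A criterion fitted to linear and quadratic functionals of \<open>v\<close>: their
  increments are linear plus quadratic in the H1 distance, with a constant that depends on the base
  time only.\<close>

lemma h1_continuous_on:
  fixes F :: "real \<Rightarrow> real"
  assumes v: "cont_norm (h1norm L) (VV L) v"
    and F: "\<And>s t. 0 \<le> s \<Longrightarrow> 0 \<le> t \<Longrightarrow> \<bar>F s - F t\<bar> \<le> C t * (h1norm L (\<lambda>x. v s x - v t x) + (h1norm L (\<lambda>x. v s x - v t x))\<^sup>2)"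
  shows "continuous_on {0..} F"
  unfolding continuous_on_def
proof
  fix t :: real assume t: "t \<in> {0..}"
  then have d: "((\<lambda>s. h1norm L (\<lambda>x. v s x - v t x)) \<longlongrightarrow> 0) (at t within {0..})"
    using v by (simp add: cont_norm_def fun_diff_def)
  have "((\<lambda>s. C t * (h1norm L (\<lambda>x. v s x - v t x) + (h1norm L (\<lambda>x. v s x - v t x))\<^sup>2)) \<longlongrightarrow> C t * (0 + 0\<^sup>2)) (at t within {0..})"
    by (intro tendsto_intros d)
  then have lim: "((\<lambda>s. C t * (h1norm L (\<lambda>x. v s x - v t x) + (h1norm L (\<lambda>x. v s x - v t x))\<^sup>2)) \<longlongrightarrow> 0) (at t within {0..})"
    by simp
  have "((\<lambda>s. F s - F t) \<longlongrightarrow> 0) (at t within {0..})"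
    by (rule Lim_null_comparison[OF _ lim]) (use F[of _ t] t in \<open>simp add: eventually_at_filter\<close>)
  then show "(F \<longlongrightarrow> F t) (at t within {0..})" by (simp add: LIM_zero_iff)
qed

lemma ip_continuous_on:
  assumes v: "cont_norm (h1norm L) (VV L) v" and w: "w \<in> L2 L"
  shows "continuous_on {0..} (\<lambda>t. ip L (v t) w)"
proof (rule h1_continuous_on[OF v, where C="\<lambda>t. l2norm L w"])
  fix s t :: real assume "0 \<le> s" "0 \<le> t"
  then have vs: "v s \<in> L2 L" "v t \<in> L2 L" using v VV_L2 by (auto simp: cont_norm_def)
  let ?d = "\<lambda>x. v s x - v t x"
  have "\<bar>ip L (v s) w - ip L (v t) w\<bar> = \<bar>ip L ?d w\<bar>" using vs w by (simp add: ip_diff_left)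
  also have "\<dots> \<le> l2norm L ?d * l2norm L w" by (intro ip_Cauchy_Schwarz L2_diff vs w)
  also have "\<dots> \<le> (h1norm L ?d + (h1norm L ?d)\<^sup>2) * l2norm L w"
    using l2norm_le_h1norm[of ?d] by (intro mult_right_mono add_increasing2) auto
  finally show "\<bar>ip L (v s) w - ip L (v t) w\<bar> \<le> l2norm L w * (h1norm L ?d + (h1norm L ?d)\<^sup>2)"
    by (simp only: mult.commute)
qed

lemma l2norm_square_continuous_on:
  assumes v: "cont_norm (h1norm L) (VV L) v"
  shows "continuous_on {0..} (\<lambda>t. (l2norm L (v t))\<^sup>2)"
proof (rule h1_continuous_on[OF v, where C="\<lambda>t. 1 + 2 * l2norm L (v t)"])
  fix s t :: real assume "0 \<le> s" "0 \<le> t"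
  then have vs: "v s \<in> L2 L" "v t \<in> L2 L" using v VV_L2 by (auto simp: cont_norm_def)
  let ?d = "\<lambda>x. v s x - v t x"
  let ?h = "h1norm L ?d"
  have d: "?d \<in> L2 L" by (intro L2_diff vs)
  have "(l2norm L (v s))\<^sup>2 - (l2norm L (v t))\<^sup>2 = (l2norm L ?d)\<^sup>2 + 2 * ip L ?d (v t)"
    using vs d by (simp add: l2norm_power2 ip_diff_self ip_diff_left)
  moreover have "(l2norm L ?d)\<^sup>2 \<le> ?h\<^sup>2" by (intro power_mono l2norm_le_h1norm) simp
  moreover have "\<bar>ip L ?d (v t)\<bar> \<le> ?h * l2norm L (v t)"
    by (intro order_trans[OF ip_Cauchy_Schwarz[OF d vs(2)]] mult_right_mono l2norm_le_h1norm l2norm_nonneg)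
  moreover have "0 \<le> ?h\<^sup>2 * l2norm L (v t)" "0 \<le> ?h" by simp_all
  moreover have "(1 + 2 * l2norm L (v t)) * (?h + ?h\<^sup>2) = ?h + ?h\<^sup>2 + 2 * (?h * l2norm L (v t)) + 2 * (?h\<^sup>2 * l2norm L (v t))"
    by (simp add: algebra_simps)
  ultimately show "\<bar>(l2norm L (v s))\<^sup>2 - (l2norm L (v t))\<^sup>2\<bar> \<le> (1 + 2 * l2norm L (v t)) * (?h + ?h\<^sup>2)"
    using zero_le_power2[of "l2norm L ?d"] unfolding abs_le_iff by linarith
qed

lemma gnorm_square_continuous_on:
  assumes v: "cont_norm (h1norm L) (VV L) v"
  shows "continuous_on {0..} (\<lambda>t. (gnorm L (v t))\<^sup>2)"
proof (rule h1_continuous_on[OF v, where C="\<lambda>t. 1 + 2 * gnorm L (v t)"])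
  fix s t :: real assume "0 \<le> s" "0 \<le> t"
  then have vs: "v s \<in> H1 L" "v t \<in> H1 L" using v VV_H1 by (auto simp: cont_norm_def)
  let ?d = "\<lambda>x. v s x - v t x"
  let ?h = "h1norm L ?d"
  have d: "?d \<in> H1 L" by (intro H1_diff vs)
  have "(gnorm L (v s))\<^sup>2 - (gnorm L (v t))\<^sup>2 = (gnorm L ?d)\<^sup>2 + 2 * gip L ?d (v t)"
    using vs d by (simp add: gnorm_power2 gip_diff_left gip_diff_right gip_commute[of "v t" "v s"])
  moreover have "(gnorm L ?d)\<^sup>2 \<le> ?h\<^sup>2" by (intro power_mono gnorm_le_h1norm) simp
  moreover have "\<bar>gip L ?d (v t)\<bar> \<le> ?h * gnorm L (v t)"
    by (intro order_trans[OF gip_Cauchy_Schwarz[OF d vs(2)]] mult_right_mono gnorm_le_h1norm gnorm_nonneg)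
  moreover have "0 \<le> ?h\<^sup>2 * gnorm L (v t)" "0 \<le> ?h" by simp_all
  moreover have "(1 + 2 * gnorm L (v t)) * (?h + ?h\<^sup>2) = ?h + ?h\<^sup>2 + 2 * (?h * gnorm L (v t)) + 2 * (?h\<^sup>2 * gnorm L (v t))"
    by (simp add: algebra_simps)
  ultimately show "\<bar>(gnorm L (v s))\<^sup>2 - (gnorm L (v t))\<^sup>2\<bar> \<le> (1 + 2 * gnorm L (v t)) * (?h + ?h\<^sup>2)"
    using zero_le_power2[of "gnorm L ?d"] unfolding abs_le_iff by linarith
qed

lemma trilin_continuous_on:
  assumes v: "cont_norm (h1norm L) (VV L) v" and E: "sfield L E"
  shows "continuous_on {0..} (\<lambda>t. trilin L (v t) (v t) E)"
proof -
  obtain M where M: "0 \<le> M" "\<And>x. x \<in> cbox 0 L \<Longrightarrow> norm (E x) \<le> M" using sfield_bounded[OF E] by blast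
  show ?thesis
  proof (rule h1_continuous_on[OF v, where C="\<lambda>t. 3 * M * (1 + gnorm L (v t) + l2norm L (v t))"])
    fix s t :: real assume "0 \<le> s" "0 \<le> t"
    then have vs: "v s \<in> H1 L" "v t \<in> H1 L" "v s \<in> L2 L" "v t \<in> L2 L" using v VV_H1 VV_L2 by (auto simp: cont_norm_def)
    let ?d = "\<lambda>x. v s x - v t x"
    let ?h = "h1norm L ?d"
    have e: "trilin L (v s) (v s) E - trilin L (v t) (v t) E = trilin L ?d (v s) E + trilin L (v t) ?d E"
      using vs E by (simp add: trilin_diff_left trilin_diff_middle)
    have "\<bar>trilin L (v s) (v s) E - trilin L (v t) (v t) E\<bar> \<le> 3 * M * (l2norm L ?d * gnorm L (v s)) + 3 * M * (l2norm L (v t) * gnorm L ?d)"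
      unfolding e by (intro order_trans[OF abs_triangle_ineq] add_mono trilin_bound vs L2_diff H1_diff E M(2))
    also have "\<dots> \<le> 3 * M * (?h * (gnorm L (v t) + ?h)) + 3 * M * (l2norm L (v t) * ?h)"
    proof -
      have g: "gnorm L (v s) \<le> gnorm L (v t) + ?h"
        using gnorm_triangle_diff2[OF vs(1,2)] gnorm_le_h1norm[of ?d] by linarith
      have "l2norm L ?d * gnorm L (v s) \<le> ?h * (gnorm L (v t) + ?h)"
        by (rule mult_mono[OF l2norm_le_h1norm g h1norm_nonneg gnorm_nonneg])
      then show ?thesis using M(1)
        by (intro add_mono mult_left_mono) (simp_all add: gnorm_le_h1norm)
    qed
    also have "\<dots> = 3 * M * (?h * (gnorm L (v t) + ?h) + l2norm L (v t) * ?h)" by (simp add: distrib_left)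
    also have "\<dots> \<le> 3 * M * ((1 + gnorm L (v t) + l2norm L (v t)) * (?h + ?h\<^sup>2))"
      using M(1) by (intro mult_left_mono) (simp_all add: algebra_simps power2_eq_square)
    finally show "\<bar>trilin L (v s) (v s) E - trilin L (v t) (v t) E\<bar> \<le>
        3 * M * (1 + gnorm L (v t) + l2norm L (v t)) * (?h + ?h\<^sup>2)" by (simp only: mult.assoc)
  qed
qed

end

context torus3_mode
begin

lemma gip_partial_modes:
  assumes v: "v \<in> H1 L"
  shows "gip L v (partial_modes N y) = (\<Sum>m<N. q m * ip L v (modal m (y m)))"
proof (induction N)
  case 0
  have "gip L v (partial_modes 0 y) = gip L v (\<lambda>x. 0 *\<^sub>R v x + 0 *\<^sub>R v x)"
    by (rule arg_cong[where f="gip L v"]) (simp add: partial_modes_def fun_eq_iff)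
  then show ?case unfolding gip_lincomb_right[OF v v v] by simp
next
  case (Suc N)
  have "gip L v (partial_modes (Suc N) y) = gip L v (\<lambda>x. 1 *\<^sub>R partial_modes N y x + 1 *\<^sub>R modal N (y N) x)"
    by (rule arg_cong[where f="gip L v"]) (simp add: partial_modes_def fun_eq_iff)
  also have "\<dots> = 1 * gip L v (partial_modes N y) + 1 * gip L v (modal N (y N))"
    by (intro gip_lincomb_right v sfield_H1 partial_modes_sfield modal_sfield)
  finally show ?case using Suc by (simp add: gip_modal[OF v])
qed

lemma ip_partial_modes_right:
  "v \<in> L2 L \<Longrightarrow> ip L v (partial_modes N y) = (\<Sum>m<N. ip L v (modal m (y m)))"
  unfolding partial_modes_def[abs_def] by (intro ip_sum_right modal_L2)

lemma trilin_partial_modes: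
  "u \<in> L2 L \<Longrightarrow> v \<in> H1 L \<Longrightarrow> trilin L u v (partial_modes N y) = (\<Sum>m<N. trilin L u v (modal m (y m)))"
  unfolding partial_modes_def[abs_def] by (intro trilin_sum_right modal_sfield)

lemma modal_VV: assumes "perp e" shows "modal m e \<in> VV L"
proof -
  let ?y = "\<lambda>n. if n = m then e else 0"
  have "partial_modes (Suc m) ?y = modal m e"
    by (rule ext) (simp add: partial_modes_def modal_0)
  then have "expands (\<lambda>n. if n < Suc m then ?y n else 0) (modal m e)"
    using partial_modes_expands[of "Suc m" ?y] by (simp only:)
  then show ?thesis
  proof (rule expands_VV)
    show "summable (\<lambda>n. q n * (norm (if n < Suc m then ?y n else 0))\<^sup>2)"
      by (rule summable_finite[of "{..m}"]) auto
    show "perp (if n < Suc m then ?y n else 0)" for n using assms perp_0 by simp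
  qed
qed

end

section \<open>Comparison of a solution with the truncated explicit solution\<close>

locale torus3_comparison = torus3_solution +
  fixes v :: "real \<Rightarrow> field3"
  assumes v_regular: "global_regular L \<Omega> v" and v0_expands: "expands z (v 0)"
begin

lemma v_cont: "cont_norm (h1norm L) (VV L) v"
  using v_regular by (simp add: global_regular_def)

lemma v_VV: "0 \<le> t \<Longrightarrow> v t \<in> VV L" using v_cont by (simp add: cont_norm_def)

lemma v_energy:
  "0 \<le> t \<Longrightarrow> (l2norm L (v t))\<^sup>2 / 2 + integral {0..t} (\<lambda>\<tau>. (gnorm L (v \<tau>))\<^sup>2) \<le> (l2norm L (v 0))\<^sup>2 / 2"
proof -
  assume t: "0 \<le> t"
  have "(LINT \<tau>:{0..t}|lebesgue. (gnorm L (v \<tau>))\<^sup>2) = integral {0..t} (\<lambda>\<tau>. (gnorm L (v \<tau>))\<^sup>2)"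
    by (intro lebesgue_integral_continuous continuous_on_subset[OF gnorm_square_continuous_on[OF v_cont]]) auto
  then show ?thesis
    using v_regular t unfolding global_regular_def leray_hopf_def Let_def by auto
qed

text \<open>Continuity of \<open>v\<close> in \<open>VV\<close> makes both the pairing and the
  right-hand side of the weak equation continuous in time, so the distributional derivative is
  classical.\<close>

lemma v_modal_derivative:
  assumes e: "perp e" and t: "0 < t"
  shows "((\<lambda>t. ip L (v t) (modal m e)) has_real_derivative
    - (q m * ip L (v t) (modal m e) + trilin L (v t) (v t) (modal m e) - \<Omega> * \<omega> * ip L (v t) (modal m (TT e)))) (at t)"
proof -
  let ?g = "\<lambda>t. - (gip L (v t) (modal m e) + trilin L (v t) (v t) (modal m e) + \<Omega> * ip L (coriolis L (v t)) (modal m e))"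
  let ?h = "\<lambda>t. - (q m * ip L (v t) (modal m e) + trilin L (v t) (v t) (modal m e) - \<Omega> * \<omega> * ip L (v t) (modal m (TT e)))"
  have gh: "?g t = ?h t" if "0 \<le> t" for t
    using v_VV[OF that] e by (simp add: gip_modal VV_H1 ip_coriolis_modal VV_HH)
  have c: "continuous_on {0<..} (\<lambda>t. ip L (v t) (modal m e'))" for e'
    by (rule continuous_on_subset[OF ip_continuous_on[OF v_cont modal_L2]]) auto
  have ct: "continuous_on {0<..} (\<lambda>t. trilin L (v t) (v t) (modal m e))"
    by (rule continuous_on_subset[OF trilin_continuous_on[OF v_cont modal_sfield]]) auto
  have "continuous_on {0<..} ?h" by (intro continuous_intros c ct)
  then have cg: "continuous_on {0<..} ?g" by (rule continuous_on_eq) (use gh in simp)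
  have "distr_deriv (\<lambda>t. ip L (v t) (modal m e)) ?g"
    using v_regular modal_VV[OF e] unfolding global_regular_def leray_hopf_def by blast
  from distr_deriv_continuous[OF this c cg t] show ?thesis unfolding gh[OF less_imp_le[OF t]] .
qed

abbreviation Y :: "nat \<Rightarrow> real \<Rightarrow> field3" where "Y N t \<equiv> partial_modes N (Z t)"

text \<open>Separates the moving mode into two fixed modes with scalar coefficients in time, since
  the equation for \<open>v\<close> may be tested with fixed fields only.\<close>

lemma Z_eq: "Z t m = (exp (- t * q m) * cos (\<omega> * (- \<Omega> * t))) *\<^sub>R z m + (exp (- t * q m) * sin (\<omega> * (- \<Omega> * t))) *\<^sub>R TT (z m)"
  by (simp only: Z_def rot_def scaleR_add_right scaleR_scaleR)

lemma ip_modal_Z: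
  assumes "0 \<le> t"
  shows "ip L (v t) (modal m (Z t m)) = (exp (- t * q m) * cos (\<omega> * (- \<Omega> * t))) * ip L (v t) (modal m (z m))
    + (exp (- t * q m) * sin (\<omega> * (- \<Omega> * t))) * ip L (v t) (modal m (TT (z m)))"
  unfolding Z_eq modal_lincomb[abs_def]
  using VV_L2[OF v_VV[OF assms]] by (simp only: ip_add_right ip_scaleR_right L2_scaleR modal_L2)

lemma trilin_modal_Z:
  assumes "0 \<le> t"
  shows "trilin L (v t) (v t) (modal m (Z t m)) = (exp (- t * q m) * cos (\<omega> * (- \<Omega> * t))) * trilin L (v t) (v t) (modal m (z m))
    + (exp (- t * q m) * sin (\<omega> * (- \<Omega> * t))) * trilin L (v t) (v t) (modal m (TT (z m)))"
  unfolding Z_eq modal_lincomb[abs_def]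
  by (intro trilin_lincomb_right modal_sfield VV_L2 VV_H1 v_VV assms)

lemma ip_modal_Z_continuous: "continuous_on {0..} (\<lambda>t. ip L (v t) (modal m (Z t m)))"
proof -
  have "continuous_on {0..} (\<lambda>t. (exp (- t * q m) * cos (\<omega> * (- \<Omega> * t))) * ip L (v t) (modal m (z m))
    + (exp (- t * q m) * sin (\<omega> * (- \<Omega> * t))) * ip L (v t) (modal m (TT (z m))))"
    by (intro continuous_intros ip_continuous_on v_cont modal_L2)
  then show ?thesis by (rule continuous_on_eq) (simp add: ip_modal_Z)
qed

lemma trilin_modal_Z_continuous: "continuous_on {0..} (\<lambda>t. trilin L (v t) (v t) (modal m (Z t m)))"
proof -
  have "continuous_on {0..} (\<lambda>t. (exp (- t * q m) * cos (\<omega> * (- \<Omega> * t))) * trilin L (v t) (v t) (modal m (z m))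
    + (exp (- t * q m) * sin (\<omega> * (- \<Omega> * t))) * trilin L (v t) (v t) (modal m (TT (z m))))"
    by (intro continuous_intros trilin_continuous_on v_cont modal_sfield)
  then show ?thesis by (rule continuous_on_eq) (simp add: trilin_modal_Z)
qed

text \<open>The Coriolis terms cancel because \<open>Z\<close> itself rotates with the flow.\<close>

lemma ip_modal_Z_derivative:
  assumes t: "0 < t"
  shows "((\<lambda>t. ip L (v t) (modal m (Z t m))) has_real_derivative
    - 2 * (q m * ip L (v t) (modal m (Z t m))) - trilin L (v t) (v t) (modal m (Z t m))) (at t)"
proof -
  let ?a = "\<lambda>t. exp (- t * q m) * cos (\<omega> * (- \<Omega> * t))" and ?b = "\<lambda>t. exp (- t * q m) * sin (\<omega> * (- \<Omega> * t))"
  let ?f = "\<lambda>t. ip L (v t) (modal m (z m))" and ?g = "\<lambda>t. ip L (v t) (modal m (TT (z m)))"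
  let ?\<tau> = "trilin L (v t) (v t) (modal m (z m))" and ?\<sigma> = "trilin L (v t) (v t) (modal m (TT (z m)))"
  have a: "(?a has_real_derivative - q m * ?a t + \<Omega> * \<omega> * ?b t) (at t)"
    by (auto intro!: derivative_eq_intros simp: algebra_simps)
  have b: "(?b has_real_derivative - q m * ?b t - \<Omega> * \<omega> * ?a t) (at t)"
    by (auto intro!: derivative_eq_intros simp: algebra_simps)
  have "modal m (TT (TT (z m))) = (\<lambda>x. - modal m (z m) x)"
    using modal_scaleR[of m "- 1" "z m"] by (simp add: TT_TT[OF perp_z] fun_eq_iff)
  then have tt: "ip L (v t) (modal m (TT (TT (z m)))) = - ?f t" by (simp add: ip_minus_right)
  note f = v_modal_derivative[OF perp_z t, of m m]
  note g = v_modal_derivative[OF TT_perp t, of m "z m", unfolded tt]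
  have "((\<lambda>t. ?a t * ?f t + ?b t * ?g t) has_real_derivative
      - 2 * (q m * (?a t * ?f t + ?b t * ?g t)) - (?a t * ?\<tau> + ?b t * ?\<sigma>)) (at t)"
    by (rule DERIV_cong[OF DERIV_add[OF DERIV_mult[OF a f] DERIV_mult[OF b g]]]) (simp add: algebra_simps)
  then have "((\<lambda>t. ?a t * ?f t + ?b t * ?g t) has_real_derivative
      - 2 * (q m * ip L (v t) (modal m (Z t m))) - trilin L (v t) (v t) (modal m (Z t m))) (at t)"
    using t by (simp add: ip_modal_Z trilin_modal_Z)
  then show ?thesis
    by (rule DERIV_cong_ev[THEN iffD1, OF refl _ refl, rotated])
      (use eventually_gt_half[OF t] t in \<open>auto elim!: eventually_mono simp: ip_modal_Z\<close>)
qed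

lemma l2norm_Y_square: "(l2norm L (Y N t))\<^sup>2 = V / 2 * (\<Sum>m<N. exp (- 2 * t * q m) * (norm (z m))\<^sup>2)"
  by (simp add: l2norm_power2 ip_partial_modes norm_Z_square flip: power2_norm_eq_inner)

lemma gnorm_Y_square: "(gnorm L (Y N t))\<^sup>2 = V / 2 * (\<Sum>m<N. q m * (exp (- 2 * t * q m) * (norm (z m))\<^sup>2))"
  by (simp add: gnorm_power2 gip_partial_modes sfield_H1 partial_modes_sfield ip_partial_modes_modal norm_Z_square sum_distrib_left
      mult_ac flip: power2_norm_eq_inner)

lemma l2norm_Y_derivative: "((\<lambda>t. (l2norm L (Y N t))\<^sup>2) has_real_derivative - 2 * (gnorm L (Y N t))\<^sup>2) (at t)"
  unfolding l2norm_Y_square gnorm_Y_square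
  by (auto intro!: derivative_eq_intros simp: sum_distrib_left mult_ac simp flip: sum_negf)

text \<open>Absolute summability of the initial coefficients bounds all truncations at all times,
  because the evolution does not increase the norm of any coefficient.\<close>

lemma Y_bounded: "\<exists>M\<ge>0. \<forall>N t x. 0 \<le> t \<longrightarrow> norm (Y N t x) \<le> M"
proof (intro exI conjI allI impI)
  note s = summable_norm_of_q[OF summable_z]
  show "0 \<le> 2 * (\<Sum>m. norm (z m))" by (simp add: suminf_nonneg s)
  fix N x and t :: real assume t: "0 \<le> t"
  have "norm (Y N t x) \<le> (\<Sum>m<N. norm (modal m (Z t m) x))"
    unfolding partial_modes_def by (rule norm_sum)
  also have "\<dots> \<le> (\<Sum>m<N. 2 * norm (z m))"
  proof (rule sum_mono)
    fix m
    have "norm (Z t m) \<le> norm (z m)" using Z_le[OF t, of m] by (rule power2_le_imp_le) simp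
    then show "norm (modal m (Z t m) x) \<le> 2 * norm (z m)" using norm_modal_le[of m "Z t m" x] by linarith
  qed
  also have "\<dots> = 2 * (\<Sum>m<N. norm (z m))" by (simp add: sum_distrib_left)
  also have "\<dots> \<le> 2 * (\<Sum>m. norm (z m))" using sum_le_suminf[OF s, of "{..<N}"] by simp
  finally show "norm (Y N t x) \<le> 2 * (\<Sum>m. norm (z m))" .
qed

lemma deviation_square:
  assumes "0 \<le> t"
  shows "(l2norm L (\<lambda>x. v t x - Y N t x))\<^sup>2 = (l2norm L (v t))\<^sup>2 - 2 * (\<Sum>m<N. ip L (v t) (modal m (Z t m))) + (l2norm L (Y N t))\<^sup>2"
  using VV_L2[OF v_VV[OF assms]] by (simp add: l2norm_power2 ip_diff_self partial_modes_L2 ip_partial_modes_right)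

lemma deviation_gradient_square:
  assumes "0 \<le> t"
  shows "(gnorm L (\<lambda>x. v t x - Y N t x))\<^sup>2 = (gnorm L (v t))\<^sup>2 - 2 * (\<Sum>m<N. q m * ip L (v t) (modal m (Z t m))) + (gnorm L (Y N t))\<^sup>2"
proof -
  note H = VV_H1[OF v_VV[OF assms]] sfield_H1[OF partial_modes_sfield]
  show ?thesis
    using H by (simp add: gnorm_power2 gip_diff_left gip_diff_right H1_diff gip_commute[of "Y N t" "v t"] gip_partial_modes[OF H(1)])
qed

text \<open>The rate \<open>9 * M\<^sup>2 / 2\<close> arises from splitting \<open>3 * M\<close>
  times the product of the L2 and gradient norms of the deviation, and doubling. It does not depend
  on \<open>N\<close>, so the truncation can later be removed.\<close>

lemma deviation_bound:
  assumes M: "0 \<le> M" "\<And>N t x. 0 \<le> t \<Longrightarrow> norm (Y N t x) \<le> M" and b: "0 \<le> b"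
  shows "(l2norm L (\<lambda>x. v b x - Y N b x))\<^sup>2 \<le> (l2norm L (\<lambda>x. v 0 x - Y N 0 x))\<^sup>2 * exp (9 * M\<^sup>2 / 2 * b)"
proof (rule gronwall)
  define X where "X t = (\<Sum>m<N. ip L (v t) (modal m (Z t m)))" for t
  define g where "g t = (\<Sum>m<N. q m * ip L (v t) (modal m (Z t m)))" for t
  define \<tau> where "\<tau> t = (\<Sum>m<N. trilin L (v t) (v t) (modal m (Z t m)))" for t
  let ?y = "\<lambda>t. (l2norm L (\<lambda>x. v t x - Y N t x))\<^sup>2"
  have y: "?y t = (l2norm L (v t))\<^sup>2 - 2 * X t + (l2norm L (Y N t))\<^sup>2" if "0 \<le> t" for t
    unfolding X_def by (rule deviation_square[OF that])
  have cX: "continuous_on {0..} X" unfolding X_def[abs_def] by (intro continuous_intros ip_modal_Z_continuous)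
  have cg: "continuous_on {0..} g" unfolding g_def[abs_def] by (intro continuous_intros ip_modal_Z_continuous)
  have c\<tau>: "continuous_on {0..} \<tau>" unfolding \<tau>_def[abs_def] by (intro continuous_intros trilin_modal_Z_continuous)
  have cY: "continuous_on {0..} (\<lambda>t. (l2norm L (Y N t))\<^sup>2)" unfolding l2norm_Y_square by (intro continuous_intros)
  have cgY: "continuous_on {0..} (\<lambda>t. (gnorm L (Y N t))\<^sup>2)" unfolding gnorm_Y_square by (intro continuous_intros)
  note cv = l2norm_square_continuous_on[OF v_cont] and cgv = gnorm_square_continuous_on[OF v_cont]
  have "continuous_on {0..} (\<lambda>t. (l2norm L (v t))\<^sup>2 - 2 * X t + (l2norm L (Y N t))\<^sup>2)"
    by (intro continuous_intros cv cX cY)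
  then have cy: "continuous_on {0..} ?y" by (rule continuous_on_eq) (simp add: y)
  then show "continuous_on {0..b} ?y" by (rule continuous_on_subset) auto
  fix t assume "t \<in> {0..b}"
  then have t: "0 \<le> t" by simp
  \<comment> \<open>\<open>?F\<close> is the part of the squared deviation that is differentiated.
    The squared norm of \<open>v\<close> is left out, as it is controlled by the energy inequality
    from time 0.\<close>
  let ?F = "\<lambda>t. - 2 * X t + (l2norm L (Y N t))\<^sup>2" and ?f = "\<lambda>t. 4 * g t + 2 * \<tau> t - 2 * (gnorm L (Y N t))\<^sup>2"
  let ?G = "\<lambda>t. (gnorm L (v t))\<^sup>2"
  have sub: "continuous_on {0..} h \<Longrightarrow> continuous_on {0..t} h" for h :: "real \<Rightarrow> real" by (rule continuous_on_subset) auto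
  have "(?f has_integral ?F t - ?F 0) {0..t}"
  proof (rule fundamental_theorem_of_calculus_interior[OF t])
    show "continuous_on {0..t} ?F" by (rule sub) (intro continuous_intros cX cY)
    fix s assume "s \<in> {0<..<t}"
    then have s: "0 < s" by simp
    have "(X has_real_derivative (\<Sum>m<N. - 2 * (q m * ip L (v s) (modal m (Z s m))) - trilin L (v s) (v s) (modal m (Z s m)))) (at s)"
      unfolding X_def[abs_def] by (intro DERIV_sum ip_modal_Z_derivative s)
    then have dX: "(X has_real_derivative - 2 * g s - \<tau> s) (at s)"
      by (simp add: g_def \<tau>_def sum_subtractf sum_distrib_left sum_negf)
    have "(?F has_real_derivative - 2 * (- 2 * g s - \<tau> s) + - 2 * (gnorm L (Y N s))\<^sup>2) (at s)"
      by (intro DERIV_add DERIV_cmult dX l2norm_Y_derivative)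
    then show "(?F has_vector_derivative ?f s) (at s)"
      by (simp add: has_real_derivative_iff_has_vector_derivative algebra_simps)
  qed
  then have F: "?F t - ?F 0 = integral {0..t} ?f" by (simp add: integral_unique)
  have if1: "?f integrable_on {0..t}" "?G integrable_on {0..t}" "?y integrable_on {0..t}"
    by (intro integrable_continuous_real sub continuous_intros cg c\<tau> cgY cgv cy)+
  have le: "?f s - 2 * ?G s \<le> 9 * M\<^sup>2 / 2 * ?y s" if "0 \<le> s" for s
  proof -
    let ?w = "\<lambda>x. v s x - Y N s x"
    note H = VV_H1[OF v_VV[OF that]] sfield_H1[OF partial_modes_sfield]
    have w: "?w \<in> H1 L" by (rule H1_diff(1)[OF H])
    have "\<tau> s = trilin L (v s) (v s) (Y N s)"
      unfolding \<tau>_def by (rule trilin_partial_modes[symmetric]) (use H H1_L2 in auto)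
    also have "\<dots> = trilin L ?w ?w (Y N s)" by (rule trilin_deviation[OF v_VV[OF that] perp_Z])
    also have "\<dots> \<le> 3 * M * (l2norm L ?w * gnorm L ?w)"
      using trilin_bound[OF H1_L2[OF w] w partial_modes_sfield M(2)[OF that]] by (rule order_trans[OF abs_ge_self])
    also have "\<dots> \<le> (gnorm L ?w)\<^sup>2 + 9 * M\<^sup>2 / 4 * ?y s"
    proof -
      \<comment> \<open>Young's inequality as a completed square, weighted so that the gradient term
        has coefficient one and is absorbed exactly by the dissipation.\<close>
      have "0 \<le> (gnorm L ?w - 3 / 2 * M * l2norm L ?w)\<^sup>2" by simp
      then show ?thesis by (simp add: power2_eq_square algebra_simps)
    qed
    finally have "\<tau> s \<le> (gnorm L ?w)\<^sup>2 + 9 * M\<^sup>2 / 4 * ?y s" .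
    moreover have "(gnorm L ?w)\<^sup>2 = ?G s - 2 * g s + (gnorm L (Y N s))\<^sup>2"
      unfolding g_def by (rule deviation_gradient_square[OF that])
    ultimately show ?thesis by simp
  qed
  have "?y t = ?y 0 + ((l2norm L (v t))\<^sup>2 - (l2norm L (v 0))\<^sup>2) + (?F t - ?F 0)" using t by (simp add: y)
  also have "\<dots> \<le> ?y 0 - 2 * integral {0..t} ?G + integral {0..t} ?f"
    unfolding F using v_energy[OF t] by simp
  also have "\<dots> = ?y 0 + integral {0..t} (\<lambda>s. ?f s - 2 * ?G s)"
    by (subst integral_diff[OF if1(1) integrable_on_mult_right[OF if1(2)]]) simp
  also have "\<dots> \<le> ?y 0 + integral {0..t} (\<lambda>s. 9 * M\<^sup>2 / 2 * ?y s)"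
    by (intro add_left_mono integral_le integrable_diff if1(1) integrable_on_mult_right if1(2,3)) (use le in auto)
  finally show "?y t \<le> ?y 0 + 9 * M\<^sup>2 / 2 * integral {0..t} ?y" by simp
qed (use b in auto)

text \<open>At a fixed time the growth factor is the same for every truncation, while the initial
  error tends to 0. Hence \<open>v t\<close> has the expansion \<open>Z t\<close>, which also
  belongs to \<open>U t\<close>.\<close>

lemma v_unique:
  assumes t: "0 \<le> t"
  shows "eqae L (v t) (U t)"
proof -
  obtain M where M: "0 \<le> M" "\<And>N t x. 0 \<le> t \<Longrightarrow> norm (Y N t x) \<le> M" using Y_bounded by blast
  have "Z 0 = z" by (rule ext) (simp add: Z_def rot_def)
  then have "(\<lambda>N. l2norm L (\<lambda>x. v 0 x - Y N 0 x)) \<longlonglongrightarrow> 0" using expands_lim[OF v0_expands] by simp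
  then have "(\<lambda>N. (l2norm L (\<lambda>x. v 0 x - Y N 0 x))\<^sup>2 * exp (9 * M\<^sup>2 / 2 * t)) \<longlonglongrightarrow> 0\<^sup>2 * exp (9 * M\<^sup>2 / 2 * t)"
    by (intro tendsto_intros)
  then have lim: "(\<lambda>N. (l2norm L (\<lambda>x. v 0 x - Y N 0 x))\<^sup>2 * exp (9 * M\<^sup>2 / 2 * t)) \<longlonglongrightarrow> 0" by simp
  have "(\<lambda>N. (l2norm L (\<lambda>x. v t x - Y N t x))\<^sup>2) \<longlonglongrightarrow> 0"
    by (rule Lim_null_comparison[OF _ lim]) (use deviation_bound[OF M t] in simp)
  from tendsto_real_sqrt[OF this] have "(\<lambda>N. l2norm L (\<lambda>x. v t x - Y N t x)) \<longlonglongrightarrow> 0" by simp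
  then have "expands (Z t) (v t)" using VV_L2[OF v_VV[OF t]] by (simp add: expands_def)
  then show ?thesis using U_expands[OF t] by (rule expands_unique)
qed

end

theorem theorem5p1:
  fixes L :: "real ^ 3" and \<Omega> :: real and k :: "int ^ 3" and u0 :: field3
    and U :: "real \<Rightarrow> field3"
  assumes "\<And>j. 0 < L $ j"
    and "Max {L $ 1, L $ 2, L $ 3} = 2 * pi"
    and "k \<noteq> 0"
    and "u0 \<in> Vmode L k"
  defines "U \<equiv> (\<lambda>t. exp_stokes L t (exp_coriolis L (- \<Omega> * t) u0))"
  shows "global_regular L \<Omega> U \<and> eqae L (U 0) u0 \<and>
    (\<forall>v. global_regular L \<Omega> v \<and> eqae L (v 0) u0 \<longrightarrow> (\<forall>t\<ge>0. eqae L (v t) (U t))) \<and>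
    solves_linear L \<Omega> U"
proof -
  interpret torus3_mode L k using assms(1,3) by unfold_locales
  obtain z where z: "expands z u0" "summable (\<lambda>m. q m * (norm (z m))\<^sup>2)" "\<And>m. perp (z m)"
    using Vmode_expands[OF assms(4)] by blast
  interpret torus3_solution L k z \<Omega> U
  proof
    show "perp (z m)" for m by (rule z(3))
    show "summable (\<lambda>m. q m * (norm (z m))\<^sup>2)" by (rule z(2))
    show "expands (\<lambda>m. exp (- t * q m) *\<^sub>R rot (\<omega> * (- \<Omega> * t)) (z m)) (U t)" if "0 \<le> t" for t
      unfolding U_def by (rule solution_expands[OF z(1) z(3,2) that])
  qed
  have U0: "eqae L (U 0) u0"
    using expands_unique[OF U_expands[of 0]] z(1) by (simp add: Z_def[abs_def] rot_def)
  have "eqae L (v t) (U t)" if v: "global_regular L \<Omega> v" "eqae L (v 0) u0" and t: "0 \<le> t" for v t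
  proof -
    have "v 0 \<in> L2 L" using v(1) VV_L2 by (simp add: global_regular_def cont_norm_def)
    then have "expands z (v 0)" using expands_cong[OF z(1) eqae_sym[OF v(2)]] by blast
    then interpret torus3_comparison L k z \<Omega> U v using v(1) by unfold_locales
    show ?thesis by (rule v_unique[OF t])
  qed
  then show ?thesis using U_global_regular U_solves_linear U0 by blast
qed

end
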